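(* Let $T$ be a consistent theory over a first-order language $L$ with equality whose signature contains only relation symbols. Let $F:\mathrm{Syn}(T)\to\mathbf{Set}$ be a functor such that (1) $F$ preserves finite limits, including final objects; (2) $F$ carries effective epimorphisms to surjections; (3) for every object $X$, $F$ induces a homomorphism of join semilattices $\mathrm{Sub}(X)\to\mathrm{Sub}(F(X))$. Suppose $M:=F(x_0=x_0)$ is nonempty. Let $U:=F(S)$ where $S$ is the sentence $\forall x_0[x_0=x_0]$ (so $U$ is a singleton), and let $\mathcal M$ be the $L$-structure with underlying set $M$ given by $P^{\mathcal M}:=(s_n\circ b_{\{x_1,\dots,x_n\}}\circ F\iota_{\widetilde P})(F(\widetilde P))\subset M^n$ for each relation symbol $P$ of arity $n>0$, where $\widetilde P$ is the formula $Px_1\dots x_n$, and $P^{\mathcal M}:=F\iota_P(F(P))\subset U$ for each $P$ of arity $0$. Then for every formula $\varphi$ of $L$ the map $b_{\mathrm{free}(\varphi)}\circ F\iota_\varphi$ is a bijection from $F(\varphi)$ onto $\mathcal M(\varphi)$, and $\mathcal M$ is a model of $T$.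
   Context: LANGUAGE AND CALCULUS. $L$ has variables $x_k$, $k\in\mathbb Z$; relation symbols of arity $0$ are allowed. Primitive logical symbols are $\neg,\vee,\exists$; $\varphi\wedge\psi:=\neg(\neg\varphi\vee\neg\psi)$, $\varphi\to\psi:=\neg\varphi\vee\psi$, $\varphi\leftrightarrow\psi:=(\varphi\to\psi)\wedge(\psi\to\varphi)$, $\forall X:=\neg\exists X\neg$. Formulas are considered up to alpha-equivalence (renaming of bound variables). $\varphi[Y_i/X_i]$ denotes capture-avoiding simultaneous substitution of $Y_i$ for the distinct variables $X_i$. $E:=\neg\exists x_0[x_0=x_0]$. A sequent $\Gamma\Rightarrow\varphi$ consists of a finite set $\Gamma$ of formulas and a formula $\varphi$; it is derivable if it is obtainable by finitely many applications of the rules: $\Gamma\Rightarrow\varphi$ if $\varphi\in\Gamma$; $\Rightarrow X=X$; from $\Gamma\Rightarrow\varphi$ infer $\Gamma'\Rightarrow\varphi$ if $\Gamma\subset\Gamma'$; from $\Gamma,\psi\Rightarrow\varphi$ and $\Gamma,\neg\psi\Rightarrow\varphi$ infer $\Gamma\Rightarrow\varphi$; from $\Gamma,\neg\varphi\Rightarrow\psi$ and $\Gamma,\neg\varphi\Rightarrow\neg\psi$ infer $\Gamma\Rightarrow\varphi$; from $\Gamma,\varphi\Rightarrow\chi$ and $\Gamma,\psi\Rightarrow\chi$ infer $\Gamma,\varphi\vee\psi\Rightarrow\chi$; from $\Gamma\Rightarrow\varphi$ infer $\Gamma\Rightarrow\varphi\vee\psi$ and $\Gamma\Rightarrow\psi\vee\varphi$;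 from $\Gamma,\varphi[Y/X]\Rightarrow\psi$ infer $\Gamma,\exists X\varphi\Rightarrow\psi$ if $Y$ is not free in the conclusion sequent; from $\Gamma\Rightarrow\varphi[Y/X]$ infer $\Gamma,\neg E\Rightarrow\exists X\varphi$; from $\Gamma,\psi[Y/X]\Rightarrow\varphi[Y'/X']$ infer $\Gamma,\exists X\psi\Rightarrow\exists X'\varphi$ if $Y$ is not free in the conclusion sequent; from $\Gamma\Rightarrow\varphi[Y/X]$ infer $\Gamma,Y=Y'\Rightarrow\varphi[Y'/X]$. A set $S$ of sentences proves $\varphi$ if $\Gamma\Rightarrow\varphi$ is derivable for some finite $\Gamma\subset S$; $\varphi$ $S$-provably implies $\varphi'$ if $\Gamma,\varphi\Rightarrow\varphi'$ is derivable for some finite $\Gamma\subset S$; $S$-provable equivalence means implication both ways. A theory $T$ is a set of sentences; it is consistent if for no formula $\psi$ does $T$ prove both $\psi$ and $\neg\psi$. THE CATEGORY $\mathrm{Syn}(T)$. A nonsentence is a formula with at least one free variable. Writing a nonsentence as $\varphi(X_i)$ means that $X_1,\dots,X_n$ enumerates its free variables in increasing index order; then $\varphi(B_i):=\varphi[B_i/X_i]$. Indices: $i$ runs over $1..n$, $j$ over $1..m$, $k$ over $1..l$; $\forall x_{-i}$ abbreviates $\forall x_{-1}\cdots\forall x_{-n}$, etc. Objects are formulas of $L$. Premorphisms ($s,s',\dots$ are sentences, $\alpha,\beta,\gamma$ nonsentences): Type 1, $\alpha(X_i)\to\beta(Y_j)$: a formula $\theta$ with free variables among $x_{-i},x_j$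 such that $T$ proves F1: $\forall x_{-i}\forall x_j[\theta\to\alpha(x_{-i})\wedge\beta(x_j)]$; F2: $\forall x_{-i}[\alpha(x_{-i})\to\exists x_j\theta]$; F3: $\forall x_{-i}\forall x_j\forall x_{m+j}[\theta\wedge\theta[x_{m+j}/x_j]\to\bigwedge_j x_j=x_{m+j}]$. Type 2, $\alpha(X_i)\to s$: a single formal object, existing iff $T$ proves $\forall x_{-i}[\alpha(x_{-i})\to s]$. Type 3, $s\to\beta(Y_j)$: a formula $\theta$ with free variables among $x_j$ such that $T$ proves $\forall x_j[\theta\to s\wedge\beta(x_j)]$, $s\to\exists x_j\theta$ and $\forall x_j\forall x_{m+j}[\theta\wedge\theta[x_{m+j}/x_j]\to\bigwedge_j x_j=x_{m+j}]$. Type 4, $s\to s'$: a single formal object, existing iff $T$ proves $s\to s'$. $\theta(A_i,B_j)$ means substituting $A_i$ for $x_{-i}$ and $B_j$ for $x_j$. Morphisms: with sentence target, the premorphisms; with nonsentence target, premorphisms modulo $T\cup\{\neg E\}$-provable equivalence. Composition is induced by: for $\theta_1:\alpha(X_i)\to\beta(Y_j)$, $\theta_2:\beta\to\gamma(Z_k)$, $\theta_2\circ\theta_1=\exists T_j[\theta_1(x_{-i},T_j)\wedge\theta_2(T_j,x_k)]$ with $T_j$ new variables in increasing order; the same without $x_{-i}$ if the source is a sentence; the composite of $\alpha(X_i)\to s$ with $\theta_2:s\to\gamma(Z_k)$ is $\alpha(x_{-i})\wedge\theta_2(x_k)$; the composite of $s\to s'$ with $\theta_2:s'\to\gamma$ is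 $s\wedge\theta_2(x_k)$; any composite with sentence target is the unique formal object. The identity of $\varphi(X_i)$ is $\varphi(x_{-i})\wedge\bigwedge_i x_i=x_{-i}$; that of a sentence $s$ is the formal $s\to s$. $\mathrm{Syn}(T)$ is a coherent category with final object $S$. CATEGORICAL NOTIONS. An effective epimorphism $g:X\to Y$ is a coequalizer of the projections $X\times_YX\rightrightarrows X$. $\mathrm{Sub}(X)$ is the poset of monomorphisms into $X$ up to isomorphism over $X$; join semilattices have, and their homomorphisms preserve, finite joins including the least element. NOTATION IN THE CLAIM. For a nonempty finite set $V=\{X_1,\dots,X_n\}$ of variables (listed in increasing index order), $E^V$ is the formula $X_1=X_1\wedge\dots\wedge X_n=X_n$; $E^{\emptyset}:=S$. For $1\le l\le n$ let $\pi_l:E^V\to(x_0=x_0)$ be the morphism represented by the formula $x_{-l}=x_1$; the $\pi_l$ exhibit $E^V$ as an $n$-fold product of $x_0=x_0$. $M^V$ is the set of functions $V\to M$, and $b_V:F(E^V)\to M^V$ is the unique bijection with $F\pi_l(z)=b_V(z)(X_l)$ for all $l$; $b_\emptyset$ is the identity of $U$. For a nonsentence $\varphi(X_i)$, $\iota_\varphi:\varphi\to E^{\mathrm{free}(\varphi)}$ is the monomorphism represented by $\varphi(x_{-i})\wedge\bigwedge_i x_i=x_{-i}$; for a sentence $\varphi$, $\iota_\varphi:\varphi\to S$ is the unique morphism. $s_n:M^{\{x_1,\dots,x_n\}}\to M^n$ is $\lambda\mapsto(\lambda(x_1),\dots,\lambda(x_n))$. A $0$-ary symbol $P$ is interpreted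 by a subset $P^{\mathcal M}\subset U$, being true iff $P^{\mathcal M}=U$. For a nonsentence $\varphi$, $\mathcal M(\varphi):=\{\lambda\in M^{\mathrm{free}(\varphi)}:\lambda\models\varphi\}$ (usual Tarskian satisfaction in $\mathcal M$); for a sentence $s$, $\mathcal M(s):=U$ if $\mathcal M\models s$ and $\emptyset$ otherwise. *)

theory Defs
  imports "HOL-Library.FuncSet" "HOL-Algebra.Order"
begin

section \<open>Formulas\<close>

text \<open>
  The variable \<open>x\<^sub>k\<close> is the integer \<open>k\<close>. Formulas up to renaming of bound variables are represented
  in locally nameless style: free variables are named, bound ones are de Bruijn indices. Hence
  alpha-equivalent formulas are equal (lemma \<open>alpha\<close> below), and mapping the free variables is
  capture-avoiding simultaneous substitution. A relational signature is a partial arity function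
  (so it may be empty).
\<close>

type_synonym 'r signature = "'r \<Rightarrow> nat option"

datatype var = Free int | Bound nat

datatype 'r fml =
  Rel 'r "var list" | Eq var var | Neg "'r fml" | Or "'r fml" "'r fml" | Ex "'r fml"

fun fv_var :: "var \<Rightarrow> int set" where
  "fv_var (Free X) = {X}"
| "fv_var (Bound k) = {}"

primrec fv :: "'r fml \<Rightarrow> int set" where
  "fv (Rel P vs) = (\<Union>v\<in>set vs. fv_var v)"
| "fv (Eq u v) = fv_var u \<union> fv_var v"
| "fv (Neg \<phi>) = fv \<phi>"
| "fv (Or \<phi> \<psi>) = fv \<phi> \<union> fv \<psi>"
| "fv (Ex \<phi>) = fv \<phi>"

fun subst_var :: "(int \<Rightarrow> int) \<Rightarrow> var \<Rightarrow> var" where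
  "subst_var \<sigma> (Free X) = Free (\<sigma> X)"
| "subst_var \<sigma> (Bound k) = Bound k"

primrec subst :: "(int \<Rightarrow> int) \<Rightarrow> 'r fml \<Rightarrow> 'r fml" where
  "subst \<sigma> (Rel P vs) = Rel P (map (subst_var \<sigma>) vs)"
| "subst \<sigma> (Eq u v) = Eq (subst_var \<sigma> u) (subst_var \<sigma> v)"
| "subst \<sigma> (Neg \<phi>) = Neg (subst \<sigma> \<phi>)"
| "subst \<sigma> (Or \<phi> \<psi>) = Or (subst \<sigma> \<phi>) (subst \<sigma> \<psi>)"
| "subst \<sigma> (Ex \<phi>) = Ex (subst \<sigma> \<phi>)"

text \<open>\<open>subst1 \<phi> Y X\<close> is \<open>\<phi>[Y/X]\<close>.\<close>

definition subst1 :: "'r fml \<Rightarrow> int \<Rightarrow> int \<Rightarrow> 'r fml" where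
  "subst1 \<phi> Y X = subst (id(X := Y)) \<phi>"

fun bind_var :: "int \<Rightarrow> nat \<Rightarrow> var \<Rightarrow> var" where
  "bind_var X k (Free Y) = (if Y = X then Bound k else Free Y)"
| "bind_var X k (Bound i) = Bound i"

primrec bind :: "int \<Rightarrow> nat \<Rightarrow> 'r fml \<Rightarrow> 'r fml" where
  "bind X k (Rel P vs) = Rel P (map (bind_var X k) vs)"
| "bind X k (Eq u v) = Eq (bind_var X k u) (bind_var X k v)"
| "bind X k (Neg \<phi>) = Neg (bind X k \<phi>)"
| "bind X k (Or \<phi> \<psi>) = Or (bind X k \<phi>) (bind X k \<psi>)"
| "bind X k (Ex \<phi>) = Ex (bind X (Suc k) \<phi>)"

definition ex :: "int \<Rightarrow> 'r fml \<Rightarrow> 'r fml" where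
  "ex X \<phi> = Ex (bind X 0 \<phi>)"

definition eqv :: "int \<Rightarrow> int \<Rightarrow> 'r fml" where
  "eqv X Y = Eq (Free X) (Free Y)"

definition conj :: "'r fml \<Rightarrow> 'r fml \<Rightarrow> 'r fml" where
  "conj \<phi> \<psi> = Neg (Or (Neg \<phi>) (Neg \<psi>))"

definition imp :: "'r fml \<Rightarrow> 'r fml \<Rightarrow> 'r fml" where
  "imp \<phi> \<psi> = Or (Neg \<phi>) \<psi>"

definition all :: "int \<Rightarrow> 'r fml \<Rightarrow> 'r fml" where
  "all X \<phi> = Neg (ex X (Neg \<phi>))"

definition exs :: "int list \<Rightarrow> 'r fml \<Rightarrow> 'r fml" where
  "exs Xs \<phi> = foldr ex Xs \<phi>"

definition alls :: "int list \<Rightarrow> 'r fml \<Rightarrow> 'r fml" where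
  "alls Xs \<phi> = foldr all Xs \<phi>"

definition E_fml :: "'r fml" where
  "E_fml = Neg (ex 0 (eqv 0 0))"

definition S_fml :: "'r fml" where
  "S_fml = all 0 (eqv 0 0)"

text \<open>The value on the empty list gives the convention \<open>E\<^sup>\<emptyset> := S\<close> in \<open>EV\<close> below.\<close>

fun conjs :: "'r fml list \<Rightarrow> 'r fml" where
  "conjs [] = S_fml"
| "conjs [\<phi>] = \<phi>"
| "conjs (\<phi> # \<psi> # \<chi>s) = conj \<phi> (conjs (\<psi> # \<chi>s))"

text \<open>The formulas of the language, generated by the named constructors.\<close>

inductive_set Fml :: "'r signature \<Rightarrow> 'r fml set" for L :: "'r signature" where
  "L P = Some (length Xs) \<Longrightarrow> Rel P (map Free Xs) \<in> Fml L"
| "eqv X Y \<in> Fml L"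
| "\<phi> \<in> Fml L \<Longrightarrow> Neg \<phi> \<in> Fml L"
| "\<phi> \<in> Fml L \<Longrightarrow> \<psi> \<in> Fml L \<Longrightarrow> Or \<phi> \<psi> \<in> Fml L"
| "\<phi> \<in> Fml L \<Longrightarrow> ex X \<phi> \<in> Fml L"

definition sentence :: "'r fml \<Rightarrow> bool" where
  "sentence \<phi> \<longleftrightarrow> fv \<phi> = {}"

lemma alpha:
  assumes "Y \<notin> fv \<phi>"
  shows "ex Y (subst1 \<phi> Y X) = ex X \<phi>"
proof -
  have v: "bind_var Y k (subst_var (id(X := Y)) v) = bind_var X k v" if "Y \<notin> fv_var v" for k v
    using that by (cases v) auto
  have "bind Y k (subst (id(X := Y)) \<phi>) = bind X k \<phi>" for k
    using assms by (induction \<phi> arbitrary: k) (auto simp: v)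
  then show ?thesis
    by (simp add: ex_def subst1_def)
qed


section \<open>The sequent calculus\<close>

inductive derivable :: "'r signature \<Rightarrow> 'r fml set \<Rightarrow> 'r fml \<Rightarrow> bool" for L :: "'r signature" where
  assm: "finite \<Gamma> \<Longrightarrow> \<Gamma> \<subseteq> Fml L \<Longrightarrow> \<phi> \<in> \<Gamma> \<Longrightarrow> derivable L \<Gamma> \<phi>"
| refl: "derivable L {} (eqv X X)"
| weaken: "derivable L \<Gamma> \<phi> \<Longrightarrow> \<Gamma> \<subseteq> \<Gamma>' \<Longrightarrow> finite \<Gamma>' \<Longrightarrow> \<Gamma>' \<subseteq> Fml L \<Longrightarrow> derivable L \<Gamma>' \<phi>"
| by_cases: "derivable L (insert \<psi> \<Gamma>) \<phi> \<Longrightarrow> derivable L (insert (Neg \<psi>) \<Gamma>) \<phi> \<Longrightarrow> derivable L \<Gamma> \<phi>"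
| contr: "derivable L (insert (Neg \<phi>) \<Gamma>) \<psi> \<Longrightarrow> derivable L (insert (Neg \<phi>) \<Gamma>) (Neg \<psi>) \<Longrightarrow>
    derivable L \<Gamma> \<phi>"
| orL: "derivable L (insert \<phi> \<Gamma>) \<chi> \<Longrightarrow> derivable L (insert \<psi> \<Gamma>) \<chi> \<Longrightarrow>
    derivable L (insert (Or \<phi> \<psi>) \<Gamma>) \<chi>"
| orR1: "derivable L \<Gamma> \<phi> \<Longrightarrow> \<psi> \<in> Fml L \<Longrightarrow> derivable L \<Gamma> (Or \<phi> \<psi>)"
| orR2: "derivable L \<Gamma> \<phi> \<Longrightarrow> \<psi> \<in> Fml L \<Longrightarrow> derivable L \<Gamma> (Or \<psi> \<phi>)"
| exL: "derivable L (insert (subst1 \<phi> Y X) \<Gamma>) \<psi> \<Longrightarrow> \<phi> \<in> Fml L \<Longrightarrow>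
    (\<forall>\<chi>\<in>insert (ex X \<phi>) (insert \<psi> \<Gamma>). Y \<notin> fv \<chi>) \<Longrightarrow>
    derivable L (insert (ex X \<phi>) \<Gamma>) \<psi>"
| exR: "derivable L \<Gamma> (subst1 \<phi> Y X) \<Longrightarrow> \<phi> \<in> Fml L \<Longrightarrow>
    derivable L (insert (Neg E_fml) \<Gamma>) (ex X \<phi>)"
| exLR: "derivable L (insert (subst1 \<psi> Y X) \<Gamma>) (subst1 \<phi> Y' X') \<Longrightarrow> \<psi> \<in> Fml L \<Longrightarrow> \<phi> \<in> Fml L \<Longrightarrow>
    (\<forall>\<chi>\<in>insert (ex X \<psi>) (insert (ex X' \<phi>) \<Gamma>). Y \<notin> fv \<chi>) \<Longrightarrow>
    derivable L (insert (ex X \<psi>) \<Gamma>) (ex X' \<phi>)"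
| eq: "derivable L \<Gamma> (subst1 \<phi> Y X) \<Longrightarrow> \<phi> \<in> Fml L \<Longrightarrow>
    derivable L (insert (eqv Y Y') \<Gamma>) (subst1 \<phi> Y' X)"

definition proves :: "'r signature \<Rightarrow> 'r fml set \<Rightarrow> 'r fml \<Rightarrow> bool" where
  "proves L T \<phi> \<longleftrightarrow> (\<exists>\<Gamma>. finite \<Gamma> \<and> \<Gamma> \<subseteq> T \<and> derivable L \<Gamma> \<phi>)"

definition prov_implies :: "'r signature \<Rightarrow> 'r fml set \<Rightarrow> 'r fml \<Rightarrow> 'r fml \<Rightarrow> bool" where
  "prov_implies L T \<phi> \<phi>' \<longleftrightarrow> (\<exists>\<Gamma>. finite \<Gamma> \<and> \<Gamma> \<subseteq> T \<and> derivable L (insert \<phi> \<Gamma>) \<phi>')"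

definition prov_equiv :: "'r signature \<Rightarrow> 'r fml set \<Rightarrow> 'r fml \<Rightarrow> 'r fml \<Rightarrow> bool" where
  "prov_equiv L T \<phi> \<phi>' \<longleftrightarrow> prov_implies L T \<phi> \<phi>' \<and> prov_implies L T \<phi>' \<phi>"

definition is_theory :: "'r signature \<Rightarrow> 'r fml set \<Rightarrow> bool" where
  "is_theory L T \<longleftrightarrow> T \<subseteq> {\<phi> \<in> Fml L. sentence \<phi>}"

definition consistent :: "'r signature \<Rightarrow> 'r fml set \<Rightarrow> bool" where
  "consistent L T \<longleftrightarrow> \<not> (\<exists>\<psi>\<in>Fml L. proves L T \<psi> \<and> proves L T (Neg \<psi>))"


section \<open>Categories, functors, and the preservation properties\<close>

record ('o, 'a) cat =
  Ob :: "'o set"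
  Ar :: "'a set"
  Src :: "'a \<Rightarrow> 'o"
  Tgt :: "'a \<Rightarrow> 'o"
  Ident :: "'o \<Rightarrow> 'a"
  Comp :: "'a \<Rightarrow> 'a \<Rightarrow> 'a"  \<comment> \<open>\<open>Comp C g f\<close> is \<open>g \<circ> f\<close>\<close>

definition hom :: "('o, 'a) cat \<Rightarrow> 'o \<Rightarrow> 'o \<Rightarrow> 'a set" where
  "hom C x y = {f \<in> Ar C. Src C f = x \<and> Tgt C f = y}"

definition category :: "('o, 'a) cat \<Rightarrow> bool" where
  "category C \<longleftrightarrow>
    (\<forall>f\<in>Ar C. Src C f \<in> Ob C \<and> Tgt C f \<in> Ob C) \<and>
    (\<forall>x\<in>Ob C. Ident C x \<in> hom C x x) \<and>
    (\<forall>f\<in>Ar C. \<forall>g\<in>Ar C. Tgt C f = Src C g \<longrightarrow> Comp C g f \<in> hom C (Src C f) (Tgt C g)) \<and>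
    (\<forall>f\<in>Ar C. Comp C f (Ident C (Src C f)) = f \<and> Comp C (Ident C (Tgt C f)) f = f) \<and>
    (\<forall>f\<in>Ar C. \<forall>g\<in>Ar C. \<forall>h\<in>Ar C. Tgt C f = Src C g \<longrightarrow> Tgt C g = Src C h \<longrightarrow>
      Comp C h (Comp C g f) = Comp C (Comp C h g) f)"

record ('o, 'a, 'p, 'b) fnctr =
  on_ob :: "'o \<Rightarrow> 'p"
  on_ar :: "'a \<Rightarrow> 'b"

definition is_functor :: "('o, 'a) cat \<Rightarrow> ('p, 'b) cat \<Rightarrow> ('o, 'a, 'p, 'b) fnctr \<Rightarrow> bool" where
  "is_functor C D F \<longleftrightarrow>
    (\<forall>x\<in>Ob C. on_ob F x \<in> Ob D) \<and>
    (\<forall>f\<in>Ar C. on_ar F f \<in> hom D (on_ob F (Src C f)) (on_ob F (Tgt C f))) \<and>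
    (\<forall>x\<in>Ob C. on_ar F (Ident C x) = Ident D (on_ob F x)) \<and>
    (\<forall>f\<in>Ar C. \<forall>g\<in>Ar C. Tgt C f = Src C g \<longrightarrow>
      on_ar F (Comp C g f) = Comp D (on_ar F g) (on_ar F f))"

definition comp_functor ::
  "('p, 'b, 'q, 'c) fnctr \<Rightarrow> ('o, 'a, 'p, 'b) fnctr \<Rightarrow> ('o, 'a, 'q, 'c) fnctr" where
  "comp_functor G F = \<lparr>on_ob = on_ob G \<circ> on_ob F, on_ar = on_ar G \<circ> on_ar F\<rparr>"

definition is_cone ::
  "('j, 'k) cat \<Rightarrow> ('o, 'a) cat \<Rightarrow> ('j, 'k, 'o, 'a) fnctr \<Rightarrow> 'o \<Rightarrow> ('j \<Rightarrow> 'a) \<Rightarrow> bool" where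
  "is_cone J C D c leg \<longleftrightarrow> c \<in> Ob C \<and>
    (\<forall>j\<in>Ob J. leg j \<in> hom C c (on_ob D j)) \<and>
    (\<forall>u\<in>Ar J. Comp C (on_ar D u) (leg (Src J u)) = leg (Tgt J u))"

definition is_limit ::
  "('j, 'k) cat \<Rightarrow> ('o, 'a) cat \<Rightarrow> ('j, 'k, 'o, 'a) fnctr \<Rightarrow> 'o \<Rightarrow> ('j \<Rightarrow> 'a) \<Rightarrow> bool" where
  "is_limit J C D c leg \<longleftrightarrow> is_cone J C D c leg \<and>
    (\<forall>c' leg'. is_cone J C D c' leg' \<longrightarrow>
      (\<exists>!h. h \<in> hom C c' c \<and> (\<forall>j\<in>Ob J. Comp C (leg j) h = leg' j)))"

text \<open>
  Every finite category is isomorphic to one whose objects and arrows are natural numbers.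
  The empty index category gives final objects.
\<close>

definition preserves_finite_limits ::
  "('o, 'a) cat \<Rightarrow> ('p, 'b) cat \<Rightarrow> ('o, 'a, 'p, 'b) fnctr \<Rightarrow> bool" where
  "preserves_finite_limits C D F \<longleftrightarrow>
    (\<forall>(J :: (nat, nat) cat) G c leg.
      category J \<and> finite (Ob J) \<and> finite (Ar J) \<and> is_functor J C G \<and> is_limit J C G c leg \<longrightarrow>
      is_limit J D (comp_functor F G) (on_ob F c) (\<lambda>j. on_ar F (leg j)))"

definition is_pullback ::
  "('o, 'a) cat \<Rightarrow> 'a \<Rightarrow> 'a \<Rightarrow> 'a \<Rightarrow> 'a \<Rightarrow> bool" where
  "is_pullback C f g p q \<longleftrightarrow>
    f \<in> Ar C \<and> g \<in> Ar C \<and> p \<in> Ar C \<and> q \<in> Ar C \<and> Tgt C f = Tgt C g \<and> Src C p = Src C q \<and>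
    Tgt C p = Src C f \<and> Tgt C q = Src C g \<and> Comp C f p = Comp C g q \<and>
    (\<forall>w\<in>Ob C. \<forall>u\<in>hom C w (Src C f). \<forall>v\<in>hom C w (Src C g). Comp C f u = Comp C g v \<longrightarrow>
      (\<exists>!h. h \<in> hom C w (Src C p) \<and> Comp C p h = u \<and> Comp C q h = v))"

definition is_coequalizer :: "('o, 'a) cat \<Rightarrow> 'a \<Rightarrow> 'a \<Rightarrow> 'a \<Rightarrow> bool" where
  "is_coequalizer C p q g \<longleftrightarrow>
    p \<in> Ar C \<and> q \<in> Ar C \<and> g \<in> Ar C \<and> Src C p = Src C q \<and> Tgt C p = Src C g \<and> Tgt C q = Src C g \<and>
    Comp C g p = Comp C g q \<and>
    (\<forall>w\<in>Ob C. \<forall>u\<in>hom C (Src C g) w. Comp C u p = Comp C u q \<longrightarrow>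
      (\<exists>!h. h \<in> hom C (Tgt C g) w \<and> Comp C h g = u))"

definition effective_epi :: "('o, 'a) cat \<Rightarrow> 'a \<Rightarrow> bool" where
  "effective_epi C g \<longleftrightarrow> (\<exists>p q. is_pullback C g g p q \<and> is_coequalizer C p q g)"

definition mono_arrow :: "('o, 'a) cat \<Rightarrow> 'a \<Rightarrow> bool" where
  "mono_arrow C m \<longleftrightarrow> m \<in> Ar C \<and>
    (\<forall>w\<in>Ob C. \<forall>u\<in>hom C w (Src C m). \<forall>v\<in>hom C w (Src C m). Comp C m u = Comp C m v \<longrightarrow> u = v)"

definition iso_arrow :: "('o, 'a) cat \<Rightarrow> 'a \<Rightarrow> bool" where
  "iso_arrow C f \<longleftrightarrow> f \<in> Ar C \<and>
    (\<exists>g\<in>hom C (Tgt C f) (Src C f).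
      Comp C g f = Ident C (Src C f) \<and> Comp C f g = Ident C (Tgt C f))"

definition monos_into :: "('o, 'a) cat \<Rightarrow> 'o \<Rightarrow> 'a set" where
  "monos_into C x = {m. mono_arrow C m \<and> Tgt C m = x}"

definition iso_over :: "('o, 'a) cat \<Rightarrow> 'o \<Rightarrow> ('a \<times> 'a) set" where
  "iso_over C x = {(m, m'). m \<in> monos_into C x \<and> m' \<in> monos_into C x \<and>
    (\<exists>h\<in>hom C (Src C m) (Src C m'). iso_arrow C h \<and> Comp C m' h = m)}"

definition Sub :: "('o, 'a) cat \<Rightarrow> 'o \<Rightarrow> 'a set gorder" where
  "Sub C x = \<lparr>carrier = monos_into C x // iso_over C x, eq = (=),
    le = (\<lambda>A B. \<exists>m\<in>A. \<exists>m'\<in>B. \<exists>h\<in>hom C (Src C m) (Src C m'). Comp C m' h = m)\<rparr>"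

definition Sub_map ::
  "('p, 'b) cat \<Rightarrow> ('o, 'a, 'p, 'b) fnctr \<Rightarrow> 'o \<Rightarrow> 'a set \<Rightarrow> 'b set" where
  "Sub_map D F x A = iso_over D (on_ob F x) `` (on_ar F ` A)"

text \<open>
  Joins are least upper bounds; \<open>A = {}\<close> gives the least element.
\<close>

definition join_hom :: "'a gorder \<Rightarrow> 'b gorder \<Rightarrow> ('a \<Rightarrow> 'b) \<Rightarrow> bool" where
  "join_hom P Q h \<longleftrightarrow> h ` carrier P \<subseteq> carrier Q \<and>
    (\<forall>A a. finite A \<and> A \<subseteq> carrier P \<and> least P a (Upper P A) \<longrightarrow>
      least Q (h a) (Upper Q (h ` A)))"

text \<open>
  The category of sets with elements in \<open>'u\<close>. An arrow \<open>A \<rightarrow> B\<close> is \<open>(A, f, B)\<close> with \<open>f\<close> extensional.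
  As the category of formulas is small, every functor from it to sets has its values
  among the subsets of a single set, i.e. factors through this category for some \<open>'u\<close>.
\<close>

type_synonym 'u set_arrow = "'u set \<times> ('u \<Rightarrow> 'u) \<times> 'u set"

definition SetCat :: "('u set, 'u set_arrow) cat" where
  "SetCat = \<lparr>Ob = UNIV, Ar = {(A, f, B). f \<in> A \<rightarrow>\<^sub>E B},
    Src = (\<lambda>(A, f, B). A), Tgt = (\<lambda>(A, f, B). B),
    Ident = (\<lambda>A. (A, restrict id A, A)),
    Comp = (\<lambda>(B, g, C) (A, f, B'). (A, compose A g f, C))\<rparr>"

definition fn :: "'u set_arrow \<Rightarrow> 'u \<Rightarrow> 'u" where
  "fn a = fst (snd a)"

definition surjection :: "'u set_arrow \<Rightarrow> bool" where
  "surjection a \<longleftrightarrow> fn a ` Src SetCat a = Tgt SetCat a"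


section \<open>The syntactic category\<close>

definition pos :: "int set \<Rightarrow> int \<Rightarrow> nat" where
  "pos V X = card {Y \<in> V. Y \<le> X}"

text \<open>\<open>inst \<phi> B\<close> is \<open>\<phi>(B\<^sub>i)\<close>, i.e. \<open>\<phi>[B\<^sub>i/X\<^sub>i]\<close> with \<open>X\<^sub>1, \<dots>, X\<^sub>n\<close> the free variables in increasing order.\<close>

definition inst :: "'r fml \<Rightarrow> (nat \<Rightarrow> int) \<Rightarrow> 'r fml" where
  "inst \<phi> B = subst (\<lambda>X. if X \<in> fv \<phi> then B (pos (fv \<phi>) X) else X) \<phi>"

text \<open>\<open>inst2 \<theta> A B\<close> is \<open>\<theta>(A\<^sub>i, B\<^sub>j)\<close>: \<open>A\<^sub>i\<close> is substituted for \<open>x\<^sub>-\<^sub>i\<close> and \<open>B\<^sub>j\<close> for \<open>x\<^sub>j\<close>.\<close>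

definition inst2 :: "'r fml \<Rightarrow> (nat \<Rightarrow> int) \<Rightarrow> (nat \<Rightarrow> int) \<Rightarrow> 'r fml" where
  "inst2 \<theta> A B = subst (\<lambda>X. if X < 0 then A (nat (- X)) else if X > 0 then B (nat X) else X) \<theta>"

definition xneg :: "nat \<Rightarrow> int" where "xneg i = - int i"
definition xpos :: "nat \<Rightarrow> int" where "xpos j = int j"

abbreviation nfv :: "'r fml \<Rightarrow> nat" where "nfv \<phi> \<equiv> card (fv \<phi>)"

text \<open>
  Premorphisms with nonsentence target. For a sentence as source, \<open>n = 0\<close>, the quantifiers over the
  \<open>x\<^sub>-\<^sub>i\<close> are absent and \<open>inst \<alpha> xneg = \<alpha>\<close>, so this is literally the definition of type 3;
  otherwise it is type 1. The same remark applies to \<open>formal_exists\<close> (types 2 and 4),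
  to \<open>comp_fml\<close> and to \<open>comp_formal_fml\<close>.
\<close>

definition premorphism :: "'r signature \<Rightarrow> 'r fml set \<Rightarrow> 'r fml \<Rightarrow> 'r fml \<Rightarrow> 'r fml \<Rightarrow> bool" where
  "premorphism L T \<alpha> \<beta> \<theta> \<longleftrightarrow>
    (let n = nfv \<alpha>; m = nfv \<beta>;
         xs = map xneg [1..<Suc n]; ys = map xpos [1..<Suc m];
         ys' = map (\<lambda>j. xpos (m + j)) [1..<Suc m]
     in \<theta> \<in> Fml L \<and> fv \<theta> \<subseteq> set xs \<union> set ys \<and>
        proves L T (alls xs (alls ys (imp \<theta> (conj (inst \<alpha> xneg) (inst \<beta> xpos))))) \<and>
        proves L T (alls xs (imp (inst \<alpha> xneg) (exs ys \<theta>))) \<and>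
        proves L T (alls xs (alls ys (alls ys'
          (imp (conj \<theta> (inst2 \<theta> xneg (\<lambda>j. xpos (m + j))))
               (conjs (map (\<lambda>j. eqv (xpos j) (xpos (m + j))) [1..<Suc m])))))))"

definition formal_exists :: "'r signature \<Rightarrow> 'r fml set \<Rightarrow> 'r fml \<Rightarrow> 'r fml \<Rightarrow> bool" where
  "formal_exists L T \<alpha> s \<longleftrightarrow> proves L T (alls (map xneg [1..<Suc (nfv \<alpha>)]) (imp (inst \<alpha> xneg) s))"

text \<open>Arrows carry source and target; \<open>Cls \<alpha> A \<beta>\<close> is an equivalence class \<open>A\<close> of premorphisms.\<close>

datatype 'r syn_arrow =
  Formal (src: "'r fml") (tgt: "'r fml")
| Cls (src: "'r fml") "'r fml set" (tgt: "'r fml")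

definition premor_class ::
  "'r signature \<Rightarrow> 'r fml set \<Rightarrow> 'r fml \<Rightarrow> 'r fml \<Rightarrow> 'r fml \<Rightarrow> 'r fml set" where
  "premor_class L T \<alpha> \<beta> \<theta> = {\<theta>'. premorphism L T \<alpha> \<beta> \<theta>' \<and> prov_equiv L (T \<union> {Neg E_fml}) \<theta> \<theta>'}"

definition mor :: "'r signature \<Rightarrow> 'r fml set \<Rightarrow> 'r fml \<Rightarrow> 'r fml \<Rightarrow> 'r fml \<Rightarrow> 'r syn_arrow" where
  "mor L T \<alpha> \<beta> \<theta> = Cls \<alpha> (premor_class L T \<alpha> \<beta> \<theta>) \<beta>"

text \<open>
  \<open>\<exists>T\<^sub>j[\<theta>\<^sub>1(x\<^sub>-\<^sub>i, T\<^sub>j) \<and> \<theta>\<^sub>2(T\<^sub>j, x\<^sub>k)]\<close> for \<open>\<theta>\<^sub>1 : \<alpha> \<rightarrow> \<beta>\<close> and \<open>\<theta>\<^sub>2 : \<beta> \<rightarrow> \<gamma>\<close>; the new variables \<open>T\<^sub>j\<close>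
  are \<open>x\<^sub>N\<^sub>+\<^sub>j\<close>, where \<open>N\<close> bounds the positive indices that occur.
\<close>

definition comp_fml :: "'r fml \<Rightarrow> 'r fml \<Rightarrow> 'r fml \<Rightarrow> 'r fml \<Rightarrow> 'r fml" where
  "comp_fml \<beta> \<gamma> \<theta>\<^sub>1 \<theta>\<^sub>2 =
    (let m = nfv \<beta>; N = max m (nfv \<gamma>); t = (\<lambda>j. xpos (N + j))
     in exs (map t [1..<Suc m]) (conj (inst2 \<theta>\<^sub>1 xneg t) (inst2 \<theta>\<^sub>2 t xpos)))"

definition comp_formal_fml :: "'r fml \<Rightarrow> 'r fml \<Rightarrow> 'r fml" where
  "comp_formal_fml \<alpha> \<theta>\<^sub>2 = conj (inst \<alpha> xneg) \<theta>\<^sub>2"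

fun syn_comp ::
  "'r signature \<Rightarrow> 'r fml set \<Rightarrow> 'r syn_arrow \<Rightarrow> 'r syn_arrow \<Rightarrow> 'r syn_arrow" where
  "syn_comp L T (Formal \<phi> s) f = Formal (src f) s"
| "syn_comp L T (Cls \<beta> B \<gamma>) (Cls \<alpha> A \<beta>') =
    Cls \<alpha> (\<Union>\<theta>\<^sub>1\<in>A. \<Union>\<theta>\<^sub>2\<in>B. premor_class L T \<alpha> \<gamma> (comp_fml \<beta> \<gamma> \<theta>\<^sub>1 \<theta>\<^sub>2)) \<gamma>"
| "syn_comp L T (Cls s B \<gamma>) (Formal \<alpha> s') =
    Cls \<alpha> (\<Union>\<theta>\<^sub>2\<in>B. premor_class L T \<alpha> \<gamma> (comp_formal_fml \<alpha> \<theta>\<^sub>2)) \<gamma>"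

definition graph_fml :: "'r fml \<Rightarrow> 'r fml" where
  "graph_fml \<phi> =
    conj (inst \<phi> xneg) (conjs (map (\<lambda>i. eqv (xpos i) (xneg i)) [1..<Suc (nfv \<phi>)]))"

definition Syn :: "'r signature \<Rightarrow> 'r fml set \<Rightarrow> ('r fml, 'r syn_arrow) cat" where
  "Syn L T = \<lparr>Ob = Fml L,
    Ar = {Formal \<phi> s |\<phi> s. \<phi> \<in> Fml L \<and> s \<in> Fml L \<and> sentence s \<and> formal_exists L T \<phi> s} \<union>
      {mor L T \<phi> \<beta> \<theta> |\<phi> \<beta> \<theta>. \<phi> \<in> Fml L \<and> \<beta> \<in> Fml L \<and> \<not> sentence \<beta> \<and> premorphism L T \<phi> \<beta> \<theta>},
    Src = src, Tgt = tgt,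
    Ident = (\<lambda>\<phi>. if sentence \<phi> then Formal \<phi> \<phi> else mor L T \<phi> \<phi> (graph_fml \<phi>)),
    Comp = syn_comp L T\<rparr>"

definition EV :: "int set \<Rightarrow> 'r fml" where
  "EV V = conjs (map (\<lambda>X. eqv X X) (sorted_list_of_set V))"

definition proj :: "'r signature \<Rightarrow> 'r fml set \<Rightarrow> int set \<Rightarrow> nat \<Rightarrow> 'r syn_arrow" where
  "proj L T V l = mor L T (EV V) (eqv 0 0) (eqv (xneg l) (xpos 1))"

definition incl :: "'r signature \<Rightarrow> 'r fml set \<Rightarrow> 'r fml \<Rightarrow> 'r syn_arrow" where
  "incl L T \<phi> =
    (if sentence \<phi> then Formal \<phi> S_fml else mor L T \<phi> (EV (fv \<phi>)) (graph_fml \<phi>))"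


section \<open>Structures and satisfaction\<close>

text \<open>\<open>pt\<close> is the singleton \<open>U\<close>; relations of positive arity are interpreted by \<open>rel\<close>, those of arity 0 by \<open>rel0\<close>.\<close>

record ('r, 'u) struct =
  uni :: "'u set"
  pt :: "'u set"
  rel :: "'r \<Rightarrow> 'u list set"
  rel0 :: "'r \<Rightarrow> 'u set"

fun val :: "(int \<Rightarrow> 'u) \<Rightarrow> 'u list \<Rightarrow> var \<Rightarrow> 'u" where
  "val \<rho> bs (Free X) = \<rho> X"
| "val \<rho> bs (Bound k) = bs ! k"

text \<open>\<open>bs\<close> holds the values of the bound variables; see lemma \<open>sat_ex\<close> for the usual clause.\<close>

primrec sat :: "('r, 'u) struct \<Rightarrow> (int \<Rightarrow> 'u) \<Rightarrow> 'u list \<Rightarrow> 'r fml \<Rightarrow> bool" where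
  "sat \<M> \<rho> bs (Rel P vs) \<longleftrightarrow>
    (if vs = [] then rel0 \<M> P = pt \<M> else map (val \<rho> bs) vs \<in> rel \<M> P)"
| "sat \<M> \<rho> bs (Eq u v) \<longleftrightarrow> val \<rho> bs u = val \<rho> bs v"
| "sat \<M> \<rho> bs (Neg \<phi>) \<longleftrightarrow> \<not> sat \<M> \<rho> bs \<phi>"
| "sat \<M> \<rho> bs (Or \<phi> \<psi>) \<longleftrightarrow> sat \<M> \<rho> bs \<phi> \<or> sat \<M> \<rho> bs \<psi>"
| "sat \<M> \<rho> bs (Ex \<phi>) \<longleftrightarrow> (\<exists>a\<in>uni \<M>. sat \<M> \<rho> (a # bs) \<phi>)"

fun closed_var :: "nat \<Rightarrow> var \<Rightarrow> bool" where
  "closed_var k (Free X) = True"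
| "closed_var k (Bound i) = (i < k)"

primrec closed_at :: "nat \<Rightarrow> 'r fml \<Rightarrow> bool" where
  "closed_at k (Rel P vs) = (\<forall>v\<in>set vs. closed_var k v)"
| "closed_at k (Eq u v) = (closed_var k u \<and> closed_var k v)"
| "closed_at k (Neg \<phi>) = closed_at k \<phi>"
| "closed_at k (Or \<phi> \<psi>) = (closed_at k \<phi> \<and> closed_at k \<psi>)"
| "closed_at k (Ex \<phi>) = closed_at (Suc k) \<phi>"

lemma closed_at_bind: "closed_at k \<phi> \<Longrightarrow> closed_at (Suc k) (bind X k \<phi>)"
proof -
  have v: "closed_var k v \<Longrightarrow> closed_var (Suc k) (bind_var X k v)" for k v
    by (cases v) auto
  show "closed_at k \<phi> \<Longrightarrow> closed_at (Suc k) (bind X k \<phi>)"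
    by (induction \<phi> arbitrary: k) (auto simp: v)
qed

lemma closed_at_Fml: "\<phi> \<in> Fml L \<Longrightarrow> closed_at 0 \<phi>"
  by (induction rule: Fml.induct) (auto simp: ex_def eqv_def closed_at_bind)

lemma sat_bind:
  "closed_at k \<phi> \<Longrightarrow> length bs = k \<Longrightarrow>
    sat \<M> \<rho> (bs @ [a]) (bind X k \<phi>) \<longleftrightarrow> sat \<M> (\<rho>(X := a)) bs \<phi>"
proof (induction \<phi> arbitrary: k bs)
  have v: "val \<rho> (bs @ [a]) (bind_var X k v) = val (\<rho>(X := a)) bs v"
    if "closed_var k v" "length bs = k" for k bs v
    using that by (cases v) (auto simp: nth_append)
  {
    case (Rel P vs)
    then have "map (val \<rho> (bs @ [a])) (map (bind_var X k) vs) = map (val (\<rho>(X := a)) bs) vs"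
      by (auto simp: v)
    then show ?case
      by (cases "vs = []") (simp_all del: map_map fun_upd_apply)
  next
    case (Eq u w)
    then show ?case
      by (simp add: v del: fun_upd_apply)
  next
    case (Ex \<phi>)
    have "sat \<M> \<rho> ((b # bs) @ [a]) (bind X (Suc k) \<phi>) \<longleftrightarrow> sat \<M> (\<rho>(X := a)) (b # bs) \<phi>" for b
      by (rule Ex.IH) (use Ex.prems in auto)
    then show ?case
      by (simp del: fun_upd_apply)
  }
qed auto

lemma sat_ex:
  assumes "\<phi> \<in> Fml L"
  shows "sat \<M> \<rho> [] (ex X \<phi>) \<longleftrightarrow> (\<exists>a\<in>uni \<M>. sat \<M> (\<rho>(X := a)) [] \<phi>)"
  using sat_bind[OF closed_at_Fml[OF assms], of "[]" \<M> \<rho> _ X] by (simp add: ex_def)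

text \<open>\<open>M\<^sup>V\<close> is \<open>V \<rightarrow>\<^sub>E M\<close>; for a sentence the assignment is the unique element of \<open>{} \<rightarrow>\<^sub>E M\<close>.\<close>

definition extension :: "('r, 'u) struct \<Rightarrow> 'r fml \<Rightarrow> (int \<Rightarrow> 'u) set" where
  "extension \<M> \<phi> = {\<rho> \<in> fv \<phi> \<rightarrow>\<^sub>E uni \<M>. sat \<M> \<rho> [] \<phi>}"

definition holds :: "('r, 'u) struct \<Rightarrow> 'r fml \<Rightarrow> bool" where
  "holds \<M> s \<longleftrightarrow> sat \<M> (\<lambda>_. undefined) [] s"

definition extension0 :: "('r, 'u) struct \<Rightarrow> 'r fml \<Rightarrow> 'u set" where
  "extension0 \<M> s = (if holds \<M> s then pt \<M> else {})"

definition is_structure :: "'r signature \<Rightarrow> ('r, 'u) struct \<Rightarrow> bool" where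
  "is_structure L \<M> \<longleftrightarrow> uni \<M> \<noteq> {} \<and> (\<exists>u. pt \<M> = {u}) \<and>
    (\<forall>P n. L P = Some n \<and> n > 0 \<longrightarrow> rel \<M> P \<subseteq> {as. length as = n \<and> set as \<subseteq> uni \<M>}) \<and>
    (\<forall>P. L P = Some 0 \<longrightarrow> rel0 \<M> P \<subseteq> pt \<M>)"

definition is_model :: "'r signature \<Rightarrow> ('r, 'u) struct \<Rightarrow> 'r fml set \<Rightarrow> bool" where
  "is_model L \<M> T \<longleftrightarrow> is_structure L \<M> \<and> (\<forall>s\<in>T. holds \<M> s)"


section \<open>The structure defined by a functor\<close>

type_synonym ('r, 'u) set_functor = "('r fml, 'r syn_arrow, 'u set, 'u set_arrow) fnctr"

text \<open>
  For nonempty \<open>V\<close>, the equations \<open>F \<pi>\<^sub>l z = b\<^sub>V(z)(X\<^sub>l)\<close> determine \<open>b\<^sub>V\<close>; they are taken as the definition.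
\<close>

definition b_map ::
  "'r signature \<Rightarrow> 'r fml set \<Rightarrow> ('r, 'u) set_functor \<Rightarrow> int set \<Rightarrow> 'u \<Rightarrow> int \<Rightarrow> 'u" where
  "b_map L T F V z = (\<lambda>X\<in>V. fn (on_ar F (proj L T V (pos V X))) z)"

definition s_map :: "nat \<Rightarrow> (int \<Rightarrow> 'u) \<Rightarrow> 'u list" where
  "s_map n \<rho> = map (\<lambda>i. \<rho> (xpos i)) [1..<Suc n]"

definition ext_map ::
  "'r signature \<Rightarrow> 'r fml set \<Rightarrow> ('r, 'u) set_functor \<Rightarrow> 'r fml \<Rightarrow> 'u \<Rightarrow> int \<Rightarrow> 'u" where
  "ext_map L T F \<phi> = b_map L T F (fv \<phi>) \<circ> fn (on_ar F (incl L T \<phi>))"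

text \<open>For a sentence, \<open>b\<^sub>\<emptyset>\<close> is the identity.\<close>

definition ext_map0 ::
  "'r signature \<Rightarrow> 'r fml set \<Rightarrow> ('r, 'u) set_functor \<Rightarrow> 'r fml \<Rightarrow> 'u \<Rightarrow> 'u" where
  "ext_map0 L T F s = fn (on_ar F (incl L T s))"

definition tilde :: "'r signature \<Rightarrow> 'r \<Rightarrow> 'r fml" where
  "tilde L P = Rel P (map (\<lambda>i. Free (xpos i)) [1..<Suc (the (L P))])"

definition functor_struct ::
  "'r signature \<Rightarrow> 'r fml set \<Rightarrow> ('r, 'u) set_functor \<Rightarrow> ('r, 'u) struct" where
  "functor_struct L T F = \<lparr>
    uni = on_ob F (eqv 0 0),
    pt = on_ob F S_fml,
    rel = (\<lambda>P. (s_map (the (L P)) \<circ> ext_map L T F (tilde L P)) ` on_ob F (tilde L P)),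
    rel0 = (\<lambda>P. ext_map0 L T F (Rel P []) ` on_ob F (Rel P []))\<rparr>"

end

theory Submission
  imports Defs "HOL-Library.Countable_Set"
begin

text \<open>
  Why the theorem is true. By completeness of the calculus for structures on the integers, whose universe
  may be empty, a sentence is provable from \<open>T\<close> iff it holds in almost all structures, in the sense of
  the filter \<open>Mods T\<close> generated by the model classes of the finite subsets of \<open>T\<close>. Hence an arrow
  \<open>\<alpha> \<rightarrow> \<beta>\<close> of \<open>Syn(T)\<close> is a definable relation which in almost all structures is a function from the
  extension of \<open>\<alpha>\<close> to that of \<open>\<beta>\<close>; arrows are equal iff almost all their denotations are, and
  composition is composition of relations (\<open>hom_ex\<close>, \<open>hom_eqI\<close>, \<open>comp\<close>). Everything in this category
  can then be computed structure by structure, as for sets: a finite cone is a limit if its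
  denotations are (\<open>limit_arrow\<close>), surjective arrows are effective epimorphisms
  (\<open>effective_epi_if_surj\<close>), and a finite union of formulas in the same variables is their join among
  the subobjects (\<open>Sub_join\<close>).

  Each free variable \<open>x\<close> of \<open>\<phi>\<close> gives an arrow from \<open>\<phi>\<close> to \<open>x\<^sub>0 = x\<^sub>0\<close>. The images under \<open>F\<close> of these
  arrows give every \<open>z \<in> F(\<phi>)\<close> an assignment \<open>coord \<phi> z\<close> of elements of \<open>M\<close> to the free variables; it is
  the map of the theorem (\<open>ext_map_coord\<close>). Let \<open>img \<phi>\<close> be the set of these assignments. Each
  preservation property of \<open>F\<close> says how \<open>img\<close> behaves. Finite limits: \<open>coord \<phi>\<close> is injective
  (\<open>coord_inj\<close>), \<open>img\<close> commutes with inverse images along changes of variables and with intersections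
  (\<open>img_glue\<close>), and \<open>img (EV V)\<close> consists of all assignments on \<open>V\<close> (\<open>img_EV\<close>). Effective epimorphisms:
  \<open>img\<close> commutes with direct images along changes of variables (\<open>img_image\<close>). Joins: \<open>img\<close> commutes with
  finite unions, also with the empty one (\<open>img_union\<close>).

  These operations are the clauses of Tarski's definition: an atom is an inverse image of \<open>P x\<^sub>1 \<dots> x\<^sub>n\<close>,
  for which the structure is made to fit; equality is the direct image of the universe along the
  diagonal; a disjunction is a union, after both formulas are weakened to the same variables; a
  negation is a complement, as \<open>\<phi>\<close> and \<open>\<not> \<phi>\<close> have union \<open>EV\<close> and empty intersection; an existential
  formula is the direct image along a projection. So \<open>img \<phi>\<close> is the extension of \<open>\<phi>\<close> by induction on
  formulas (\<open>img_extension\<close>). Finally an axiom has almost everywhere the same extension as \<open>S\<close>, so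
  there is an arrow to it from \<open>S\<close>, and the element of \<open>F(S)\<close> shows that it holds (\<open>F_model\<close>).
\<close>

section \<open>Substitution and satisfaction\<close>

lemma fv_bind: "fv (bind X k \<phi>) = fv \<phi> - {X}"
proof -
  have v: "fv_var (bind_var X k v) = fv_var v - {X}" for k v
    by (cases v) auto
  show ?thesis
    by (induction \<phi> arbitrary: k) (auto simp: v)
qed

lemma fv_ex [simp]: "fv (ex X \<phi>) = fv \<phi> - {X}"
  by (simp add: ex_def fv_bind)

lemma fv_eqv [simp]: "fv (eqv X Y) = {X, Y}"
  by (auto simp: eqv_def)

lemma finite_fv [simp]: "finite (fv \<phi>)"
proof -
  have v: "finite (fv_var v)" for v by (cases v) auto
  show ?thesis by (induction \<phi>) (auto simp: v)
qed

lemma fv_subst: "fv (subst \<sigma> \<phi>) = \<sigma> ` fv \<phi>"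
proof -
  have v: "fv_var (subst_var \<sigma> v) = \<sigma> ` fv_var v" for v by (cases v) auto
  show ?thesis by (induction \<phi>) (auto simp: v)
qed

lemma subst_cong:
  assumes "\<And>X. X \<in> fv \<phi> \<Longrightarrow> \<sigma> X = \<tau> X"
  shows "subst \<sigma> \<phi> = subst \<tau> \<phi>"
proof -
  have v: "(\<And>X. X \<in> fv_var v \<Longrightarrow> \<sigma> X = \<tau> X) \<Longrightarrow> subst_var \<sigma> v = subst_var \<tau> v" for v
    by (cases v) auto
  show ?thesis using assms by (induction \<phi>) (auto intro!: v)
qed

lemma subst_subst: "subst \<sigma> (subst \<tau> \<phi>) = subst (\<sigma> \<circ> \<tau>) \<phi>"
proof -
  have v: "subst_var \<sigma> (subst_var \<tau> v) = subst_var (\<lambda>X. \<sigma> (\<tau> X)) v" for v by (cases v) auto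
  show ?thesis by (induction \<phi>) (auto simp: v comp_def)
qed

lemma subst_id: "subst id \<phi> = \<phi>"
proof -
  have v: "subst_var (\<lambda>X. X) v = v" for v by (cases v) auto
  show ?thesis by (induction \<phi>) (auto simp: v id_def intro: map_idI)
qed

lemma subst_bind:
  assumes "Y \<notin> \<sigma> ` (fv \<phi> - {X})"
  shows "subst \<sigma> (bind X k \<phi>) = bind Y k (subst (\<sigma>(X := Y)) \<phi>)"
proof -
  have v: "subst_var \<sigma> (bind_var X k v) = bind_var Y k (subst_var (\<sigma>(X := Y)) v)"
    if "Y \<notin> \<sigma> ` (fv_var v - {X})" for k v
    using that by (cases v) auto
  show ?thesis using assms
    by (induction \<phi> arbitrary: k) (auto intro!: v simp del: fun_upd_apply)
qed

lemma subst_ex: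
  "Y \<notin> \<sigma> ` (fv \<phi> - {X}) \<Longrightarrow> subst \<sigma> (ex X \<phi>) = ex Y (subst (\<sigma>(X := Y)) \<phi>)"
  by (simp add: ex_def subst_bind)

lemma subst_eqv [simp]: "subst \<sigma> (eqv X Y) = eqv (\<sigma> X) (\<sigma> Y)"
  by (simp add: eqv_def)

lemma fresh_var: "finite A \<Longrightarrow> \<exists>Y::int. Y \<notin> A"
  using ex_new_if_finite[of A] by (simp add: infinite_UNIV_int)

lemma subst_Fml [intro, simp]: "\<phi> \<in> Fml L \<Longrightarrow> subst \<sigma> \<phi> \<in> Fml L"
proof (induction arbitrary: \<sigma> rule: Fml.induct)
  case (1 P Xs)
  then have "Rel P (map Free (map \<sigma> Xs)) \<in> Fml L"
    by (intro Fml.intros) simp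
  then show ?case by (simp add: comp_def)
next
  case (5 \<phi> X)
  obtain Y where "Y \<notin> \<sigma> ` (fv \<phi> - {X})"
    using fresh_var[of "\<sigma> ` (fv \<phi> - {X})"] by auto
  with 5 show ?case by (simp add: subst_ex Fml.intros)
qed (auto intro: Fml.intros)

lemma sat_cong:
  assumes "\<And>X. X \<in> fv \<phi> \<Longrightarrow> \<rho> X = \<rho>' X"
  shows "sat \<M> \<rho> bs \<phi> = sat \<M> \<rho>' bs \<phi>"
proof -
  have v: "(\<And>X. X \<in> fv_var v \<Longrightarrow> \<rho> X = \<rho>' X) \<Longrightarrow> val \<rho> bs v = val \<rho>' bs v" for v bs
    by (cases v) auto
  show ?thesis using assms
  proof (induction \<phi> arbitrary: bs)
    case (Rel P vs)
    then have "map (val \<rho> bs) vs = map (val \<rho>' bs) vs" by (auto intro!: v)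
    then show ?case by (simp only: sat.simps)
  qed (auto simp: v)
qed

lemma sat_subst: "sat \<M> \<rho> bs (subst \<sigma> \<phi>) = sat \<M> (\<rho> \<circ> \<sigma>) bs \<phi>"
proof -
  have v: "val \<rho> bs (subst_var \<sigma> v) = val (\<rho> \<circ> \<sigma>) bs v" for v bs by (cases v) auto
  show ?thesis by (induction \<phi> arbitrary: bs) (auto simp: v comp_def[of "val \<rho> _"])
qed

lemma sat_eqv [simp]: "sat \<M> \<rho> bs (eqv X Y) \<longleftrightarrow> \<rho> X = \<rho> Y"
  by (simp add: eqv_def)

lemma sat_conj [simp]: "sat \<M> \<rho> bs (conj \<phi> \<psi>) \<longleftrightarrow> sat \<M> \<rho> bs \<phi> \<and> sat \<M> \<rho> bs \<psi>"
  by (simp add: conj_def)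

lemma sat_imp [simp]: "sat \<M> \<rho> bs (imp \<phi> \<psi>) \<longleftrightarrow> (sat \<M> \<rho> bs \<phi> \<longrightarrow> sat \<M> \<rho> bs \<psi>)"
  by (simp add: imp_def)

lemma Fml_Neg [simp]: "Neg \<phi> \<in> Fml L \<longleftrightarrow> \<phi> \<in> Fml L"
  by (auto intro: Fml.intros elim: Fml.cases simp: ex_def eqv_def)

lemma Fml_Or [simp]: "Or \<phi> \<psi> \<in> Fml L \<longleftrightarrow> \<phi> \<in> Fml L \<and> \<psi> \<in> Fml L"
  by (auto intro: Fml.intros elim: Fml.cases simp: ex_def eqv_def)

lemma Fml_eqv [simp]: "eqv X Y \<in> Fml L"
  by (rule Fml.intros)

lemma Fml_ex [intro, simp]: "\<phi> \<in> Fml L \<Longrightarrow> ex X \<phi> \<in> Fml L"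
  by (rule Fml.intros)

lemma Fml_conj [simp]: "conj \<phi> \<psi> \<in> Fml L \<longleftrightarrow> \<phi> \<in> Fml L \<and> \<psi> \<in> Fml L"
  by (simp add: conj_def)

lemma Fml_imp [simp]: "imp \<phi> \<psi> \<in> Fml L \<longleftrightarrow> \<phi> \<in> Fml L \<and> \<psi> \<in> Fml L"
  by (simp add: imp_def)

lemma Fml_E [simp]: "E_fml \<in> Fml L"
  by (simp add: E_fml_def)

lemma Fml_S [simp]: "S_fml \<in> Fml L"
  by (simp add: S_fml_def all_def)

lemma fv_E [simp]: "fv E_fml = {}"
  by (simp add: E_fml_def)

lemma fv_S [simp]: "fv S_fml = {}"
  by (simp add: S_fml_def all_def)

lemma sat_E: "sat \<M> \<rho> [] E_fml \<longleftrightarrow> uni \<M> = {}"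
  unfolding E_fml_def sat.simps sat_ex[OF Fml_eqv] by auto

lemma sat_S [simp]: "sat \<M> \<rho> [] S_fml"
  using sat_ex[of "Neg (eqv 0 0)"] by (simp add: S_fml_def all_def)

text \<open>Instances survive alpha-equivalence: a witness for \<open>ex X \<phi>\<close> is one for every way to write this formula.\<close>

lemma ex_eq_subst1:
  assumes "ex X \<phi> = ex X' \<phi>'" "\<phi> \<in> Fml L" "\<phi>' \<in> Fml L"
  shows "subst1 \<phi> Y X = subst1 \<phi>' Y X'"
proof -
  have v: "subst_var (id(X := Y)) v = subst_var (id(X' := Y)) v'"
    if "bind_var X k v = bind_var X' k v'" "closed_var k v" "closed_var k v'" for k v v'
    using that by (cases v; cases v') (auto split: if_splits)
  have "subst (id(X := Y)) \<phi> = subst (id(X' := Y)) \<phi>'"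
    if "bind X k \<phi> = bind X' k \<phi>'" "closed_at k \<phi>" "closed_at k \<phi>'" for k
    using that
  proof (induction \<phi> arbitrary: k \<phi>')
    case (Rel P vs)
    then obtain vs' where vs': "\<phi>' = Rel P vs'" "map (bind_var X k) vs = map (bind_var X' k) vs'"
      by (cases \<phi>') auto
    then have "list_all2 (\<lambda>v v'. bind_var X k v = bind_var X' k v') vs vs'"
      by (simp add: list_all2_conv_all_nth list_eq_iff_nth_eq)
    then have "list_all2 (\<lambda>v v'. subst_var (id(X := Y)) v = subst_var (id(X' := Y)) v') vs vs'"
      using Rel.prems vs' by (elim list.rel_mono_strong) (auto intro: v)
    then have "map (subst_var (id(X := Y))) vs = map (subst_var (id(X' := Y))) vs'"
      by (simp add: list_all2_conv_all_nth list_eq_iff_nth_eq del: fun_upd_apply)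
    then show ?case using vs' by (simp only: subst.simps)
  next
    case (Eq u w)
    then show ?case by (cases \<phi>') (auto intro!: v simp del: fun_upd_apply id_apply)
  next
    case (Neg \<phi>)
    then show ?case by (cases \<phi>') auto
  next
    case (Or \<phi> \<psi>)
    from Or.prems obtain \<phi>1 \<phi>2 where eq: "\<phi>' = Or \<phi>1 \<phi>2" by (cases \<phi>') auto
    show ?case using Or.IH(1)[of k \<phi>1] Or.IH(2)[of k \<phi>2] Or.prems eq by simp
  next
    case (Ex \<phi>)
    from Ex.prems obtain \<psi> where \<psi>: "\<phi>' = Ex \<psi>" by (cases \<phi>') auto
    show ?case using Ex.IH[of "Suc k" \<psi>] Ex.prems \<psi> by simp
  qed
  with assms show ?thesis by (auto simp: ex_def subst1_def dest: closed_at_Fml)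
qed

lemma sat_subst1:
  "sat \<M> \<rho> [] (subst1 \<phi> Y X) \<longleftrightarrow> sat \<M> (\<rho>(X := \<rho> Y)) [] \<phi>"
proof -
  have "\<rho> \<circ> id(X := Y) = \<rho>(X := \<rho> Y)" by auto
  then show ?thesis by (simp add: subst1_def sat_subst)
qed

section \<open>Soundness and completeness\<close>

text \<open>Free variables denote elements of the universe; if that is empty they may denote anything.\<close>

definition assignments :: "('r, 'u) struct \<Rightarrow> (int \<Rightarrow> 'u) set" where
  "assignments \<M> = {\<rho>. uni \<M> \<noteq> {} \<longrightarrow> range \<rho> \<subseteq> uni \<M>}"

lemma derivable_Fml:
  "derivable L \<Gamma> \<phi> \<Longrightarrow> finite \<Gamma> \<and> \<Gamma> \<subseteq> Fml L \<and> \<phi> \<in> Fml L"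
  by (induction rule: derivable.induct) (auto simp: subst1_def)

text \<open>
  An empty universe makes all existential formulas false although assignments exist, which is why
  the rules for \<open>\<exists>\<close> on the right need \<open>\<not> E\<close> or an existential formula on the left.
\<close>

lemma soundness:
  "derivable L \<Gamma> \<phi> \<Longrightarrow> \<rho> \<in> assignments \<M> \<Longrightarrow> \<forall>\<gamma>\<in>\<Gamma>. sat \<M> \<rho> [] \<gamma> \<Longrightarrow> sat \<M> \<rho> [] \<phi>"
proof (induction arbitrary: \<rho> rule: derivable.induct)
  case (by_cases \<psi> \<Gamma> \<phi>)
  then show ?case by (metis insert_iff sat.simps(3))
next
  case (contr \<phi> \<Gamma> \<psi>)
  then show ?case by (metis insert_iff sat.simps(3))
next
  case (exL \<phi> Y X \<Gamma> \<psi>)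
  then obtain a where a: "a \<in> uni \<M>" "sat \<M> (\<rho>(X := a)) [] \<phi>"
    by (auto simp: sat_ex)
  let ?\<rho> = "\<rho>(Y := a)"
  have "sat \<M> (?\<rho>(X := ?\<rho> Y)) [] \<phi> \<longleftrightarrow> sat \<M> (\<rho>(X := a)) [] \<phi>"
    by (rule sat_cong) (use exL.hyps in auto)
  then have 1: "sat \<M> ?\<rho> [] (subst1 \<phi> Y X)" using a by (simp add: sat_subst1)
  have 2: "sat \<M> ?\<rho> [] \<chi> \<longleftrightarrow> sat \<M> \<rho> [] \<chi>" if "\<chi> \<in> insert \<psi> \<Gamma>" for \<chi>
    by (rule sat_cong) (use exL.hyps that in auto)
  have "?\<rho> \<in> assignments \<M>" using exL.prems a by (auto simp: assignments_def)
  then have "sat \<M> ?\<rho> [] \<psi>" using exL.IH[of ?\<rho>] exL.prems 1 2 by (metis insert_iff)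
  then show ?case using 2 by blast
next
  case (exR \<Gamma> \<phi> Y X)
  then have "sat \<M> (\<rho>(X := \<rho> Y)) [] \<phi>" by (auto simp: sat_subst1)
  moreover have "\<rho> Y \<in> uni \<M>" using exR.prems by (auto simp: assignments_def sat_E)
  ultimately show ?case using exR.hyps by (auto simp: sat_ex)
next
  case (exLR \<psi> Y X \<Gamma> \<phi> Y' X')
  then obtain a where a: "a \<in> uni \<M>" "sat \<M> (\<rho>(X := a)) [] \<psi>"
    by (auto simp: sat_ex)
  let ?\<rho> = "\<rho>(Y := a)"
  have "sat \<M> (?\<rho>(X := ?\<rho> Y)) [] \<psi> \<longleftrightarrow> sat \<M> (\<rho>(X := a)) [] \<psi>"
    by (rule sat_cong) (use exLR.hyps in auto)
  then have 1: "sat \<M> ?\<rho> [] (subst1 \<psi> Y X)" using a by (simp add: sat_subst1)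
  have 2: "sat \<M> ?\<rho> [] \<chi> \<longleftrightarrow> sat \<M> \<rho> [] \<chi>" if "\<chi> \<in> insert (ex X' \<phi>) \<Gamma>" for \<chi>
    by (rule sat_cong) (use exLR.hyps that in auto)
  have as: "?\<rho> \<in> assignments \<M>" using exLR.prems a by (auto simp: assignments_def)
  then have "sat \<M> (?\<rho>(X' := ?\<rho> Y')) [] \<phi>"
    using exLR.IH[of ?\<rho>] exLR.prems 1 2 by (metis insert_iff sat_subst1)
  moreover have "?\<rho> Y' \<in> uni \<M>" using as a by (auto simp: assignments_def)
  ultimately show ?case using 2[of "ex X' \<phi>"] exLR.hyps by (auto simp: sat_ex)
next
  case (eq \<Gamma> \<phi> Y X Y')
  then show ?case by (metis insert_iff sat_eqv sat_subst1)
qed auto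

lemma Fml_mono: "\<phi> \<in> Fml L' \<Longrightarrow> L' \<subseteq>\<^sub>m L \<Longrightarrow> \<phi> \<in> Fml L"
proof (induction rule: Fml.induct)
  case (1 P Xs)
  then have "L P = Some (length Xs)" by (auto simp: map_le_def dom_def)
  then show ?case by (rule Fml.intros)
qed auto

text \<open>
  Completeness is proved over the finitely many symbols of a sequent and transferred to the whole
  signature by this monotonicity.
\<close>

lemma derivable_mono: "derivable L' \<Gamma> \<phi> \<Longrightarrow> L' \<subseteq>\<^sub>m L \<Longrightarrow> derivable L \<Gamma> \<phi>"
proof (induction rule: derivable.induct)
  case (assm \<Gamma> \<phi>)
  then have "\<Gamma> \<subseteq> Fml L" by (auto intro: Fml_mono)
  with assm show ?case by (intro derivable.assm)
next
  case (weaken \<Gamma> \<phi> \<Gamma>')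
  then have "\<Gamma>' \<subseteq> Fml L" by (auto intro: Fml_mono)
  with weaken show ?case by (metis derivable.weaken)
next
  case (by_cases \<psi> \<Gamma> \<phi>)
  then show ?case using derivable.by_cases[of L \<psi> \<Gamma> \<phi>] by blast
next
  case (contr \<phi> \<Gamma> \<psi>)
  then show ?case using derivable.contr[of L \<phi> \<Gamma> \<psi>] by blast
next
  case (orL \<phi> \<Gamma> \<chi> \<psi>)
  then show ?case using derivable.orL[of L \<phi> \<Gamma> \<chi> \<psi>] by blast
next
  case (orR1 \<Gamma> \<phi> \<psi>)
  then show ?case using derivable.orR1[of L \<Gamma> \<phi> \<psi>] Fml_mono by blast
next
  case (orR2 \<Gamma> \<phi> \<psi>)
  then show ?case using derivable.orR2[of L \<Gamma> \<phi> \<psi>] Fml_mono by blast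
next
  case (exL \<phi> Y X \<Gamma> \<psi>)
  then show ?case using derivable.exL[of L \<phi> Y X \<Gamma> \<psi>] Fml_mono by blast
next
  case (exR \<Gamma> \<phi> Y X)
  then show ?case using derivable.exR[of L \<Gamma> \<phi> Y X] Fml_mono by blast
next
  case (exLR \<psi> Y X \<Gamma> \<phi> Y' X')
  then show ?case using derivable.exLR[of L \<psi> Y X \<Gamma> \<phi> Y' X'] Fml_mono by blast
next
  case (eq \<Gamma> \<phi> Y X Y')
  then show ?case using derivable.eq[of L \<Gamma> \<phi> Y X Y'] Fml_mono by blast
qed (rule derivable.refl)

lemma finite_set_fml: "finite (set_fml \<phi>)"
  by (induction \<phi>) auto

lemma set_fml_bind [simp]: "set_fml (bind X k \<phi>) = set_fml \<phi>"
  by (induction \<phi> arbitrary: k) auto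

lemma set_fml_ex [simp]: "set_fml (ex X \<phi>) = set_fml \<phi>"
  by (simp add: ex_def)

lemma Fml_restrict: "\<phi> \<in> Fml L \<Longrightarrow> set_fml \<phi> \<subseteq> S \<Longrightarrow> \<phi> \<in> Fml (L |` S)"
proof (induction rule: Fml.induct)
  case (1 P Xs)
  then have "(L |` S) P = Some (length Xs)" by simp
  then show ?case by (rule Fml.intros)
qed auto

lemma set_fml_Fml: "\<phi> \<in> Fml L \<Longrightarrow> set_fml \<phi> \<subseteq> dom L"
  by (induction rule: Fml.induct) (auto simp: eqv_def)

instance var :: countable by countable_datatype
instance fml :: (countable) countable by countable_datatype

lemma countable_Fml:
  assumes "finite (dom L)"
  shows "countable (Fml L)"
proof -
  obtain f :: "'a \<Rightarrow> nat" where f: "inj_on f (dom L)"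
    using inj_on_to_nat_on[OF countable_finite[OF assms]] by blast
  have "inj_on (map_fml f) (Fml L)"
  proof (rule inj_onI)
    fix \<phi> \<psi> assume "\<phi> \<in> Fml L" "\<psi> \<in> Fml L" "map_fml f \<phi> = map_fml f \<psi>"
    then show "\<phi> = \<psi>"
      using f set_fml_Fml[of \<phi> L] set_fml_Fml[of \<psi> L]
      by (intro fml.inj_map_strong[of \<phi> \<psi> f f]) (meson inj_onD subsetD)+
  qed
  then show ?thesis by (rule countableI')
qed

subsection \<open>Completeness\<close>

definition inconsistent :: "'r signature \<Rightarrow> 'r fml set \<Rightarrow> bool" where
  "inconsistent L \<Gamma> \<longleftrightarrow> (\<exists>\<psi>. derivable L \<Gamma> \<psi> \<and> derivable L \<Gamma> (Neg \<psi>))"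

lemma inconsistent_derives:
  assumes "inconsistent L \<Gamma>" "\<phi> \<in> Fml L"
  shows "derivable L \<Gamma> \<phi>"
proof -
  obtain \<psi> where \<psi>: "derivable L \<Gamma> \<psi>" "derivable L \<Gamma> (Neg \<psi>)"
    using assms by (auto simp: inconsistent_def)
  have "finite (insert (Neg \<phi>) \<Gamma>)" "insert (Neg \<phi>) \<Gamma> \<subseteq> Fml L"
    using derivable_Fml[OF \<psi>(1)] assms(2) by auto
  then have "derivable L (insert (Neg \<phi>) \<Gamma>) \<psi>" "derivable L (insert (Neg \<phi>) \<Gamma>) (Neg \<psi>)"
    using derivable.weaken[OF \<psi>(1), of "insert (Neg \<phi>) \<Gamma>"]
      derivable.weaken[OF \<psi>(2), of "insert (Neg \<phi>) \<Gamma>"] by auto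
  then show ?thesis by (rule derivable.contr)
qed

lemma inconsistentI:
  "\<phi> \<in> \<Gamma> \<Longrightarrow> Neg \<phi> \<in> \<Gamma> \<Longrightarrow> finite \<Gamma> \<Longrightarrow> \<Gamma> \<subseteq> Fml L \<Longrightarrow> inconsistent L \<Gamma>"
  unfolding inconsistent_def using derivable.assm by blast

lemma inconsistent_mono:
  assumes "inconsistent L \<Gamma>" "\<Gamma> \<subseteq> \<Gamma>'" "finite \<Gamma>'" "\<Gamma>' \<subseteq> Fml L"
  shows "inconsistent L \<Gamma>'"
  using assms derivable.weaken unfolding inconsistent_def by blast

lemma inconsistent_cases:
  assumes "inconsistent L (insert \<phi> \<Gamma>)" "inconsistent L (insert (Neg \<phi>) \<Gamma>)"
  shows "inconsistent L \<Gamma>"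
proof -
  have "derivable L \<Gamma> \<psi>" if "\<psi> \<in> Fml L" for \<psi>
    using derivable.by_cases[OF inconsistent_derives inconsistent_derives] assms that by blast
  then show ?thesis unfolding inconsistent_def using Fml_E Fml_Neg by blast
qed

text \<open>
  A witness can be introduced by the left rule for \<open>\<exists>\<close>, whose conclusion must not contain the new
  variable: an inconsistent set proves \<open>E\<close> and \<open>\<not> E\<close>, which contain no variables at all.
\<close>

lemma inconsistent_witness:
  assumes "inconsistent L (insert (subst1 \<phi> Y X) (insert (ex X \<phi>) \<Gamma>))" "\<phi> \<in> Fml L"
    and "\<forall>\<chi>\<in>insert (ex X \<phi>) \<Gamma>. Y \<notin> fv \<chi>"
  shows "inconsistent L (insert (ex X \<phi>) \<Gamma>)"
proof -
  have "derivable L (insert (ex X \<phi>) (insert (ex X \<phi>) \<Gamma>)) \<psi>" if "\<psi> \<in> Fml L" "fv \<psi> = {}" for \<psi>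
    using derivable.exL[OF inconsistent_derives[OF assms(1) that(1)]] assms that(2) by blast
  from this[of E_fml] this[of "Neg E_fml"] show ?thesis
    unfolding inconsistent_def by auto
qed

text \<open>
  One step of the Henkin construction. Every stage is finite, so a fresh variable can serve as the
  witness although the language has no constants.
\<close>

lemma henkin_step:
  assumes "finite \<Gamma>" "\<Gamma> \<subseteq> Fml L" "\<not> inconsistent L \<Gamma>" "\<phi> \<in> Fml L"
  shows "\<exists>\<Gamma>'. \<Gamma> \<subseteq> \<Gamma>' \<and> finite \<Gamma>' \<and> \<Gamma>' \<subseteq> Fml L \<and> \<not> inconsistent L \<Gamma>' \<and>
    (\<phi> \<in> \<Gamma>' \<or> Neg \<phi> \<in> \<Gamma>') \<and>
    (\<phi> \<in> \<Gamma>' \<longrightarrow> (\<forall>X \<psi>. \<psi> \<in> Fml L \<longrightarrow> \<phi> = ex X \<psi> \<longrightarrow> (\<exists>Y. subst1 \<psi> Y X \<in> \<Gamma>')))"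
proof (cases "inconsistent L (insert \<phi> \<Gamma>)")
  case True
  then have con: "\<not> inconsistent L (insert (Neg \<phi>) \<Gamma>)"
    using inconsistent_cases assms by blast
  then have "\<phi> \<notin> insert (Neg \<phi>) \<Gamma>"
    using inconsistentI[of \<phi> "insert (Neg \<phi>) \<Gamma>" L] assms by auto
  then show ?thesis using con assms by (intro exI[of _ "insert (Neg \<phi>) \<Gamma>"]) auto
next
  case con: False
  show ?thesis
  proof (cases "\<exists>X \<psi>. \<psi> \<in> Fml L \<and> \<phi> = ex X \<psi>")
    case False
    then show ?thesis using con assms by (intro exI[of _ "insert \<phi> \<Gamma>"]) auto
  next
    case True
    then obtain X \<psi> where \<psi>: "\<psi> \<in> Fml L" "\<phi> = ex X \<psi>" by auto
    obtain Y where Y: "\<forall>\<chi>\<in>insert \<phi> \<Gamma>. Y \<notin> fv \<chi>"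
      using fresh_var[of "\<Union>(fv ` insert \<phi> \<Gamma>)"] assms by auto
    let ?\<Gamma>' = "insert (subst1 \<psi> Y X) (insert \<phi> \<Gamma>)"
    have "\<not> inconsistent L ?\<Gamma>'"
      using inconsistent_witness[of L \<psi> Y X \<Gamma>] \<psi> Y con by auto
    moreover have "subst1 \<psi>' Y X' \<in> ?\<Gamma>'" if "\<psi>' \<in> Fml L" "\<phi> = ex X' \<psi>'" for X' \<psi>'
      using ex_eq_subst1[of X \<psi> X' \<psi>' L Y] that \<psi> by simp
    moreover have "?\<Gamma>' \<subseteq> Fml L" using assms \<psi> by (auto simp: subst1_def)
    ultimately show ?thesis using assms by (intro exI[of _ ?\<Gamma>']) blast
  qed
qed

text \<open>
  The steps are iterated along an enumeration of the formulas; the union stays consistent because a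
  derivation uses only finitely many formulas.
\<close>

lemma henkin_set:
  assumes "finite \<Gamma>" "\<Gamma> \<subseteq> Fml L" "\<not> inconsistent L \<Gamma>" "countable (Fml L)"
  shows "\<exists>\<Delta>. \<Gamma> \<subseteq> \<Delta> \<and> \<Delta> \<subseteq> Fml L \<and> (\<forall>\<Gamma>'\<subseteq>\<Delta>. finite \<Gamma>' \<longrightarrow> \<not> inconsistent L \<Gamma>') \<and>
    (\<forall>\<phi>\<in>Fml L. \<phi> \<in> \<Delta> \<or> Neg \<phi> \<in> \<Delta>) \<and>
    (\<forall>X \<psi>. \<psi> \<in> Fml L \<longrightarrow> ex X \<psi> \<in> \<Delta> \<longrightarrow> (\<exists>Y. subst1 \<psi> Y X \<in> \<Delta>))"
proof -
  have ne: "Fml L \<noteq> {}" using Fml_E by blast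
  define e where "e = from_nat_into (Fml L)"
  have e: "range e = Fml L" unfolding e_def using range_from_nat_into[OF ne assms(4)] .
  let ?ok = "\<lambda>\<Gamma>. finite \<Gamma> \<and> \<Gamma> \<subseteq> Fml L \<and> \<not> inconsistent L \<Gamma>"
  let ?nx = "\<lambda>n \<Gamma> \<Gamma>'. \<Gamma> \<subseteq> \<Gamma>' \<and> (e n \<in> \<Gamma>' \<or> Neg (e n) \<in> \<Gamma>') \<and>
    (e n \<in> \<Gamma>' \<longrightarrow> (\<forall>X \<psi>. \<psi> \<in> Fml L \<longrightarrow> e n = ex X \<psi> \<longrightarrow> (\<exists>Y. subst1 \<psi> Y X \<in> \<Gamma>')))"
  have "\<exists>f. \<forall>n. (?ok (f n) \<and> (n = 0 \<longrightarrow> \<Gamma> \<subseteq> f n)) \<and> ?nx n (f n) (f (Suc n))"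
  proof (rule dependent_nat_choice[where P = "\<lambda>n x. ?ok x \<and> (n = 0 \<longrightarrow> \<Gamma> \<subseteq> x)" and Q = ?nx])
    show "\<exists>x. ?ok x \<and> (0 = 0 \<longrightarrow> \<Gamma> \<subseteq> x)" using assms by blast
  next
    fix x and n :: nat assume "?ok x \<and> (n = 0 \<longrightarrow> \<Gamma> \<subseteq> x)"
    moreover have "e n \<in> Fml L" using e by blast
    ultimately obtain y where "?ok y" "?nx n x y"
      using henkin_step[of x L "e n"] by blast
    then show "\<exists>y. (?ok y \<and> (Suc n = 0 \<longrightarrow> \<Gamma> \<subseteq> y)) \<and> ?nx n x y" by blast
  qed
  then obtain f
    where f: "\<And>n. (?ok (f n) \<and> (n = 0 \<longrightarrow> \<Gamma> \<subseteq> f n)) \<and> ?nx n (f n) (f (Suc n))" by blast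
  have ok: "?ok (f n)" and nx: "?nx n (f n) (f (Suc n))" for n using f[of n] by argo+
  have f0: "\<Gamma> \<subseteq> f 0" using f[of 0] by simp
  have mono: "f m \<subseteq> f n" if "m \<le> n" for m n
    using lift_Suc_mono_le[of f, OF _ that] nx by blast
  have fin: "\<exists>n. \<Gamma>' \<subseteq> f n" if "finite \<Gamma>'" "\<Gamma>' \<subseteq> (\<Union>n. f n)" for \<Gamma>'
    using that
  proof (induction \<Gamma>')
    case (insert \<phi> \<Gamma>')
    then obtain n m where "\<Gamma>' \<subseteq> f n" "\<phi> \<in> f m" by auto
    then have "insert \<phi> \<Gamma>' \<subseteq> f (max n m)"
      using mono[of n "max n m"] mono[of m "max n m"] by auto
    then show ?case ..
  qed auto
  show ?thesis
  proof (intro exI[of _ "\<Union>n. f n"] conjI ballI allI impI)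
    show "\<Gamma> \<subseteq> (\<Union>n. f n)" using f0 by blast
    show "(\<Union>n. f n) \<subseteq> Fml L" using ok by blast
  next
    fix \<Gamma>' assume "\<Gamma>' \<subseteq> (\<Union>n. f n)" "finite \<Gamma>'"
    then obtain n where "\<Gamma>' \<subseteq> f n" using fin by blast
    then show "\<not> inconsistent L \<Gamma>'" using inconsistent_mono[of L \<Gamma>' "f n"] ok by blast
  next
    fix \<phi> assume "\<phi> \<in> Fml L"
    then obtain n where "\<phi> = e n" using e by (metis imageE)
    then show "\<phi> \<in> (\<Union>n. f n) \<or> Neg \<phi> \<in> (\<Union>n. f n)" using nx[of n] by blast
  next
    fix X \<psi> assume \<psi>: "\<psi> \<in> Fml L" "ex X \<psi> \<in> (\<Union>n. f n)"
    then obtain n where n: "ex X \<psi> = e n" using e by (metis Fml_ex imageE)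
    obtain m where m: "e n \<in> f m" using \<psi> n by auto
    have "e n \<in> f (Suc n)"
    proof (rule ccontr)
      assume "e n \<notin> f (Suc n)"
      then have "Neg (e n) \<in> f (max m (Suc n))" "e n \<in> f (max m (Suc n))"
        using nx[of n] m mono[of "Suc n" "max m (Suc n)"] mono[of m "max m (Suc n)"] by auto
      then show False using inconsistentI[of "e n" "f (max m (Suc n))" L] ok by blast
    qed
    then show "\<exists>Y. subst1 \<psi> Y X \<in> (\<Union>n. f n)" using nx[of n] n \<psi> by (metis UN_I UNIV_I)
  qed
qed

lemma Fml_Rel: "Rel P (map Free Xs) \<in> Fml L \<longleftrightarrow> L P = Some (length Xs)"
proof
  assume "Rel P (map Free Xs) \<in> Fml L"
  then show "L P = Some (length Xs)"
    by (cases rule: Fml.cases) (auto simp: eqv_def ex_def dest: map_eq_imp_length_eq)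
qed (rule Fml.intros)

locale henkin =
  fixes L :: "'r signature" and \<Delta> :: "'r fml set"
  assumes \<Delta>: "\<Delta> \<subseteq> Fml L"
    and con: "\<And>\<Gamma>. \<Gamma> \<subseteq> \<Delta> \<Longrightarrow> finite \<Gamma> \<Longrightarrow> \<not> inconsistent L \<Gamma>"
    and total: "\<And>\<phi>. \<phi> \<in> Fml L \<Longrightarrow> \<phi> \<in> \<Delta> \<or> Neg \<phi> \<in> \<Delta>"
    and wit: "\<And>X \<psi>. \<psi> \<in> Fml L \<Longrightarrow> ex X \<psi> \<in> \<Delta> \<Longrightarrow> \<exists>Y. subst1 \<psi> Y X \<in> \<Delta>"
begin

lemma closed:
  assumes "derivable L \<Gamma> \<phi>" "\<Gamma> \<subseteq> \<Delta>"
  shows "\<phi> \<in> \<Delta>"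
proof (rule ccontr)
  assume "\<phi> \<notin> \<Delta>"
  have w: "finite \<Gamma>" "\<phi> \<in> Fml L" using derivable_Fml[OF assms(1)] by auto
  then have \<phi>: "Neg \<phi> \<in> \<Delta>" using total \<open>\<phi> \<notin> \<Delta>\<close> by blast
  let ?\<Gamma> = "insert (Neg \<phi>) \<Gamma>"
  have g: "finite ?\<Gamma>" "?\<Gamma> \<subseteq> \<Delta>" "?\<Gamma> \<subseteq> Fml L" using w assms \<phi> \<Delta> by auto
  have "derivable L ?\<Gamma> \<phi>" using derivable.weaken[OF assms(1), of ?\<Gamma>] g by blast
  moreover have "derivable L ?\<Gamma> (Neg \<phi>)" using derivable.assm[of ?\<Gamma> L "Neg \<phi>"] g by blast
  ultimately show False using con[of ?\<Gamma>] g unfolding inconsistent_def by blast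
qed

lemma Neg_iff: "\<phi> \<in> Fml L \<Longrightarrow> Neg \<phi> \<in> \<Delta> \<longleftrightarrow> \<phi> \<notin> \<Delta>"
  using total[of \<phi>] con[of "{\<phi>, Neg \<phi>}"] inconsistentI[of \<phi> "{\<phi>, Neg \<phi>}" L] by auto

lemma Or_iff:
  assumes "\<phi> \<in> Fml L" "\<psi> \<in> Fml L"
  shows "Or \<phi> \<psi> \<in> \<Delta> \<longleftrightarrow> \<phi> \<in> \<Delta> \<or> \<psi> \<in> \<Delta>"
proof
  assume "\<phi> \<in> \<Delta> \<or> \<psi> \<in> \<Delta>"
  then show "Or \<phi> \<psi> \<in> \<Delta>"
  proof
    assume "\<phi> \<in> \<Delta>"
    then show ?thesis
      using closed[OF derivable.orR1[OF derivable.assm[of "{\<phi>}"]]] assms by simp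
  next
    assume "\<psi> \<in> \<Delta>"
    then show ?thesis
      using closed[OF derivable.orR2[OF derivable.assm[of "{\<psi>}"]]] assms by simp
  qed
next
  assume or: "Or \<phi> \<psi> \<in> \<Delta>"
  show "\<phi> \<in> \<Delta> \<or> \<psi> \<in> \<Delta>"
  proof (rule ccontr)
    assume "\<not> ?thesis"
    then have n: "Neg \<phi> \<in> \<Delta>" "Neg \<psi> \<in> \<Delta>" using assms by (auto simp: Neg_iff)
    let ?N = "{Neg \<phi>, Neg \<psi>}"
    have "inconsistent L (insert \<phi> ?N)" "inconsistent L (insert \<psi> ?N)"
      using inconsistentI[of \<phi> "insert \<phi> ?N" L] inconsistentI[of \<psi> "insert \<psi> ?N" L] assms by auto
    then have "derivable L (insert (Or \<phi> \<psi>) ?N) \<chi>" if "\<chi> \<in> Fml L" for \<chi>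
      using derivable.orL[OF inconsistent_derives inconsistent_derives] that by blast
    from this[of E_fml] this[of "Neg E_fml"] have "inconsistent L (insert (Or \<phi> \<psi>) ?N)"
      unfolding inconsistent_def by auto
    then show False using con[of "insert (Or \<phi> \<psi>) ?N"] n or by auto
  qed
qed

lemma eq_subst:
  assumes "eqv Y Y' \<in> \<Delta>" "\<phi> \<in> Fml L" "subst1 \<phi> Y X \<in> \<Delta>"
  shows "subst1 \<phi> Y' X \<in> \<Delta>"
  using closed[OF derivable.eq[OF derivable.assm[of "{subst1 \<phi> Y X}"]]] assms
  by (simp add: subst1_def)

lemma eqv_refl: "eqv X X \<in> \<Delta>"
  using closed[OF derivable.refl] by simp

lemma eqv_sym: "eqv X Y \<in> \<Delta> \<Longrightarrow> eqv Y X \<in> \<Delta>"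
  using eq_subst[of X Y "eqv (X + 1) X" "X + 1"] eqv_refl[of X] by (simp add: subst1_def)

lemma eqv_trans: "eqv X Y \<in> \<Delta> \<Longrightarrow> eqv Y Z \<in> \<Delta> \<Longrightarrow> eqv X Z \<in> \<Delta>"
  using eq_subst[of Y Z "eqv X (X + 1)" "X + 1"] by (simp add: subst1_def)

definition rep :: "int \<Rightarrow> int" where
  "rep X = (SOME Y. eqv X Y \<in> \<Delta>)"

lemma rep: "eqv X (rep X) \<in> \<Delta>"
  unfolding rep_def using eqv_refl[of X] by (rule someI)

lemma rep_eq_iff: "rep X = rep Y \<longleftrightarrow> eqv X Y \<in> \<Delta>"
proof
  assume "rep X = rep Y"
  then show "eqv X Y \<in> \<Delta>" using rep[of X] rep[of Y] eqv_sym eqv_trans by metis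
next
  assume "eqv X Y \<in> \<Delta>"
  then have "eqv X Z \<in> \<Delta> \<longleftrightarrow> eqv Y Z \<in> \<Delta>" for Z using eqv_sym eqv_trans by blast
  then show "rep X = rep Y" by (simp add: rep_def)
qed

text \<open>
  The substitution rule replaces one variable, so the arguments are exchanged one at a time; \<open>As\<close> are
  those already treated.
\<close>

lemma Rel_cong:
  assumes "map rep Xs = map rep Ys" "Rel P (map Free Xs) \<in> \<Delta>"
  shows "Rel P (map Free Ys) \<in> \<Delta>"
proof -
  have len: "length Xs = length Ys" using assms(1) map_eq_imp_length_eq by blast
  have "Rel P (map Free (As @ Ys)) \<in> \<Delta>"
    if "map rep Xs = map rep Ys" "Rel P (map Free (As @ Xs)) \<in> \<Delta>" for As
    using len that
  proof (induction Xs Ys arbitrary: As rule: list_induct2)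
    case (Cons x Xs y Ys)
    obtain Z where Z: "Z \<notin> set (As @ Xs)" using fresh_var[of "set (As @ Xs)"] by auto
    let ?\<phi> = "Rel P (map Free (As @ Z # Xs))"
    have s: "subst1 ?\<phi> W Z = Rel P (map Free (As @ W # Xs))" for W
      using Z by (auto simp: subst1_def)
    have "Rel P (map Free (As @ x # Xs)) \<in> Fml L" using Cons.prems \<Delta> by blast
    then have "L P = Some (length (As @ x # Xs))" by (simp only: Fml_Rel)
    then have "L P = Some (length (As @ Z # Xs))" by simp
    then have "?\<phi> \<in> Fml L" by (rule Fml.intros)
    then have "Rel P (map Free (As @ y # Xs)) \<in> \<Delta>"
      using eq_subst[of x y ?\<phi> Z] s Cons.prems by (simp add: rep_eq_iff)
    then show ?case using Cons.IH[of "As @ [y]"] Cons.prems by simp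
  qed simp
  from this[of "[]"] show ?thesis using assms by simp
qed

text \<open>If the theory says that nothing exists, the term model keeps its values but quantifies over nothing.\<close>

definition \<M> :: "('r, int) struct" where
  "\<M> = \<lparr>uni = (if E_fml \<in> \<Delta> then {} else range rep), pt = {0},
     rel = (\<lambda>P. {map rep Xs |Xs. Rel P (map Free Xs) \<in> \<Delta>}),
     rel0 = (\<lambda>P. if Rel P [] \<in> \<Delta> then {0} else {})\<rparr>"

text \<open>
  The rule that has \<open>\<exists>\<close> on both sides excludes \<open>E\<close>; the one that has \<open>\<not> E\<close> on the left gives the
  converse.
\<close>

lemma ex_iff:
  assumes "\<phi> \<in> Fml L"
  shows "ex X \<phi> \<in> \<Delta> \<longleftrightarrow> E_fml \<notin> \<Delta> \<and> (\<exists>Y. subst1 \<phi> Y X \<in> \<Delta>)"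
proof (intro iffI conjI)
  assume ex: "ex X \<phi> \<in> \<Delta>"
  show "\<exists>Y. subst1 \<phi> Y X \<in> \<Delta>" using wit[OF assms ex] .
  obtain Y where Y: "Y \<notin> fv \<phi>" using fresh_var[of "fv \<phi>"] by auto
  have "derivable L {subst1 \<phi> Y X} (eqv Y Y)"
    by (rule derivable.weaken[OF derivable.refl]) (use assms in \<open>auto simp: subst1_def\<close>)
  then have "derivable L (insert (subst1 \<phi> Y X) {}) (subst1 (eqv 0 0) Y 0)"
    by (simp add: subst1_def)
  then have "derivable L (insert (ex X \<phi>) {}) (ex 0 (eqv 0 0))"
    by (rule derivable.exLR) (use assms Y in auto)
  then have "ex 0 (eqv 0 0) \<in> \<Delta>" using closed ex by blast
  then show "E_fml \<notin> \<Delta>" by (simp add: E_fml_def Neg_iff)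
next
  assume "E_fml \<notin> \<Delta> \<and> (\<exists>Y. subst1 \<phi> Y X \<in> \<Delta>)"
  then obtain Y where Y: "Neg E_fml \<in> \<Delta>" "subst1 \<phi> Y X \<in> \<Delta>" by (auto simp: Neg_iff)
  have "derivable L (insert (Neg E_fml) {subst1 \<phi> Y X}) (ex X \<phi>)"
    by (rule derivable.exR[OF derivable.assm]) (use assms in \<open>auto simp: subst1_def\<close>)
  then show "ex X \<phi> \<in> \<Delta>" using closed Y by blast
qed

text \<open>
  Bound variables are instantiated in the course of the induction, so the formula is considered
  under all changes of variables at once.
\<close>

lemma truth: "\<phi> \<in> Fml L \<Longrightarrow> sat \<M> rep [] (subst \<sigma> \<phi>) \<longleftrightarrow> subst \<sigma> \<phi> \<in> \<Delta>"
proof (induction arbitrary: \<sigma> rule: Fml.induct)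
  case (1 P Xs)
  have s: "subst \<sigma> (Rel P (map Free Xs)) = Rel P (map Free (map \<sigma> Xs))" by simp
  have v: "map (val rep []) (map Free (map \<sigma> Xs)) = map rep (map \<sigma> Xs)" by simp
  show ?case
  proof (cases "Xs = []")
    case True
    then show ?thesis by (simp add: \<M>_def)
  next
    case False
    have "map rep (map \<sigma> Xs) \<in> rel \<M> P \<longleftrightarrow> Rel P (map Free (map \<sigma> Xs)) \<in> \<Delta>"
      using Rel_cong[of _ "map \<sigma> Xs" P] by (auto simp: \<M>_def simp del: map_map)
    then show ?thesis using False unfolding s sat.simps v by simp
  qed
next
  case (2 X Y)
  then show ?case by (simp add: rep_eq_iff)
next
  case (3 \<phi>)
  then show ?case by (simp add: Neg_iff)
next
  case (4 \<phi> \<psi>)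
  then show ?case by (simp add: Or_iff)
next
  case (5 \<phi> X)
  obtain Z where Z: "Z \<notin> \<sigma> ` (fv \<phi> - {X})"
    using fresh_var[of "\<sigma> ` (fv \<phi> - {X})"] by auto
  let ?\<psi> = "subst (\<sigma>(X := Z)) \<phi>"
  have \<psi>: "?\<psi> \<in> Fml L" using 5 by simp
  have s: "subst1 ?\<psi> Y Z = subst (\<sigma>(X := Y)) \<phi>" for Y
    unfolding subst1_def subst_subst by (rule subst_cong) (use Z in auto)
  have "sat \<M> rep [] (subst \<sigma> (ex X \<phi>)) \<longleftrightarrow> (\<exists>a\<in>uni \<M>. sat \<M> (rep(Z := a)) [] ?\<psi>)"
    using Z \<psi> by (simp only: subst_ex sat_ex)
  also have "\<dots> \<longleftrightarrow> E_fml \<notin> \<Delta> \<and> (\<exists>Y. sat \<M> (rep(Z := rep Y)) [] ?\<psi>)"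
    by (auto simp: \<M>_def)
  also have "\<dots> \<longleftrightarrow> E_fml \<notin> \<Delta> \<and> (\<exists>Y. sat \<M> rep [] (subst1 ?\<psi> Y Z))"
    by (simp only: sat_subst1)
  also have "\<dots> \<longleftrightarrow> E_fml \<notin> \<Delta> \<and> (\<exists>Y. subst1 ?\<psi> Y Z \<in> \<Delta>)"
    by (simp only: s "5.IH")
  also have "\<dots> \<longleftrightarrow> subst \<sigma> (ex X \<phi>) \<in> \<Delta>"
    using Z \<psi> by (simp only: subst_ex ex_iff)
  finally show ?case .
qed

lemma rep_assignment: "rep \<in> assignments \<M>"
  by (auto simp: assignments_def \<M>_def)

end

text \<open>
  Only the finitely many relation symbols of the sequent matter, so structures on the integers
  suffice even if the signature is uncountable.
\<close>

theorem completeness: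
  fixes L :: "'r signature"
  assumes "finite \<Gamma>" "\<Gamma> \<subseteq> Fml L" "\<phi> \<in> Fml L"
    and valid: "\<And>(\<M> :: ('r, int) struct) \<rho>. \<rho> \<in> assignments \<M> \<Longrightarrow>
      \<forall>\<gamma>\<in>\<Gamma>. sat \<M> \<rho> [] \<gamma> \<Longrightarrow> sat \<M> \<rho> [] \<phi>"
  shows "derivable L \<Gamma> \<phi>"
proof (rule ccontr)
  assume not: "\<not> derivable L \<Gamma> \<phi>"
  define S where "S = \<Union>(set_fml ` insert \<phi> \<Gamma>)"
  define L' where "L' = L |` S"
  have fin: "finite (dom L')" using assms finite_set_fml by (auto simp: L'_def S_def)
  have le: "L' \<subseteq>\<^sub>m L" by (auto simp: L'_def map_le_def)
  have \<phi>: "\<phi> \<in> Fml L'" unfolding L'_def by (rule Fml_restrict) (use assms in \<open>auto simp: S_def\<close>)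
  have \<Gamma>: "\<Gamma> \<subseteq> Fml L'"
    unfolding L'_def by (auto intro!: Fml_restrict) (use assms in \<open>auto simp: S_def\<close>)
  let ?\<Gamma> = "insert (Neg \<phi>) \<Gamma>"
  have "\<not> inconsistent L' ?\<Gamma>"
  proof
    assume "inconsistent L' ?\<Gamma>"
    then have "derivable L' \<Gamma> \<phi>" unfolding inconsistent_def using derivable.contr by blast
    then show False using not derivable_mono le by blast
  qed
  moreover have "finite ?\<Gamma>" "?\<Gamma> \<subseteq> Fml L'" using assms \<phi> \<Gamma> by auto
  ultimately obtain \<Delta> where sub: "?\<Gamma> \<subseteq> \<Delta>" and sub': "\<Delta> \<subseteq> Fml L'"
    and con: "\<forall>\<Gamma>'\<subseteq>\<Delta>. finite \<Gamma>' \<longrightarrow> \<not> inconsistent L' \<Gamma>'"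
    and total: "\<forall>\<phi>\<in>Fml L'. \<phi> \<in> \<Delta> \<or> Neg \<phi> \<in> \<Delta>"
    and wit: "\<forall>X \<psi>. \<psi> \<in> Fml L' \<longrightarrow> ex X \<psi> \<in> \<Delta> \<longrightarrow> (\<exists>Y. subst1 \<psi> Y X \<in> \<Delta>)"
    using henkin_set[of ?\<Gamma> L', OF _ _ _ countable_Fml[OF fin]] by metis
  interpret henkin L' \<Delta>
    using sub' con total wit by unfold_locales simp_all
  have t: "sat \<M> rep [] \<psi> \<longleftrightarrow> \<psi> \<in> \<Delta>" if "\<psi> \<in> Fml L'" for \<psi>
    using truth[OF that, of id] by (simp only: subst_id)
  have "sat \<M> rep [] \<phi>"
  proof (rule valid[OF rep_assignment], rule ballI)
    fix \<gamma> assume "\<gamma> \<in> \<Gamma>"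
    then show "sat \<M> rep [] \<gamma>" using t[of \<gamma>] \<Gamma> sub by auto
  qed
  then show False using t[OF \<phi>] sub Neg_iff[OF \<phi>] by simp
qed

section \<open>Provability and the filter of models\<close>

lemma Fml_exs [intro, simp]: "\<phi> \<in> Fml L \<Longrightarrow> exs Xs \<phi> \<in> Fml L"
  by (induction Xs) (auto simp: exs_def)

lemma Fml_alls [intro, simp]: "\<phi> \<in> Fml L \<Longrightarrow> alls Xs \<phi> \<in> Fml L"
  by (induction Xs) (auto simp: alls_def all_def)

lemma fv_exs [simp]: "fv (exs Xs \<phi>) = fv \<phi> - set Xs"
  by (induction Xs) (auto simp: exs_def)

lemma alls_append: "alls Xs (alls Ys \<phi>) = alls (Xs @ Ys) \<phi>"
  by (simp add: alls_def)

lemma sat_exs: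
  assumes "\<phi> \<in> Fml L"
  shows "sat \<M> \<rho> [] (exs Xs \<phi>) \<longleftrightarrow>
    (\<exists>\<tau>. (\<forall>X\<in>set Xs. \<tau> X \<in> uni \<M>) \<and> sat \<M> (override_on \<rho> \<tau> (set Xs)) [] \<phi>)"
proof (induction Xs arbitrary: \<rho>)
  case Nil
  then show ?case by (simp add: exs_def)
next
  case (Cons X Xs)
  have "sat \<M> \<rho> [] (exs (X # Xs) \<phi>) \<longleftrightarrow> (\<exists>a\<in>uni \<M>. sat \<M> (\<rho>(X := a)) [] (exs Xs \<phi>))"
    using sat_ex[OF Fml_exs[OF assms], of \<M> \<rho> X Xs] by (simp add: exs_def)
  also have "\<dots> \<longleftrightarrow> (\<exists>a\<in>uni \<M>. \<exists>\<tau>. (\<forall>X\<in>set Xs. \<tau> X \<in> uni \<M>) \<and>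
      sat \<M> (override_on (\<rho>(X := a)) \<tau> (set Xs)) [] \<phi>)"
    by (simp only: Cons.IH)
  also have "\<dots> \<longleftrightarrow> (\<exists>\<tau>. (\<forall>X\<in>set (X # Xs). \<tau> X \<in> uni \<M>) \<and>
      sat \<M> (override_on \<rho> \<tau> (set (X # Xs))) [] \<phi>)" (is "?l \<longleftrightarrow> ?r")
  proof
    assume ?l
    then obtain a \<tau> where a: "a \<in> uni \<M>" "\<forall>X\<in>set Xs. \<tau> X \<in> uni \<M>"
      "sat \<M> (override_on (\<rho>(X := a)) \<tau> (set Xs)) [] \<phi>" by auto
    let ?\<tau> = "\<lambda>Z. if Z \<in> set Xs then \<tau> Z else a"
    have "override_on (\<rho>(X := a)) \<tau> (set Xs) = override_on \<rho> ?\<tau> (set (X # Xs))"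
      by (auto simp: override_on_def)
    then show ?r using a by (intro exI[of _ ?\<tau>]) auto
  next
    assume ?r
    then obtain \<tau> where t: "\<forall>X\<in>set (X # Xs). \<tau> X \<in> uni \<M>"
      "sat \<M> (override_on \<rho> \<tau> (set (X # Xs))) [] \<phi>" by auto
    have "override_on (\<rho>(X := \<tau> X)) \<tau> (set Xs) = override_on \<rho> \<tau> (set (X # Xs))"
      by (auto simp: override_on_def)
    then show ?l using t by (intro bexI[of _ "\<tau> X"] exI[of _ \<tau>]) auto
  qed
  finally show ?case .
qed

lemma sat_alls:
  assumes "\<phi> \<in> Fml L"
  shows "sat \<M> \<rho> [] (alls Xs \<phi>) \<longleftrightarrow>
    (\<forall>\<tau>. (\<forall>X\<in>set Xs. \<tau> X \<in> uni \<M>) \<longrightarrow> sat \<M> (override_on \<rho> \<tau> (set Xs)) [] \<phi>)"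
proof -
  have "sat \<M> \<rho> [] (alls Xs \<phi>) \<longleftrightarrow> \<not> sat \<M> \<rho> [] (exs Xs (Neg \<phi>))"
  proof (induction Xs arbitrary: \<rho>)
    case (Cons X Xs)
    have "Neg (alls Xs \<phi>) \<in> Fml L" "exs Xs (Neg \<phi>) \<in> Fml L" using assms by auto
    note ex = sat_ex[OF this(1), of \<M> \<rho> X] sat_ex[OF this(2), of \<M> \<rho> X]
    have "alls (X # Xs) \<phi> = Neg (ex X (Neg (alls Xs \<phi>)))" "exs (X # Xs) (Neg \<phi>) = ex X (exs Xs (Neg \<phi>))"
      by (simp_all add: exs_def alls_def all_def)
    then show ?case by (simp only: ex sat.simps(3) Cons.IH not_not)
  qed (simp add: exs_def alls_def)
  also have "\<dots> \<longleftrightarrow> (\<forall>\<tau>. (\<forall>X\<in>set Xs. \<tau> X \<in> uni \<M>) \<longrightarrow> sat \<M> (override_on \<rho> \<tau> (set Xs)) [] \<phi>)"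
    using sat_exs[of "Neg \<phi>" L \<M> \<rho> Xs] assms unfolding Fml_Neg sat.simps(3) by blast
  finally show ?thesis .
qed

lemma Fml_conjs [simp]: "conjs \<phi>s \<in> Fml L \<longleftrightarrow> set \<phi>s \<subseteq> Fml L"
  by (induction \<phi>s rule: conjs.induct) simp_all

lemma fv_conj [simp]: "fv (conj \<phi> \<psi>) = fv \<phi> \<union> fv \<psi>"
  by (simp add: conj_def)

lemma fv_imp [simp]: "fv (imp \<phi> \<psi>) = fv \<phi> \<union> fv \<psi>"
  by (simp add: imp_def)

lemma fv_conjs [simp]: "fv (conjs \<phi>s) = (\<Union>\<phi>\<in>set \<phi>s. fv \<phi>)"
  by (induction \<phi>s rule: conjs.induct) simp_all

lemma sat_conjs [simp]: "sat \<M> \<rho> [] (conjs \<phi>s) \<longleftrightarrow> (\<forall>\<phi>\<in>set \<phi>s. sat \<M> \<rho> [] \<phi>)"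
  by (induction \<phi>s rule: conjs.induct) simp_all

lemma Fml_EV [simp]: "EV V \<in> Fml L"
  by (auto simp: EV_def)

lemma fv_EV [simp]: "finite V \<Longrightarrow> fv (EV V) = V"
  by (auto simp: EV_def)

lemma sat_EV [simp]: "sat \<M> \<rho> [] (EV V)"
  by (auto simp: EV_def)

lemma sat_sentence: "sentence s \<Longrightarrow> sat \<M> \<rho> [] s \<longleftrightarrow> holds \<M> s"
  unfolding holds_def sentence_def by (rule sat_cong) simp

lemma ex_assignment: "\<exists>\<rho>. \<rho> \<in> assignments \<M>"
proof (cases "uni \<M> = {}")
  case False
  then obtain a where "a \<in> uni \<M>" by auto
  then show ?thesis by (intro exI[of _ "\<lambda>_. a"]) (auto simp: assignments_def)
qed (auto simp: assignments_def)

text \<open>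
  A filter rather than the set of models of \<open>T\<close>: a proof uses finitely many axioms, so this makes
  provability from \<open>T\<close> a semantic notion without any compactness theorem.
\<close>

definition Mods :: "'r fml set \<Rightarrow> ('r, int) struct filter" where
  "Mods T = (INF \<gamma>\<in>T. principal {\<M>. holds \<M> \<gamma>})"

definition entails :: "'r fml set \<Rightarrow> (('r, int) struct \<Rightarrow> bool) \<Rightarrow> bool" where
  "entails \<Gamma> P \<longleftrightarrow> (\<forall>\<M>. (\<forall>\<gamma>\<in>\<Gamma>. holds \<M> \<gamma>) \<longrightarrow> P \<M>)"

lemma eventually_Mods: "eventually P (Mods T) \<longleftrightarrow> (\<exists>\<Gamma>\<subseteq>T. finite \<Gamma> \<and> entails \<Gamma> P)"
proof -
  have mem: "\<M> \<in> (\<Inter>\<gamma>\<in>\<Gamma>. {\<M>. holds \<M> \<gamma>}) \<longleftrightarrow> (\<forall>\<gamma>\<in>\<Gamma>. holds \<M> \<gamma>)"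
    for \<M> :: "('a, int) struct" and \<Gamma>
    by (simp only: INT_iff mem_Collect_eq)
  have fin: "eventually P (INF \<gamma>\<in>\<Gamma>. principal {\<M>. holds \<M> \<gamma>}) \<longleftrightarrow> entails \<Gamma> P"
    if "finite \<Gamma>" for \<Gamma>
    unfolding INF_principal_finite[OF that] eventually_principal entails_def
  proof (intro iffI allI ballI impI)
    fix \<M> :: "('a, int) struct"
    assume "\<forall>\<M>\<in>\<Inter>\<gamma>\<in>\<Gamma>. {\<M>. holds \<M> \<gamma>}. P \<M>" "\<forall>\<gamma>\<in>\<Gamma>. holds \<M> \<gamma>"
    then show "P \<M>" by (elim bspec) (simp only: mem)
  next
    fix \<M> :: "('a, int) struct"
    assume "\<forall>\<M>. (\<forall>\<gamma>\<in>\<Gamma>. holds \<M> \<gamma>) \<longrightarrow> P \<M>" "\<M> \<in> (\<Inter>\<gamma>\<in>\<Gamma>. {\<M>. holds \<M> \<gamma>})"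
    then show "P \<M>" by (simp only: mem)
  qed
  show ?thesis
    unfolding Mods_def by (subst eventually_INF) (simp only: fin cong: conj_cong)
qed

lemma derivable_iff:
  fixes L :: "'r signature"
  assumes "finite \<Gamma>" "\<Gamma> \<subseteq> Fml L" "\<phi> \<in> Fml L"
  shows "derivable L \<Gamma> \<phi> \<longleftrightarrow>
    (\<forall>\<M> :: ('r, int) struct. \<forall>\<rho>\<in>assignments \<M>. (\<forall>\<gamma>\<in>\<Gamma>. sat \<M> \<rho> [] \<gamma>) \<longrightarrow> sat \<M> \<rho> [] \<phi>)"
proof (intro iffI allI ballI impI)
  fix \<M> :: "('r, int) struct" and \<rho>
  assume "derivable L \<Gamma> \<phi>" "\<rho> \<in> assignments \<M>" "\<forall>\<gamma>\<in>\<Gamma>. sat \<M> \<rho> [] \<gamma>"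
  then show "sat \<M> \<rho> [] \<phi>" by (rule soundness)
next
  assume *: "\<forall>\<M> :: ('r, int) struct. \<forall>\<rho>\<in>assignments \<M>.
      (\<forall>\<gamma>\<in>\<Gamma>. sat \<M> \<rho> [] \<gamma>) \<longrightarrow> sat \<M> \<rho> [] \<phi>"
  show "derivable L \<Gamma> \<phi>"
  proof (rule completeness[OF assms])
    fix \<M> :: "('r, int) struct" and \<rho>
    assume "\<rho> \<in> assignments \<M>" "\<forall>\<gamma>\<in>\<Gamma>. sat \<M> \<rho> [] \<gamma>"
    then show "sat \<M> \<rho> [] \<phi>" by (rule *[THEN spec, THEN bspec, THEN mp])
  qed
qed

lemma derivable_from_theory:
  fixes L :: "'r signature"
  assumes T: "is_theory L T" and \<Gamma>: "finite \<Gamma>" "\<Gamma> \<subseteq> T"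
    and \<Phi>: "finite \<Phi>" "\<Phi> \<subseteq> Fml L" and \<psi>: "\<psi> \<in> Fml L"
  shows "derivable L (\<Phi> \<union> \<Gamma>) \<psi> \<longleftrightarrow> entails \<Gamma> (\<lambda>\<M>.
    \<forall>\<rho>\<in>assignments \<M>. (\<forall>\<phi>\<in>\<Phi>. sat \<M> \<rho> [] \<phi>) \<longrightarrow> sat \<M> \<rho> [] \<psi>)"
proof -
  have sub: "\<gamma> \<in> Fml L" "sentence \<gamma>" if "\<gamma> \<in> \<Gamma>" for \<gamma>
    using T \<Gamma>(2) that by (auto simp: is_theory_def)
  have "\<Phi> \<union> \<Gamma> \<subseteq> Fml L" using sub(1) \<Phi>(2) by blast
  from derivable_iff[OF finite_UnI[OF \<Phi>(1) \<Gamma>(1)] this \<psi>] have iff: "derivable L (\<Phi> \<union> \<Gamma>) \<psi> \<longleftrightarrow>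
    (\<forall>\<M> :: ('r, int) struct. \<forall>\<rho>\<in>assignments \<M>. (\<forall>\<gamma>\<in>\<Phi> \<union> \<Gamma>. sat \<M> \<rho> [] \<gamma>) \<longrightarrow> sat \<M> \<rho> [] \<psi>)"
    .
  have h: "sat \<M> \<rho> [] \<gamma> \<longleftrightarrow> holds \<M> \<gamma>" if "\<gamma> \<in> \<Gamma>" for \<M> :: "('r, int) struct" and \<rho> \<gamma>
    using sat_sentence[OF sub(2)[OF that]] .
  have split: "(\<forall>\<gamma>\<in>\<Phi> \<union> \<Gamma>. sat \<M> \<rho> [] \<gamma>) \<longleftrightarrow>
    (\<forall>\<phi>\<in>\<Phi>. sat \<M> \<rho> [] \<phi>) \<and> (\<forall>\<gamma>\<in>\<Gamma>. holds \<M> \<gamma>)" for \<M> :: "('r, int) struct" and \<rho>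
    unfolding ball_Un using h by simp
  show ?thesis
    unfolding iff entails_def split
  proof (rule iff_allI, intro iffI impI ballI)
    fix \<M> :: "('r, int) struct" and \<rho>
    assume *: "\<forall>\<rho>\<in>assignments \<M>.
        (\<forall>\<phi>\<in>\<Phi>. sat \<M> \<rho> [] \<phi>) \<and> (\<forall>\<gamma>\<in>\<Gamma>. holds \<M> \<gamma>) \<longrightarrow> sat \<M> \<rho> [] \<psi>"
      and "\<rho> \<in> assignments \<M>" "\<forall>\<gamma>\<in>\<Gamma>. holds \<M> \<gamma>" "\<forall>\<phi>\<in>\<Phi>. sat \<M> \<rho> [] \<phi>"
    then show "sat \<M> \<rho> [] \<psi>" using *[THEN bspec, THEN mp, OF _ conjI] by iprover
  next
    fix \<M> :: "('r, int) struct" and \<rho>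
    assume *: "(\<forall>\<gamma>\<in>\<Gamma>. holds \<M> \<gamma>) \<longrightarrow>
        (\<forall>\<rho>\<in>assignments \<M>. (\<forall>\<phi>\<in>\<Phi>. sat \<M> \<rho> [] \<phi>) \<longrightarrow> sat \<M> \<rho> [] \<psi>)"
      and "\<rho> \<in> assignments \<M>" "(\<forall>\<phi>\<in>\<Phi>. sat \<M> \<rho> [] \<phi>) \<and> (\<forall>\<gamma>\<in>\<Gamma>. holds \<M> \<gamma>)"
    then show "sat \<M> \<rho> [] \<psi>" using *[THEN mp, THEN bspec, THEN mp] by iprover
  qed
qed

lemma prov_implies_iff:
  assumes "is_theory L T" "\<phi> \<in> Fml L" "\<psi> \<in> Fml L"
  shows "prov_implies L T \<phi> \<psi> \<longleftrightarrow>
    (\<forall>\<^sub>F \<M> in Mods T. \<forall>\<rho>\<in>assignments \<M>. sat \<M> \<rho> [] \<phi> \<longrightarrow> sat \<M> \<rho> [] \<psi>)"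
  using derivable_from_theory[OF assms(1), of _ "{\<phi>}" \<psi>] assms
  by (simp add: prov_implies_def eventually_Mods cong: conj_cong) (simp add: conj_commute conj_left_commute cong: conj_cong)

lemma proves_iff:
  assumes "is_theory L T" "\<phi> \<in> Fml L"
  shows "proves L T \<phi> \<longleftrightarrow> (\<forall>\<^sub>F \<M> in Mods T. \<forall>\<rho>\<in>assignments \<M>. sat \<M> \<rho> [] \<phi>)"
  using derivable_from_theory[OF assms(1), of _ "{}" \<phi>] assms
  by (simp add: proves_def eventually_Mods cong: conj_cong) (simp add: conj_commute conj_left_commute cong: conj_cong)

text \<open>
  The assignments of the calculus are arbitrary when the universe is empty. Under a universal closure
  only assignments with values in the universe remain.
\<close>

lemma proves_alls_iff:
  assumes "is_theory L T" "\<phi> \<in> Fml L" "fv \<phi> \<subseteq> set Xs"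
  shows "proves L T (alls Xs \<phi>) \<longleftrightarrow>
    (\<forall>\<^sub>F \<M> in Mods T. \<forall>\<mu>. (\<forall>X\<in>set Xs. \<mu> X \<in> uni \<M>) \<longrightarrow> sat \<M> \<mu> [] \<phi>)"
proof -
  have c: "sat \<M> (override_on \<rho> \<mu> (set Xs)) [] \<phi> \<longleftrightarrow> sat \<M> \<mu> [] \<phi>"
    for \<M> :: "('a, int) struct" and \<rho> \<mu>
    by (rule sat_cong) (use assms in \<open>auto simp: override_on_def\<close>)
  have "(\<forall>\<rho>\<in>assignments \<M>. sat \<M> \<rho> [] (alls Xs \<phi>)) \<longleftrightarrow>
    (\<forall>\<mu>. (\<forall>X\<in>set Xs. \<mu> X \<in> uni \<M>) \<longrightarrow> sat \<M> \<mu> [] \<phi>)" for \<M> :: "('a, int) struct"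
    using ex_assignment[of \<M>] by (auto simp: sat_alls[OF assms(2)] c)
  then show ?thesis using assms by (simp add: proves_iff)
qed

text \<open>Adding \<open>\<not> E\<close> to the theory discards exactly the empty structures.\<close>

lemma Mods_nonempty:
  "eventually P (Mods (T \<union> {Neg E_fml})) \<longleftrightarrow> (\<forall>\<^sub>F \<M> in Mods T. uni \<M> \<noteq> {} \<longrightarrow> P \<M>)"
proof -
  have "Mods (T \<union> {Neg E_fml}) = inf (Mods T) (principal {\<M>. uni \<M> \<noteq> {}})"
    by (simp add: Mods_def holds_def sat_E inf_commute)
  then show ?thesis by (simp add: eventually_inf_principal)
qed

section \<open>Formulas as relations between assignments\<close>

lemma bij_pos:
  assumes "finite V"
  shows "bij_betw (pos V) V {1..card V}"
proof -
  have lt: "pos V X < pos V Y" if "X \<in> V" "Y \<in> V" "X < Y" for X Y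
  proof -
    have "Y \<in> {Z \<in> V. Z \<le> Y}" "Y \<notin> {Z \<in> V. Z \<le> X}" using that by auto
    then have "{Z \<in> V. Z \<le> X} \<subset> {Z \<in> V. Z \<le> Y}" using that by fastforce
    then show ?thesis unfolding pos_def by (rule psubset_card_mono[rotated]) (use assms in auto)
  qed
  have inj: "inj_on (pos V) V"
    by (rule inj_onI) (metis lt less_irrefl linorder_neqE)
  have "pos V ` V \<subseteq> {1..card V}"
  proof clarify
    fix X assume "X \<in> V"
    then have "0 < card {Y \<in> V. Y \<le> X}" using assms by (auto simp: card_gt_0_iff)
    moreover have "card {Y \<in> V. Y \<le> X} \<le> card V" by (rule card_mono) (use assms in auto)
    ultimately show "pos V X \<in> {1..card V}" by (simp add: pos_def)
  qed
  then have "pos V ` V = {1..card V}"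
    using inj by (intro card_subset_eq) (auto simp: card_image)
  with inj show ?thesis by (simp add: bij_betw_def)
qed

lemma pos_range: "finite V \<Longrightarrow> X \<in> V \<Longrightarrow> 1 \<le> pos V X \<and> pos V X \<le> card V"
  using bij_betwE[OF bij_pos] by auto

lemma pos_surj: "finite V \<Longrightarrow> 1 \<le> i \<Longrightarrow> i \<le> card V \<Longrightarrow> \<exists>X\<in>V. pos V X = i"
  using bij_betw_imp_surj_on[OF bij_pos, of V] by (metis atLeastAtMost_iff imageE)

text \<open>The variables of a premorphism: \<open>x\<^sub>-\<^sub>i\<close> for the source, \<open>x\<^sub>j\<close> for the target.\<close>

definition sg :: "int set \<Rightarrow> int set \<Rightarrow> int set" where
  "sg V W = (\<lambda>i. xneg i) ` {1..card V} \<union> xpos ` {1..card W}"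

text \<open>
  An assignment \<open>\<mu>\<close> for \<open>\<theta>(x\<^sub>-\<^sub>i, x\<^sub>j)\<close> is split into assignments for the variables \<open>V\<close> of the source and
  \<open>W\<close> of the target, whose own names may be arbitrary and may overlap.
\<close>

definition lft :: "int set \<Rightarrow> (int \<Rightarrow> 'u) \<Rightarrow> int \<Rightarrow> 'u" where
  "lft V \<mu> = (\<lambda>X\<in>V. \<mu> (xneg (pos V X)))"

definition rgt :: "int set \<Rightarrow> (int \<Rightarrow> 'u) \<Rightarrow> int \<Rightarrow> 'u" where
  "rgt W \<mu> = (\<lambda>X\<in>W. \<mu> (xpos (pos W X)))"

definition den ::
  "int set \<Rightarrow> int set \<Rightarrow> 'r fml \<Rightarrow> ('r, 'u) struct \<Rightarrow> ((int \<Rightarrow> 'u) \<times> (int \<Rightarrow> 'u)) set" where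
  "den V W \<theta> \<M> = {(lft V \<mu>, rgt W \<mu>) |\<mu>. (\<forall>k\<in>sg V W. \<mu> k \<in> uni \<M>) \<and> sat \<M> \<mu> [] \<theta>}"

lemma rgt_empty [simp]: "rgt {} \<mu> = (\<lambda>_. undefined)"
  by (auto simp: rgt_def)

lemma lft_empty [simp]: "lft {} \<mu> = (\<lambda>_. undefined)"
  by (auto simp: lft_def)

lemma finite_sg [simp]: "finite (sg V W)"
  by (simp add: sg_def)

lemma sg_iff: "k \<in> sg V W \<longleftrightarrow> k < 0 \<and> - k \<le> int (card V) \<or> 0 < k \<and> k \<le> int (card W)"
proof
  assume "k < 0 \<and> - k \<le> int (card V) \<or> 0 < k \<and> k \<le> int (card W)"
  then show "k \<in> sg V W"
  proof
    assume "k < 0 \<and> - k \<le> int (card V)"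
    then have "k = xneg (nat (- k))" "nat (- k) \<in> {1..card V}" by (auto simp: xneg_def)
    then show ?thesis unfolding sg_def by blast
  next
    assume "0 < k \<and> k \<le> int (card W)"
    then have "k = xpos (nat k)" "nat k \<in> {1..card W}" by (auto simp: xpos_def)
    then show ?thesis unfolding sg_def by blast
  qed
qed (auto simp: sg_def xneg_def xpos_def)

lemma pos_sg:
  assumes "finite V" "X \<in> V"
  shows "xneg (pos V X) \<in> sg V W" "xpos (pos V X) \<in> sg W V"
  using pos_range[OF assms] by (auto simp: sg_def)

lemma lft_eq_iff:
  assumes "finite V"
  shows "lft V \<mu> = lft V \<mu>' \<longleftrightarrow> (\<forall>k. k < 0 \<and> - k \<le> int (card V) \<longrightarrow> \<mu> k = \<mu>' k)"
proof (intro iffI allI impI)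
  fix k assume eq: "lft V \<mu> = lft V \<mu>'" and k: "k < 0 \<and> - k \<le> int (card V)"
  then have "1 \<le> nat (- k)" "nat (- k) \<le> card V" by linarith+
  then obtain X where "X \<in> V" "pos V X = nat (- k)"
    using pos_surj[OF assms] by blast
  then show "\<mu> k = \<mu>' k" using fun_cong[OF eq, of X] k by (simp add: lft_def xneg_def)
next
  assume *: "\<forall>k. k < 0 \<and> - k \<le> int (card V) \<longrightarrow> \<mu> k = \<mu>' k"
  show "lft V \<mu> = lft V \<mu>'"
    unfolding lft_def
  proof (rule restrict_ext)
    fix X assume "X \<in> V"
    then have "xneg (pos V X) < 0 \<and> - xneg (pos V X) \<le> int (card V)"
      using pos_range[OF assms] by (fastforce simp: xneg_def)
    with * show "\<mu> (xneg (pos V X)) = \<mu>' (xneg (pos V X))" by blast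
  qed
qed

lemma rgt_eq_iff:
  assumes "finite W"
  shows "rgt W \<mu> = rgt W \<mu>' \<longleftrightarrow> (\<forall>k. 0 < k \<and> k \<le> int (card W) \<longrightarrow> \<mu> k = \<mu>' k)"
proof (intro iffI allI impI)
  fix k assume eq: "rgt W \<mu> = rgt W \<mu>'" and k: "0 < k \<and> k \<le> int (card W)"
  then have "1 \<le> nat k" "nat k \<le> card W" by linarith+
  then obtain X where "X \<in> W" "pos W X = nat k"
    using pos_surj[OF assms] by blast
  then show "\<mu> k = \<mu>' k" using fun_cong[OF eq, of X] k by (simp add: rgt_def xpos_def)
next
  assume *: "\<forall>k. 0 < k \<and> k \<le> int (card W) \<longrightarrow> \<mu> k = \<mu>' k"
  show "rgt W \<mu> = rgt W \<mu>'"
    unfolding rgt_def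
  proof (rule restrict_ext)
    fix X assume "X \<in> W"
    then have "0 < xpos (pos W X) \<and> xpos (pos W X) \<le> int (card W)"
      using pos_range[OF assms] by (fastforce simp: xpos_def)
    with * show "\<mu> (xpos (pos W X)) = \<mu>' (xpos (pos W X))" by blast
  qed
qed

lemma lft_rgt_mem:
  assumes "finite V" "finite W" "\<forall>k\<in>sg V W. \<mu> k \<in> U"
  shows "lft V \<mu> \<in> V \<rightarrow>\<^sub>E U" "rgt W \<mu> \<in> W \<rightarrow>\<^sub>E U"
  using assms pos_sg by (auto simp: lft_def rgt_def)

lemma sg_mem:
  assumes "finite V" "finite W" "lft V \<mu> \<in> V \<rightarrow>\<^sub>E U" "rgt W \<mu> \<in> W \<rightarrow>\<^sub>E U"
  shows "\<forall>k\<in>sg V W. \<mu> k \<in> U"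
proof
  fix k assume "k \<in> sg V W"
  then consider i where "k = xneg i" "1 \<le> i" "i \<le> card V" | i where "k = xpos i" "1 \<le> i" "i \<le> card W"
    by (auto simp: sg_def)
  then show "\<mu> k \<in> U"
  proof cases
    case 1
    then obtain X where X: "X \<in> V" "pos V X = i" using pos_surj assms by blast
    then have "lft V \<mu> X \<in> U" using assms by blast
    then show ?thesis using X 1 by (simp add: lft_def)
  next
    case 2
    then obtain X where X: "X \<in> W" "pos W X = i" using pos_surj assms by blast
    then have "rgt W \<mu> X \<in> U" using assms by blast
    then show ?thesis using X 2 by (simp add: rgt_def)
  qed
qed

lemma ex_lft_rgt:
  assumes "finite V" "finite W" "\<rho> \<in> V \<rightarrow>\<^sub>E U" "\<tau> \<in> W \<rightarrow>\<^sub>E U"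
  shows "\<exists>\<mu>. lft V \<mu> = \<rho> \<and> rgt W \<mu> = \<tau>"
proof -
  define \<mu> where "\<mu> k = (if k < 0 then \<rho> (the_inv_into V (pos V) (nat (- k)))
    else \<tau> (the_inv_into W (pos W) (nat k)))" for k
  have inv: "the_inv_into Z (pos Z) (pos Z X) = X" if "finite Z" "X \<in> Z" for Z X
    using that bij_pos[of Z] by (simp add: bij_betw_def the_inv_into_f_f)
  have "lft V \<mu> = \<rho>"
  proof
    fix X show "lft V \<mu> X = \<rho> X"
    proof (cases "X \<in> V")
      case True
      then show ?thesis
        using inv[OF assms(1) True] pos_range[OF assms(1) True] by (simp add: lft_def \<mu>_def xneg_def)
    next
      case False
      then show ?thesis using PiE_arb[OF assms(3) False] by (simp add: lft_def)
    qed
  qed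
  moreover have "rgt W \<mu> = \<tau>"
  proof
    fix X show "rgt W \<mu> X = \<tau> X"
    proof (cases "X \<in> W")
      case True
      then show ?thesis
        using inv[OF assms(2) True] pos_range[OF assms(2) True] by (simp add: rgt_def \<mu>_def xpos_def)
    next
      case False
      then show ?thesis using PiE_arb[OF assms(4) False] by (simp add: rgt_def)
    qed
  qed
  ultimately show ?thesis by blast
qed

lemma sat_sg_cong:
  assumes "fv \<theta> \<subseteq> sg V W" "finite V" "finite W" "lft V \<mu> = lft V \<mu>'" "rgt W \<mu> = rgt W \<mu>'"
  shows "sat \<M> \<mu> [] \<theta> \<longleftrightarrow> sat \<M> \<mu>' [] \<theta>"
proof (rule sat_cong)
  fix k assume "k \<in> fv \<theta>"
  then have "k \<in> sg V W" using assms by auto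
  then show "\<mu> k = \<mu>' k"
    using assms(4,5) unfolding lft_eq_iff[OF assms(2)] rgt_eq_iff[OF assms(3)] sg_iff by blast
qed

lemma den_iff:
  assumes "fv \<theta> \<subseteq> sg V W" "finite V" "finite W"
  shows "(lft V \<mu>, rgt W \<mu>) \<in> den V W \<theta> \<M> \<longleftrightarrow>
    lft V \<mu> \<in> V \<rightarrow>\<^sub>E uni \<M> \<and> rgt W \<mu> \<in> W \<rightarrow>\<^sub>E uni \<M> \<and> sat \<M> \<mu> [] \<theta>"
proof
  assume "(lft V \<mu>, rgt W \<mu>) \<in> den V W \<theta> \<M>"
  then obtain \<mu>' where \<mu>': "lft V \<mu> = lft V \<mu>'" "rgt W \<mu> = rgt W \<mu>'"
    "\<forall>k\<in>sg V W. \<mu>' k \<in> uni \<M>" "sat \<M> \<mu>' [] \<theta>" unfolding den_def by blast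
  have "sat \<M> \<mu> [] \<theta>" using \<mu>'(4) sat_sg_cong[OF assms \<mu>'(1,2), of \<M>] by blast
  then show "lft V \<mu> \<in> V \<rightarrow>\<^sub>E uni \<M> \<and> rgt W \<mu> \<in> W \<rightarrow>\<^sub>E uni \<M> \<and> sat \<M> \<mu> [] \<theta>"
    using lft_rgt_mem[OF assms(2,3) \<mu>'(3)] by (simp only: \<mu>'(1,2) simp_thms)
next
  assume *: "lft V \<mu> \<in> V \<rightarrow>\<^sub>E uni \<M> \<and> rgt W \<mu> \<in> W \<rightarrow>\<^sub>E uni \<M> \<and> sat \<M> \<mu> [] \<theta>"
  then have "\<forall>k\<in>sg V W. \<mu> k \<in> uni \<M>" using sg_mem[OF assms(2,3)] by blast
  with * show "(lft V \<mu>, rgt W \<mu>) \<in> den V W \<theta> \<M>" unfolding den_def by blast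
qed

lemma den_sub:
  assumes "finite V" "finite W"
  shows "den V W \<theta> \<M> \<subseteq> (V \<rightarrow>\<^sub>E uni \<M>) \<times> (W \<rightarrow>\<^sub>E uni \<M>)"
proof
  fix p assume "p \<in> den V W \<theta> \<M>"
  then obtain \<mu> where "p = (lft V \<mu>, rgt W \<mu>)" "\<forall>k\<in>sg V W. \<mu> k \<in> uni \<M>"
    unfolding den_def by blast
  then show "p \<in> (V \<rightarrow>\<^sub>E uni \<M>) \<times> (W \<rightarrow>\<^sub>E uni \<M>)" using lft_rgt_mem[OF assms, of \<mu>] by simp
qed

text \<open>Every pair of assignments arises from some \<open>\<mu>\<close>, as the two sides use disjoint sets of variables.\<close>

lemma rel_eqI:
  assumes "finite V" "finite W" "R \<subseteq> (V \<rightarrow>\<^sub>E U) \<times> (W \<rightarrow>\<^sub>E U)" "R' \<subseteq> (V \<rightarrow>\<^sub>E U) \<times> (W \<rightarrow>\<^sub>E U)"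
    and "\<And>\<mu>. lft V \<mu> \<in> V \<rightarrow>\<^sub>E U \<Longrightarrow> rgt W \<mu> \<in> W \<rightarrow>\<^sub>E U \<Longrightarrow>
      (lft V \<mu>, rgt W \<mu>) \<in> R \<longleftrightarrow> (lft V \<mu>, rgt W \<mu>) \<in> R'"
  shows "R = R'"
proof -
  have "(\<rho>, \<tau>) \<in> R \<longleftrightarrow> (\<rho>, \<tau>) \<in> R'" if m: "\<rho> \<in> V \<rightarrow>\<^sub>E U" "\<tau> \<in> W \<rightarrow>\<^sub>E U" for \<rho> \<tau>
    using ex_lft_rgt[OF assms(1,2) m] assms(5) m by blast
  then show ?thesis using assms(3,4) by auto
qed

lemma sat_inst:
  "sat \<M> \<mu> [] (inst \<alpha> B) \<longleftrightarrow> sat \<M> (\<lambda>X\<in>fv \<alpha>. \<mu> (B (pos (fv \<alpha>) X))) [] \<alpha>"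
  unfolding inst_def sat_subst by (rule sat_cong) auto

lemma sat_inst_xneg: "sat \<M> \<mu> [] (inst \<alpha> xneg) \<longleftrightarrow> sat \<M> (lft (fv \<alpha>) \<mu>) [] \<alpha>"
  by (simp add: sat_inst lft_def)

lemma sat_inst_xpos: "sat \<M> \<mu> [] (inst \<alpha> xpos) \<longleftrightarrow> sat \<M> (rgt (fv \<alpha>) \<mu>) [] \<alpha>"
  by (simp add: sat_inst rgt_def)

lemma Fml_inst [simp]: "\<alpha> \<in> Fml L \<Longrightarrow> inst \<alpha> B \<in> Fml L"
  by (simp add: inst_def)

lemma Fml_inst2 [simp]: "\<theta> \<in> Fml L \<Longrightarrow> inst2 \<theta> A B \<in> Fml L"
  by (simp add: inst2_def)

lemma fv_inst_xneg: "fv (inst \<alpha> xneg) \<subseteq> sg (fv \<alpha>) W"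
  using pos_sg(1)[OF finite_fv] by (auto simp: inst_def fv_subst)

lemma fv_inst_xpos: "fv (inst \<alpha> xpos) \<subseteq> sg W (fv \<alpha>)"
  using pos_sg(2)[OF finite_fv] by (auto simp: inst_def fv_subst)

lemma fv_inst_xneg': "fv (inst \<alpha> xneg) \<subseteq> set (map xneg [1..<Suc (nfv \<alpha>)])"
  using fv_inst_xneg[of \<alpha> "{}"] by (simp add: sg_def atLeastLessThanSuc_atLeastAtMost del: upt_Suc)

lemma extension_iff: "\<rho> \<in> extension \<M> \<alpha> \<longleftrightarrow> \<rho> \<in> fv \<alpha> \<rightarrow>\<^sub>E uni \<M> \<and> sat \<M> \<rho> [] \<alpha>"
  by (simp add: extension_def)

definition func :: "'a set \<Rightarrow> 'b set \<Rightarrow> ('a \<times> 'b) set \<Rightarrow> bool" where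
  "func A B R \<longleftrightarrow> R \<subseteq> A \<times> B \<and> (\<forall>a\<in>A. \<exists>b. (a, b) \<in> R) \<and> single_valued R"

lemma inst2_shift:
  "sat \<M> \<mu> [] (inst2 \<theta> xneg (\<lambda>j. xpos (m + j))) \<longleftrightarrow>
    sat \<M> (\<lambda>k. if k > 0 then \<mu> (int m + k) else \<mu> k) [] \<theta>"
  unfolding inst2_def sat_subst by (rule sat_cong) (auto simp: xneg_def xpos_def)

text \<open>Inclusion in the product, totality and single-valuedness are the three provability conditions.\<close>

lemma premorphism_iff:
  assumes T: "is_theory L T" and \<alpha>: "\<alpha> \<in> Fml L" and \<beta>: "\<beta> \<in> Fml L"
  shows "premorphism L T \<alpha> \<beta> \<theta> \<longleftrightarrow> \<theta> \<in> Fml L \<and> fv \<theta> \<subseteq> sg (fv \<alpha>) (fv \<beta>) \<and>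
    (\<forall>\<^sub>F \<M> in Mods T. func (extension \<M> \<alpha>) (extension \<M> \<beta>) (den (fv \<alpha>) (fv \<beta>) \<theta> \<M>))"
proof (cases "\<theta> \<in> Fml L \<and> fv \<theta> \<subseteq> sg (fv \<alpha>) (fv \<beta>)")
  case False
  then show ?thesis by (auto simp: premorphism_def Let_def sg_def)
next
  case True
  then have \<theta>: "\<theta> \<in> Fml L" "fv \<theta> \<subseteq> sg (fv \<alpha>) (fv \<beta>)" by auto
  define V W m where "V = fv \<alpha>" and "W = fv \<beta>" and "m = card W"
  have fin: "finite V" "finite W" by (auto simp: V_def W_def)
  have fvt: "fv \<theta> \<subseteq> sg V W" using \<theta> by (simp add: V_def W_def)
  define xs where "xs = map xneg [1..<Suc (card V)]"
  define ys where "ys = map xpos [1..<Suc m]"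
  define ys' where "ys' = map (\<lambda>j. xpos (m + j)) [1..<Suc m]"
  have set_xs: "k \<in> set xs \<longleftrightarrow> k < 0 \<and> - k \<le> int (card V)" for k
    using sg_iff[of k V "{}"] by (auto simp: xs_def sg_def)
  have set_ys: "k \<in> set ys \<longleftrightarrow> 0 < k \<and> k \<le> int m" for k
    using sg_iff[of k "{}" W] by (auto simp: ys_def sg_def m_def)
  have set_ys': "k \<in> set ys' \<longleftrightarrow> int m < k \<and> k \<le> 2 * int m" for k
  proof -
    have "ys' = map (\<lambda>k. int m + k) ys" by (simp add: ys'_def ys_def xpos_def)
    then have "k \<in> set ys' \<longleftrightarrow> k - int m \<in> set ys" by (auto simp: image_iff) (metis add_diff_cancel_left' diff_add_cancel add.commute)+
    then show ?thesis by (auto simp: set_ys)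
  qed
  have sx: "set xs = sg V {}" by (auto simp: sg_iff set_xs)
  have sg: "sg V W = set (xs @ ys)" by (auto simp: sg_iff set_xs set_ys m_def)
  have fxn: "fv (inst \<alpha> xneg) \<subseteq> set xs" using fv_inst_xneg'[of \<alpha>] by (simp add: xs_def V_def)
  have fxp: "fv (inst \<beta> xpos) \<subseteq> sg V W" using fv_inst_xpos[of \<beta> V] by (simp add: W_def)
  define F1 where "F1 = alls xs (alls ys (imp \<theta> (conj (inst \<alpha> xneg) (inst \<beta> xpos))))"
  define F2 where "F2 = alls xs (imp (inst \<alpha> xneg) (exs ys \<theta>))"
  define F3 where "F3 = alls xs (alls ys (alls ys'
          (imp (conj \<theta> (inst2 \<theta> xneg (\<lambda>j. xpos (m + j))))
               (conjs (map (\<lambda>j. eqv (xpos j) (xpos (m + j))) [1..<Suc m])))))"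
  have pre: "premorphism L T \<alpha> \<beta> \<theta> \<longleftrightarrow> proves L T F1 \<and> proves L T F2 \<and> proves L T F3"
    using \<theta> sg unfolding premorphism_def Let_def F1_def F2_def F3_def
    by (simp add: xs_def ys_def ys'_def V_def W_def m_def)
  let ?D = "\<lambda>\<M> :: ('a, int) struct. den V W \<theta> \<M>"
  have "proves L T F1 \<longleftrightarrow> (\<forall>\<^sub>F \<M> in Mods T. ?D \<M> \<subseteq> extension \<M> \<alpha> \<times> extension \<M> \<beta>)"
  proof -
    have "proves L T F1 \<longleftrightarrow> (\<forall>\<^sub>F \<M> in Mods T. \<forall>\<mu>. (\<forall>X\<in>set (xs @ ys). \<mu> X \<in> uni \<M>) \<longrightarrow>
      sat \<M> \<mu> [] (imp \<theta> (conj (inst \<alpha> xneg) (inst \<beta> xpos))))"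
      unfolding F1_def alls_append
      by (rule proves_alls_iff[OF T]) (use \<theta> \<alpha> \<beta> fvt fxn fxp in \<open>auto simp: sg\<close>)
    also have "\<dots> \<longleftrightarrow> (\<forall>\<^sub>F \<M> in Mods T. ?D \<M> \<subseteq> extension \<M> \<alpha> \<times> extension \<M> \<beta>)"
    proof (rule eventually_subst, rule always_eventually, rule allI)
      fix \<M> :: "('a, int) struct"
      show "(\<forall>\<mu>. (\<forall>X\<in>set (xs @ ys). \<mu> X \<in> uni \<M>) \<longrightarrow>
        sat \<M> \<mu> [] (imp \<theta> (conj (inst \<alpha> xneg) (inst \<beta> xpos)))) =
        (?D \<M> \<subseteq> extension \<M> \<alpha> \<times> extension \<M> \<beta>)"
      proof (intro iffI subsetI allI impI)
        fix p assume F1: "\<forall>\<mu>. (\<forall>X\<in>set (xs @ ys). \<mu> X \<in> uni \<M>) \<longrightarrow>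
          sat \<M> \<mu> [] (imp \<theta> (conj (inst \<alpha> xneg) (inst \<beta> xpos)))" and "p \<in> ?D \<M>"
        then obtain \<mu> where \<mu>: "p = (lft V \<mu>, rgt W \<mu>)" "\<forall>k\<in>sg V W. \<mu> k \<in> uni \<M>" "sat \<M> \<mu> [] \<theta>"
          by (auto simp: den_def)
        then have "sat \<M> \<mu> [] (imp \<theta> (conj (inst \<alpha> xneg) (inst \<beta> xpos)))"
          using F1[THEN spec, THEN mp, of \<mu>] by (simp only: sg)
        then have "sat \<M> (lft V \<mu>) [] \<alpha> \<and> sat \<M> (rgt W \<mu>) [] \<beta>"
          using \<mu>(3) by (simp add: sat_inst_xneg sat_inst_xpos V_def W_def)
        then show "p \<in> extension \<M> \<alpha> \<times> extension \<M> \<beta>"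
          using lft_rgt_mem[OF fin \<mu>(2)] \<mu>(1) by (simp add: extension_iff V_def W_def)
      next
        fix \<mu> assume sub: "?D \<M> \<subseteq> extension \<M> \<alpha> \<times> extension \<M> \<beta>"
          and \<mu>: "\<forall>X\<in>set (xs @ ys). \<mu> X \<in> uni \<M>"
        have "(lft V \<mu>, rgt W \<mu>) \<in> ?D \<M>" if "sat \<M> \<mu> [] \<theta>"
          using that \<mu> by (auto simp: den_def sg)
        then show "sat \<M> \<mu> [] (imp \<theta> (conj (inst \<alpha> xneg) (inst \<beta> xpos)))"
          using sub by (auto simp: sat_inst_xneg sat_inst_xpos extension_iff V_def W_def)
      qed
    qed
    finally show ?thesis .
  qed
  moreover have "proves L T F2 \<longleftrightarrow> (\<forall>\<^sub>F \<M> in Mods T. \<forall>\<rho>\<in>extension \<M> \<alpha>. \<exists>\<tau>. (\<rho>, \<tau>) \<in> ?D \<M>)"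
  proof -
    have "proves L T F2 \<longleftrightarrow> (\<forall>\<^sub>F \<M> in Mods T. \<forall>\<mu>. (\<forall>X\<in>set xs. \<mu> X \<in> uni \<M>) \<longrightarrow>
      sat \<M> \<mu> [] (imp (inst \<alpha> xneg) (exs ys \<theta>)))"
      unfolding F2_def
      by (rule proves_alls_iff[OF T]) (use \<theta> \<alpha> \<beta> fvt fxn fxp in \<open>auto simp: sg\<close>)
    also have "\<dots> \<longleftrightarrow> (\<forall>\<^sub>F \<M> in Mods T. \<forall>\<rho>\<in>extension \<M> \<alpha>. \<exists>\<tau>. (\<rho>, \<tau>) \<in> ?D \<M>)"
    proof (rule eventually_subst, rule always_eventually, rule allI)
      fix \<M> :: "('a, int) struct"
      have ex: "sat \<M> \<mu> [] (exs ys \<theta>) \<longleftrightarrow> (\<exists>\<tau>. (lft V \<mu>, \<tau>) \<in> ?D \<M>)"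
        if \<mu>: "\<forall>X\<in>set xs. \<mu> X \<in> uni \<M>" for \<mu>
      proof
        assume "sat \<M> \<mu> [] (exs ys \<theta>)"
        then obtain \<tau> where \<tau>: "\<forall>X\<in>set ys. \<tau> X \<in> uni \<M>" "sat \<M> (override_on \<mu> \<tau> (set ys)) [] \<theta>"
          by (auto simp: sat_exs[OF \<theta>(1)])
        let ?\<mu> = "override_on \<mu> \<tau> (set ys)"
        have "\<forall>k\<in>sg V W. ?\<mu> k \<in> uni \<M>" using \<mu> \<tau> by (auto simp: override_on_def sg)
        then have "(lft V ?\<mu>, rgt W ?\<mu>) \<in> ?D \<M>" using \<tau> by (auto simp: den_def)
        moreover have "lft V ?\<mu> = lft V \<mu>"
          using fin by (auto simp: lft_eq_iff override_on_def set_ys)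
        ultimately show "\<exists>\<tau>. (lft V \<mu>, \<tau>) \<in> ?D \<M>" by auto
      next
        assume "\<exists>\<tau>. (lft V \<mu>, \<tau>) \<in> ?D \<M>"
        then obtain \<mu>' where \<mu>': "lft V \<mu> = lft V \<mu>'" "\<forall>k\<in>sg V W. \<mu>' k \<in> uni \<M>" "sat \<M> \<mu>' [] \<theta>"
          by (auto simp: den_def)
        have "sat \<M> (override_on \<mu> \<mu>' (set ys)) [] \<theta> \<longleftrightarrow> sat \<M> \<mu>' [] \<theta>"
          by (rule sat_sg_cong[OF fvt fin])
            (use \<mu>'(1) fin in \<open>auto simp: override_on_def lft_eq_iff rgt_eq_iff set_ys m_def\<close>)
        then show "sat \<M> \<mu> [] (exs ys \<theta>)"
          using \<mu>' by (auto simp: sat_exs[OF \<theta>(1)] sg)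
      qed
      show "(\<forall>\<mu>. (\<forall>X\<in>set xs. \<mu> X \<in> uni \<M>) \<longrightarrow>
        sat \<M> \<mu> [] (imp (inst \<alpha> xneg) (exs ys \<theta>))) =
        (\<forall>\<rho>\<in>extension \<M> \<alpha>. \<exists>\<tau>. (\<rho>, \<tau>) \<in> ?D \<M>)" (is "?l = ?r")
      proof
        assume l: ?l
        show ?r
        proof
          fix \<rho> assume \<rho>: "\<rho> \<in> extension \<M> \<alpha>"
          then obtain \<mu> where "lft V \<mu> = \<rho>"
            using ex_lft_rgt[of V "{}" \<rho> "uni \<M>"] fin by (auto simp: extension_iff V_def)
          moreover have "\<forall>X\<in>set xs. \<mu> X \<in> uni \<M>"
            unfolding sx
            by (rule sg_mem) (use \<rho> \<open>lft V \<mu> = \<rho>\<close> fin in \<open>auto simp: extension_iff V_def rgt_empty\<close>)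
          ultimately show "\<exists>\<tau>. (\<rho>, \<tau>) \<in> ?D \<M>"
            using l ex[of \<mu>] \<rho> by (auto simp: sat_inst_xneg V_def extension_iff)
        qed
      next
        assume r: ?r
        show ?l
        proof (intro allI impI)
          fix \<mu> assume \<mu>: "\<forall>X\<in>set xs. \<mu> X \<in> uni \<M>"
          then have "lft V \<mu> \<in> V \<rightarrow>\<^sub>E uni \<M>"
            using lft_rgt_mem(1)[of V "{}" \<mu> "uni \<M>"] fin unfolding sx by simp
          then show "sat \<M> \<mu> [] (imp (inst \<alpha> xneg) (exs ys \<theta>))"
            using r ex[OF \<mu>] by (auto simp: sat_inst_xneg V_def extension_iff)
        qed
      qed
    qed
    finally show ?thesis .
  qed
  moreover have "proves L T F3 \<longleftrightarrow> (\<forall>\<^sub>F \<M> in Mods T. single_valued (?D \<M>))"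
  proof -
    have "fv (inst2 \<theta> xneg (\<lambda>j. xpos (m + j))) \<subseteq> set (xs @ ys @ ys')"
    proof
      fix k assume "k \<in> fv (inst2 \<theta> xneg (\<lambda>j. xpos (m + j)))"
      then obtain k' where "k' \<in> sg V W"
        "k = (if k' < 0 then xneg (nat (- k')) else if k' > 0 then xpos (m + nat k') else k')"
        using fvt by (auto simp: inst2_def fv_subst)
      then show "k \<in> set (xs @ ys @ ys')"
        unfolding set_append Un_iff set_xs set_ys set_ys' sg_iff
        by (auto simp: xneg_def xpos_def m_def split: if_splits)
    qed
    moreover have "fv (conjs (map (\<lambda>j. eqv (xpos j) (xpos (m + j))) [1..<Suc m])) \<subseteq> set (xs @ ys @ ys')"
      by (auto simp: ys_def ys'_def)
    ultimately have "proves L T F3 \<longleftrightarrow> (\<forall>\<^sub>F \<M> in Mods T. \<forall>\<mu>. (\<forall>X\<in>set (xs @ ys @ ys'). \<mu> X \<in> uni \<M>) \<longrightarrow>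
      sat \<M> \<mu> [] (imp (conj \<theta> (inst2 \<theta> xneg (\<lambda>j. xpos (m + j))))
               (conjs (map (\<lambda>j. eqv (xpos j) (xpos (m + j))) [1..<Suc m]))))"
      unfolding F3_def alls_append
      by (intro proves_alls_iff[OF T]) (use \<theta>(1) fvt in \<open>auto simp: sg\<close>)
    also have "\<dots> \<longleftrightarrow> (\<forall>\<^sub>F \<M> in Mods T. single_valued (?D \<M>))"
    proof (rule eventually_subst, rule always_eventually, rule allI)
      fix \<M> :: "('a, int) struct"
      define sh where "sh \<mu> k = (if k > 0 then \<mu> (int m + k) else \<mu> k)" for \<mu> :: "int \<Rightarrow> int" and k
      have eqs: "sat \<M> \<mu> [] (conjs (map (\<lambda>j. eqv (xpos j) (xpos (m + j))) [1..<Suc m])) \<longleftrightarrow>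
        rgt W \<mu> = rgt W (sh \<mu>)" for \<mu>
      proof -
        have "sat \<M> \<mu> [] (conjs (map (\<lambda>j. eqv (xpos j) (xpos (m + j))) [1..<Suc m])) \<longleftrightarrow>
          (\<forall>j\<in>{1..m}. \<mu> (xpos j) = sh \<mu> (xpos j))"
          by (auto simp: sh_def xpos_def)
        also have "\<dots> \<longleftrightarrow> (\<forall>k\<in>set ys. \<mu> k = sh \<mu> k)" by (auto simp: ys_def)
        finally show ?thesis by (auto simp: rgt_eq_iff[OF fin(2)] set_ys m_def)
      qed
      have sh: "sat \<M> \<mu> [] (inst2 \<theta> xneg (\<lambda>j. xpos (m + j))) \<longleftrightarrow> sat \<M> (sh \<mu>) [] \<theta>" for \<mu>
        by (simp add: inst2_shift sh_def[abs_def])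
      have "(\<forall>\<mu>. (\<forall>X\<in>set (xs @ ys @ ys'). \<mu> X \<in> uni \<M>) \<longrightarrow>
        sat \<M> \<mu> [] \<theta> \<and> sat \<M> (sh \<mu>) [] \<theta> \<longrightarrow> rgt W \<mu> = rgt W (sh \<mu>)) =
        single_valued (?D \<M>)" (is "?l = ?r")
      proof
        assume l: ?l
        show ?r
        proof (rule single_valuedI)
          fix \<rho> \<tau> \<tau>' assume "(\<rho>, \<tau>) \<in> ?D \<M>" "(\<rho>, \<tau>') \<in> ?D \<M>"
          then obtain \<mu>1 \<mu>2 where
            1: "\<rho> = lft V \<mu>1" "\<tau> = rgt W \<mu>1" "\<forall>k\<in>sg V W. \<mu>1 k \<in> uni \<M>" "sat \<M> \<mu>1 [] \<theta>" and
            2: "\<rho> = lft V \<mu>2" "\<tau>' = rgt W \<mu>2" "\<forall>k\<in>sg V W. \<mu>2 k \<in> uni \<M>" "sat \<M> \<mu>2 [] \<theta>"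
            unfolding den_def by blast
          define \<mu> where "\<mu> k = (if k \<le> int m then \<mu>1 k else \<mu>2 (k - int m))" for k
          have l1: "lft V \<mu> = lft V \<mu>1" by (auto simp: lft_eq_iff[OF fin(1)] \<mu>_def)
          have r1: "rgt W \<mu> = rgt W \<mu>1" by (auto simp: rgt_eq_iff[OF fin(2)] \<mu>_def m_def)
          have l2: "lft V (sh \<mu>) = lft V \<mu>2"
            using 1(1) 2(1) l1 by (auto simp: lft_eq_iff[OF fin(1)] sh_def)
          have r2: "rgt W (sh \<mu>) = rgt W \<mu>2" by (auto simp: rgt_eq_iff[OF fin(2)] sh_def \<mu>_def)
          have "\<mu> X \<in> uni \<M>" if "X \<in> set (xs @ ys @ ys')" for X
          proof (cases "X \<le> int m")
            case True
            then have "X \<in> sg V W" using that by (auto simp: sg set_ys')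
            then show ?thesis using 1(3) True by (simp add: \<mu>_def)
          next
            case False
            then have "X - int m \<in> sg V W" using that by (auto simp: sg set_ys' set_ys set_xs)
            then show ?thesis using 2(3) False by (simp add: \<mu>_def)
          qed
          then have "rgt W \<mu> = rgt W (sh \<mu>)"
            using l sat_sg_cong[OF fvt fin l1 r1, of \<M>] sat_sg_cong[OF fvt fin l2 r2, of \<M>] 1 2 by blast
          then show "\<tau> = \<tau>'" using 1 2 r1 r2 by simp
        qed
      next
        assume r: ?r
        show ?l
        proof (intro allI impI)
          fix \<mu> assume \<mu>: "\<forall>X\<in>set (xs @ ys @ ys'). \<mu> X \<in> uni \<M>"
            and s: "sat \<M> \<mu> [] \<theta> \<and> sat \<M> (sh \<mu>) [] \<theta>"
          have "sh \<mu> k \<in> uni \<M>" if "k \<in> sg V W" for k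
          proof (cases "k > 0")
            case True
            then have "int m + k \<in> set ys'" using that by (auto simp: set_ys' sg_iff m_def)
            then show ?thesis using \<mu> True by (simp add: sh_def)
          qed (use that \<mu> in \<open>auto simp: sh_def sg\<close>)
          then have "(lft V (sh \<mu>), rgt W (sh \<mu>)) \<in> ?D \<M>" using s by (auto simp: den_def)
          moreover have "(lft V \<mu>, rgt W \<mu>) \<in> ?D \<M>" using s \<mu> by (auto simp: den_def sg)
          moreover have "lft V (sh \<mu>) = lft V \<mu>" by (auto simp: lft_eq_iff[OF fin(1)] sh_def)
          ultimately show "rgt W \<mu> = rgt W (sh \<mu>)" using r by (auto dest: single_valuedD)
        qed
      qed
      then show "(\<forall>\<mu>. (\<forall>X\<in>set (xs @ ys @ ys'). \<mu> X \<in> uni \<M>) \<longrightarrow>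
        sat \<M> \<mu> [] (imp (conj \<theta> (inst2 \<theta> xneg (\<lambda>j. xpos (m + j))))
               (conjs (map (\<lambda>j. eqv (xpos j) (xpos (m + j))) [1..<Suc m])))) = single_valued (?D \<M>)"
        by (simp only: sat_imp sat_conj eqs sh)
    qed
    finally show ?thesis .
  qed
  ultimately show ?thesis
    using True unfolding pre func_def eventually_conj_iff V_def W_def by simp
qed

lemma formal_exists_iff:
  assumes "is_theory L T" "\<alpha> \<in> Fml L" "s \<in> Fml L" "sentence s"
  shows "formal_exists L T \<alpha> s \<longleftrightarrow> (\<forall>\<^sub>F \<M> in Mods T. extension \<M> \<alpha> \<noteq> {} \<longrightarrow> holds \<M> s)"
proof -
  let ?xs = "map xneg [1..<Suc (nfv \<alpha>)]"
  have "formal_exists L T \<alpha> s \<longleftrightarrow> (\<forall>\<^sub>F \<M> in Mods T. \<forall>\<mu>. (\<forall>X\<in>set ?xs. \<mu> X \<in> uni \<M>) \<longrightarrow>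
    sat \<M> \<mu> [] (imp (inst \<alpha> xneg) s))"
    unfolding formal_exists_def
    by (rule proves_alls_iff) (use assms fv_inst_xneg'[of \<alpha>] in \<open>auto simp: sentence_def\<close>)
  also have "\<dots> \<longleftrightarrow> (\<forall>\<^sub>F \<M> in Mods T. extension \<M> \<alpha> \<noteq> {} \<longrightarrow> holds \<M> s)"
  proof (rule eventually_subst, rule always_eventually, rule allI)
    fix \<M> :: "('a, int) struct"
    have sx: "set ?xs = sg (fv \<alpha>) {}" by (auto simp: sg_def)
    show "(\<forall>\<mu>. (\<forall>X\<in>set ?xs. \<mu> X \<in> uni \<M>) \<longrightarrow> sat \<M> \<mu> [] (imp (inst \<alpha> xneg) s)) =
      (extension \<M> \<alpha> \<noteq> {} \<longrightarrow> holds \<M> s)" (is "?l = ?r")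
    proof
      assume l: ?l
      show ?r
      proof
        assume "extension \<M> \<alpha> \<noteq> {}"
        then obtain \<rho> where \<rho>: "\<rho> \<in> extension \<M> \<alpha>" by auto
        then obtain \<mu> where \<mu>: "lft (fv \<alpha>) \<mu> = \<rho>"
          using ex_lft_rgt[of "fv \<alpha>" "{}" \<rho> "uni \<M>"] by (auto simp: extension_iff)
        have "\<forall>k\<in>sg (fv \<alpha>) {}. \<mu> k \<in> uni \<M>"
          by (rule sg_mem) (use \<mu> \<rho> in \<open>auto simp: extension_iff rgt_def\<close>)
        then show "holds \<M> s"
          using l \<mu> \<rho> unfolding sx
          by (auto simp: sat_inst_xneg extension_iff sat_sentence[OF assms(4)])
      qed
    next
      assume r: ?r
      show ?l
      proof (intro allI impI)
        fix \<mu> assume "\<forall>X\<in>set ?xs. \<mu> X \<in> uni \<M>"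
        then have "lft (fv \<alpha>) \<mu> \<in> fv \<alpha> \<rightarrow>\<^sub>E uni \<M>"
          using lft_rgt_mem(1)[of "fv \<alpha>" "{}" \<mu> "uni \<M>"] unfolding sx by simp
        then have "lft (fv \<alpha>) \<mu> \<in> extension \<M> \<alpha>" if "sat \<M> \<mu> [] (inst \<alpha> xneg)"
          using that by (simp add: sat_inst_xneg extension_iff)
        then show "sat \<M> \<mu> [] (imp (inst \<alpha> xneg) s)"
          using r by (auto simp: sat_sentence[OF assms(4)])
      qed
    qed
  qed
  finally show ?thesis .
qed

text \<open>
  In an empty structure all denotations are empty since \<open>W\<close> is not, whereas \<open>\<theta>\<close> and \<open>\<theta>'\<close> may differ
  there at assignments with values outside the universe. This is what \<open>\<not> E\<close> is for.
\<close>

lemma prov_equiv_iff: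
  assumes T: "is_theory L T" and \<theta>: "\<theta> \<in> Fml L" "fv \<theta> \<subseteq> sg V W"
    and \<theta>': "\<theta>' \<in> Fml L" "fv \<theta>' \<subseteq> sg V W" and fin: "finite V" "finite W" and W: "W \<noteq> {}"
  shows "prov_equiv L (T \<union> {Neg E_fml}) \<theta> \<theta>' \<longleftrightarrow>
    (\<forall>\<^sub>F \<M> in Mods T. den V W \<theta> \<M> = den V W \<theta>' \<M>)"
proof -
  have T': "is_theory L (T \<union> {Neg E_fml})" using T by (auto simp: is_theory_def sentence_def)
  have "prov_equiv L (T \<union> {Neg E_fml}) \<theta> \<theta>' \<longleftrightarrow> (\<forall>\<^sub>F \<M> in Mods T. uni \<M> \<noteq> {} \<longrightarrow>
    (\<forall>\<rho>\<in>assignments \<M>. sat \<M> \<rho> [] \<theta> \<longleftrightarrow> sat \<M> \<rho> [] \<theta>'))"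
    unfolding prov_equiv_def prov_implies_iff[OF T' \<theta>(1) \<theta>'(1)] prov_implies_iff[OF T' \<theta>'(1) \<theta>(1)]
      Mods_nonempty eventually_conj_iff[symmetric]
    by (rule eventually_subst, rule always_eventually) blast
  also have "\<dots> \<longleftrightarrow> (\<forall>\<^sub>F \<M> in Mods T. den V W \<theta> \<M> = den V W \<theta>' \<M>)"
  proof (rule eventually_subst, rule always_eventually, rule allI)
    fix \<M> :: "('a, int) struct"
    show "(uni \<M> \<noteq> {} \<longrightarrow> (\<forall>\<rho>\<in>assignments \<M>. sat \<M> \<rho> [] \<theta> \<longleftrightarrow> sat \<M> \<rho> [] \<theta>')) =
      (den V W \<theta> \<M> = den V W \<theta>' \<M>)"
    proof (cases "uni \<M> = {}")
      case True
      have "1 \<le> card W" using W fin by (simp add: Suc_leI card_gt_0_iff)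
      then have "1 \<in> sg V W" by (simp add: sg_iff)
      then show ?thesis using True by (auto simp: den_def)
    next
      case False
      then obtain a where a: "a \<in> uni \<M>" by auto
      show ?thesis
      proof (intro iffI impI)
        assume eq: "uni \<M> \<noteq> {} \<longrightarrow> (\<forall>\<rho>\<in>assignments \<M>. sat \<M> \<rho> [] \<theta> \<longleftrightarrow> sat \<M> \<rho> [] \<theta>')"
        show "den V W \<theta> \<M> = den V W \<theta>' \<M>"
        proof (rule rel_eqI[OF fin den_sub[OF fin] den_sub[OF fin]])
          fix \<mu> assume m: "lft V \<mu> \<in> V \<rightarrow>\<^sub>E uni \<M>" "rgt W \<mu> \<in> W \<rightarrow>\<^sub>E uni \<M>"
          let ?\<mu> = "\<lambda>k. if k \<in> sg V W then \<mu> k else a"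
          have l: "lft V \<mu> = lft V ?\<mu>" and r: "rgt W \<mu> = rgt W ?\<mu>"
            using fin by (auto simp: lft_eq_iff rgt_eq_iff sg_iff)
          have "?\<mu> \<in> assignments \<M>" using sg_mem[OF fin m] a by (auto simp: assignments_def)
          then have "sat \<M> \<mu> [] \<theta> \<longleftrightarrow> sat \<M> \<mu> [] \<theta>'"
            using eq False sat_sg_cong[OF \<theta>(2) fin l r, of \<M>] sat_sg_cong[OF \<theta>'(2) fin l r, of \<M>]
            by blast
          then show "(lft V \<mu>, rgt W \<mu>) \<in> den V W \<theta> \<M> \<longleftrightarrow> (lft V \<mu>, rgt W \<mu>) \<in> den V W \<theta>' \<M>"
            using \<theta> \<theta>' fin by (simp add: den_iff)
        qed
      next
        assume eq: "den V W \<theta> \<M> = den V W \<theta>' \<M>"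
        show "\<forall>\<rho>\<in>assignments \<M>. sat \<M> \<rho> [] \<theta> \<longleftrightarrow> sat \<M> \<rho> [] \<theta>'"
        proof
          fix \<mu> assume "\<mu> \<in> assignments \<M>"
          then have "\<forall>k\<in>sg V W. \<mu> k \<in> uni \<M>" using False by (auto simp: assignments_def)
          from lft_rgt_mem[OF fin this] show "sat \<M> \<mu> [] \<theta> \<longleftrightarrow> sat \<M> \<mu> [] \<theta>'"
            using den_iff[OF \<theta>(2) fin, of \<mu> \<M>] den_iff[OF \<theta>'(2) fin, of \<mu> \<M>] eq by simp
        qed
      qed
    qed
  qed
  finally show ?thesis .
qed

section \<open>Definable relations\<close>

lemma func_comp: "func A B R \<Longrightarrow> func B C S \<Longrightarrow> func A C (R O S)"
  unfolding func_def by (intro conjI single_valued_relcomp) blast+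

lemma func_eqI:
  assumes "func A B R" "func A B S" "R \<subseteq> S"
  shows "R = S"
proof -
  have "p \<in> R" if p: "p \<in> S" for p
  proof -
    obtain a b where ab: "p = (a, b)" by (cases p)
    then have "a \<in> A" using p assms(2) unfolding func_def by blast
    then obtain b' where "(a, b') \<in> R" using assms(1) unfolding func_def by blast
    moreover from this have "(a, b') \<in> S" using assms(3) by blast
    ultimately show ?thesis
      using ab p assms(2) unfolding func_def single_valued_def by blast
  qed
  with assms(3) show ?thesis by blast
qed

lemma extension_sentence:
  "sentence s \<Longrightarrow> extension \<M> s = (if holds \<M> s then {\<lambda>_. undefined} else {})"
  using sat_sentence[of s \<M>] by (auto simp: extension_def sentence_def)

lemma extension_sub: "extension \<M> \<phi> \<subseteq> fv \<phi> \<rightarrow>\<^sub>E uni \<M>"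
  by (auto simp: extension_def)

lemma sat_inst2:
  "sat \<M> \<mu> [] (inst2 \<theta> A B) \<longleftrightarrow>
    sat \<M> (\<lambda>k. if k < 0 then \<mu> (A (nat (- k))) else if k > 0 then \<mu> (B (nat k)) else \<mu> k) [] \<theta>"
  unfolding inst2_def sat_subst by (rule sat_cong) simp

text \<open>
  The existentially quantified middle variables are assigned by the value of the first relation; being
  fresh, they do not disturb the source and target variables.
\<close>

lemma den_comp:
  assumes \<theta>1: "\<theta>\<^sub>1 \<in> Fml L" "fv \<theta>\<^sub>1 \<subseteq> sg V (fv \<beta>)"
    and \<theta>2: "\<theta>\<^sub>2 \<in> Fml L" "fv \<theta>\<^sub>2 \<subseteq> sg (fv \<beta>) (fv \<gamma>)" and V: "finite V"
  shows "comp_fml \<beta> \<gamma> \<theta>\<^sub>1 \<theta>\<^sub>2 \<in> Fml L"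
    and "fv (comp_fml \<beta> \<gamma> \<theta>\<^sub>1 \<theta>\<^sub>2) \<subseteq> sg V (fv \<gamma>)"
    and "den V (fv \<gamma>) (comp_fml \<beta> \<gamma> \<theta>\<^sub>1 \<theta>\<^sub>2) \<M> = den V (fv \<beta>) \<theta>\<^sub>1 \<M> O den (fv \<beta>) (fv \<gamma>) \<theta>\<^sub>2 \<M>"
proof -
  define W U m N where "W = fv \<beta>" and "U = fv \<gamma>" and "m = card W" and "N = max m (card U)"
  define t where "t j = xpos (N + j)" for j
  define ts where "ts = map t [1..<Suc m]"
  have fin: "finite W" "finite U" by (simp_all add: W_def U_def)
  have comp: "comp_fml \<beta> \<gamma> \<theta>\<^sub>1 \<theta>\<^sub>2 = exs ts (conj (inst2 \<theta>\<^sub>1 xneg t) (inst2 \<theta>\<^sub>2 t xpos))"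
    unfolding comp_fml_def Let_def ts_def m_def N_def W_def U_def t_def[abs_def] by simp
  have Fml: "conj (inst2 \<theta>\<^sub>1 xneg t) (inst2 \<theta>\<^sub>2 t xpos) \<in> Fml L" using \<theta>1 \<theta>2 by simp
  then show F: "comp_fml \<beta> \<gamma> \<theta>\<^sub>1 \<theta>\<^sub>2 \<in> Fml L" by (simp add: comp)
  have ts: "k \<in> set ts \<longleftrightarrow> int N < k \<and> k \<le> int N + int m" for k
  proof
    assume "int N < k \<and> k \<le> int N + int m"
    then have "k = t (nat (k - int N))" "nat (k - int N) \<in> set [1..<Suc m]"
      by (auto simp: t_def xpos_def)
    then show "k \<in> set ts" unfolding ts_def set_map by blast
  qed (auto simp: ts_def t_def xpos_def)
  show fv: "fv (comp_fml \<beta> \<gamma> \<theta>\<^sub>1 \<theta>\<^sub>2) \<subseteq> sg V (fv \<gamma>)"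
  proof
    fix k assume "k \<in> fv (comp_fml \<beta> \<gamma> \<theta>\<^sub>1 \<theta>\<^sub>2)"
    then have k: "k \<notin> set ts" "k \<in> fv (inst2 \<theta>\<^sub>1 xneg t) \<or> k \<in> fv (inst2 \<theta>\<^sub>2 t xpos)"
      by (auto simp: comp)
    from k(2) show "k \<in> sg V (fv \<gamma>)"
    proof
      assume "k \<in> fv (inst2 \<theta>\<^sub>1 xneg t)"
      then obtain k' where k': "k' \<in> sg V W"
        "k = (if k' < 0 then xneg (nat (- k')) else if k' > 0 then t (nat k') else k')"
        using \<theta>1 by (auto simp: inst2_def fv_subst W_def)
      show ?thesis
      proof (cases "k' < 0")
        case True
        then show ?thesis using k' by (simp add: xneg_def sg_iff)
      next
        case False
        then have "k \<in> set ts" using k' by (simp add: ts sg_iff t_def xpos_def m_def)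
        with k(1) show ?thesis by blast
      qed
    next
      assume "k \<in> fv (inst2 \<theta>\<^sub>2 t xpos)"
      then obtain k' where k': "k' \<in> sg W U"
        "k = (if k' < 0 then t (nat (- k')) else if k' > 0 then xpos (nat k') else k')"
        using \<theta>2 by (auto simp: inst2_def fv_subst W_def U_def)
      show ?thesis
      proof (cases "k' < 0")
        case True
        then have "k \<in> set ts" using k' by (simp add: ts sg_iff t_def xpos_def m_def)
        with k(1) show ?thesis by blast
      next
        case False
        then show ?thesis using k' by (simp add: xpos_def sg_iff U_def)
      qed
    qed
  qed
  show "den V (fv \<gamma>) (comp_fml \<beta> \<gamma> \<theta>\<^sub>1 \<theta>\<^sub>2) \<M> = den V (fv \<beta>) \<theta>\<^sub>1 \<M> O den (fv \<beta>) (fv \<gamma>) \<theta>\<^sub>2 \<M>"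
    unfolding W_def[symmetric] U_def[symmetric]
  proof (rule rel_eqI[OF V fin(2) den_sub[OF V fin(2)]])
    show "den V W \<theta>\<^sub>1 \<M> O den W U \<theta>\<^sub>2 \<M> \<subseteq> (V \<rightarrow>\<^sub>E uni \<M>) \<times> (U \<rightarrow>\<^sub>E uni \<M>)"
      using den_sub[OF V fin(1), of \<theta>\<^sub>1 \<M>] den_sub[OF fin, of \<theta>\<^sub>2 \<M>] by blast
    fix \<mu> assume \<mu>: "lft V \<mu> \<in> V \<rightarrow>\<^sub>E uni \<M>" "rgt U \<mu> \<in> U \<rightarrow>\<^sub>E uni \<M>"
    define a b where "a \<tau> k = (if k > 0 then \<tau> (int N + k) else override_on \<mu> \<tau> (set ts) k)"
      and "b \<tau> k = (if k < 0 then \<tau> (int N - k) else override_on \<mu> \<tau> (set ts) k)" for \<tau> :: "int \<Rightarrow> 'b" and k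
    have sa: "sat \<M> (override_on \<mu> \<tau> (set ts)) [] (inst2 \<theta>\<^sub>1 xneg t) \<longleftrightarrow> sat \<M> (a \<tau>) [] \<theta>\<^sub>1" for \<tau>
      unfolding sat_inst2
    proof (rule sat_cong)
      fix k assume "k \<in> fv \<theta>\<^sub>1"
      then have k: "k \<in> sg V W" using \<theta>1 by (auto simp: W_def)
      then have "k > 0 \<Longrightarrow> t (nat k) \<in> set ts \<and> t (nat k) = int N + k"
        by (simp add: ts t_def xpos_def sg_iff m_def)
      then show "(if k < 0 then override_on \<mu> \<tau> (set ts) (xneg (nat (- k)))
          else if 0 < k then override_on \<mu> \<tau> (set ts) (t (nat k))
          else override_on \<mu> \<tau> (set ts) k) = a \<tau> k"
        using k by (auto simp: a_def xneg_def sg_iff)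
    qed
    have sb: "sat \<M> (override_on \<mu> \<tau> (set ts)) [] (inst2 \<theta>\<^sub>2 t xpos) \<longleftrightarrow> sat \<M> (b \<tau>) [] \<theta>\<^sub>2" for \<tau>
      unfolding sat_inst2
    proof (rule sat_cong)
      fix k assume "k \<in> fv \<theta>\<^sub>2"
      then have k: "k \<in> sg W U" using \<theta>2 by (auto simp: W_def U_def)
      then have "k < 0 \<Longrightarrow> t (nat (- k)) \<in> set ts \<and> t (nat (- k)) = int N - k"
        by (simp add: ts t_def xpos_def sg_iff m_def)
      then show "(if k < 0 then override_on \<mu> \<tau> (set ts) (t (nat (- k)))
          else if 0 < k then override_on \<mu> \<tau> (set ts) (xpos (nat k))
          else override_on \<mu> \<tau> (set ts) k) = b \<tau> k"
        using k by (auto simp: b_def xpos_def sg_iff)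
    qed
    have la: "lft V (a \<tau>) = lft V \<mu>" for \<tau>
      by (auto simp: lft_eq_iff[OF V] a_def override_on_def ts)
    have rb: "rgt U (b \<tau>) = rgt U \<mu>" for \<tau>
      by (auto simp: rgt_eq_iff[OF fin(2)] b_def override_on_def ts N_def)
    have ra: "rgt W (a \<tau>) = rgt W (\<lambda>k. \<tau> (int N + k))" for \<tau>
      by (auto simp: rgt_eq_iff[OF fin(1)] a_def)
    have lb: "lft W (b \<tau>) = rgt W (\<lambda>k. \<tau> (int N + k))" for \<tau>
      unfolding lft_def rgt_def
    proof (rule restrict_ext)
      fix X assume "X \<in> W"
      then show "b \<tau> (xneg (pos W X)) = \<tau> (int N + xpos (pos W X))"
        using pos_range[OF fin(1), of X] by (simp add: b_def xneg_def xpos_def)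
    qed
    have "(lft V \<mu>, rgt U \<mu>) \<in> den V U (comp_fml \<beta> \<gamma> \<theta>\<^sub>1 \<theta>\<^sub>2) \<M> \<longleftrightarrow>
      (\<exists>\<tau>. (\<forall>X\<in>set ts. \<tau> X \<in> uni \<M>) \<and> sat \<M> (a \<tau>) [] \<theta>\<^sub>1 \<and> sat \<M> (b \<tau>) [] \<theta>\<^sub>2)"
      using \<mu> fv unfolding U_def[symmetric]
      by (simp add: den_iff V fin) (simp add: comp sat_exs[OF Fml] sa sb)
    also have "\<dots> \<longleftrightarrow> (lft V \<mu>, rgt U \<mu>) \<in> den V W \<theta>\<^sub>1 \<M> O den W U \<theta>\<^sub>2 \<M>"
    proof
      assume "\<exists>\<tau>. (\<forall>X\<in>set ts. \<tau> X \<in> uni \<M>) \<and> sat \<M> (a \<tau>) [] \<theta>\<^sub>1 \<and> sat \<M> (b \<tau>) [] \<theta>\<^sub>2"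
      then obtain \<tau> where \<tau>: "\<forall>X\<in>set ts. \<tau> X \<in> uni \<M>" "sat \<M> (a \<tau>) [] \<theta>\<^sub>1" "sat \<M> (b \<tau>) [] \<theta>\<^sub>2"
        by blast
      have mid: "rgt W (a \<tau>) \<in> W \<rightarrow>\<^sub>E uni \<M>"
        unfolding ra
      proof (rule lft_rgt_mem(2)[of "{}"])
        show "\<forall>k\<in>sg {} W. \<tau> (int N + k) \<in> uni \<M>" using \<tau>(1) by (auto simp: sg_iff ts m_def)
      qed (use fin in auto)
      have "(lft V (a \<tau>), rgt W (a \<tau>)) \<in> den V W \<theta>\<^sub>1 \<M>"
        using den_iff[OF \<theta>1(2)[folded W_def] V fin(1), of "a \<tau>" \<M>] mid \<mu> \<tau> la by simp
      moreover have "(lft W (b \<tau>), rgt U (b \<tau>)) \<in> den W U \<theta>\<^sub>2 \<M>"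
        using den_iff[OF \<theta>2(2)[folded W_def U_def] fin, of "b \<tau>" \<M>] mid \<mu> \<tau> rb lb ra by simp
      ultimately show "(lft V \<mu>, rgt U \<mu>) \<in> den V W \<theta>\<^sub>1 \<M> O den W U \<theta>\<^sub>2 \<M>"
        unfolding la rb lb ra by (rule relcompI)
    next
      assume "(lft V \<mu>, rgt U \<mu>) \<in> den V W \<theta>\<^sub>1 \<M> O den W U \<theta>\<^sub>2 \<M>"
      then obtain \<sigma> where \<sigma>: "(lft V \<mu>, \<sigma>) \<in> den V W \<theta>\<^sub>1 \<M>" "(\<sigma>, rgt U \<mu>) \<in> den W U \<theta>\<^sub>2 \<M>" by blast
      then have \<sigma>W: "\<sigma> \<in> W \<rightarrow>\<^sub>E uni \<M>" using den_sub[OF V fin(1), of \<theta>\<^sub>1 \<M>] by blast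
      then obtain \<nu> where \<nu>: "rgt W \<nu> = \<sigma>"
        using ex_lft_rgt[of "{}" W "\<lambda>_. undefined" "uni \<M>" \<sigma>] fin by auto
      define \<tau> where "\<tau> k = \<nu> (k - int N)" for k
      have "rgt W (\<lambda>k. \<tau> (int N + k)) = \<sigma>" using \<nu> by (simp add: \<tau>_def)
      then have "sat \<M> (a \<tau>) [] \<theta>\<^sub>1" "sat \<M> (b \<tau>) [] \<theta>\<^sub>2"
        using \<sigma> den_iff[OF \<theta>1(2)[folded W_def] V fin(1), of "a \<tau>" \<M>]
          den_iff[OF \<theta>2(2)[folded W_def U_def] fin, of "b \<tau>" \<M>] la[of \<tau>] ra[of \<tau>] lb[of \<tau>] rb[of \<tau>]
        by simp_all
      moreover have "\<forall>k\<in>sg {} W. \<nu> k \<in> uni \<M>"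
        by (rule sg_mem) (use fin \<nu> \<sigma>W in simp_all)
      then have "\<forall>X\<in>set ts. \<tau> X \<in> uni \<M>" by (simp add: \<tau>_def ts sg_iff m_def)
      ultimately show "\<exists>\<tau>. (\<forall>X\<in>set ts. \<tau> X \<in> uni \<M>) \<and> sat \<M> (a \<tau>) [] \<theta>\<^sub>1 \<and> sat \<M> (b \<tau>) [] \<theta>\<^sub>2"
        by blast
    qed
    finally show "(lft V \<mu>, rgt U \<mu>) \<in> den V U (comp_fml \<beta> \<gamma> \<theta>\<^sub>1 \<theta>\<^sub>2) \<M> \<longleftrightarrow>
      (lft V \<mu>, rgt U \<mu>) \<in> den V W \<theta>\<^sub>1 \<M> O den W U \<theta>\<^sub>2 \<M>" .
  qed
qed

definition definable ::
  "'r signature \<Rightarrow> int set \<Rightarrow> int set \<Rightarrow> (('r, int) struct \<Rightarrow> ((int \<Rightarrow> int) \<times> (int \<Rightarrow> int)) set) \<Rightarrow> bool" where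
  "definable L V W R \<longleftrightarrow> finite V \<and> finite W \<and> (\<exists>\<theta>\<in>Fml L. fv \<theta> \<subseteq> sg V W \<and> (\<forall>\<M>. R \<M> = den V W \<theta> \<M>))"

text \<open>
  A formula defines \<open>R\<close> as soon as it does so on the pairs \<open>(lft V \<mu>, rgt W \<mu>)\<close>, where satisfaction is
  evaluated directly and no renaming occurs.
\<close>

lemma definableI:
  assumes "finite V" "finite W" "\<theta> \<in> Fml L" "fv \<theta> \<subseteq> sg V W"
    and "\<And>\<M>. R \<M> \<subseteq> (V \<rightarrow>\<^sub>E uni \<M>) \<times> (W \<rightarrow>\<^sub>E uni \<M>)"
    and "\<And>\<M> \<mu>. lft V \<mu> \<in> V \<rightarrow>\<^sub>E uni \<M> \<Longrightarrow> rgt W \<mu> \<in> W \<rightarrow>\<^sub>E uni \<M> \<Longrightarrow>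
      (lft V \<mu>, rgt W \<mu>) \<in> R \<M> \<longleftrightarrow> sat \<M> \<mu> [] \<theta>"
  shows "definable L V W R"
proof -
  have "R \<M> = den V W \<theta> \<M>" for \<M>
  proof (rule rel_eqI[OF assms(1,2) assms(5) den_sub[OF assms(1,2)]])
    fix \<mu> assume "lft V \<mu> \<in> V \<rightarrow>\<^sub>E uni \<M>" "rgt W \<mu> \<in> W \<rightarrow>\<^sub>E uni \<M>"
    then show "(lft V \<mu>, rgt W \<mu>) \<in> R \<M> \<longleftrightarrow> (lft V \<mu>, rgt W \<mu>) \<in> den V W \<theta> \<M>"
      using assms(6) den_iff[OF assms(4,1,2), of \<mu> \<M>] by simp
  qed
  then show ?thesis unfolding definable_def using assms by blast
qed

lemma definableE:
  assumes "definable L V W R"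
  obtains \<theta> where "finite V" "finite W" "\<theta> \<in> Fml L" "fv \<theta> \<subseteq> sg V W"
    "\<And>\<M>. R \<M> = den V W \<theta> \<M>"
    "\<And>\<M>. R \<M> \<subseteq> (V \<rightarrow>\<^sub>E uni \<M>) \<times> (W \<rightarrow>\<^sub>E uni \<M>)"
    "\<And>\<M> \<mu>. (lft V \<mu>, rgt W \<mu>) \<in> R \<M> \<longleftrightarrow>
      lft V \<mu> \<in> V \<rightarrow>\<^sub>E uni \<M> \<and> rgt W \<mu> \<in> W \<rightarrow>\<^sub>E uni \<M> \<and> sat \<M> \<mu> [] \<theta>"
proof -
  from assms obtain \<theta> where \<theta>: "finite V" "finite W" "\<theta> \<in> Fml L" "fv \<theta> \<subseteq> sg V W"
    "\<And>\<M>. R \<M> = den V W \<theta> \<M>" unfolding definable_def by blast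
  show ?thesis
    by (rule that[OF \<theta>]) (simp_all only: \<theta>(5) den_sub[OF \<theta>(1,2)] den_iff[OF \<theta>(4,1,2)])
qed

lemma definable_inter:
  assumes "definable L V W R" "definable L V W S"
  shows "definable L V W (\<lambda>\<M>. R \<M> \<inter> S \<M>)"
proof -
  from assms(1) obtain \<theta> where \<theta>: "finite V" "finite W" "\<theta> \<in> Fml L" "fv \<theta> \<subseteq> sg V W"
    "\<And>\<M>. R \<M> \<subseteq> (V \<rightarrow>\<^sub>E uni \<M>) \<times> (W \<rightarrow>\<^sub>E uni \<M>)"
    "\<And>\<M> \<mu>. (lft V \<mu>, rgt W \<mu>) \<in> R \<M> \<longleftrightarrow>
      lft V \<mu> \<in> V \<rightarrow>\<^sub>E uni \<M> \<and> rgt W \<mu> \<in> W \<rightarrow>\<^sub>E uni \<M> \<and> sat \<M> \<mu> [] \<theta>"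
    by (elim definableE) blast
  from assms(2) obtain \<eta> where \<eta>: "\<eta> \<in> Fml L" "fv \<eta> \<subseteq> sg V W"
    "\<And>\<M> \<mu>. (lft V \<mu>, rgt W \<mu>) \<in> S \<M> \<longleftrightarrow>
      lft V \<mu> \<in> V \<rightarrow>\<^sub>E uni \<M> \<and> rgt W \<mu> \<in> W \<rightarrow>\<^sub>E uni \<M> \<and> sat \<M> \<mu> [] \<eta>"
    by (elim definableE) blast
  show ?thesis
    by (rule definableI[of _ _ "conj \<theta> \<eta>"]) (use \<theta> \<eta> in \<open>simp_all add: le_infI1\<close>)
qed

lemma definable_union:
  assumes "definable L V W R" "definable L V W S"
  shows "definable L V W (\<lambda>\<M>. R \<M> \<union> S \<M>)"
proof -
  from assms(1) obtain \<theta> where \<theta>: "finite V" "finite W" "\<theta> \<in> Fml L" "fv \<theta> \<subseteq> sg V W"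
    "\<And>\<M>. R \<M> \<subseteq> (V \<rightarrow>\<^sub>E uni \<M>) \<times> (W \<rightarrow>\<^sub>E uni \<M>)"
    "\<And>\<M> \<mu>. (lft V \<mu>, rgt W \<mu>) \<in> R \<M> \<longleftrightarrow>
      lft V \<mu> \<in> V \<rightarrow>\<^sub>E uni \<M> \<and> rgt W \<mu> \<in> W \<rightarrow>\<^sub>E uni \<M> \<and> sat \<M> \<mu> [] \<theta>"
    by (elim definableE) blast
  from assms(2) obtain \<eta> where \<eta>: "\<eta> \<in> Fml L" "fv \<eta> \<subseteq> sg V W"
    "\<And>\<M>. S \<M> \<subseteq> (V \<rightarrow>\<^sub>E uni \<M>) \<times> (W \<rightarrow>\<^sub>E uni \<M>)"
    "\<And>\<M> \<mu>. (lft V \<mu>, rgt W \<mu>) \<in> S \<M> \<longleftrightarrow>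
      lft V \<mu> \<in> V \<rightarrow>\<^sub>E uni \<M> \<and> rgt W \<mu> \<in> W \<rightarrow>\<^sub>E uni \<M> \<and> sat \<M> \<mu> [] \<eta>"
    by (elim definableE) blast
  show ?thesis
    by (rule definableI[of _ _ "Or \<theta> \<eta>"]) (use \<theta> \<eta> in simp_all)
qed

lemma definable_empty: "finite V \<Longrightarrow> finite W \<Longrightarrow> definable L V W (\<lambda>\<M>. {})"
  by (rule definableI[of _ _ "Neg S_fml"]) simp_all

lemma definable_UN:
  assumes "finite A" "finite V" "finite W" "\<And>a. a \<in> A \<Longrightarrow> definable L V W (R a)"
  shows "definable L V W (\<lambda>\<M>. \<Union>a\<in>A. R a \<M>)"
  using assms(1,4)
proof (induction A)
  case empty
  then show ?case using definable_empty[OF assms(2,3)] by simp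
next
  case (insert a A)
  have "definable L V W (\<lambda>\<M>. R a \<M> \<union> (\<Union>a\<in>A. R a \<M>))"
    by (rule definable_union) (use insert in auto)
  then show ?case by simp
qed

lemma definable_INT:
  assumes "finite A" "definable L V W S" "\<And>a. a \<in> A \<Longrightarrow> definable L V W (R a)"
  shows "definable L V W (\<lambda>\<M>. S \<M> \<inter> (\<Inter>a\<in>A. R a \<M>))"
  using assms(1,3)
proof (induction A)
  case empty
  then show ?case using assms(2) by simp
next
  case (insert a A)
  have "definable L V W (\<lambda>\<M>. R a \<M> \<inter> (S \<M> \<inter> (\<Inter>a\<in>A. R a \<M>)))"
    by (rule definable_inter) (use insert in auto)
  moreover have "R a \<M> \<inter> (S \<M> \<inter> (\<Inter>a\<in>A. R a \<M>)) = S \<M> \<inter> (\<Inter>a\<in>insert a A. R a \<M>)" for \<M>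
    by blast
  ultimately show ?case by (simp only:)
qed

lemma definable_converse:
  assumes "definable L V W R"
  shows "definable L W V (\<lambda>\<M>. (R \<M>)\<inverse>)"
proof -
  from assms obtain \<theta> where \<theta>: "finite V" "finite W" "\<theta> \<in> Fml L" "fv \<theta> \<subseteq> sg V W"
    "\<And>\<M>. R \<M> \<subseteq> (V \<rightarrow>\<^sub>E uni \<M>) \<times> (W \<rightarrow>\<^sub>E uni \<M>)"
    "\<And>\<M> \<mu>. (lft V \<mu>, rgt W \<mu>) \<in> R \<M> \<longleftrightarrow>
      lft V \<mu> \<in> V \<rightarrow>\<^sub>E uni \<M> \<and> rgt W \<mu> \<in> W \<rightarrow>\<^sub>E uni \<M> \<and> sat \<M> \<mu> [] \<theta>"
    by (elim definableE) blast
  have flip: "lft Z (\<lambda>k. \<mu> (- k)) = rgt Z \<mu>" "rgt Z (\<lambda>k. \<mu> (- k)) = lft Z \<mu>" for Z and \<mu> :: "int \<Rightarrow> int"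
    by (simp_all add: lft_def rgt_def xneg_def xpos_def)
  show ?thesis
  proof (rule definableI[of _ _ "subst uminus \<theta>"])
    show "fv (subst uminus \<theta>) \<subseteq> sg W V"
    proof
      fix k assume "k \<in> fv (subst uminus \<theta>)"
      then have "- k \<in> sg V W" using \<theta>(4) by (auto simp: fv_subst)
      then show "k \<in> sg W V" by (auto simp: sg_iff)
    qed
    show "(R \<M>)\<inverse> \<subseteq> (W \<rightarrow>\<^sub>E uni \<M>) \<times> (V \<rightarrow>\<^sub>E uni \<M>)"
      for \<M> :: "('a, int) struct" using \<theta>(5) by blast
    fix \<M> :: "('a, int) struct" and \<mu> assume "lft W \<mu> \<in> W \<rightarrow>\<^sub>E uni \<M>" "rgt V \<mu> \<in> V \<rightarrow>\<^sub>E uni \<M>"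
    then show "((lft W \<mu>, rgt V \<mu>) \<in> (R \<M>)\<inverse>) = sat \<M> \<mu> [] (subst uminus \<theta>)"
      using \<theta>(6)[of "\<lambda>k. \<mu> (- k)" \<M>] by (simp add: flip sat_subst comp_def)
  qed (use \<theta> in simp_all)
qed

lemma definable_relcomp:
  assumes "definable L V W R" "definable L W U S"
  shows "definable L V U (\<lambda>\<M>. R \<M> O S \<M>)"
proof -
  from assms(1) obtain \<theta> where \<theta>: "finite V" "finite W" "\<theta> \<in> Fml L" "fv \<theta> \<subseteq> sg V W"
    "\<And>\<M>. R \<M> = den V W \<theta> \<M>" by (elim definableE) blast
  from assms(2) obtain \<eta> where \<eta>: "finite U" "\<eta> \<in> Fml L" "fv \<eta> \<subseteq> sg W U"
    "\<And>\<M>. S \<M> = den W U \<eta> \<M>" by (elim definableE) blast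
  have "fv (EV W :: 'a fml) = W" "fv (EV U :: 'a fml) = U" using \<theta> \<eta> by simp_all
  with den_comp[of \<theta> L V "EV W" \<eta> "EV U"] \<theta> \<eta> show ?thesis
    unfolding definable_def by (simp only: finite_fv) blast
qed

lemma reindex_PiE:
  assumes "\<rho> \<in> V \<rightarrow>\<^sub>E U" "\<sigma> ` W \<subseteq> V"
  shows "(\<lambda>w\<in>W. \<rho> (\<sigma> w)) \<in> W \<rightarrow>\<^sub>E U"
proof (rule PiE_I)
  fix w assume "w \<in> W"
  then show "(\<lambda>w\<in>W. \<rho> (\<sigma> w)) w \<in> U" using PiE_mem[OF assms(1), of "\<sigma> w"] assms(2) by auto
qed simp

text \<open>The graph of the change of variables \<open>\<rho> \<mapsto> \<rho> \<circ> \<sigma>\<close>.\<close>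

lemma definable_reindex:
  assumes "finite V" "finite W" "\<sigma> ` W \<subseteq> V"
  shows "definable L V W (\<lambda>\<M>. {(\<rho>, \<lambda>w\<in>W. \<rho> (\<sigma> w)) |\<rho>. \<rho> \<in> V \<rightarrow>\<^sub>E uni \<M>})"
proof -
  let ?\<theta> = "conjs (map (\<lambda>w. eqv (xpos (pos W w)) (xneg (pos V (\<sigma> w)))) (sorted_list_of_set W))"
  show ?thesis
  proof (rule definableI[of _ _ ?\<theta>])
    show "fv ?\<theta> \<subseteq> sg V W"
      using pos_sg[OF assms(1), of _ W] pos_sg[OF assms(2), of _ V] assms by auto
    show "{(\<rho>, \<lambda>w\<in>W. \<rho> (\<sigma> w)) |\<rho>. \<rho> \<in> V \<rightarrow>\<^sub>E uni \<M>} \<subseteq> (V \<rightarrow>\<^sub>E uni \<M>) \<times> (W \<rightarrow>\<^sub>E uni \<M>)"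
      for \<M> :: "('a, int) struct" using reindex_PiE[OF _ assms(3)] by blast
    fix \<M> :: "('a, int) struct" and \<mu> assume \<mu>: "lft V \<mu> \<in> V \<rightarrow>\<^sub>E uni \<M>"
    have "(lft V \<mu>, rgt W \<mu>) \<in> {(\<rho>, \<lambda>w\<in>W. \<rho> (\<sigma> w)) |\<rho>. \<rho> \<in> V \<rightarrow>\<^sub>E uni \<M>} \<longleftrightarrow>
      rgt W \<mu> = (\<lambda>w\<in>W. lft V \<mu> (\<sigma> w))" using \<mu> by blast
    also have "\<dots> \<longleftrightarrow> (\<forall>w\<in>W. \<mu> (xpos (pos W w)) = \<mu> (xneg (pos V (\<sigma> w))))"
    proof
      assume eq: "rgt W \<mu> = (\<lambda>w\<in>W. lft V \<mu> (\<sigma> w))"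
      show "\<forall>w\<in>W. \<mu> (xpos (pos W w)) = \<mu> (xneg (pos V (\<sigma> w)))"
      proof
        fix w assume "w \<in> W"
        then show "\<mu> (xpos (pos W w)) = \<mu> (xneg (pos V (\<sigma> w)))"
          using fun_cong[OF eq, of w] assms(3) by (auto simp: lft_def rgt_def)
      qed
    next
      assume "\<forall>w\<in>W. \<mu> (xpos (pos W w)) = \<mu> (xneg (pos V (\<sigma> w)))"
      then show "rgt W \<mu> = (\<lambda>w\<in>W. lft V \<mu> (\<sigma> w))"
        unfolding rgt_def using assms(3) by (intro restrict_ext) (auto simp: lft_def)
    qed
    also have "\<dots> \<longleftrightarrow> sat \<M> \<mu> [] ?\<theta>" using assms(2) by simp
    finally show "(lft V \<mu>, rgt W \<mu>) \<in> {(\<rho>, \<lambda>w\<in>W. \<rho> (\<sigma> w)) |\<rho>. \<rho> \<in> V \<rightarrow>\<^sub>E uni \<M>} \<longleftrightarrow>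
      sat \<M> \<mu> [] ?\<theta>" .
  qed (use assms in auto)
qed

lemma definable_source:
  assumes "\<alpha> \<in> Fml L" "finite W"
  shows "definable L (fv \<alpha>) W (\<lambda>\<M>. extension \<M> \<alpha> \<times> (W \<rightarrow>\<^sub>E uni \<M>))"
  by (rule definableI[of _ _ "inst \<alpha> xneg"])
    (use assms fv_inst_xneg extension_sub[of _ \<alpha>] in \<open>auto simp: sat_inst_xneg extension_iff\<close>)

definition graph :: "'r fml \<Rightarrow> 'r fml \<Rightarrow> (int \<Rightarrow> int) \<Rightarrow> ('r, 'u) struct \<Rightarrow> ((int \<Rightarrow> 'u) \<times> (int \<Rightarrow> 'u)) set" where
  "graph \<alpha> \<beta> \<sigma> \<M> = {(\<rho>, \<lambda>w\<in>fv \<beta>. \<rho> (\<sigma> w)) |\<rho>. \<rho> \<in> extension \<M> \<alpha>}"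

lemma definable_graph:
  assumes "\<alpha> \<in> Fml L" "\<sigma> ` fv \<beta> \<subseteq> fv \<alpha>"
  shows "definable L (fv \<alpha>) (fv \<beta>) (graph \<alpha> \<beta> \<sigma>)"
proof -
  let ?R = "\<lambda>\<M>. {(\<rho>, \<lambda>w\<in>fv \<beta>. \<rho> (\<sigma> w)) |\<rho>. \<rho> \<in> fv \<alpha> \<rightarrow>\<^sub>E uni \<M>}"
  have "graph \<alpha> \<beta> \<sigma> \<M> = ?R \<M> \<inter> (extension \<M> \<alpha> \<times> (fv \<beta> \<rightarrow>\<^sub>E uni \<M>))" for \<M> :: "('a, int) struct"
    using reindex_PiE[OF _ assms(2), of _ "uni \<M>"] by (fastforce simp: graph_def extension_iff)
  then have "graph \<alpha> \<beta> \<sigma> = (\<lambda>\<M> :: ('a, int) struct. ?R \<M> \<inter> (extension \<M> \<alpha> \<times> (fv \<beta> \<rightarrow>\<^sub>E uni \<M>)))" by (rule ext)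
  then show ?thesis
    using definable_inter[OF definable_reindex[OF finite_fv finite_fv assms(2), of L] definable_source[OF assms(1) finite_fv[of \<beta>]]]
    by (simp only:)
qed

section \<open>The syntactic category in terms of definable functions\<close>

text \<open>
  A sentence has at most the one assignment with empty domain, so a formal arrow denotes the constant
  function; the denotation of a class is that of one representative, defined up to almost everywhere
  equality.
\<close>

fun Den :: "'r syn_arrow \<Rightarrow> ('r, int) struct \<Rightarrow> ((int \<Rightarrow> int) \<times> (int \<Rightarrow> int)) set" where
  "Den (Formal \<alpha> s) \<M> = extension \<M> \<alpha> \<times> {\<lambda>_. undefined}"
| "Den (Cls \<alpha> A \<beta>) \<M> = den (fv \<alpha>) (fv \<beta>) (SOME \<theta>. \<theta> \<in> A) \<M>"

lemma hom_Syn: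
  "f \<in> hom (Syn L T) \<alpha> \<beta> \<longleftrightarrow> \<alpha> \<in> Fml L \<and> \<beta> \<in> Fml L \<and>
    (if sentence \<beta> then f = Formal \<alpha> \<beta> \<and> formal_exists L T \<alpha> \<beta>
     else (\<exists>\<theta>. premorphism L T \<alpha> \<beta> \<theta> \<and> f = mor L T \<alpha> \<beta> \<theta>))"
  unfolding hom_def Syn_def mor_def by (cases f) auto

lemma graph_iff:
  "(\<rho>, \<tau>) \<in> graph \<alpha> \<beta> \<sigma> \<M> \<longleftrightarrow> \<rho> \<in> extension \<M> \<alpha> \<and> \<tau> = (\<lambda>w\<in>fv \<beta>. \<rho> (\<sigma> w))"
  unfolding graph_def by blast

lemma UN_image_pairs: "(\<Union>z\<in>(\<lambda>(x, y). h x y) ` (A \<times> B). P z) = (\<Union>x\<in>A. \<Union>y\<in>B. P (h x y))"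
  by force

locale syntactic =
  fixes L :: "'r signature" and T :: "'r fml set"
  assumes T: "is_theory L T"
begin

abbreviation "C \<equiv> Syn L T"
abbreviation "ev P \<equiv> eventually P (Mods T)"

definition Func :: "'r fml \<Rightarrow> 'r fml \<Rightarrow> (('r, int) struct \<Rightarrow> ((int \<Rightarrow> int) \<times> (int \<Rightarrow> int)) set) \<Rightarrow> bool" where
  "Func \<alpha> \<beta> R \<longleftrightarrow> ev (\<lambda>\<M>. func (extension \<M> \<alpha>) (extension \<M> \<beta>) (R \<M>))"

lemma premorphism_Func:
  "\<alpha> \<in> Fml L \<Longrightarrow> \<beta> \<in> Fml L \<Longrightarrow> premorphism L T \<alpha> \<beta> \<theta> \<longleftrightarrow>
    \<theta> \<in> Fml L \<and> fv \<theta> \<subseteq> sg (fv \<alpha>) (fv \<beta>) \<and> Func \<alpha> \<beta> (den (fv \<alpha>) (fv \<beta>) \<theta>)"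
  unfolding Func_def by (rule premorphism_iff[OF T])

lemma premor_class_iff:
  assumes "\<alpha> \<in> Fml L" "\<beta> \<in> Fml L" "\<not> sentence \<beta>" "premorphism L T \<alpha> \<beta> \<theta>"
  shows "\<theta>' \<in> premor_class L T \<alpha> \<beta> \<theta> \<longleftrightarrow> premorphism L T \<alpha> \<beta> \<theta>' \<and>
    ev (\<lambda>\<M>. den (fv \<alpha>) (fv \<beta>) \<theta> \<M> = den (fv \<alpha>) (fv \<beta>) \<theta>' \<M>)"
proof (cases "premorphism L T \<alpha> \<beta> \<theta>'")
  case True
  have "prov_equiv L (T \<union> {Neg E_fml}) \<theta> \<theta>' \<longleftrightarrow>
      ev (\<lambda>\<M>. den (fv \<alpha>) (fv \<beta>) \<theta> \<M> = den (fv \<alpha>) (fv \<beta>) \<theta>' \<M>)"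
    by (rule prov_equiv_iff[OF T])
      (use True assms premorphism_Func[OF assms(1,2)] in \<open>simp_all add: sentence_def\<close>)
  then show ?thesis using True by (simp add: premor_class_def)
qed (simp add: premor_class_def)

lemma class_eq:
  assumes "\<alpha> \<in> Fml L" "\<beta> \<in> Fml L" "\<not> sentence \<beta>" "premorphism L T \<alpha> \<beta> \<theta>" "premorphism L T \<alpha> \<beta> \<theta>'"
    and "ev (\<lambda>\<M>. den (fv \<alpha>) (fv \<beta>) \<theta> \<M> = den (fv \<alpha>) (fv \<beta>) \<theta>' \<M>)"
  shows "premor_class L T \<alpha> \<beta> \<theta> = premor_class L T \<alpha> \<beta> \<theta>'"
proof (rule Set.set_eqI)
  fix \<eta>
  have "ev (\<lambda>\<M>. den (fv \<alpha>) (fv \<beta>) \<theta> \<M> = den (fv \<alpha>) (fv \<beta>) \<eta> \<M>) \<longleftrightarrow>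
    ev (\<lambda>\<M>. den (fv \<alpha>) (fv \<beta>) \<theta>' \<M> = den (fv \<alpha>) (fv \<beta>) \<eta> \<M>)"
    by (rule eventually_subst, use assms(6) in eventually_elim) simp
  then show "\<eta> \<in> premor_class L T \<alpha> \<beta> \<theta> \<longleftrightarrow> \<eta> \<in> premor_class L T \<alpha> \<beta> \<theta>'"
    using premor_class_iff[OF assms(1-4)] premor_class_iff[OF assms(1-3,5)] by simp
qed

lemma class_self:
  assumes "\<alpha> \<in> Fml L" "\<beta> \<in> Fml L" "\<not> sentence \<beta>" "premorphism L T \<alpha> \<beta> \<theta>"
  shows "\<theta> \<in> premor_class L T \<alpha> \<beta> \<theta>"
  using premor_class_iff[OF assms] assms(4) by simp

lemma Den_mor:
  assumes "\<alpha> \<in> Fml L" "\<beta> \<in> Fml L" "\<not> sentence \<beta>" "premorphism L T \<alpha> \<beta> \<theta>"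
  shows "ev (\<lambda>\<M>. Den (mor L T \<alpha> \<beta> \<theta>) \<M> = den (fv \<alpha>) (fv \<beta>) \<theta> \<M>)"
proof -
  have "(SOME \<theta>'. \<theta>' \<in> premor_class L T \<alpha> \<beta> \<theta>) \<in> premor_class L T \<alpha> \<beta> \<theta>"
    using class_self[OF assms] by (rule someI)
  then have "ev (\<lambda>\<M>. den (fv \<alpha>) (fv \<beta>) \<theta> \<M> =
      den (fv \<alpha>) (fv \<beta>) (SOME \<theta>'. \<theta>' \<in> premor_class L T \<alpha> \<beta> \<theta>) \<M>)"
    using premor_class_iff[OF assms] by blast
  then show ?thesis by eventually_elim (simp add: mor_def)
qed

lemma mor_hom:
  "\<alpha> \<in> Fml L \<Longrightarrow> \<beta> \<in> Fml L \<Longrightarrow> \<not> sentence \<beta> \<Longrightarrow> premorphism L T \<alpha> \<beta> \<theta> \<Longrightarrow>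
    mor L T \<alpha> \<beta> \<theta> \<in> hom C \<alpha> \<beta>"
  unfolding hom_Syn by (simp only: if_False) blast

lemma Func_cong:
  assumes "Func \<alpha> \<beta> R" "ev (\<lambda>\<M>. R \<M> = S \<M>)"
  shows "Func \<alpha> \<beta> S"
  unfolding Func_def using assms(1)[unfolded Func_def] assms(2) by eventually_elim simp

lemma formal_exists_Func:
  assumes "\<alpha> \<in> Fml L" "s \<in> Fml L" "sentence s"
  shows "formal_exists L T \<alpha> s \<longleftrightarrow> Func \<alpha> s (\<lambda>\<M>. extension \<M> \<alpha> \<times> {\<lambda>_. undefined})"
  unfolding Func_def formal_exists_iff[OF T assms] func_def extension_sentence[OF assms(3)]
  by (rule eventually_subst, rule always_eventually) (auto simp: single_valued_def)

lemma func_sentence: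
  assumes "sentence s" "func (extension \<M> \<alpha>) (extension \<M> s) R"
  shows "R = extension \<M> \<alpha> \<times> {\<lambda>_. undefined}"
  using assms(2) unfolding func_def extension_sentence[OF assms(1)] by (auto split: if_splits)

lemma homD: "f \<in> hom C \<alpha> \<beta> \<Longrightarrow> \<alpha> \<in> Fml L \<and> \<beta> \<in> Fml L"
  by (simp add: hom_Syn)

lemma hom_Func:
  assumes "f \<in> hom C \<alpha> \<beta>"
  shows "Func \<alpha> \<beta> (Den f)"
proof -
  note Fml = homD[OF assms]
  show ?thesis
  proof (cases "sentence \<beta>")
    case True
    then have f: "f = Formal \<alpha> \<beta>" "formal_exists L T \<alpha> \<beta>" using assms by (simp_all add: hom_Syn)
    have "Den f = (\<lambda>\<M>. extension \<M> \<alpha> \<times> {\<lambda>_. undefined})" by (rule ext) (simp add: f(1))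
    then show ?thesis using f(2) formal_exists_Func[of \<alpha> \<beta>] Fml True by simp
  next
    case False
    then obtain \<theta> where \<theta>: "premorphism L T \<alpha> \<beta> \<theta>" "f = mor L T \<alpha> \<beta> \<theta>"
      using assms by (auto simp: hom_Syn)
    then have "Func \<alpha> \<beta> (den (fv \<alpha>) (fv \<beta>) \<theta>)" using premorphism_Func Fml by blast
    moreover have "ev (\<lambda>\<M>. den (fv \<alpha>) (fv \<beta>) \<theta> \<M> = Den f \<M>)"
      using Den_mor[OF _ _ False \<theta>(1)] Fml unfolding \<theta>(2) by (simp add: eq_commute)
    ultimately show ?thesis by (rule Func_cong)
  qed
qed

lemma hom_definable:
  assumes "f \<in> hom C \<alpha> \<beta>"
  shows "definable L (fv \<alpha>) (fv \<beta>) (Den f)"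
proof -
  note Fml = homD[OF assms]
  show ?thesis
  proof (cases "sentence \<beta>")
    case True
    then have "Den f = (\<lambda>\<M>. extension \<M> \<alpha> \<times> (fv \<beta> \<rightarrow>\<^sub>E uni \<M>))"
      using assms by (auto simp: hom_Syn sentence_def)
    then show ?thesis using definable_source[of \<alpha> L "fv \<beta>"] Fml by simp
  next
    case False
    then obtain \<theta> where \<theta>: "premorphism L T \<alpha> \<beta> \<theta>" "f = mor L T \<alpha> \<beta> \<theta>"
      using assms by (auto simp: hom_Syn)
    let ?\<theta> = "SOME \<theta>'. \<theta>' \<in> premor_class L T \<alpha> \<beta> \<theta>"
    have "?\<theta> \<in> premor_class L T \<alpha> \<beta> \<theta>"
      using class_self[OF _ _ False \<theta>(1)] Fml by (intro someI) blast
    then have "premorphism L T \<alpha> \<beta> ?\<theta>" by (simp add: premor_class_def)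
    then have "?\<theta> \<in> Fml L" "fv ?\<theta> \<subseteq> sg (fv \<alpha>) (fv \<beta>)" using premorphism_Func Fml by blast+
    moreover have "Den f \<M> = den (fv \<alpha>) (fv \<beta>) ?\<theta> \<M>" for \<M> by (simp add: \<theta>(2) mor_def)
    ultimately show ?thesis unfolding definable_def using finite_fv by blast
  qed
qed

text \<open>Together with \<open>hom_eqI\<close>: arrows are the definable functions, up to equality in almost all structures.\<close>

lemma hom_ex:
  assumes "\<alpha> \<in> Fml L" "\<beta> \<in> Fml L" "definable L (fv \<alpha>) (fv \<beta>) R" "Func \<alpha> \<beta> R"
  shows "\<exists>f\<in>hom C \<alpha> \<beta>. ev (\<lambda>\<M>. Den f \<M> = R \<M>)"
proof (cases "sentence \<beta>")
  case True
  have eq: "ev (\<lambda>\<M>. R \<M> = extension \<M> \<alpha> \<times> {\<lambda>_. undefined})"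
    using assms(4)[unfolded Func_def] by eventually_elim (rule func_sentence[OF True])
  then have "formal_exists L T \<alpha> \<beta>"
    unfolding formal_exists_Func[OF assms(1,2) True] by (rule Func_cong[OF assms(4)])
  then have "Formal \<alpha> \<beta> \<in> hom C \<alpha> \<beta>" using assms True by (simp add: hom_Syn)
  moreover have "ev (\<lambda>\<M>. Den (Formal \<alpha> \<beta>) \<M> = R \<M>)" using eq by eventually_elim simp
  ultimately show ?thesis ..
next
  case False
  from assms(3) obtain \<theta> where \<theta>: "\<theta> \<in> Fml L" "fv \<theta> \<subseteq> sg (fv \<alpha>) (fv \<beta>)"
    "\<And>\<M>. R \<M> = den (fv \<alpha>) (fv \<beta>) \<theta> \<M>" unfolding definable_def by blast
  then have "R = den (fv \<alpha>) (fv \<beta>) \<theta>" by (intro ext)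
  then have pre: "premorphism L T \<alpha> \<beta> \<theta>"
    using premorphism_Func[OF assms(1,2)] assms(4) \<theta> by simp
  have "mor L T \<alpha> \<beta> \<theta> \<in> hom C \<alpha> \<beta>" by (rule mor_hom[OF assms(1,2) False pre])
  moreover have "ev (\<lambda>\<M>. Den (mor L T \<alpha> \<beta> \<theta>) \<M> = R \<M>)"
    using Den_mor[OF assms(1,2) False pre] by (simp add: \<theta>(3))
  ultimately show ?thesis ..
qed

lemma hom_eqI:
  assumes f: "f \<in> hom C \<alpha> \<beta>" and g: "g \<in> hom C \<alpha> \<beta>" and eq: "ev (\<lambda>\<M>. Den f \<M> = Den g \<M>)"
  shows "f = g"
proof (cases "sentence \<beta>")
  case True
  then show ?thesis using f g by (simp add: hom_Syn)
next
  case False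
  note Fml = homD[OF f]
  obtain \<theta> where \<theta>: "premorphism L T \<alpha> \<beta> \<theta>" "f = mor L T \<alpha> \<beta> \<theta>"
    using f False by (auto simp: hom_Syn)
  obtain \<eta> where \<eta>: "premorphism L T \<alpha> \<beta> \<eta>" "g = mor L T \<alpha> \<beta> \<eta>"
    using g False by (auto simp: hom_Syn)
  have "ev (\<lambda>\<M>. den (fv \<alpha>) (fv \<beta>) \<theta> \<M> = den (fv \<alpha>) (fv \<beta>) \<eta> \<M>)"
    using Den_mor[OF Fml[THEN conjunct1] Fml[THEN conjunct2] False \<theta>(1)]
      Den_mor[OF Fml[THEN conjunct1] Fml[THEN conjunct2] False \<eta>(1)] eq
    unfolding \<theta>(2) \<eta>(2) by eventually_elim simp
  then have "premor_class L T \<alpha> \<beta> \<theta> = premor_class L T \<alpha> \<beta> \<eta>"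
    using class_eq[OF _ _ False \<theta>(1) \<eta>(1)] Fml by blast
  then show ?thesis by (simp add: \<theta>(2) \<eta>(2) mor_def)
qed

text \<open>
  The composite is defined as a union over all representatives; they all give the same class because
  they have the same denotation.
\<close>

lemma union_of_classes:
  assumes "\<alpha> \<in> Fml L" "\<gamma> \<in> Fml L" "\<not> sentence \<gamma>" "S \<noteq> {}" "Func \<alpha> \<gamma> R"
    and S: "\<And>\<theta>. \<theta> \<in> S \<Longrightarrow> \<theta> \<in> Fml L \<and> fv \<theta> \<subseteq> sg (fv \<alpha>) (fv \<gamma>) \<and>
      ev (\<lambda>\<M>. den (fv \<alpha>) (fv \<gamma>) \<theta> \<M> = R \<M>)"
  shows "Cls \<alpha> (\<Union>\<theta>\<in>S. premor_class L T \<alpha> \<gamma> \<theta>) \<gamma> \<in> hom C \<alpha> \<gamma> \<and>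
    ev (\<lambda>\<M>. Den (Cls \<alpha> (\<Union>\<theta>\<in>S. premor_class L T \<alpha> \<gamma> \<theta>) \<gamma>) \<M> = R \<M>)"
proof -
  have pre: "premorphism L T \<alpha> \<gamma> \<theta>" if "\<theta> \<in> S" for \<theta>
  proof -
    have "ev (\<lambda>\<M>. R \<M> = den (fv \<alpha>) (fv \<gamma>) \<theta> \<M>)" using S[OF that] by (simp add: eq_commute)
    then show ?thesis
      using S[OF that] premorphism_Func[OF assms(1,2)] Func_cong[OF assms(5)] by blast
  qed
  obtain \<theta> where \<theta>: "\<theta> \<in> S" using assms(4) by blast
  have "premor_class L T \<alpha> \<gamma> \<eta> = premor_class L T \<alpha> \<gamma> \<theta>" if "\<eta> \<in> S" for \<eta>
  proof (rule class_eq[OF assms(1-3) pre[OF that] pre[OF \<theta>]])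
    have "ev (\<lambda>\<M>. den (fv \<alpha>) (fv \<gamma>) \<eta> \<M> = R \<M>)" "ev (\<lambda>\<M>. den (fv \<alpha>) (fv \<gamma>) \<theta> \<M> = R \<M>)"
      using S[OF that] S[OF \<theta>] by blast+
    then show "ev (\<lambda>\<M>. den (fv \<alpha>) (fv \<gamma>) \<eta> \<M> = den (fv \<alpha>) (fv \<gamma>) \<theta> \<M>)"
      by eventually_elim simp
  qed
  then have "(\<Union>\<theta>\<in>S. premor_class L T \<alpha> \<gamma> \<theta>) = premor_class L T \<alpha> \<gamma> \<theta>"
    by (rule SUP_eq_const[OF assms(4)])
  then have eq: "Cls \<alpha> (\<Union>\<theta>\<in>S. premor_class L T \<alpha> \<gamma> \<theta>) \<gamma> = mor L T \<alpha> \<gamma> \<theta>" by (simp add: mor_def)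
  have "ev (\<lambda>\<M>. den (fv \<alpha>) (fv \<gamma>) \<theta> \<M> = R \<M>)" using S[OF \<theta>] by blast
  with Den_mor[OF assms(1-3) pre[OF \<theta>]] have "ev (\<lambda>\<M>. Den (mor L T \<alpha> \<gamma> \<theta>) \<M> = R \<M>)"
    by eventually_elim simp
  moreover have "mor L T \<alpha> \<gamma> \<theta> \<in> hom C \<alpha> \<gamma>" by (rule mor_hom[OF assms(1-3) pre[OF \<theta>]])
  ultimately show ?thesis unfolding eq by blast
qed

lemma Func_comp:
  assumes "Func \<alpha> \<beta> R" "Func \<beta> \<gamma> S"
  shows "Func \<alpha> \<gamma> (\<lambda>\<M>. R \<M> O S \<M>)"
  unfolding Func_def using assms[unfolded Func_def] by eventually_elim (rule func_comp)

lemma den_formal_comp: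
  assumes "sentence s" "fv \<theta> \<subseteq> sg {} W" "\<theta> \<in> Fml L" "\<alpha> \<in> Fml L" "finite W"
  shows "comp_formal_fml \<alpha> \<theta> \<in> Fml L" "fv (comp_formal_fml \<alpha> \<theta>) \<subseteq> sg (fv \<alpha>) W"
    "den (fv \<alpha>) W (comp_formal_fml \<alpha> \<theta>) \<M> = (extension \<M> \<alpha> \<times> {\<lambda>_. undefined}) O den {} W \<theta> \<M>"
proof -
  show "comp_formal_fml \<alpha> \<theta> \<in> Fml L" using assms by (simp add: comp_formal_fml_def)
  show fv: "fv (comp_formal_fml \<alpha> \<theta>) \<subseteq> sg (fv \<alpha>) W"
  proof -
    have "sg {} W \<subseteq> sg (fv \<alpha>) W" by (auto simp: sg_def)
    then show ?thesis using assms(2) fv_inst_xneg[of \<alpha> W] by (auto simp: comp_formal_fml_def)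
  qed
  show "den (fv \<alpha>) W (comp_formal_fml \<alpha> \<theta>) \<M> = (extension \<M> \<alpha> \<times> {\<lambda>_. undefined}) O den {} W \<theta> \<M>"
  proof (rule rel_eqI[OF finite_fv assms(5) den_sub[OF finite_fv assms(5)]])
    show "(extension \<M> \<alpha> \<times> {\<lambda>_. undefined}) O den {} W \<theta> \<M> \<subseteq> (fv \<alpha> \<rightarrow>\<^sub>E uni \<M>) \<times> (W \<rightarrow>\<^sub>E uni \<M>)"
      using den_sub[of "{}" W \<theta> \<M>] assms(5) extension_sub[of \<M> \<alpha>] by blast
    fix \<mu> assume \<mu>: "lft (fv \<alpha>) \<mu> \<in> fv \<alpha> \<rightarrow>\<^sub>E uni \<M>" "rgt W \<mu> \<in> W \<rightarrow>\<^sub>E uni \<M>"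
    have "(lft (fv \<alpha>) \<mu>, rgt W \<mu>) \<in> (extension \<M> \<alpha> \<times> {\<lambda>_. undefined}) O den {} W \<theta> \<M> \<longleftrightarrow>
      lft (fv \<alpha>) \<mu> \<in> extension \<M> \<alpha> \<and> (lft {} \<mu>, rgt W \<mu>) \<in> den {} W \<theta> \<M>"
      by (auto simp: relcomp_unfold)
    also have "\<dots> \<longleftrightarrow> (lft (fv \<alpha>) \<mu>, rgt W \<mu>) \<in> den (fv \<alpha>) W (comp_formal_fml \<alpha> \<theta>) \<M>"
      unfolding den_iff[OF assms(2) finite.emptyI assms(5)] den_iff[OF fv finite_fv assms(5)]
      using \<mu> by (simp add: comp_formal_fml_def sat_inst_xneg extension_iff)
    finally show "(lft (fv \<alpha>) \<mu>, rgt W \<mu>) \<in> den (fv \<alpha>) W (comp_formal_fml \<alpha> \<theta>) \<M> \<longleftrightarrow>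
      (lft (fv \<alpha>) \<mu>, rgt W \<mu>) \<in> (extension \<M> \<alpha> \<times> {\<lambda>_. undefined}) O den {} W \<theta> \<M>" by blast
  qed
qed

lemma comp:
  assumes f: "f \<in> hom C \<alpha> \<beta>" and g: "g \<in> hom C \<beta> \<gamma>"
  shows "Comp C g f \<in> hom C \<alpha> \<gamma> \<and> ev (\<lambda>\<M>. Den (Comp C g f) \<M> = Den f \<M> O Den g \<M>)"
proof -
  have Fml: "\<alpha> \<in> Fml L" "\<beta> \<in> Fml L" "\<gamma> \<in> Fml L" using homD[OF f] homD[OF g] by auto
  have Comp: "Comp C = syn_comp L T" by (simp add: Syn_def)
  have src: "src f = \<alpha>" using f unfolding hom_def Syn_def by simp
  have FR: "Func \<alpha> \<gamma> (\<lambda>\<M>. Den f \<M> O Den g \<M>)"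
    by (rule Func_comp[OF hom_Func[OF f] hom_Func[OF g]])
  show ?thesis
  proof (cases "sentence \<gamma>")
    case True
    then have "g = Formal \<beta> \<gamma>" using g by (simp add: hom_Syn)
    then have c: "Comp C g f = Formal \<alpha> \<gamma>" by (simp add: Comp src)
    have eq: "ev (\<lambda>\<M>. Den f \<M> O Den g \<M> = extension \<M> \<alpha> \<times> {\<lambda>_. undefined})"
      using FR[unfolded Func_def] by eventually_elim (rule func_sentence[OF True])
    then have "formal_exists L T \<alpha> \<gamma>"
      unfolding formal_exists_Func[OF Fml(1,3) True] by (rule Func_cong[OF FR])
    then have "Formal \<alpha> \<gamma> \<in> hom C \<alpha> \<gamma>" using Fml True by (simp add: hom_Syn)
    moreover have "ev (\<lambda>\<M>. Den (Formal \<alpha> \<gamma>) \<M> = Den f \<M> O Den g \<M>)"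
      using eq by eventually_elim simp
    ultimately show ?thesis unfolding c by blast
  next
    case ns: False
    then obtain \<theta>2 where \<theta>2: "premorphism L T \<beta> \<gamma> \<theta>2" "g = mor L T \<beta> \<gamma> \<theta>2"
      using g by (auto simp: hom_Syn)
    let ?B = "premor_class L T \<beta> \<gamma> \<theta>2"
    have gB: "ev (\<lambda>\<M>. den (fv \<beta>) (fv \<gamma>) \<theta> \<M> = Den g \<M>)" if "\<theta> \<in> ?B" for \<theta>
    proof -
      have "ev (\<lambda>\<M>. den (fv \<beta>) (fv \<gamma>) \<theta>2 \<M> = den (fv \<beta>) (fv \<gamma>) \<theta> \<M>)"
        using that premor_class_iff[OF Fml(2,3) ns \<theta>2(1)] by blast
      with Den_mor[OF Fml(2,3) ns \<theta>2(1)] show ?thesis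
        unfolding \<theta>2(2) by eventually_elim simp
    qed
    have B: "\<theta> \<in> Fml L" "fv \<theta> \<subseteq> sg (fv \<beta>) (fv \<gamma>)" if "\<theta> \<in> ?B" for \<theta>
      using that premorphism_Func[OF Fml(2,3)] by (auto simp: premor_class_def)
    have neB: "?B \<noteq> {}" using class_self[OF Fml(2,3) ns \<theta>2(1)] by blast
    show ?thesis
    proof (cases "sentence \<beta>")
      case True
      then have fF: "f = Formal \<alpha> \<beta>" using f by (simp add: hom_Syn)
      have fvb: "fv \<beta> = {}" using True by (simp add: sentence_def)
      have c: "Comp C g f = Cls \<alpha> (\<Union>\<theta>\<in>comp_formal_fml \<alpha> ` ?B. premor_class L T \<alpha> \<gamma> \<theta>) \<gamma>"
        by (simp add: Comp fF \<theta>2(2) mor_def)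
      show ?thesis
        unfolding c
      proof (rule union_of_classes[OF Fml(1,3) ns _ FR])
        show "comp_formal_fml \<alpha> ` ?B \<noteq> {}" using neB by simp
        fix \<eta> assume "\<eta> \<in> comp_formal_fml \<alpha> ` ?B"
        then obtain \<theta> where \<theta>: "\<theta> \<in> ?B" "\<eta> = comp_formal_fml \<alpha> \<theta>" by blast
        note d = den_formal_comp[OF True B(2)[OF \<theta>(1), unfolded fvb] B(1)[OF \<theta>(1)] Fml(1) finite_fv]
        have "ev (\<lambda>\<M>. den (fv \<alpha>) (fv \<gamma>) \<eta> \<M> = Den f \<M> O Den g \<M>)"
          using gB[OF \<theta>(1)] unfolding \<theta>(2) d(3) fvb by eventually_elim (simp add: fF)
        then show "\<eta> \<in> Fml L \<and> fv \<eta> \<subseteq> sg (fv \<alpha>) (fv \<gamma>) \<and>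
          ev (\<lambda>\<M>. den (fv \<alpha>) (fv \<gamma>) \<eta> \<M> = Den f \<M> O Den g \<M>)"
          using d(1,2) \<theta>(2) by blast
      qed
    next
      case nb: False
      then obtain \<theta>1 where \<theta>1: "premorphism L T \<alpha> \<beta> \<theta>1" "f = mor L T \<alpha> \<beta> \<theta>1"
        using f by (auto simp: hom_Syn)
      let ?A = "premor_class L T \<alpha> \<beta> \<theta>1"
      have fA: "ev (\<lambda>\<M>. den (fv \<alpha>) (fv \<beta>) \<theta> \<M> = Den f \<M>)" if "\<theta> \<in> ?A" for \<theta>
      proof -
        have "ev (\<lambda>\<M>. den (fv \<alpha>) (fv \<beta>) \<theta>1 \<M> = den (fv \<alpha>) (fv \<beta>) \<theta> \<M>)"
          using that premor_class_iff[OF Fml(1,2) nb \<theta>1(1)] by blast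
        with Den_mor[OF Fml(1,2) nb \<theta>1(1)] show ?thesis
          unfolding \<theta>1(2) by eventually_elim simp
      qed
      have A: "\<theta> \<in> Fml L" "fv \<theta> \<subseteq> sg (fv \<alpha>) (fv \<beta>)" if "\<theta> \<in> ?A" for \<theta>
        using that premorphism_Func[OF Fml(1,2)] by (auto simp: premor_class_def)
      have neA: "?A \<noteq> {}" using class_self[OF Fml(1,2) nb \<theta>1(1)] by blast
      let ?S = "(\<lambda>(\<theta>1, \<theta>2). comp_fml \<beta> \<gamma> \<theta>1 \<theta>2) ` (?A \<times> ?B)"
      have c: "Comp C g f = Cls \<alpha> (\<Union>\<theta>\<in>?S. premor_class L T \<alpha> \<gamma> \<theta>) \<gamma>"
        unfolding Comp \<theta>1(2) \<theta>2(2) mor_def syn_comp.simps UN_image_pairs ..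
      show ?thesis
        unfolding c
      proof (rule union_of_classes[OF Fml(1,3) ns _ FR])
        show "?S \<noteq> {}" using neA neB by simp
        fix \<eta> assume "\<eta> \<in> ?S"
        then obtain \<theta> \<theta>' where \<theta>: "\<theta> \<in> ?A" "\<theta>' \<in> ?B" "\<eta> = comp_fml \<beta> \<gamma> \<theta> \<theta>'"
          by (elim imageE SigmaE) simp
        note d = den_comp[OF A[OF \<theta>(1)] B[OF \<theta>(2)] finite_fv]
        have "ev (\<lambda>\<M>. den (fv \<alpha>) (fv \<gamma>) \<eta> \<M> = Den f \<M> O Den g \<M>)"
          using fA[OF \<theta>(1)] gB[OF \<theta>(2)] unfolding \<theta>(3) d(3) by eventually_elim simp
        then show "\<eta> \<in> Fml L \<and> fv \<eta> \<subseteq> sg (fv \<alpha>) (fv \<gamma>) \<and>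
          ev (\<lambda>\<M>. den (fv \<alpha>) (fv \<gamma>) \<eta> \<M> = Den f \<M> O Den g \<M>)"
          using d(1,2) \<theta>(3) by blast
      qed
    qed
  qed
qed

lemmas comp_hom = comp[THEN conjunct1] and Den_comp = comp[THEN conjunct2]

subsection \<open>Changes of variables as arrows\<close>

lemma Func_graph:
  "ev (\<lambda>\<M>. \<forall>\<rho>\<in>extension \<M> \<alpha>. (\<lambda>w\<in>fv \<beta>. \<rho> (\<sigma> w)) \<in> extension \<M> \<beta>) \<Longrightarrow> Func \<alpha> \<beta> (graph \<alpha> \<beta> \<sigma>)"
  unfolding Func_def
  by (erule eventually_mono) (auto simp: func_def graph_def single_valued_def)

text \<open>
  The arrow \<open>\<rho> \<mapsto> \<rho> \<circ> \<sigma>\<close>. Projections, diagonals, weakenings and inclusions of formulas in the same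
  variables are all of this form.
\<close>

definition reidx :: "'r fml \<Rightarrow> 'r fml \<Rightarrow> (int \<Rightarrow> int) \<Rightarrow> 'r syn_arrow" where
  "reidx \<alpha> \<beta> \<sigma> = (SOME f. f \<in> hom C \<alpha> \<beta> \<and> ev (\<lambda>\<M>. Den f \<M> = graph \<alpha> \<beta> \<sigma> \<M>))"

lemma reidx:
  assumes "\<alpha> \<in> Fml L" "\<beta> \<in> Fml L" "\<sigma> ` fv \<beta> \<subseteq> fv \<alpha>"
    and "ev (\<lambda>\<M>. \<forall>\<rho>\<in>extension \<M> \<alpha>. (\<lambda>w\<in>fv \<beta>. \<rho> (\<sigma> w)) \<in> extension \<M> \<beta>)"
  shows "reidx \<alpha> \<beta> \<sigma> \<in> hom C \<alpha> \<beta> \<and> ev (\<lambda>\<M>. Den (reidx \<alpha> \<beta> \<sigma>) \<M> = graph \<alpha> \<beta> \<sigma> \<M>)"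
  unfolding reidx_def
  by (rule someI_ex) (use hom_ex[OF assms(1,2) definable_graph[OF assms(1,3)] Func_graph[OF assms(4)]] in blast)

lemma den_graph_fml:
  assumes "\<phi> \<in> Fml L"
  shows "graph_fml \<phi> \<in> Fml L" "fv (graph_fml \<phi>) \<subseteq> sg (fv \<phi>) (fv \<phi>)"
    "den (fv \<phi>) (fv \<phi>) (graph_fml \<phi>) \<M> = Id_on (extension \<M> \<phi>)"
proof -
  show "graph_fml \<phi> \<in> Fml L" using assms by (auto simp: graph_fml_def)
  have "xpos ` {1..nfv \<phi>} \<union> xneg ` {1..nfv \<phi>} \<subseteq> sg (fv \<phi>) (fv \<phi>)" by (auto simp: sg_def)
  then show fv: "fv (graph_fml \<phi>) \<subseteq> sg (fv \<phi>) (fv \<phi>)"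
    using fv_inst_xneg[of \<phi> "fv \<phi>"]
    by (simp add: graph_fml_def atLeastLessThanSuc_atLeastAtMost del: upt_Suc) blast
  show "den (fv \<phi>) (fv \<phi>) (graph_fml \<phi>) \<M> = Id_on (extension \<M> \<phi>)"
  proof (rule rel_eqI[OF finite_fv finite_fv den_sub[OF finite_fv finite_fv]])
    show "Id_on (extension \<M> \<phi>) \<subseteq> (fv \<phi> \<rightarrow>\<^sub>E uni \<M>) \<times> (fv \<phi> \<rightarrow>\<^sub>E uni \<M>)"
      using extension_sub[of \<M> \<phi>] by blast
    fix \<mu> assume \<mu>: "lft (fv \<phi>) \<mu> \<in> fv \<phi> \<rightarrow>\<^sub>E uni \<M>" "rgt (fv \<phi>) \<mu> \<in> fv \<phi> \<rightarrow>\<^sub>E uni \<M>"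
    have "(\<forall>i\<in>{1..nfv \<phi>}. \<mu> (xpos i) = \<mu> (xneg i)) \<longleftrightarrow> rgt (fv \<phi>) \<mu> = lft (fv \<phi>) \<mu>"
    proof
      assume "\<forall>i\<in>{1..nfv \<phi>}. \<mu> (xpos i) = \<mu> (xneg i)"
      then show "rgt (fv \<phi>) \<mu> = lft (fv \<phi>) \<mu>"
        unfolding lft_def rgt_def using pos_range[OF finite_fv, of _ \<phi>] by (intro restrict_ext) (meson atLeastAtMost_iff)
    next
      assume eq: "rgt (fv \<phi>) \<mu> = lft (fv \<phi>) \<mu>"
      show "\<forall>i\<in>{1..nfv \<phi>}. \<mu> (xpos i) = \<mu> (xneg i)"
      proof
        fix i assume "i \<in> {1..nfv \<phi>}"
        then obtain X where "X \<in> fv \<phi>" "pos (fv \<phi>) X = i" using pos_surj[OF finite_fv, of i] by auto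
        then show "\<mu> (xpos i) = \<mu> (xneg i)" using fun_cong[OF eq, of X] by (simp add: lft_def rgt_def)
      qed
    qed
    then have "sat \<M> \<mu> [] (graph_fml \<phi>) \<longleftrightarrow>
      sat \<M> (lft (fv \<phi>) \<mu>) [] \<phi> \<and> rgt (fv \<phi>) \<mu> = lft (fv \<phi>) \<mu>"
      by (simp add: graph_fml_def sat_inst_xneg atLeastLessThanSuc_atLeastAtMost del: upt_Suc)
    then show "(lft (fv \<phi>) \<mu>, rgt (fv \<phi>) \<mu>) \<in> den (fv \<phi>) (fv \<phi>) (graph_fml \<phi>) \<M> \<longleftrightarrow>
      (lft (fv \<phi>) \<mu>, rgt (fv \<phi>) \<mu>) \<in> Id_on (extension \<M> \<phi>)"
      unfolding den_iff[OF fv finite_fv finite_fv] using \<mu> by (auto simp: Id_on_iff extension_iff)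
  qed
qed

lemma func_Id_on: "A \<subseteq> B \<Longrightarrow> func A B (Id_on A)"
  by (auto simp: func_def single_valued_def)

lemma ident:
  assumes "\<alpha> \<in> Fml L"
  shows "Ident C \<alpha> \<in> hom C \<alpha> \<alpha> \<and> ev (\<lambda>\<M>. Den (Ident C \<alpha>) \<M> = Id_on (extension \<M> \<alpha>))"
proof (cases "sentence \<alpha>")
  case True
  have eq: "extension \<M> \<alpha> \<times> {\<lambda>_. undefined} = Id_on (extension \<M> \<alpha>)" for \<M> :: "('r, int) struct"
    by (auto simp: extension_sentence[OF True])
  have "formal_exists L T \<alpha> \<alpha>"
    unfolding formal_exists_Func[OF assms assms True] eq Func_def by (simp add: func_Id_on)
  moreover have "Ident C \<alpha> = Formal \<alpha> \<alpha>" using True by (simp add: Syn_def)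
  ultimately show ?thesis using True assms eq by (simp add: hom_Syn)
next
  case False
  note d = den_graph_fml[OF assms]
  have pre: "premorphism L T \<alpha> \<alpha> (graph_fml \<alpha>)"
    unfolding premorphism_Func[OF assms assms] Func_def d(3) using d(1,2) by (simp add: func_Id_on)
  have I: "Ident C \<alpha> = mor L T \<alpha> \<alpha> (graph_fml \<alpha>)" using False by (simp add: Syn_def)
  show ?thesis
    unfolding I using Den_mor[OF assms assms False pre] mor_hom[OF assms assms False pre]
    by (simp add: d(3))
qed

lemma incl:
  assumes "\<phi> \<in> Fml L"
  shows "incl L T \<phi> \<in> hom C \<phi> (EV (fv \<phi>)) \<and> ev (\<lambda>\<M>. Den (incl L T \<phi>) \<M> = Id_on (extension \<M> \<phi>))"
proof (cases "sentence \<phi>")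
  case True
  have EV: "EV (fv \<phi>) = (S_fml :: 'r fml)" using True by (simp add: EV_def sentence_def)
  have S: "sentence (S_fml :: 'r fml)" "S_fml \<in> Fml L" by (simp_all add: sentence_def)
  have eq: "extension \<M> \<phi> \<times> {\<lambda>_. undefined} = Id_on (extension \<M> \<phi>)" for \<M> :: "('r, int) struct"
    by (auto simp: extension_sentence[OF True])
  have "extension \<M> \<phi> \<subseteq> extension \<M> S_fml" for \<M> :: "('r, int) struct"
    using True by (auto simp: extension_def sentence_def)
  then have "formal_exists L T \<phi> S_fml"
    unfolding formal_exists_Func[OF assms S(2,1)] eq Func_def by (simp add: func_Id_on)
  then show ?thesis using True assms S eq by (simp add: hom_Syn EV incl_def)
next
  case False
  note d = den_graph_fml[OF assms]
  have EV: "EV (fv \<phi>) \<in> Fml L" "\<not> sentence (EV (fv \<phi>) :: 'r fml)" "fv (EV (fv \<phi>) :: 'r fml) = fv \<phi>"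
    using False by (simp_all add: sentence_def)
  have "extension \<M> \<phi> \<subseteq> extension \<M> (EV (fv \<phi>))" for \<M> :: "('r, int) struct"
    by (auto simp: extension_def)
  then have pre: "premorphism L T \<phi> (EV (fv \<phi>)) (graph_fml \<phi>)"
    unfolding premorphism_Func[OF assms EV(1)] Func_def EV(3) d(3) using d(1,2) by (simp add: func_Id_on)
  have I: "incl L T \<phi> = mor L T \<phi> (EV (fv \<phi>)) (graph_fml \<phi>)" using False by (simp add: incl_def)
  show ?thesis
    unfolding I using Den_mor[OF assms EV(1,2) pre] mor_hom[OF assms EV(1,2) pre]
    by (simp add: d(3) EV(3))
qed

lemma proj:
  assumes "finite V" "X \<in> V"
  shows "proj L T V (pos V X) \<in> hom C (EV V) (eqv 0 0) \<and>
    ev (\<lambda>\<M>. Den (proj L T V (pos V X)) \<M> = graph (EV V) (eqv 0 0) (\<lambda>_. X) \<M>)"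
proof -
  let ?\<theta> = "eqv (xneg (pos V X)) (xpos 1) :: 'r fml"
  have Fml: "EV V \<in> Fml L" "eqv 0 0 \<in> Fml L" "\<not> sentence (eqv 0 0 :: 'r fml)" by (simp_all add: sentence_def)
  have fvE: "fv (EV V :: 'r fml) = V" using assms by simp
  have "{Y \<in> {0 :: int}. Y \<le> 0} = {0}" by auto
  then have pos0: "pos {0} 0 = 1" by (simp add: pos_def)
  have fv0: "fv (eqv 0 0 :: 'r fml) = {0}" by simp
  have fv: "fv ?\<theta> \<subseteq> sg V {0}" using pos_sg(1)[OF assms, of "{0}"] by (simp add: sg_iff xpos_def)
  have d: "den V {0} ?\<theta> \<M> = graph (EV V) (eqv 0 0) (\<lambda>_. X) \<M>" for \<M> :: "('r, int) struct"
  proof (rule rel_eqI[OF assms(1) _ den_sub[OF assms(1)]])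
    show "graph (EV V) (eqv 0 0) (\<lambda>_. X) \<M> \<subseteq> (V \<rightarrow>\<^sub>E uni \<M>) \<times> ({0} \<rightarrow>\<^sub>E uni \<M>)"
    proof
      fix p assume p: "p \<in> graph (EV V) (eqv 0 0) (\<lambda>_. X) \<M>"
      obtain \<rho> \<tau> where "p = (\<rho>, \<tau>)" by (cases p)
      then show "p \<in> (V \<rightarrow>\<^sub>E uni \<M>) \<times> ({0} \<rightarrow>\<^sub>E uni \<M>)"
        using p reindex_PiE[of \<rho> V "uni \<M>" "\<lambda>_. X" "{0}"] assms
        by (simp add: graph_iff extension_iff fvE)
    qed
    fix \<mu> assume \<mu>: "lft V \<mu> \<in> V \<rightarrow>\<^sub>E uni \<M>" "rgt {0} \<mu> \<in> {0} \<rightarrow>\<^sub>E uni \<M>"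
    have r0: "rgt {0} \<mu> = (\<lambda>w\<in>{0}. \<mu> (xpos 1))"
      unfolding rgt_def by (rule restrict_ext) (simp add: pos0)
    have lX: "lft V \<mu> X = \<mu> (xneg (pos V X))" using assms(2) by (simp add: lft_def)
    have "rgt {0} \<mu> = (\<lambda>w\<in>{0}. lft V \<mu> X) \<longleftrightarrow> \<mu> (xneg (pos V X)) = \<mu> (xpos 1)"
      unfolding r0 lX by (metis restrict_apply' singletonI)
    then show "(lft V \<mu>, rgt {0} \<mu>) \<in> den V {0} ?\<theta> \<M> \<longleftrightarrow>
      (lft V \<mu>, rgt {0} \<mu>) \<in> graph (EV V) (eqv 0 0) (\<lambda>_. X) \<M>"
      unfolding den_iff[OF fv assms(1) finite.insertI[OF finite.emptyI]] graph_iff extension_iff fvE fv0 sat_eqv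
      using \<mu> by simp
  qed simp_all
  have "(\<lambda>w\<in>fv (eqv 0 0 :: 'r fml). \<rho> X) \<in> extension \<M> (eqv 0 0)"
    if "\<rho> \<in> extension \<M> (EV V)" for \<M> :: "('r, int) struct" and \<rho>
    using reindex_PiE[of \<rho> V "uni \<M>" "\<lambda>_. X" "{0}"] that assms by (simp add: extension_iff fvE)
  then have F: "Func (EV V) (eqv 0 0) (graph (EV V) (eqv 0 0) (\<lambda>_. X))"
    by (intro Func_graph always_eventually allI ballI)
  have d': "(\<lambda>\<M> :: ('r, int) struct. den V {0} ?\<theta> \<M>) = graph (EV V) (eqv 0 0) (\<lambda>_. X)"
    by (rule ext) (rule d)
  have pre: "premorphism L T (EV V) (eqv 0 0) ?\<theta>"
    unfolding premorphism_Func[OF Fml(1,2)] fvE fv0 d' by (intro conjI Fml_eqv fv F)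
  from mor_hom[OF Fml pre] Den_mor[OF Fml pre] show ?thesis
    unfolding proj_def fvE fv0 d by (rule conjI)
qed

end

section \<open>Limits, effective epimorphisms and monomorphisms of formulas\<close>

text \<open>
  The set-level content of a limit: if compatible families \<open>x\<close> come from unique points of \<open>Z\<close>, then the
  relation below is the only function that induces the given cone.
\<close>

definition lim_rel :: "'i set \<Rightarrow> 'a set \<Rightarrow> 'z set \<Rightarrow> ('i \<Rightarrow> ('a \<times> 'x) set) \<Rightarrow> ('i \<Rightarrow> ('z \<times> 'x) set) \<Rightarrow> ('a \<times> 'z) set" where
  "lim_rel I A Z f g = A \<times> Z \<inter> (\<Inter>i\<in>I. f i O (g i)\<inverse>)"

lemma lim_rel_iff:
  "(a, z) \<in> lim_rel I A Z f g \<longleftrightarrow> a \<in> A \<and> z \<in> Z \<and> (\<forall>i\<in>I. \<exists>y. (a, y) \<in> f i \<and> (z, y) \<in> g i)"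
  unfolding lim_rel_def by blast

lemma func_lim_rel:
  assumes f: "\<And>i. i \<in> I \<Longrightarrow> func A (X i) (f i)" and g: "\<And>i. i \<in> I \<Longrightarrow> func Z (X i) (g i)"
    and lim: "\<And>a x. a \<in> A \<Longrightarrow> \<forall>i\<in>I. (a, x i) \<in> f i \<Longrightarrow> \<exists>!z. z \<in> Z \<and> (\<forall>i\<in>I. (z, x i) \<in> g i)"
  shows "func A Z (lim_rel I A Z f g)"
    and "i \<in> I \<Longrightarrow> lim_rel I A Z f g O g i = f i"
    and "func A Z H \<Longrightarrow> (\<And>i. i \<in> I \<Longrightarrow> H O g i = f i) \<Longrightarrow> H = lim_rel I A Z f g"
proof -
  let ?R = "lim_rel I A Z f g"
  have ex: "\<exists>x. \<forall>i\<in>I. (a, x i) \<in> f i" if "a \<in> A" for a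
    using f that unfolding func_def by (intro bchoice) blast
  have f1: "y = y'" if "i \<in> I" "(a, y) \<in> f i" "(a, y') \<in> f i" for i a y y'
    using f[OF that(1)] that(2,3) unfolding func_def single_valued_def by blast
  have g1: "y = y'" if "i \<in> I" "(z, y) \<in> g i" "(z, y') \<in> g i" for i z y y'
    using g[OF that(1)] that(2,3) unfolding func_def single_valued_def by blast
  have R: "(a, z) \<in> ?R \<longleftrightarrow> z \<in> Z \<and> (\<forall>i\<in>I. (z, x i) \<in> g i)"
    if a: "a \<in> A" and x: "\<forall>i\<in>I. (a, x i) \<in> f i" for a x z
  proof
    assume r: "(a, z) \<in> ?R"
    have "(z, x i) \<in> g i" if i: "i \<in> I" for i
    proof -
      obtain y where y: "(a, y) \<in> f i" "(z, y) \<in> g i" using r i unfolding lim_rel_iff by blast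
      have "y = x i" by (rule f1[OF i y(1)]) (use x i in blast)
      with y(2) show ?thesis by simp
    qed
    then show "z \<in> Z \<and> (\<forall>i\<in>I. (z, x i) \<in> g i)" using r unfolding lim_rel_iff by blast
  next
    assume "z \<in> Z \<and> (\<forall>i\<in>I. (z, x i) \<in> g i)"
    then show "(a, z) \<in> ?R" using a x unfolding lim_rel_iff by blast
  qed
  have uniq: "\<exists>!z. (a, z) \<in> ?R" if a: "a \<in> A" for a
  proof -
    obtain x where x: "\<forall>i\<in>I. (a, x i) \<in> f i" using ex[OF a] by blast
    show ?thesis using lim[OF a x] unfolding R[OF a x] .
  qed
  have "?R \<subseteq> A \<times> Z" unfolding lim_rel_def by blast
  moreover have "\<exists>z. (a, z) \<in> ?R" if "a \<in> A" for a using uniq[OF that] by blast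
  moreover have "single_valued ?R"
  proof (rule single_valuedI)
    fix a z z' assume r: "(a, z) \<in> ?R" "(a, z') \<in> ?R"
    then have "a \<in> A" unfolding lim_rel_iff by blast
    from uniq[OF this] r show "z = z'" by blast
  qed
  ultimately show F: "func A Z ?R" unfolding func_def by blast
  show "?R O g i = f i" if i: "i \<in> I" for i
  proof (rule func_eqI[OF func_comp[OF F g[OF i]] f[OF i]])
    show "?R O g i \<subseteq> f i"
    proof
      fix p assume "p \<in> ?R O g i"
      then obtain a z y where p: "p = (a, y)" "(a, z) \<in> ?R" "(z, y) \<in> g i" by blast
      then obtain y' where y': "(a, y') \<in> f i" "(z, y') \<in> g i" using i unfolding lim_rel_iff by blast
      show "p \<in> f i" using g1[OF i p(3) y'(2)] y'(1) p(1) by simp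
    qed
  qed
  show "H = ?R" if H: "func A Z H" and eq: "\<And>i. i \<in> I \<Longrightarrow> H O g i = f i" for H
  proof (rule func_eqI[OF H F])
    show "H \<subseteq> ?R"
    proof
      fix p assume pH: "p \<in> H"
      obtain a z where p: "p = (a, z)" by (cases p)
      have m: "a \<in> A" "z \<in> Z" using H pH p unfolding func_def by blast+
      have "\<exists>y. (a, y) \<in> f i \<and> (z, y) \<in> g i" if i: "i \<in> I" for i
      proof -
        obtain y where y: "(z, y) \<in> g i" using g[OF i] m(2) unfolding func_def by blast
        then have "(a, y) \<in> H O g i" using pH p by blast
        then show ?thesis using y eq[OF i] by blast
      qed
      then show "p \<in> ?R" using m unfolding p lim_rel_iff by blast
    qed
  qed
qed

context syntactic
begin

lemma Ob_C [simp]: "Ob C = Fml L"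
  by (simp add: Syn_def)

lemma hom_arr: "f \<in> hom C \<alpha> \<beta> \<longleftrightarrow> f \<in> Ar C \<and> Src C f = \<alpha> \<and> Tgt C f = \<beta>"
  by (simp add: hom_def)

lemma ev_func: "f \<in> hom C \<alpha> \<beta> \<Longrightarrow> ev (\<lambda>\<M>. func (extension \<M> \<alpha>) (extension \<M> \<beta>) (Den f \<M>))"
  using hom_Func unfolding Func_def .

lemma comp_eq_iff:
  assumes "f \<in> hom C \<alpha> \<beta>" "g \<in> hom C \<beta> \<gamma>" "h \<in> hom C \<alpha> \<gamma>"
  shows "Comp C g f = h \<longleftrightarrow> ev (\<lambda>\<M>. Den f \<M> O Den g \<M> = Den h \<M>)"
proof
  assume "Comp C g f = h"
  then show "ev (\<lambda>\<M>. Den f \<M> O Den g \<M> = Den h \<M>)"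
    using Den_comp[OF assms(1,2)] by (simp add: eq_commute)
next
  assume "ev (\<lambda>\<M>. Den f \<M> O Den g \<M> = Den h \<M>)"
  with Den_comp[OF assms(1,2)] have "ev (\<lambda>\<M>. Den (Comp C g f) \<M> = Den h \<M>)"
    by eventually_elim simp
  then show "Comp C g f = h" by (rule hom_eqI[OF comp_hom[OF assms(1,2)] assms(3)])
qed

lemma comp_id_right: "f \<in> hom C \<alpha> \<beta> \<Longrightarrow> Comp C f (Ident C \<alpha>) = f"
proof -
  assume f: "f \<in> hom C \<alpha> \<beta>"
  have id: "Ident C \<alpha> \<in> hom C \<alpha> \<alpha>" "ev (\<lambda>\<M>. Den (Ident C \<alpha>) \<M> = Id_on (extension \<M> \<alpha>))"
    using ident homD[OF f] by blast+
  have "ev (\<lambda>\<M>. Den (Ident C \<alpha>) \<M> O Den f \<M> = Den f \<M>)"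
    using id(2) ev_func[OF f]
  proof eventually_elim
    case (elim \<M>)
    then show ?case unfolding func_def by (simp only:) blast
  qed
  then show ?thesis using comp_eq_iff[OF id(1) f f] by blast
qed

lemma comp_id_left: "f \<in> hom C \<alpha> \<beta> \<Longrightarrow> Comp C (Ident C \<beta>) f = f"
proof -
  assume f: "f \<in> hom C \<alpha> \<beta>"
  have id: "Ident C \<beta> \<in> hom C \<beta> \<beta>" "ev (\<lambda>\<M>. Den (Ident C \<beta>) \<M> = Id_on (extension \<M> \<beta>))"
    using ident homD[OF f] by blast+
  have "ev (\<lambda>\<M>. Den f \<M> O Den (Ident C \<beta>) \<M> = Den f \<M>)"
    using id(2) ev_func[OF f]
  proof eventually_elim
    case (elim \<M>)
    then show ?case unfolding func_def by (simp only:) blast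
  qed
  then show ?thesis using comp_eq_iff[OF f id(1) f] by blast
qed

lemma comp_assoc:
  assumes "f \<in> hom C \<alpha> \<beta>" "g \<in> hom C \<beta> \<gamma>" "h \<in> hom C \<gamma> \<delta>"
  shows "Comp C h (Comp C g f) = Comp C (Comp C h g) f"
proof -
  note gf = comp[OF assms(1,2)] and hg = comp[OF assms(2,3)]
  note r = comp[OF assms(1) hg[THEN conjunct1]]
  have "ev (\<lambda>\<M>. Den (Comp C g f) \<M> O Den h \<M> = Den (Comp C (Comp C h g) f) \<M>)"
    using gf[THEN conjunct2] hg[THEN conjunct2] r[THEN conjunct2]
    by eventually_elim (simp add: O_assoc)
  then show ?thesis
    using comp_eq_iff[OF gf[THEN conjunct1] assms(3) r[THEN conjunct1]] by blast
qed

lemma definable_lim_rel: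
  assumes "finite I" "\<alpha> \<in> Fml L" "\<zeta> \<in> Fml L"
    and "\<And>i. i \<in> I \<Longrightarrow> definable L (fv \<alpha>) (W i) (f i)" "\<And>i. i \<in> I \<Longrightarrow> definable L (fv \<zeta>) (W i) (g i)"
  shows "definable L (fv \<alpha>) (fv \<zeta>) (\<lambda>\<M>. lim_rel I (extension \<M> \<alpha>) (extension \<M> \<zeta>) (\<lambda>i. f i \<M>) (\<lambda>i. g i \<M>))"
proof -
  have "definable L (fv \<alpha>) (fv \<zeta>) (\<lambda>\<M>. (extension \<M> \<alpha> \<times> (fv \<zeta> \<rightarrow>\<^sub>E uni \<M>)) \<inter>
      (extension \<M> \<zeta> \<times> (fv \<alpha> \<rightarrow>\<^sub>E uni \<M>))\<inverse>)"
    using assms(2,3) by (intro definable_inter definable_source definable_converse finite_fv)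
  moreover have "(extension \<M> \<alpha> \<times> (fv \<zeta> \<rightarrow>\<^sub>E uni \<M>)) \<inter> (extension \<M> \<zeta> \<times> (fv \<alpha> \<rightarrow>\<^sub>E uni \<M>))\<inverse> =
      extension \<M> \<alpha> \<times> extension \<M> \<zeta>" for \<M> :: "('r, int) struct"
    using extension_sub[of \<M> \<alpha>] extension_sub[of \<M> \<zeta>] by blast
  ultimately have base: "definable L (fv \<alpha>) (fv \<zeta>) (\<lambda>\<M>. extension \<M> \<alpha> \<times> extension \<M> \<zeta>)"
    by (simp only:)
  show ?thesis
    unfolding lim_rel_def
    by (rule definable_INT[OF assms(1) base]) (rule definable_relcomp[OF assms(4) definable_converse[OF assms(5)]])
qed

text \<open>
  A cone of formulas is a limit as soon as it is a limit of sets in almost every model: the induced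
  arrow is definable because the index category is finite.
\<close>

lemma limit_arrow:
  assumes fin: "finite I" and c: "c \<in> Fml L" "c' \<in> Fml L"
    and leg: "\<And>i. i \<in> I \<Longrightarrow> leg i \<in> hom C c (D i)" and leg': "\<And>i. i \<in> I \<Longrightarrow> leg' i \<in> hom C c' (D i)"
    and lim: "ev (\<lambda>\<M>. \<forall>a\<in>extension \<M> c'. \<forall>x. (\<forall>i\<in>I. (a, x i) \<in> Den (leg' i) \<M>) \<longrightarrow>
      (\<exists>!z. z \<in> extension \<M> c \<and> (\<forall>i\<in>I. (z, x i) \<in> Den (leg i) \<M>)))"
  shows "\<exists>!h. h \<in> hom C c' c \<and> (\<forall>i\<in>I. Comp C (leg i) h = leg' i)"
proof -
  define R where "R \<M> = lim_rel I (extension \<M> c') (extension \<M> c) (\<lambda>i. Den (leg' i) \<M>) (\<lambda>i. Den (leg i) \<M>)"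
    for \<M>
  have ok: "ev (\<lambda>\<M>. (\<forall>i\<in>I. func (extension \<M> c') (extension \<M> (D i)) (Den (leg' i) \<M>)) \<and>
      (\<forall>i\<in>I. func (extension \<M> c) (extension \<M> (D i)) (Den (leg i) \<M>)))"
    using fin leg leg' by (intro eventually_conj eventually_ball_finite ballI ev_func)
  have lr: "ev (\<lambda>\<M>. func (extension \<M> c') (extension \<M> c) (R \<M>) \<and>
      (\<forall>i\<in>I. R \<M> O Den (leg i) \<M> = Den (leg' i) \<M>) \<and>
      (\<forall>H. func (extension \<M> c') (extension \<M> c) H \<longrightarrow>
        (\<forall>i\<in>I. H O Den (leg i) \<M> = Den (leg' i) \<M>) \<longrightarrow> H = R \<M>))"
    using ok lim
  proof eventually_elim
    case (elim \<M>)
    have f: "func (extension \<M> c') (extension \<M> (D i)) (Den (leg' i) \<M>)" if "i \<in> I" for i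
      using elim(1) that by blast
    have g: "func (extension \<M> c) (extension \<M> (D i)) (Den (leg i) \<M>)" if "i \<in> I" for i
      using elim(1) that by blast
    have l: "\<exists>!z. z \<in> extension \<M> c \<and> (\<forall>i\<in>I. (z, x i) \<in> Den (leg i) \<M>)"
      if "a \<in> extension \<M> c'" "\<forall>i\<in>I. (a, x i) \<in> Den (leg' i) \<M>" for a x
      using elim(2)[THEN bspec, OF that(1), THEN spec, THEN mp, OF that(2)] .
    show ?case
      unfolding R_def
    proof (intro conjI ballI allI impI)
      show "func (extension \<M> c') (extension \<M> c)
          (lim_rel I (extension \<M> c') (extension \<M> c) (\<lambda>i. Den (leg' i) \<M>) (\<lambda>i. Den (leg i) \<M>))"
        by (rule func_lim_rel(1)[where X = "\<lambda>i. extension \<M> (D i)"], erule f, erule g, erule (1) l)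
      show "lim_rel I (extension \<M> c') (extension \<M> c) (\<lambda>i. Den (leg' i) \<M>) (\<lambda>i. Den (leg i) \<M>)
          O Den (leg i) \<M> = Den (leg' i) \<M>" if "i \<in> I" for i
        by (rule func_lim_rel(2)[where X = "\<lambda>i. extension \<M> (D i)"], erule f, erule g, erule (1) l, rule that)
      show "H = lim_rel I (extension \<M> c') (extension \<M> c) (\<lambda>i. Den (leg' i) \<M>) (\<lambda>i. Den (leg i) \<M>)"
        if "func (extension \<M> c') (extension \<M> c) H"
        "\<forall>i\<in>I. H O Den (leg i) \<M> = Den (leg' i) \<M>" for H
        by (rule func_lim_rel(3)[where X = "\<lambda>i. extension \<M> (D i)"], erule f, erule g, erule (1) l, rule that(1),
            erule that(2)[THEN bspec])
    qed
  qed
  have "definable L (fv c') (fv c) R"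
    unfolding R_def[abs_def]
    by (rule definable_lim_rel[OF fin c(2,1) hom_definable[OF leg'] hom_definable[OF leg]])
  moreover have "Func c' c R"
    unfolding Func_def using lr by eventually_elim blast
  ultimately obtain h where h: "h \<in> hom C c' c" "ev (\<lambda>\<M>. Den h \<M> = R \<M>)"
    using hom_ex[OF c(2,1)] by blast
  show ?thesis
  proof (rule ex1I[of _ h])
    show "h \<in> hom C c' c \<and> (\<forall>i\<in>I. Comp C (leg i) h = leg' i)"
    proof (intro conjI ballI h)
      fix i assume i: "i \<in> I"
      have "ev (\<lambda>\<M>. Den h \<M> O Den (leg i) \<M> = Den (leg' i) \<M>)"
        using lr h(2) by eventually_elim (simp add: i)
      then show "Comp C (leg i) h = leg' i"
        using comp_eq_iff[OF h(1) leg[OF i] leg'[OF i]] by blast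
    qed
    fix k assume k: "k \<in> hom C c' c \<and> (\<forall>i\<in>I. Comp C (leg i) k = leg' i)"
    have "ev (\<lambda>\<M>. \<forall>i\<in>I. Den k \<M> O Den (leg i) \<M> = Den (leg' i) \<M>)"
    proof (rule eventually_ball_finite[OF fin], rule ballI)
      fix i assume i: "i \<in> I"
      then have "Comp C (leg i) k = leg' i" using k by blast
      then show "ev (\<lambda>\<M>. Den k \<M> O Den (leg i) \<M> = Den (leg' i) \<M>)"
        using comp_eq_iff[OF k[THEN conjunct1] leg[OF i] leg'[OF i]] by blast
    qed
    with lr ev_func[OF k[THEN conjunct1]] h(2) have "ev (\<lambda>\<M>. Den k \<M> = Den h \<M>)"
    proof eventually_elim
      case (elim \<M>)
      from elim(1)[THEN conjunct2, THEN conjunct2, THEN spec, THEN mp, OF elim(2), THEN mp, OF elim(4)] elim(3)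
      show ?case by simp
    qed
    then show "k = h" by (rule hom_eqI[OF k[THEN conjunct1] h(1)])
  qed
qed

text \<open>
  A definable relation is itself an object: its two coordinates become the variables of a formula.
\<close>

lemma tabulation:
  assumes Fml: "\<alpha> \<in> Fml L" "\<beta> \<in> Fml L" and R: "definable L (fv \<alpha>) (fv \<beta>) R"
    and sub: "ev (\<lambda>\<M>. R \<M> \<subseteq> extension \<M> \<alpha> \<times> extension \<M> \<beta>)"
  shows "\<exists>P p q. p \<in> hom C P \<alpha> \<and> q \<in> hom C P \<beta> \<and>
    ev (\<lambda>\<M>. \<forall>a b. (a, b) \<in> R \<M> \<longrightarrow> (\<exists>!z. z \<in> extension \<M> P \<and> (z, a) \<in> Den p \<M> \<and> (z, b) \<in> Den q \<M>)) \<and>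
    ev (\<lambda>\<M>. \<forall>z a b. (z, a) \<in> Den p \<M> \<longrightarrow> (z, b) \<in> Den q \<M> \<longrightarrow> (a, b) \<in> R \<M>)"
proof -
  define V W where "V = fv \<alpha>" and "W = fv \<beta>"
  have fin: "finite V" "finite W" by (simp_all add: V_def W_def)
  from R obtain \<theta> where \<theta>: "\<theta> \<in> Fml L" "fv \<theta> \<subseteq> sg V W"
    "\<And>\<M>. R \<M> \<subseteq> (V \<rightarrow>\<^sub>E uni \<M>) \<times> (W \<rightarrow>\<^sub>E uni \<M>)"
    "\<And>\<M> \<mu>. (lft V \<mu>, rgt W \<mu>) \<in> R \<M> \<longleftrightarrow>
      lft V \<mu> \<in> V \<rightarrow>\<^sub>E uni \<M> \<and> rgt W \<mu> \<in> W \<rightarrow>\<^sub>E uni \<M> \<and> sat \<M> \<mu> [] \<theta>"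
    unfolding V_def W_def by (elim definableE) blast
  define P where "P = conj \<theta> (EV (sg V W))"
  have PF: "P \<in> Fml L" using \<theta>(1) by (simp add: P_def)
  have fvP: "fv P = sg V W" using \<theta>(2) by (auto simp: P_def)
  have ext: "\<mu> \<in> extension \<M> P \<longleftrightarrow> \<mu> \<in> sg V W \<rightarrow>\<^sub>E uni \<M> \<and> (lft V \<mu>, rgt W \<mu>) \<in> R \<M>"
    for \<M> :: "('r, int) struct" and \<mu>
  proof -
    have "lft V \<mu> \<in> V \<rightarrow>\<^sub>E uni \<M>" "rgt W \<mu> \<in> W \<rightarrow>\<^sub>E uni \<M>" if "\<mu> \<in> sg V W \<rightarrow>\<^sub>E uni \<M>"
      using lft_rgt_mem[OF fin, of \<mu> "uni \<M>"] that by (meson PiE_mem)+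
    then show ?thesis unfolding extension_iff fvP \<theta>(4) by (auto simp: P_def)
  qed
  let ?l = "\<lambda>X. xneg (pos V X)" and ?r = "\<lambda>X. xpos (pos W X)"
  have l: "(\<lambda>w\<in>fv \<alpha>. \<mu> (?l w)) = lft V \<mu>" and r: "(\<lambda>w\<in>fv \<beta>. \<mu> (?r w)) = rgt W \<mu>"
    for \<mu> :: "int \<Rightarrow> int" by (simp_all add: lft_def rgt_def V_def W_def)
  have p: "reidx P \<alpha> ?l \<in> hom C P \<alpha> \<and> ev (\<lambda>\<M>. Den (reidx P \<alpha> ?l) \<M> = graph P \<alpha> ?l \<M>)"
  proof (rule reidx[OF PF Fml(1)])
    show "?l ` fv \<alpha> \<subseteq> fv P" using pos_sg(1)[OF fin(1)] by (auto simp: fvP V_def)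
    show "ev (\<lambda>\<M>. \<forall>\<rho>\<in>extension \<M> P. (\<lambda>w\<in>fv \<alpha>. \<rho> (?l w)) \<in> extension \<M> \<alpha>)"
      using sub unfolding l by eventually_elim (use ext in blast)
  qed
  have q: "reidx P \<beta> ?r \<in> hom C P \<beta> \<and> ev (\<lambda>\<M>. Den (reidx P \<beta> ?r) \<M> = graph P \<beta> ?r \<M>)"
  proof (rule reidx[OF PF Fml(2)])
    show "?r ` fv \<beta> \<subseteq> fv P" using pos_sg(2)[OF fin(2)] by (auto simp: fvP W_def)
    show "ev (\<lambda>\<M>. \<forall>\<rho>\<in>extension \<M> P. (\<lambda>w\<in>fv \<beta>. \<rho> (?r w)) \<in> extension \<M> \<beta>)"
      using sub unfolding r by eventually_elim (use ext in blast)
  qed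
  have gp: "(z, a) \<in> graph P \<alpha> ?l \<M> \<longleftrightarrow> z \<in> extension \<M> P \<and> a = lft V z"
    and gq: "(z, b) \<in> graph P \<beta> ?r \<M> \<longleftrightarrow> z \<in> extension \<M> P \<and> b = rgt W z"
    for \<M> :: "('r, int) struct" and z a b unfolding graph_iff l r by simp_all
  have e1: "\<exists>!z. z \<in> extension \<M> P \<and> a = lft V z \<and> b = rgt W z" if ab: "(a, b) \<in> R \<M>"
    for \<M> :: "('r, int) struct" and a b
  proof -
    have m: "a \<in> V \<rightarrow>\<^sub>E uni \<M>" "b \<in> W \<rightarrow>\<^sub>E uni \<M>" using ab \<theta>(3)[of \<M>] by blast+
    obtain \<mu> where \<mu>: "lft V \<mu> = a" "rgt W \<mu> = b" using ex_lft_rgt[OF fin m] by blast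
    let ?z = "restrict \<mu> (sg V W)"
    have z: "lft V ?z = a" "rgt W ?z = b"
      unfolding \<mu>[symmetric] lft_eq_iff[OF fin(1)] rgt_eq_iff[OF fin(2)] by (simp_all add: sg_iff)
    have "\<forall>k\<in>sg V W. \<mu> k \<in> uni \<M>" by (rule sg_mem[OF fin]) (use \<mu> m in simp_all)
    then have "?z \<in> sg V W \<rightarrow>\<^sub>E uni \<M>" by simp
    then have zP: "?z \<in> extension \<M> P" unfolding ext z using ab by blast
    have "z' = ?z" if z': "z' \<in> extension \<M> P" "a = lft V z'" "b = rgt W z'" for z'
    proof
      fix k show "z' k = ?z k"
      proof (cases "k \<in> sg V W")
        case True
        have "lft V z' = lft V \<mu>" "rgt W z' = rgt W \<mu>" using z' \<mu> by simp_all
        then show ?thesis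
          using True unfolding lft_eq_iff[OF fin(1)] rgt_eq_iff[OF fin(2)] by (auto simp: sg_iff)
      next
        case False
        have "z' \<in> sg V W \<rightarrow>\<^sub>E uni \<M>" using z'(1) unfolding ext by (rule conjunct1)
        from PiE_arb[OF this False] False show ?thesis by simp
      qed
    qed
    then show ?thesis using z zP by blast
  qed
  have "ev (\<lambda>\<M>. \<forall>a b. (a, b) \<in> R \<M> \<longrightarrow>
      (\<exists>!z. z \<in> extension \<M> P \<and> (z, a) \<in> Den (reidx P \<alpha> ?l) \<M> \<and> (z, b) \<in> Den (reidx P \<beta> ?r) \<M>))"
    using p[THEN conjunct2] q[THEN conjunct2]
  proof eventually_elim
    case (elim \<M>)
    have "z \<in> extension \<M> P \<and> (z, a) \<in> Den (reidx P \<alpha> ?l) \<M> \<and> (z, b) \<in> Den (reidx P \<beta> ?r) \<M> \<longleftrightarrow>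
      z \<in> extension \<M> P \<and> a = lft V z \<and> b = rgt W z" for z a b
      unfolding elim gp gq by blast
    then show ?case using e1[of _ _ \<M>] by (simp only:) blast
  qed
  moreover have "ev (\<lambda>\<M>. \<forall>z a b. (z, a) \<in> Den (reidx P \<alpha> ?l) \<M> \<longrightarrow>
      (z, b) \<in> Den (reidx P \<beta> ?r) \<M> \<longrightarrow> (a, b) \<in> R \<M>)"
    using p[THEN conjunct2] q[THEN conjunct2]
  proof eventually_elim
    case (elim \<M>)
    show ?case unfolding elim gp gq ext by blast
  qed
  ultimately show ?thesis using p[THEN conjunct1] q[THEN conjunct1] by blast
qed

lemma is_pullbackI:
  assumes "f \<in> hom C \<alpha> \<gamma>" "g \<in> hom C \<beta> \<gamma>" "p \<in> hom C P \<alpha>" "q \<in> hom C P \<beta>" "Comp C f p = Comp C g q"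
    and "\<And>w u v. u \<in> hom C w \<alpha> \<Longrightarrow> v \<in> hom C w \<beta> \<Longrightarrow> Comp C f u = Comp C g v \<Longrightarrow>
      \<exists>!h. h \<in> hom C w P \<and> Comp C p h = u \<and> Comp C q h = v"
  shows "is_pullback C f g p q"
proof -
  have s: "Src C f = \<alpha>" "Src C g = \<beta>" "Src C p = P" "Src C q = P"
    "Tgt C f = \<gamma>" "Tgt C g = \<gamma>" "Tgt C p = \<alpha>" "Tgt C q = \<beta>"
    and a: "f \<in> Ar C" "g \<in> Ar C" "p \<in> Ar C" "q \<in> Ar C"
    using assms(1-4) by (simp_all add: hom_arr)
  show ?thesis
    unfolding is_pullback_def s using a assms(5) by (intro conjI ballI impI assms(6) HOL.refl) assumption+
qed

lemma is_coequalizerI: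
  assumes "p \<in> hom C P \<alpha>" "q \<in> hom C P \<alpha>" "e \<in> hom C \<alpha> \<beta>" "Comp C e p = Comp C e q"
    and "\<And>w u. u \<in> hom C \<alpha> w \<Longrightarrow> Comp C u p = Comp C u q \<Longrightarrow> \<exists>!h. h \<in> hom C \<beta> w \<and> Comp C h e = u"
  shows "is_coequalizer C p q e"
proof -
  have s: "Src C p = P" "Src C q = P" "Src C e = \<alpha>" "Tgt C p = \<alpha>" "Tgt C q = \<alpha>" "Tgt C e = \<beta>"
    and a: "p \<in> Ar C" "q \<in> Ar C" "e \<in> Ar C"
    using assms(1-3) by (simp_all add: hom_arr)
  show ?thesis
    unfolding is_coequalizer_def s using a assms(4) by (intro conjI ballI impI assms(5) HOL.refl) assumption+
qed

text \<open>
  The last clause adds to the universal property that pairs with equal images are actual points of the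
  pullback; this is what kernel pairs are used for below.
\<close>

lemma pullback_ex:
  assumes f: "f \<in> hom C \<alpha> \<gamma>" and g: "g \<in> hom C \<beta> \<gamma>"
  shows "\<exists>P p q. p \<in> hom C P \<alpha> \<and> q \<in> hom C P \<beta> \<and> is_pullback C f g p q \<and>
    ev (\<lambda>\<M>. \<forall>a b. (a, b) \<in> Den f \<M> O (Den g \<M>)\<inverse> \<longrightarrow> (\<exists>z. (z, a) \<in> Den p \<M> \<and> (z, b) \<in> Den q \<M>))"
proof -
  let ?R = "\<lambda>\<M>. Den f \<M> O (Den g \<M>)\<inverse>"
  have Fml: "\<alpha> \<in> Fml L" "\<beta> \<in> Fml L" using homD f g by blast+
  have R: "definable L (fv \<alpha>) (fv \<beta>) ?R" by (rule definable_relcomp[OF hom_definable[OF f] definable_converse[OF hom_definable[OF g]]])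
  have "ev (\<lambda>\<M>. ?R \<M> \<subseteq> extension \<M> \<alpha> \<times> extension \<M> \<beta>)"
    using ev_func[OF f] ev_func[OF g] by eventually_elim (unfold func_def, blast)
  from tabulation[OF Fml R this] obtain P p q where p: "p \<in> hom C P \<alpha>" and q: "q \<in> hom C P \<beta>"
    and 1: "ev (\<lambda>\<M>. \<forall>a b. (a, b) \<in> ?R \<M> \<longrightarrow> (\<exists>!z. z \<in> extension \<M> P \<and> (z, a) \<in> Den p \<M> \<and> (z, b) \<in> Den q \<M>))"
    and 2: "ev (\<lambda>\<M>. \<forall>z a b. (z, a) \<in> Den p \<M> \<longrightarrow> (z, b) \<in> Den q \<M> \<longrightarrow> (a, b) \<in> ?R \<M>)"
    by blast
  have "ev (\<lambda>\<M>. Den p \<M> O Den f \<M> = Den (Comp C g q) \<M>)"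
    using ev_func[OF p] ev_func[OF q] ev_func[OF f] ev_func[OF g] 2 Den_comp[OF q g]
  proof eventually_elim
    case (elim \<M>)
    have "Den p \<M> O Den f \<M> \<subseteq> Den q \<M> O Den g \<M>"
    proof
      fix s assume "s \<in> Den p \<M> O Den f \<M>"
      then obtain z a c where s: "s = (z, c)" "(z, a) \<in> Den p \<M>" "(a, c) \<in> Den f \<M>" by blast
      obtain b where b: "(z, b) \<in> Den q \<M>" using elim(1,2) s(2) unfolding func_def by blast
      obtain c' where "(a, c') \<in> Den f \<M>" "(b, c') \<in> Den g \<M>" using elim(5) s(2) b by blast
      moreover from this have "c' = c" using elim(3) s(3) unfolding func_def single_valued_def by blast
      ultimately show "s \<in> Den q \<M> O Den g \<M>" using b s(1) by blast
    qed
    then show ?case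
      unfolding elim(6) by (rule func_eqI[OF func_comp[OF elim(1,3)] func_comp[OF elim(2,4)]])
  qed
  then have comm: "Comp C f p = Comp C g q" using comp_eq_iff[OF p f comp_hom[OF q g]] by blast
  have "is_pullback C f g p q"
  proof (rule is_pullbackI[OF f g p q comm])
    fix w u v assume u: "u \<in> hom C w \<alpha>" and v: "v \<in> hom C w \<beta>" and eq: "Comp C f u = Comp C g v"
    have "\<exists>!h. h \<in> hom C w P \<and> (\<forall>i\<in>UNIV. Comp C (if i then p else q) h = (if i then u else v))"
    proof (rule limit_arrow[of UNIV P w _ "\<lambda>i. if i then \<alpha> else \<beta>"])
      have "ev (\<lambda>\<M>. Den u \<M> O Den f \<M> = Den v \<M> O Den g \<M>)"
        using Den_comp[OF u f] Den_comp[OF v g] by eventually_elim (simp add: eq)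
      with 1 ev_func[OF v] ev_func[OF f] ev_func[OF u]
      show "ev (\<lambda>\<M>. \<forall>a\<in>extension \<M> w. \<forall>x. (\<forall>i\<in>UNIV. (a, x i) \<in> Den (if i then u else v) \<M>) \<longrightarrow>
        (\<exists>!z. z \<in> extension \<M> P \<and> (\<forall>i\<in>UNIV. (z, x i) \<in> Den (if i then p else q) \<M>)))"
      proof eventually_elim
        case (elim \<M>)
        show ?case
        proof (intro ballI allI impI)
          fix a x assume a: "a \<in> extension \<M> w" and "\<forall>i\<in>UNIV. (a, x i) \<in> Den (if i then u else v) \<M>"
          then have x: "(a, x True) \<in> Den u \<M>" "(a, x False) \<in> Den v \<M>" by (metis UNIV_I)+
          have "x True \<in> extension \<M> \<alpha>" using x(1) elim(4) unfolding func_def by blast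
          then obtain c where c: "(x True, c) \<in> Den f \<M>" using elim(3) unfolding func_def by blast
          then have "(a, c) \<in> Den v \<M> O Den g \<M>" using x(1) elim(5) by blast
          then have "(x False, c) \<in> Den g \<M>" using x(2) elim(2) unfolding func_def single_valued_def by blast
          then have "\<exists>!z. z \<in> extension \<M> P \<and> (z, x True) \<in> Den p \<M> \<and> (z, x False) \<in> Den q \<M>"
            using elim(1) c by blast
          then show "\<exists>!z. z \<in> extension \<M> P \<and> (\<forall>i\<in>UNIV. (z, x i) \<in> Den (if i then p else q) \<M>)"
            by (simp only: ball_UNIV all_bool_eq if_True if_False)
        qed
      qed
    qed (use u v p q homD in \<open>auto split: if_splits\<close>)
    then show "\<exists>!h. h \<in> hom C w P \<and> Comp C p h = u \<and> Comp C q h = v"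
      by (simp only: ball_UNIV all_bool_eq if_True if_False)
  qed
  moreover have "ev (\<lambda>\<M>. \<forall>a b. (a, b) \<in> ?R \<M> \<longrightarrow> (\<exists>z. (z, a) \<in> Den p \<M> \<and> (z, b) \<in> Den q \<M>))"
    using 1 by eventually_elim blast
  ultimately show ?thesis using p q by blast
qed

lemma mono_if_inj:
  assumes m: "m \<in> hom C \<alpha> \<beta>" and inj: "ev (\<lambda>\<M>. single_valued ((Den m \<M>)\<inverse>))"
  shows "mono_arrow C m"
proof -
  have "u = v" if u: "u \<in> hom C w \<alpha>" and v: "v \<in> hom C w \<alpha>" and eq: "Comp C m u = Comp C m v" for w u v
  proof (rule hom_eqI[OF u v])
    show "ev (\<lambda>\<M>. Den u \<M> = Den v \<M>)"
      using Den_comp[OF u m] Den_comp[OF v m] ev_func[OF u] ev_func[OF v] ev_func[OF m] inj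
    proof eventually_elim
      case (elim \<M>)
      show ?case
      proof (rule func_eqI[OF elim(3,4)], rule subrelI)
        fix a b assume ab: "(a, b) \<in> Den u \<M>"
        obtain c where c: "(b, c) \<in> Den m \<M>" using ab elim(3,5) unfolding func_def by blast
        have "(a, c) \<in> Den v \<M> O Den m \<M>" using ab c elim(1,2) eq by auto
        then obtain b' where b': "(a, b') \<in> Den v \<M>" "(b', c) \<in> Den m \<M>" by blast
        have "b = b'" using elim(6) c b'(2) unfolding single_valued_def by blast
        then show "(a, b) \<in> Den v \<M>" using b'(1) by simp
      qed
    qed
  qed
  then show ?thesis using m unfolding mono_arrow_def by (simp add: hom_arr)
qed

text \<open>A monomorphism has equal kernel projections, and these enumerate all pairs with equal images.\<close>

lemma inj_if_mono:
  assumes m: "m \<in> hom C \<alpha> \<beta>" and mono: "mono_arrow C m"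
  shows "ev (\<lambda>\<M>. single_valued ((Den m \<M>)\<inverse>))"
proof -
  obtain P p q where p: "p \<in> hom C P \<alpha>" and q: "q \<in> hom C P \<alpha>" and pb: "is_pullback C m m p q"
    and z: "ev (\<lambda>\<M>. \<forall>a b. (a, b) \<in> Den m \<M> O (Den m \<M>)\<inverse> \<longrightarrow> (\<exists>z. (z, a) \<in> Den p \<M> \<and> (z, b) \<in> Den q \<M>))"
    using pullback_ex[OF m m] by blast
  have "Comp C m p = Comp C m q" using pb unfolding is_pullback_def by blast
  moreover have "Src C m = \<alpha>" "P \<in> Fml L" using m homD[OF p] by (simp_all add: hom_arr)
  ultimately have pq: "p = q" using mono p q unfolding mono_arrow_def Ob_C by blast
  show ?thesis
    using z ev_func[OF q]
  proof eventually_elim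
    case (elim \<M>)
    show ?case
    proof (rule single_valuedI)
      fix c a b assume "(c, a) \<in> (Den m \<M>)\<inverse>" "(c, b) \<in> (Den m \<M>)\<inverse>"
      then have "(a, b) \<in> Den m \<M> O (Den m \<M>)\<inverse>" by blast
      then obtain z where "(z, a) \<in> Den q \<M>" "(z, b) \<in> Den q \<M>" using elim(1) pq by blast
      then show "a = b" using elim(2) unfolding func_def single_valued_def by blast
    qed
  qed
qed

text \<open>
  The arrow induced by \<open>u\<close> is the relation \<open>e\<inverse>\<close> followed by \<open>u\<close>: surjectivity makes it total, and it is
  single-valued because \<open>u\<close> equalizes the kernel pair, which contains all pairs identified by \<open>e\<close>.
\<close>

lemma effective_epi_if_surj:
  assumes e: "e \<in> hom C \<alpha> \<beta>" and surj: "ev (\<lambda>\<M>. \<forall>b\<in>extension \<M> \<beta>. \<exists>a. (a, b) \<in> Den e \<M>)"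
  shows "effective_epi C e"
proof -
  obtain P p q where p: "p \<in> hom C P \<alpha>" and q: "q \<in> hom C P \<alpha>" and pb: "is_pullback C e e p q"
    and z: "ev (\<lambda>\<M>. \<forall>a b. (a, b) \<in> Den e \<M> O (Den e \<M>)\<inverse> \<longrightarrow> (\<exists>z. (z, a) \<in> Den p \<M> \<and> (z, b) \<in> Den q \<M>))"
    using pullback_ex[OF e e] by blast
  have "Comp C e p = Comp C e q" using pb unfolding is_pullback_def by blast
  then have "is_coequalizer C p q e"
  proof (rule is_coequalizerI[OF p q e])
    fix w u assume u: "u \<in> hom C \<alpha> w" and eq: "Comp C u p = Comp C u q"
    let ?R = "\<lambda>\<M>. (Den e \<M>)\<inverse> O Den u \<M>"
    have FR: "ev (\<lambda>\<M>. func (extension \<M> \<beta>) (extension \<M> w) (?R \<M>) \<and> Den e \<M> O ?R \<M> = Den u \<M>)"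
      using ev_func[OF e] ev_func[OF u] ev_func[OF q] surj z Den_comp[OF p u] Den_comp[OF q u]
    proof eventually_elim
      case (elim \<M>)
      have same: "y = y'" if "(b, y) \<in> ?R \<M>" "(b, y') \<in> ?R \<M>" for b y y'
      proof -
        obtain a a' where a: "(a, b) \<in> Den e \<M>" "(a, y) \<in> Den u \<M>" "(a', b) \<in> Den e \<M>" "(a', y') \<in> Den u \<M>"
          using \<open>(b, y) \<in> ?R \<M>\<close> \<open>(b, y') \<in> ?R \<M>\<close> by blast
        then obtain s where s: "(s, a) \<in> Den p \<M>" "(s, a') \<in> Den q \<M>" using elim(5) by blast
        have "(s, y) \<in> Den p \<M> O Den u \<M>" "(s, y') \<in> Den q \<M> O Den u \<M>" using s a by blast+
        moreover have "Den p \<M> O Den u \<M> = Den q \<M> O Den u \<M>" using elim(6,7) eq by simp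
        moreover have "single_valued (Den q \<M> O Den u \<M>)"
          using func_comp[OF elim(3,2)] unfolding func_def by blast
        ultimately show ?thesis unfolding single_valued_def by blast
      qed
      have F: "func (extension \<M> \<beta>) (extension \<M> w) (?R \<M>)"
        unfolding func_def
      proof (intro conjI ballI)
        show "?R \<M> \<subseteq> extension \<M> \<beta> \<times> extension \<M> w"
          using elim(1,2) unfolding func_def by blast
        show "\<exists>y. (b, y) \<in> ?R \<M>" if b: "b \<in> extension \<M> \<beta>" for b
        proof -
          obtain a where a: "(a, b) \<in> Den e \<M>" using elim(4) b by blast
          then have "a \<in> extension \<M> \<alpha>" using elim(1) unfolding func_def by blast
          then show ?thesis using a elim(2) unfolding func_def by blast
        qed
        show "single_valued (?R \<M>)" using same unfolding single_valued_def by blast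
      qed
      have "Den u \<M> \<subseteq> Den e \<M> O ?R \<M>"
      proof (rule subrelI)
        fix a y assume ay: "(a, y) \<in> Den u \<M>"
        then obtain b where "(a, b) \<in> Den e \<M>" using elim(1,2) unfolding func_def by blast
        then show "(a, y) \<in> Den e \<M> O ?R \<M>" using ay by blast
      qed
      then have "Den u \<M> = Den e \<M> O ?R \<M>" by (rule func_eqI[OF elim(2) func_comp[OF elim(1) F]])
      with F show ?case by simp
    qed
    have "definable L (fv \<beta>) (fv w) ?R"
      by (rule definable_relcomp[OF definable_converse[OF hom_definable[OF e]] hom_definable[OF u]])
    moreover have "Func \<beta> w ?R" unfolding Func_def using FR by eventually_elim blast
    ultimately obtain h where h: "h \<in> hom C \<beta> w" "ev (\<lambda>\<M>. Den h \<M> = ?R \<M>)"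
      using hom_ex[of \<beta> w ?R] homD[OF e] homD[OF u] by blast
    show "\<exists>!h. h \<in> hom C \<beta> w \<and> Comp C h e = u"
    proof (rule ex1I[of _ h])
      have "ev (\<lambda>\<M>. Den e \<M> O Den h \<M> = Den u \<M>)" using FR h(2) by eventually_elim simp
      then show "h \<in> hom C \<beta> w \<and> Comp C h e = u" using comp_eq_iff[OF e h(1) u] h(1) by blast
      fix k assume k: "k \<in> hom C \<beta> w \<and> Comp C k e = u"
      have "ev (\<lambda>\<M>. Den e \<M> O Den k \<M> = Den u \<M>)" using comp_eq_iff[OF e _ u] k by blast
      then have "ev (\<lambda>\<M>. Den h \<M> = Den k \<M>)"
        using h(2) ev_func[OF h(1)] ev_func[OF k[THEN conjunct1]] ev_func[OF e]
      proof eventually_elim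
        case (elim \<M>)
        have "Den h \<M> \<subseteq> Den k \<M>"
        proof (rule subrelI)
          fix b y assume "(b, y) \<in> Den h \<M>"
          then obtain a where a: "(a, b) \<in> Den e \<M>" "(a, y) \<in> Den u \<M>" using elim(2) by blast
          then obtain b' where b': "(a, b') \<in> Den e \<M>" "(b', y) \<in> Den k \<M>" using elim(1) by blast
          have "b' = b" using a(1) b'(1) elim(5) unfolding func_def single_valued_def by blast
          then show "(b, y) \<in> Den k \<M>" using b'(2) by simp
        qed
        then show ?case by (rule func_eqI[OF elim(3,4)])
      qed
      then show "k = h" using hom_eqI[OF h(1) k[THEN conjunct1]] by simp
    qed
  qed
  then show ?thesis using pb unfolding effective_epi_def by blast
qed

end

section \<open>Changes of variables and subobjects\<close>

lemma ext_EV: "finite V \<Longrightarrow> extension \<M> (EV V) = V \<rightarrow>\<^sub>E uni \<M>"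
  by (simp add: extension_def)

context syntactic
begin

definition admissible :: "'r fml \<Rightarrow> 'r fml \<Rightarrow> (int \<Rightarrow> int) \<Rightarrow> bool" where
  "admissible \<alpha> \<beta> \<sigma> \<longleftrightarrow> \<alpha> \<in> Fml L \<and> \<beta> \<in> Fml L \<and> \<sigma> ` fv \<beta> \<subseteq> fv \<alpha> \<and>
    ev (\<lambda>\<M>. \<forall>\<rho>\<in>extension \<M> \<alpha>. (\<lambda>w\<in>fv \<beta>. \<rho> (\<sigma> w)) \<in> extension \<M> \<beta>)"

lemma reidx_hom: "admissible \<alpha> \<beta> \<sigma> \<Longrightarrow> reidx \<alpha> \<beta> \<sigma> \<in> hom C \<alpha> \<beta>"
  and Den_reidx: "admissible \<alpha> \<beta> \<sigma> \<Longrightarrow> ev (\<lambda>\<M>. Den (reidx \<alpha> \<beta> \<sigma>) \<M> = graph \<alpha> \<beta> \<sigma> \<M>)"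
  using reidx[of \<alpha> \<beta> \<sigma>] unfolding admissible_def by blast+

lemma reidx_comp:
  assumes "admissible \<alpha> \<beta> \<sigma>" "admissible \<beta> \<gamma> \<tau>" "admissible \<alpha> \<gamma> \<upsilon>" "\<And>w. w \<in> fv \<gamma> \<Longrightarrow> \<upsilon> w = \<sigma> (\<tau> w)"
  shows "Comp C (reidx \<beta> \<gamma> \<tau>) (reidx \<alpha> \<beta> \<sigma>) = reidx \<alpha> \<gamma> \<upsilon>"
proof -
  have e: "ev (\<lambda>\<M>. \<forall>\<rho>\<in>extension \<M> \<alpha>. (\<lambda>w\<in>fv \<beta>. \<rho> (\<sigma> w)) \<in> extension \<M> \<beta>)"
    and sub: "\<tau> ` fv \<gamma> \<subseteq> fv \<beta>" using assms(1,2) unfolding admissible_def by blast+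
  have "ev (\<lambda>\<M>. Den (reidx \<alpha> \<beta> \<sigma>) \<M> O Den (reidx \<beta> \<gamma> \<tau>) \<M> = Den (reidx \<alpha> \<gamma> \<upsilon>) \<M>)"
    using e Den_reidx[OF assms(1)] Den_reidx[OF assms(2)] Den_reidx[OF assms(3)]
  proof eventually_elim
    case (elim \<M>)
    have r: "(\<lambda>w\<in>fv \<gamma>. (\<lambda>w\<in>fv \<beta>. \<rho> (\<sigma> w)) (\<tau> w)) = (\<lambda>w\<in>fv \<gamma>. \<rho> (\<upsilon> w))" for \<rho> :: "int \<Rightarrow> int"
    proof (rule restrict_ext)
      fix w assume "w \<in> fv \<gamma>"
      then show "(\<lambda>w\<in>fv \<beta>. \<rho> (\<sigma> w)) (\<tau> w) = \<rho> (\<upsilon> w)" using sub assms(4)[of w] by auto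
    qed
    have "(a, c) \<in> graph \<alpha> \<beta> \<sigma> \<M> O graph \<beta> \<gamma> \<tau> \<M> \<longleftrightarrow> (a, c) \<in> graph \<alpha> \<gamma> \<upsilon> \<M>" for a c
    proof
      assume "(a, c) \<in> graph \<alpha> \<beta> \<sigma> \<M> O graph \<beta> \<gamma> \<tau> \<M>"
      then obtain b where "(a, b) \<in> graph \<alpha> \<beta> \<sigma> \<M>" "(b, c) \<in> graph \<beta> \<gamma> \<tau> \<M>" by blast
      then show "(a, c) \<in> graph \<alpha> \<gamma> \<upsilon> \<M>" unfolding graph_iff using r[of a] by simp
    next
      assume "(a, c) \<in> graph \<alpha> \<gamma> \<upsilon> \<M>"
      then have "(a, (\<lambda>w\<in>fv \<beta>. a (\<sigma> w))) \<in> graph \<alpha> \<beta> \<sigma> \<M>" "((\<lambda>w\<in>fv \<beta>. a (\<sigma> w)), c) \<in> graph \<beta> \<gamma> \<tau> \<M>"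
        unfolding graph_iff using r[of a] elim(1) by simp_all
      then show "(a, c) \<in> graph \<alpha> \<beta> \<sigma> \<M> O graph \<beta> \<gamma> \<tau> \<M>" by (rule relcompI)
    qed
    then show ?case unfolding elim(2-4) by (intro set_eq_subset[THEN iffD2] conjI subrelI) blast+
  qed
  then show ?thesis
    using comp_eq_iff[OF reidx_hom[OF assms(1)] reidx_hom[OF assms(2)] reidx_hom[OF assms(3)]] by blast
qed

lemma restrict_extension: "\<rho> \<in> extension \<M> \<alpha> \<Longrightarrow> (\<lambda>w\<in>fv \<alpha>. \<rho> w) = \<rho>"
  unfolding extension_iff by (rule extensional_restrict) (simp add: PiE_def)

lemma admissible_sub:
  assumes "\<alpha> \<in> Fml L" "\<beta> \<in> Fml L" "fv \<alpha> = fv \<beta>" "ev (\<lambda>\<M>. extension \<M> \<alpha> \<subseteq> extension \<M> \<beta>)"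
  shows "admissible \<alpha> \<beta> (\<lambda>w. w)"
proof -
  have "ev (\<lambda>\<M>. \<forall>\<rho>\<in>extension \<M> \<alpha>. (\<lambda>w\<in>fv \<beta>. \<rho> w) \<in> extension \<M> \<beta>)"
    using assms(4)
  proof eventually_elim
    case (elim \<M>)
    show ?case
    proof
      fix \<rho> assume "\<rho> \<in> extension \<M> \<alpha>"
      then have m: "\<rho> \<in> extension \<M> \<beta>" using elim by blast
      show "(\<lambda>w\<in>fv \<beta>. \<rho> w) \<in> extension \<M> \<beta>" unfolding restrict_extension[OF m] by (rule m)
    qed
  qed
  then show ?thesis using assms(1-3) unfolding admissible_def by simp
qed

lemma admissible_pr:
  assumes "\<alpha> \<in> Fml L" "x \<in> fv \<alpha>"
  shows "admissible \<alpha> (eqv 0 0) (\<lambda>_. x)"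
proof -
  have "(\<lambda>w\<in>fv (eqv 0 0 :: 'r fml). \<rho> x) \<in> extension \<M> (eqv 0 0)"
    if \<rho>: "\<rho> \<in> extension \<M> \<alpha>" for \<M> :: "('r, int) struct" and \<rho>
    using reindex_PiE[of \<rho> "fv \<alpha>" "uni \<M>" "\<lambda>_. x" "{0}"] \<rho> assms by (simp add: extension_iff)
  then show ?thesis unfolding admissible_def using assms by (simp add: always_eventually)
qed

lemma admissible_EV: "\<alpha> \<in> Fml L \<Longrightarrow> admissible \<alpha> (EV (fv \<alpha>)) (\<lambda>w. w)"
  by (rule admissible_sub) (simp_all add: ext_EV extension_sub)

lemma Den_reidx_sub:
  assumes "admissible \<alpha> \<beta> (\<lambda>w. w)" "fv \<alpha> = fv \<beta>"
  shows "ev (\<lambda>\<M>. Den (reidx \<alpha> \<beta> (\<lambda>w. w)) \<M> = Id_on (extension \<M> \<alpha>))"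
  using Den_reidx[OF assms(1)]
proof eventually_elim
  case (elim \<M>)
  have "(a, b) \<in> graph \<alpha> \<beta> (\<lambda>w. w) \<M> \<longleftrightarrow> (a, b) \<in> Id_on (extension \<M> \<alpha>)" for a b
    unfolding graph_iff assms(2)[symmetric] Id_on_iff using restrict_extension[of a \<M> \<alpha>] by metis
  then show ?case unfolding elim by (intro set_eq_subset[THEN iffD2] conjI subrelI) blast+
qed

lemma iso_over_refl:
  assumes "m \<in> hom C \<alpha> X" "mono_arrow C m"
  shows "(m, m) \<in> iso_over C X"
proof -
  have id: "Ident C \<alpha> \<in> hom C \<alpha> \<alpha>" using ident homD[OF assms(1)] by blast
  have s: "Src C m = \<alpha>" "Tgt C m = X" "Src C (Ident C \<alpha>) = \<alpha>" "Tgt C (Ident C \<alpha>) = \<alpha>" "Ident C \<alpha> \<in> Ar C"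
    using assms id by (simp_all add: hom_arr)
  have "iso_arrow C (Ident C \<alpha>)"
    unfolding iso_arrow_def s using id s(5) comp_id_left[OF id] by blast
  then show ?thesis
    unfolding iso_over_def monos_into_def using assms s id comp_id_right[OF assms(1)] by auto
qed

text \<open>A formula in the variables \<open>V\<close> as a subobject of \<open>EV V\<close>: \<open>sub\<close> is the monomorphism, \<open>cls\<close> its class.\<close>

definition sub :: "int set \<Rightarrow> 'r fml \<Rightarrow> 'r syn_arrow" where
  "sub V \<alpha> = reidx \<alpha> (EV V) (\<lambda>w. w)"

lemma sub:
  assumes "\<alpha> \<in> Fml L" "fv \<alpha> = V"
  shows "sub V \<alpha> \<in> hom C \<alpha> (EV V)" "ev (\<lambda>\<M>. Den (sub V \<alpha>) \<M> = Id_on (extension \<M> \<alpha>))"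
    "mono_arrow C (sub V \<alpha>)"
proof -
  have r: "admissible \<alpha> (EV V) (\<lambda>w. w)" using admissible_EV[OF assms(1)] assms(2) by simp
  have "fv \<alpha> = fv (EV V :: 'r fml)" using assms(2) finite_fv[of \<alpha>] by simp
  from Den_reidx_sub[OF r this]
  show d: "ev (\<lambda>\<M>. Den (sub V \<alpha>) \<M> = Id_on (extension \<M> \<alpha>))" unfolding sub_def .
  show h: "sub V \<alpha> \<in> hom C \<alpha> (EV V)" unfolding sub_def by (rule reidx_hom[OF r])
  have "ev (\<lambda>\<M>. single_valued ((Den (sub V \<alpha>) \<M>)\<inverse>))"
    using d by eventually_elim (simp add: single_valued_def Id_on_iff)
  then show "mono_arrow C (sub V \<alpha>)" by (rule mono_if_inj[OF h])
qed

definition cls :: "int set \<Rightarrow> 'r fml \<Rightarrow> 'r syn_arrow set" where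
  "cls V \<alpha> = iso_over C (EV V) `` {sub V \<alpha>}"

lemma sub_in_cls: "\<alpha> \<in> Fml L \<Longrightarrow> fv \<alpha> = V \<Longrightarrow> sub V \<alpha> \<in> cls V \<alpha>"
  unfolding cls_def using iso_over_refl[OF sub(1,3)] by blast

lemma cls_carrier: "\<alpha> \<in> Fml L \<Longrightarrow> fv \<alpha> = V \<Longrightarrow> cls V \<alpha> \<in> carrier (Sub C (EV V))"
  unfolding cls_def Sub_def using sub(1,3)[of \<alpha> V]
  by (auto simp: monos_into_def hom_arr intro!: quotientI)

lemma Sub_le:
  "le (Sub D X) A B \<longleftrightarrow> (\<exists>m\<in>A. \<exists>m'\<in>B. \<exists>h\<in>hom D (Src D m) (Src D m'). Comp D m' h = m)"
  by (simp add: Sub_def)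

text \<open>
  A union of formulas in the same variables is their join: maps out of the pieces into a subobject
  agree on overlaps because the subobject is injective, so their union is again a function.
\<close>

lemma Sub_join:
  assumes A: "finite A" "\<And>a. a \<in> A \<Longrightarrow> a \<in> Fml L" "\<And>a. a \<in> A \<Longrightarrow> fv a = V"
    and X: "X \<in> Fml L" "fv X = V" and un: "ev (\<lambda>\<M>. extension \<M> X = (\<Union>a\<in>A. extension \<M> a))"
  shows "least (Sub C (EV V)) (cls V X) (Upper (Sub C (EV V)) (cls V ` A))"
proof -
  let ?S = "Sub C (EV V)"
  have V: "finite V" using X(2) finite_fv by blast
  have up: "le ?S (cls V a) (cls V X)" if a: "a \<in> A" for a
  proof -
    have "ev (\<lambda>\<M>. extension \<M> a \<subseteq> extension \<M> X)" using un by eventually_elim (use a in blast)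
    then have r: "admissible a X (\<lambda>w. w)" using admissible_sub[of a X] A(2,3)[OF a] X by simp
    have ra: "admissible a (EV V) (\<lambda>w. w)" and rX: "admissible X (EV V) (\<lambda>w. w)"
      using admissible_EV[of a] admissible_EV[of X] A(2,3)[OF a] X by simp_all
    have "Comp C (sub V X) (reidx a X (\<lambda>w. w)) = sub V a"
      unfolding sub_def by (rule reidx_comp[OF r rX ra]) simp
    moreover have "reidx a X (\<lambda>w. w) \<in> hom C (Src C (sub V a)) (Src C (sub V X))"
      using reidx_hom[OF r] sub(1)[OF A(2,3)[OF a]] sub(1)[OF X] by (simp add: hom_arr)
    ultimately show ?thesis
      unfolding Sub_le using sub_in_cls[OF A(2,3)[OF a]] sub_in_cls[OF X] by blast
  qed
  have "le ?S (cls V X) u" if u: "u \<in> Upper ?S (cls V ` A)" for u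
  proof -
    have uc: "u \<in> carrier ?S" and ua: "\<And>a. a \<in> A \<Longrightarrow> le ?S (cls V a) u"
      using u cls_carrier[OF A(2,3)] unfolding Upper_def by auto
    from uc obtain m0 where m0: "m0 \<in> monos_into C (EV V)" "u = iso_over C (EV V) `` {m0}"
      unfolding Sub_def by (auto elim: quotientE)
    define Z where "Z = Src C m0"
    have m0h: "m0 \<in> hom C Z (EV V)" and m0m: "mono_arrow C m0"
      using m0(1) unfolding monos_into_def mono_arrow_def Z_def by (auto simp: hom_arr)
    have m0u: "m0 \<in> u" unfolding m0(2) using iso_over_refl[OF m0h m0m] by blast
    have "\<exists>n. n \<in> hom C a Z \<and> Comp C m0 n = sub V a" if a: "a \<in> A" for a
    proof -
      note sa = sub(1)[OF A(2,3)[OF a]]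
      \<comment> \<open>The order relates some members of the two classes; isomorphisms carry it to \<open>sub V a\<close> and \<open>m0\<close>.\<close>
      obtain m1 m2 h where h: "m1 \<in> cls V a" "m2 \<in> u" "h \<in> hom C (Src C m1) (Src C m2)" "Comp C m2 h = m1"
        using ua[OF a] unfolding Sub_le by blast
      obtain h1 where h1: "h1 \<in> hom C (Src C (sub V a)) (Src C m1)" "Comp C m1 h1 = sub V a"
        and m1: "m1 \<in> Ar C" "Tgt C m1 = EV V"
        using h(1) unfolding cls_def iso_over_def monos_into_def mono_arrow_def by blast
      obtain k where k: "k \<in> hom C (Src C m0) (Src C m2)" "iso_arrow C k" "Comp C m2 k = m0"
        and m2: "m2 \<in> Ar C" "Tgt C m2 = EV V"
        using h(2) unfolding m0(2) iso_over_def monos_into_def mono_arrow_def by blast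
      have ks: "Src C k = Z" "Tgt C k = Src C m2" and kh: "k \<in> hom C Z (Src C m2)"
        using k(1) by (simp_all add: hom_arr Z_def)
      obtain k' where k': "k' \<in> hom C (Src C m2) Z" "Comp C k k' = Ident C (Src C m2)"
        using k(2) unfolding iso_arrow_def ks by blast
      have m1h: "m1 \<in> hom C (Src C m1) (EV V)" and m2h: "m2 \<in> hom C (Src C m2) (EV V)"
        using m1 m2 by (simp_all add: hom_arr)
      have h1h: "h1 \<in> hom C a (Src C m1)" using h1(1) sa by (simp add: hom_arr)
      note hh1 = comp_hom[OF h1h h(3)]
      have "Comp C m0 (Comp C k' (Comp C h h1)) = Comp C (Comp C m2 k) (Comp C k' (Comp C h h1))"
        by (simp only: k(3))
      also have "\<dots> = Comp C m2 (Comp C k (Comp C k' (Comp C h h1)))"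
        by (rule comp_assoc[OF comp_hom[OF hh1 k'(1)] kh m2h, symmetric])
      also have "\<dots> = Comp C m2 (Comp C (Comp C k k') (Comp C h h1))"
        by (simp only: comp_assoc[OF hh1 k'(1) kh])
      also have "\<dots> = Comp C m2 (Comp C h h1)" by (simp only: k'(2) comp_id_left[OF hh1])
      also have "\<dots> = Comp C (Comp C m2 h) h1" by (rule comp_assoc[OF h1h h(3) m2h])
      also have "\<dots> = sub V a" by (simp only: h(4) h1(2))
      finally show ?thesis using comp_hom[OF hh1 k'(1)] by blast
    qed
    then obtain n where n: "\<And>a. a \<in> A \<Longrightarrow> n a \<in> hom C a Z" "\<And>a. a \<in> A \<Longrightarrow> Comp C m0 (n a) = sub V a"
      by metis
    let ?R = "\<lambda>\<M>. \<Union>a\<in>A. Den (n a) \<M>"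
    have "ev (\<lambda>\<M>. \<forall>a\<in>A. func (extension \<M> a) (extension \<M> Z) (Den (n a) \<M>) \<and>
        Den (n a) \<M> O Den m0 \<M> = Id_on (extension \<M> a))"
    proof (rule eventually_ball_finite[OF A(1)], rule ballI)
      fix a assume a: "a \<in> A"
      show "ev (\<lambda>\<M>. func (extension \<M> a) (extension \<M> Z) (Den (n a) \<M>) \<and>
        Den (n a) \<M> O Den m0 \<M> = Id_on (extension \<M> a))"
        using ev_func[OF n(1)[OF a]] Den_comp[OF n(1)[OF a] m0h] sub(2)[OF A(2,3)[OF a]]
        by eventually_elim (simp add: n(2)[OF a])
    qed
    then have FR: "ev (\<lambda>\<M>. func (extension \<M> X) (extension \<M> Z) (?R \<M>) \<and>
        ?R \<M> O Den m0 \<M> = Id_on (extension \<M> X))"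
      using un inj_if_mono[OF m0h m0m] ev_func[OF m0h]
    proof eventually_elim
      case (elim \<M>)
      have pt: "(y, \<rho>) \<in> Den m0 \<M>" if "(\<rho>, y) \<in> ?R \<M>" for \<rho> y
      proof -
        obtain a where a: "a \<in> A" "(\<rho>, y) \<in> Den (n a) \<M>" using \<open>(\<rho>, y) \<in> ?R \<M>\<close> by blast
        then have "y \<in> extension \<M> Z" using elim(1) unfolding func_def by blast
        then obtain c where c: "(y, c) \<in> Den m0 \<M>" using elim(4) unfolding func_def by blast
        then have "(\<rho>, c) \<in> Id_on (extension \<M> a)" using elim(1) a by blast
        then show ?thesis using c by (simp add: Id_on_iff)
      qed
      have F: "func (extension \<M> X) (extension \<M> Z) (?R \<M>)"
        unfolding func_def
      proof (intro conjI ballI)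
        show "?R \<M> \<subseteq> extension \<M> X \<times> extension \<M> Z"
          using elim(1) unfolding elim(2) func_def by blast
        show "\<exists>y. (\<rho>, y) \<in> ?R \<M>" if "\<rho> \<in> extension \<M> X" for \<rho>
        proof -
          obtain a where a: "a \<in> A" "\<rho> \<in> extension \<M> a"
            using \<open>\<rho> \<in> extension \<M> X\<close> unfolding elim(2) by blast
          then obtain y where "(\<rho>, y) \<in> Den (n a) \<M>" using elim(1) unfolding func_def by blast
          with a(1) show ?thesis by blast
        qed
        show "single_valued (?R \<M>)"
          using pt elim(3) unfolding single_valued_def converse_iff by blast
      qed
      have "func (extension \<M> X) (extension \<M> (EV V)) (?R \<M> O Den m0 \<M>)"
        by (rule func_comp[OF F elim(4)])
      moreover have "func (extension \<M> X) (extension \<M> (EV V)) (Id_on (extension \<M> X))"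
        by (rule func_Id_on) (use X V extension_sub[of \<M> X] in \<open>simp add: ext_EV\<close>)
      moreover have "?R \<M> O Den m0 \<M> \<subseteq> Id_on (extension \<M> X)"
      proof (rule subrelI)
        fix \<rho> c assume "(\<rho>, c) \<in> ?R \<M> O Den m0 \<M>"
        then obtain a where a: "a \<in> A" "(\<rho>, c) \<in> Den (n a) \<M> O Den m0 \<M>" by blast
        then have "(\<rho>, c) \<in> Id_on (extension \<M> a)" using elim(1) by simp
        then show "(\<rho>, c) \<in> Id_on (extension \<M> X)" using a(1) unfolding elim(2) Id_on_iff by blast
      qed
      ultimately have "?R \<M> O Den m0 \<M> = Id_on (extension \<M> X)" by (rule func_eqI)
      with F show ?case by blast
    qed
    have ZF: "Z \<in> Fml L" using homD[OF m0h] by blast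
    have "definable L (fv X) (fv Z) ?R"
      by (rule definable_UN[OF A(1) finite_fv finite_fv]) (metis A(3) X(2) hom_definable n(1))
    moreover have "Func X Z ?R" unfolding Func_def using FR by eventually_elim blast
    ultimately obtain h where h: "h \<in> hom C X Z" "ev (\<lambda>\<M>. Den h \<M> = ?R \<M>)"
      using hom_ex[OF X(1) ZF] by blast
    have "ev (\<lambda>\<M>. Den h \<M> O Den m0 \<M> = Den (sub V X) \<M>)"
      using FR h(2) sub(2)[OF X] by eventually_elim simp
    then have "Comp C m0 h = sub V X" using comp_eq_iff[OF h(1) m0h sub(1)[OF X]] by blast
    moreover have "h \<in> hom C (Src C (sub V X)) (Src C m0)"
      using h(1) sub(1)[OF X] by (simp add: hom_arr Z_def)
    ultimately show ?thesis unfolding Sub_le using sub_in_cls[OF X] m0u by blast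
  qed
  then show ?thesis
    using up cls_carrier[OF X] unfolding least_def Upper_def by auto
qed

end

section \<open>Functors to sets\<close>

lemma hom_SetCat: "a \<in> hom SetCat A B \<longleftrightarrow> (\<exists>f\<in>A \<rightarrow>\<^sub>E B. a = (A, f, B))"
  by (cases a) (auto simp: hom_def SetCat_def)

lemma hom_SetCatD:
  assumes "a \<in> hom SetCat A B"
  shows "a = (A, fn a, B)" "fn a \<in> A \<rightarrow>\<^sub>E B"
  using assms by (auto simp: hom_SetCat fn_def)

lemma Comp_SetCat: "Comp SetCat (B, g, D) (A, f, B') = (A, compose A g f, D)"
  by (simp add: SetCat_def)

lemma fn_Comp:
  assumes "f \<in> hom SetCat A B" "g \<in> hom SetCat B D" "z \<in> A"
  shows "fn (Comp SetCat g f) z = fn g (fn f z)"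
proof -
  obtain f' g' where "f = (A, f', B)" "g = (B, g', D)" using assms unfolding hom_SetCat by blast
  then show ?thesis using assms(3) by (simp add: Comp_SetCat fn_def compose_eq)
qed

text \<open>A point of a limit of sets is a compatible family of points.\<close>

lemma set_limit:
  fixes leg :: "'j \<Rightarrow> 'u set_arrow"
  assumes lim: "is_limit J SetCat D c leg"
    and D: "\<And>u. u \<in> Ar J \<Longrightarrow> Src J u \<in> Ob J \<and> Tgt J u \<in> Ob J \<and>
      on_ar D u \<in> hom SetCat (on_ob D (Src J u)) (on_ob D (Tgt J u))"
    and x: "\<And>j. j \<in> Ob J \<Longrightarrow> x j \<in> on_ob D j"
    and comp: "\<And>u. u \<in> Ar J \<Longrightarrow> fn (on_ar D u) (x (Src J u)) = x (Tgt J u)"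
  shows "\<exists>!z. z \<in> c \<and> (\<forall>j\<in>Ob J. fn (leg j) z = x j)"
proof -
  \<comment> \<open>Points are arrows from a singleton; any element can serve as its only one.\<close>
  define e :: 'u where "e = undefined"
  define pt where "pt y B = ({e}, (\<lambda>_\<in>{e}. y), B)" for y :: 'u and B :: "'u set"
  have pt: "pt y B \<in> hom SetCat {e} B" if "y \<in> B" for y B
    unfolding hom_SetCat pt_def using that by auto
  have ptE: "h = pt (fn h e) B" "fn h e \<in> B" if "h \<in> hom SetCat {e} B" for h B
  proof -
    obtain f where f: "f \<in> {e} \<rightarrow>\<^sub>E B" "h = ({e}, f, B)"
      using \<open>h \<in> hom SetCat {e} B\<close> unfolding hom_SetCat by blast
    then show "fn h e \<in> B" by (auto simp: fn_def)
    have "f = (\<lambda>_\<in>{e}. f e)"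
    proof
      fix z show "f z = (\<lambda>_\<in>{e}. f e) z" using PiE_arb[OF f(1), of z] by (cases "z = e") simp_all
    qed
    then show "h = pt (fn h e) B" using f(2) by (simp add: pt_def fn_def)
  qed
  have cp: "Comp SetCat a (pt y A) = pt (fn a y) B" if "a \<in> hom SetCat A B" for a A B y
  proof -
    obtain f where f: "a = (A, f, B)" using \<open>a \<in> hom SetCat A B\<close> unfolding hom_SetCat by blast
    show ?thesis unfolding f pt_def Comp_SetCat by (simp add: fn_def compose_def cong: restrict_cong)
  qed
  have cone: "is_cone J SetCat D c leg" using lim unfolding is_limit_def by blast
  have leg: "leg j \<in> hom SetCat c (on_ob D j)" if "j \<in> Ob J" for j
    using cone that unfolding is_cone_def by blast
  have pc: "is_cone J SetCat D {e} (\<lambda>j. pt (x j) (on_ob D j))"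
    unfolding is_cone_def
  proof (intro conjI ballI)
    show "{e} \<in> Ob SetCat" by (simp add: SetCat_def)
    show "pt (x j) (on_ob D j) \<in> hom SetCat {e} (on_ob D j)" if "j \<in> Ob J" for j
      by (rule pt[OF x[OF that]])
    show "Comp SetCat (on_ar D u) (pt (x (Src J u)) (on_ob D (Src J u))) = pt (x (Tgt J u)) (on_ob D (Tgt J u))"
      if "u \<in> Ar J" for u
      using cp[of "on_ar D u"] D[OF that] comp[OF that] by metis
  qed
  then have u: "\<exists>!h. h \<in> hom SetCat {e} c \<and> (\<forall>j\<in>Ob J. Comp SetCat (leg j) h = pt (x j) (on_ob D j))"
    using lim unfolding is_limit_def by blast
  have pt_inj: "y = y'" if "pt y B = pt y' B" for y y' :: 'u and B
    using that unfolding pt_def by (metis Pair_inject restrict_apply' singletonI)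
  have key: "pt z c \<in> hom SetCat {e} c \<and> (\<forall>j\<in>Ob J. Comp SetCat (leg j) (pt z c) = pt (x j) (on_ob D j)) \<longleftrightarrow>
    z \<in> c \<and> (\<forall>j\<in>Ob J. fn (leg j) z = x j)" for z
  proof -
    have "pt z c \<in> hom SetCat {e} c \<longleftrightarrow> z \<in> c"
    proof
      assume "pt z c \<in> hom SetCat {e} c"
      from ptE[OF this] show "z \<in> c" by (metis pt_inj)
    qed (rule pt)
    moreover have "Comp SetCat (leg j) (pt z c) = pt (x j) (on_ob D j) \<longleftrightarrow> fn (leg j) z = x j"
      if "j \<in> Ob J" for j
      unfolding cp[OF leg[OF that]] by (rule iffI, erule pt_inj, simp)
    ultimately show ?thesis by blast
  qed
  from u obtain h where h: "h \<in> hom SetCat {e} c" "\<forall>j\<in>Ob J. Comp SetCat (leg j) h = pt (x j) (on_ob D j)"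
    by blast
  have hp: "h = pt (fn h e) c" by (rule ptE(1)[OF h(1)])
  show ?thesis
  proof (rule ex1I[of _ "fn h e"])
    have "pt (fn h e) c \<in> hom SetCat {e} c \<and>
        (\<forall>j\<in>Ob J. Comp SetCat (leg j) (pt (fn h e) c) = pt (x j) (on_ob D j))"
      using h unfolding hp[symmetric] by blast
    then show "fn h e \<in> c \<and> (\<forall>j\<in>Ob J. fn (leg j) (fn h e) = x j)" unfolding key .
    fix z assume "z \<in> c \<and> (\<forall>j\<in>Ob J. fn (leg j) z = x j)"
    then have "pt z c = h" unfolding key[symmetric] using u h by blast
    then have "pt z c = pt (fn h e) c" by (simp only: hp[symmetric])
    then show "z = fn h e" by (rule pt_inj)
  qed
qed

text \<open>
  Diagrams of height one: no two edges of \<open>E\<close> are composable, so composition with identities is the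
  only case, and taking the outer end points gives the right answer for it.
\<close>

definition shape :: "nat \<Rightarrow> (nat \<times> nat) set \<Rightarrow> (nat, nat) cat" where
  "shape p E = \<lparr>Ob = {..<p}, Ar = prod_encode ` ((\<lambda>i. (i, i)) ` {..<p} \<union> E),
    Src = fst \<circ> prod_decode, Tgt = snd \<circ> prod_decode, Ident = (\<lambda>i. prod_encode (i, i)),
    Comp = (\<lambda>g f. prod_encode (fst (prod_decode f), snd (prod_decode g)))\<rparr>"

lemma shape_simps [simp]:
  "Ob (shape p E) = {..<p}" "Ar (shape p E) = prod_encode ` ((\<lambda>i. (i, i)) ` {..<p} \<union> E)"
  "Src (shape p E) (prod_encode (i, j)) = i" "Tgt (shape p E) (prod_encode (i, j)) = j"
  "Ident (shape p E) i = prod_encode (i, i)"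
  "Comp (shape p E) (prod_encode (k, l)) (prod_encode (i, j)) = prod_encode (i, l)"
  by (simp_all add: shape_def)

lemma shape_ArE:
  assumes "u \<in> Ar (shape p E)"
  obtains i where "i < p" "u = prod_encode (i, i)" | i j where "(i, j) \<in> E" "u = prod_encode (i, j)"
  using assms by auto

definition height_one :: "nat \<Rightarrow> (nat \<times> nat) set \<Rightarrow> bool" where
  "height_one p E \<longleftrightarrow> E \<subseteq> {..<p} \<times> {..<p} \<and> fst ` E \<inter> snd ` E = {}"

lemma height_oneD:
  assumes "height_one p E" "(i, j) \<in> E"
  shows "i < p" "j < p" "i \<noteq> j" "(j, k) \<notin> E" "(k, i) \<notin> E"
proof -
  have d: "fst ` E \<inter> snd ` E = {}" and s: "E \<subseteq> {..<p} \<times> {..<p}" using assms(1) unfolding height_one_def by blast+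
  have i: "i \<in> fst ` E" and j: "j \<in> snd ` E" using assms(2) by force+
  show "i < p" "j < p" using s assms(2) by auto
  show "i \<noteq> j" using d i j by blast
  show "(j, k) \<notin> E" using d j by force
  show "(k, i) \<notin> E" using d i by force
qed

lemma category_shape:
  assumes E: "height_one p E"
  shows "category (shape p E)"
  unfolding category_def
proof (intro conjI ballI impI)
  fix u assume u: "u \<in> Ar (shape p E)"
  have "Src (shape p E) u \<in> Ob (shape p E) \<and> Tgt (shape p E) u \<in> Ob (shape p E) \<and>
    Comp (shape p E) u (Ident (shape p E) (Src (shape p E) u)) = u \<and>
    Comp (shape p E) (Ident (shape p E) (Tgt (shape p E) u)) u = u"
    using u by (rule shape_ArE) (simp_all add: height_oneD(1,2)[OF E])
  then show "Src (shape p E) u \<in> Ob (shape p E)" "Tgt (shape p E) u \<in> Ob (shape p E)"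
    "Comp (shape p E) u (Ident (shape p E) (Src (shape p E) u)) = u"
    "Comp (shape p E) (Ident (shape p E) (Tgt (shape p E) u)) u = u"
    by blast+
  fix v assume v: "v \<in> Ar (shape p E)"
  show "Comp (shape p E) v u \<in> hom (shape p E) (Src (shape p E) u) (Tgt (shape p E) v)"
    if t: "Tgt (shape p E) u = Src (shape p E) v"
    using u v
  proof (elim shape_ArE)
    fix i j i' j' assume e: "(i, j) \<in> E" "u = prod_encode (i, j)" "(i', j') \<in> E" "v = prod_encode (i', j')"
    then show ?thesis using t height_oneD(4)[OF E e(1), of j'] by simp
  qed (use t in \<open>auto simp: hom_def\<close>)
  fix w assume w: "w \<in> Ar (shape p E)"
  obtain i j i' j' k l where "u = prod_encode (i, j)" "v = prod_encode (i', j')" "w = prod_encode (k, l)"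
    by (metis prod_decode_inverse surj_pair)
  then show "Comp (shape p E) w (Comp (shape p E) v u) = Comp (shape p E) (Comp (shape p E) w v) u"
    by simp
qed (auto simp: hom_def)

locale set_functor = syntactic L T for L :: "'r signature" and T :: "'r fml set" +
  fixes F :: "('r fml, 'r syn_arrow, 'u set, 'u set_arrow) fnctr"
  assumes F_functor: "is_functor (Syn L T) SetCat F"
    and limits: "preserves_finite_limits (Syn L T) SetCat F"
    and epis: "\<And>g. effective_epi (Syn L T) g \<Longrightarrow> surjection (on_ar F g)"
    and joins: "\<And>X. X \<in> Ob (Syn L T) \<Longrightarrow>
      join_hom (Sub (Syn L T) X) (Sub SetCat (on_ob F X)) (Sub_map SetCat F X)"
    and nonempty: "on_ob F (eqv 0 0) \<noteq> {}"
begin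

abbreviation "Fo \<equiv> on_ob F"
abbreviation "Fa f \<equiv> fn (on_ar F f)"

lemma F_hom:
  assumes "f \<in> hom C \<alpha> \<beta>"
  shows "on_ar F f \<in> hom SetCat (Fo \<alpha>) (Fo \<beta>)" "Fa f \<in> Fo \<alpha> \<rightarrow>\<^sub>E Fo \<beta>"
    "on_ar F f = (Fo \<alpha>, Fa f, Fo \<beta>)"
proof -
  show h: "on_ar F f \<in> hom SetCat (Fo \<alpha>) (Fo \<beta>)"
    using F_functor assms unfolding is_functor_def hom_arr by blast
  show "Fa f \<in> Fo \<alpha> \<rightarrow>\<^sub>E Fo \<beta>" "on_ar F f = (Fo \<alpha>, Fa f, Fo \<beta>)" using hom_SetCatD[OF h] by blast+
qed

lemma Fa_mem: "f \<in> hom C \<alpha> \<beta> \<Longrightarrow> z \<in> Fo \<alpha> \<Longrightarrow> Fa f z \<in> Fo \<beta>"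
  using F_hom(2) by blast

lemma Fa_comp:
  assumes "f \<in> hom C \<alpha> \<beta>" "g \<in> hom C \<beta> \<gamma>" "z \<in> Fo \<alpha>"
  shows "Fa (Comp C g f) z = Fa g (Fa f z)"
proof -
  have "f \<in> Ar C" "g \<in> Ar C" "Tgt C f = Src C g" using assms by (simp_all add: hom_arr)
  then have "on_ar F (Comp C g f) = Comp SetCat (on_ar F g) (on_ar F f)"
    using F_functor unfolding is_functor_def by blast
  then show ?thesis using fn_Comp[OF F_hom(1)[OF assms(1)] F_hom(1)[OF assms(2)] assms(3)] by simp
qed

lemma Fa_ident:
  assumes "\<alpha> \<in> Fml L" "z \<in> Fo \<alpha>"
  shows "Fa (Ident C \<alpha>) z = z"
proof -
  have "on_ar F (Ident C \<alpha>) = Ident SetCat (Fo \<alpha>)" using F_functor assms(1) unfolding is_functor_def by simp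
  then show ?thesis using assms(2) by (simp add: SetCat_def fn_def)
qed

text \<open>
  Limits of height one transfer from the extensions in almost all structures to \<open>F\<close>. Twice a limit
  of sets is read off: for \<open>Syn(T)\<close> by \<open>limit_arrow\<close>, for the values of \<open>F\<close> by \<open>set_limit\<close>.
\<close>

lemma F_limit:
  assumes E: "height_one p E" and obs: "\<And>i. i < p \<Longrightarrow> obs i \<in> Fml L"
    and ar: "\<And>i j. (i, j) \<in> E \<Longrightarrow> ar i j \<in> hom C (obs i) (obs j)"
    and c: "c \<in> Fml L" and leg: "\<And>i. i < p \<Longrightarrow> leg i \<in> hom C c (obs i)"
    and cone: "\<And>i j. (i, j) \<in> E \<Longrightarrow> Comp C (ar i j) (leg i) = leg j"
    and lim: "ev (\<lambda>\<M>. \<forall>x. (\<forall>i<p. x i \<in> extension \<M> (obs i)) \<longrightarrow>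
      (\<forall>(i, j)\<in>E. (x i, x j) \<in> Den (ar i j) \<M>) \<longrightarrow>
      (\<exists>!z. z \<in> extension \<M> c \<and> (\<forall>i<p. (z, x i) \<in> Den (leg i) \<M>)))"
    and x: "\<And>i. i < p \<Longrightarrow> x i \<in> Fo (obs i)" "\<And>i j. (i, j) \<in> E \<Longrightarrow> Fa (ar i j) (x i) = x j"
  shows "\<exists>!z. z \<in> Fo c \<and> (\<forall>i<p. Fa (leg i) z = x i)"
proof -
  let ?J = "shape p E"
  define G where "G = \<lparr>on_ob = obs, on_ar = (\<lambda>u. let (i, j) = prod_decode u in
    if i = j then Ident C (obs i) else ar i j)\<rparr>"
  have G_ob: "on_ob G = obs" by (simp add: G_def)
  have G_id: "on_ar G (prod_encode (i, i)) = Ident C (obs i)" for i by (simp add: G_def)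
  have G_ar: "on_ar G (prod_encode (i, j)) = ar i j" if "(i, j) \<in> E" for i j
    using height_oneD(3)[OF E that] by (simp add: G_def)
  have id: "Ident C (obs i) \<in> hom C (obs i) (obs i)" if "i < p" for i using ident[OF obs[OF that]] by blast
  have fE: "finite E" using E unfolding height_one_def by (meson finite_SigmaI finite_lessThan finite_subset)
  have G_hom: "on_ar G u \<in> hom C (obs (Src ?J u)) (obs (Tgt ?J u))" if "u \<in> Ar ?J" for u
    using that by (rule shape_ArE) (simp_all add: G_id G_ar id ar)
  have functG: "is_functor ?J C G"
    unfolding is_functor_def G_ob
  proof (intro conjI ballI impI)
    show "obs i \<in> Ob C" if "i \<in> Ob ?J" for i using obs that by simp
    show "on_ar G u \<in> hom C (obs (Src ?J u)) (obs (Tgt ?J u))" if "u \<in> Ar ?J" for u by (rule G_hom[OF that])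
    show "on_ar G (Ident ?J i) = Ident C (obs i)" if "i \<in> Ob ?J" for i by (simp add: G_id)
    fix u v assume u: "u \<in> Ar ?J" and v: "v \<in> Ar ?J" and t: "Tgt ?J u = Src ?J v"
    show "on_ar G (Comp ?J v u) = Comp C (on_ar G v) (on_ar G u)"
      using u
    proof (rule shape_ArE)
      fix i assume i: "i < p" "u = prod_encode (i, i)"
      obtain k l where kl: "v = prod_encode (k, l)" by (metis prod_decode_inverse surj_pair)
      have "Comp ?J v u = v" using t by (simp add: i(2) kl)
      moreover have "on_ar G v \<in> hom C (obs i) (obs l)" using G_hom[OF v] t by (simp add: i(2) kl)
      ultimately show ?thesis by (simp add: i(2) G_id comp_id_right)
    next
      fix i j assume ij: "(i, j) \<in> E" "u = prod_encode (i, j)"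
      show ?thesis
        using v
      proof (rule shape_ArE)
        fix k assume k: "k < p" "v = prod_encode (k, k)"
        then have "k = j" using t ij(2) by simp
        then show ?thesis
          using comp_id_left[OF ar[OF ij(1)]] by (simp add: k(2) ij(2) G_id G_ar[OF ij(1)])
      next
        fix k l assume kl: "(k, l) \<in> E" "v = prod_encode (k, l)"
        then show ?thesis using t ij(2) height_oneD(4)[OF E ij(1), of l] by simp
      qed
    qed
  qed
  have cone_iff: "is_cone ?J C G c' leg' \<longleftrightarrow> c' \<in> Fml L \<and> (\<forall>i<p. leg' i \<in> hom C c' (obs i)) \<and>
      (\<forall>(i, j)\<in>E. Comp C (ar i j) (leg' i) = leg' j)" for c' leg'
  proof
    assume k: "is_cone ?J C G c' leg'"
    have "Comp C (ar i j) (leg' i) = leg' j" if "(i, j) \<in> E" for i j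
    proof -
      have "prod_encode (i, j) \<in> Ar ?J" using that by simp
      with k have "Comp C (on_ar G (prod_encode (i, j))) (leg' (Src ?J (prod_encode (i, j)))) =
          leg' (Tgt ?J (prod_encode (i, j)))" unfolding is_cone_def by blast
      then show ?thesis by (simp add: G_ar[OF that])
    qed
    moreover have "leg' i \<in> hom C c' (obs i)" if "i < p" for i
      using k that unfolding is_cone_def G_ob by simp
    moreover have "c' \<in> Fml L" using k unfolding is_cone_def by simp
    ultimately show "c' \<in> Fml L \<and> (\<forall>i<p. leg' i \<in> hom C c' (obs i)) \<and>
      (\<forall>(i, j)\<in>E. Comp C (ar i j) (leg' i) = leg' j)" by blast
  next
    assume k: "c' \<in> Fml L \<and> (\<forall>i<p. leg' i \<in> hom C c' (obs i)) \<and>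
      (\<forall>(i, j)\<in>E. Comp C (ar i j) (leg' i) = leg' j)"
    have "Comp C (on_ar G u) (leg' (Src ?J u)) = leg' (Tgt ?J u)" if "u \<in> Ar ?J" for u
      using that
    proof (rule shape_ArE)
      fix i assume i: "i < p" "u = prod_encode (i, i)"
      then have "leg' i \<in> hom C c' (obs i)" using k by blast
      then show ?thesis by (simp add: i(2) G_id comp_id_left)
    next
      fix i j assume ij: "(i, j) \<in> E" "u = prod_encode (i, j)"
      then show ?thesis using k by (auto simp: G_ar)
    qed
    then show "is_cone ?J C G c' leg'" using k unfolding is_cone_def G_ob by simp
  qed
  have "is_limit ?J C G c leg"
    unfolding is_limit_def
  proof (intro conjI allI impI)
    show "is_cone ?J C G c leg" unfolding cone_iff using c leg cone by blast
    fix c' leg' assume "is_cone ?J C G c' leg'"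
    then have k: "c' \<in> Fml L" "\<And>i. i < p \<Longrightarrow> leg' i \<in> hom C c' (obs i)"
      "\<And>i j. (i, j) \<in> E \<Longrightarrow> Comp C (ar i j) (leg' i) = leg' j" unfolding cone_iff by blast+
    have ok1: "ev (\<lambda>\<M>. \<forall>i\<in>{..<p}. func (extension \<M> c') (extension \<M> (obs i)) (Den (leg' i) \<M>))"
      by (rule eventually_ball_finite) (use k(2) ev_func in auto)
    have ok2: "ev (\<lambda>\<M>. \<forall>e\<in>E. Den (leg' (fst e)) \<M> O Den (ar (fst e) (snd e)) \<M> = Den (leg' (snd e)) \<M>)"
    proof (rule eventually_ball_finite[OF fE], rule ballI)
      fix e assume e: "e \<in> E"
      then have e': "(fst e, snd e) \<in> E" by simp
      show "ev (\<lambda>\<M>. Den (leg' (fst e)) \<M> O Den (ar (fst e) (snd e)) \<M> = Den (leg' (snd e)) \<M>)"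
        using comp_eq_iff[OF k(2) ar k(2)] k(3) height_oneD(1,2)[OF E e'] e' by blast
    qed
    have "\<exists>!h. h \<in> hom C c' c \<and> (\<forall>i\<in>{..<p}. Comp C (leg i) h = leg' i)"
    proof (rule limit_arrow[OF finite_lessThan c k(1)])
      show "ev (\<lambda>\<M>. \<forall>a\<in>extension \<M> c'. \<forall>x. (\<forall>i\<in>{..<p}. (a, x i) \<in> Den (leg' i) \<M>) \<longrightarrow>
        (\<exists>!z. z \<in> extension \<M> c \<and> (\<forall>i\<in>{..<p}. (z, x i) \<in> Den (leg i) \<M>)))"
        using ok1 ok2 lim
      proof eventually_elim
        case (elim \<M>)
        show ?case
        proof (intro ballI allI impI)
          fix a x assume a: "a \<in> extension \<M> c'" and x: "\<forall>i\<in>{..<p}. (a, x i) \<in> Den (leg' i) \<M>"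
          have 1: "\<forall>i<p. x i \<in> extension \<M> (obs i)" using x elim(1) unfolding func_def by blast
          have 2: "(x i, x j) \<in> Den (ar i j) \<M>" if ij: "(i, j) \<in> E" for i j
          proof -
            have "(a, x j) \<in> Den (leg' j) \<M>" using x height_oneD(2)[OF E ij] by blast
            then have "(a, x j) \<in> Den (leg' i) \<M> O Den (ar i j) \<M>" using elim(2) ij by force
            then obtain y where y: "(a, y) \<in> Den (leg' i) \<M>" "(y, x j) \<in> Den (ar i j) \<M>" by blast
            have "(a, x i) \<in> Den (leg' i) \<M>" using x height_oneD(1)[OF E ij] by blast
            moreover have "single_valued (Den (leg' i) \<M>)"
              using elim(1) height_oneD(1)[OF E ij] unfolding func_def by blast
            ultimately have "y = x i" using y(1) unfolding single_valued_def by blast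
            with y(2) show ?thesis by simp
          qed
          then have "\<forall>(i, j)\<in>E. (x i, x j) \<in> Den (ar i j) \<M>" by blast
          with 1 elim(3) have "\<exists>!z. z \<in> extension \<M> c \<and> (\<forall>i<p. (z, x i) \<in> Den (leg i) \<M>)" by blast
          then show "\<exists>!z. z \<in> extension \<M> c \<and> (\<forall>i\<in>{..<p}. (z, x i) \<in> Den (leg i) \<M>)"
            by (simp only: Ball_def lessThan_iff)
        qed
      qed
    qed (use leg k(2) in simp_all)
    then show "\<exists>!h. h \<in> hom C c' c \<and> (\<forall>j\<in>Ob ?J. Comp C (leg j) h = leg' j)" by simp
  qed
  then have L: "is_limit ?J SetCat (comp_functor F G) (Fo c) (\<lambda>j. on_ar F (leg j))"
    using limits functG category_shape[OF E] fE unfolding preserves_finite_limits_def by simp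
  have "\<exists>!z. z \<in> Fo c \<and> (\<forall>j\<in>Ob ?J. Fa (leg j) z = x j)"
  proof (rule set_limit[OF L])
    fix u assume u: "u \<in> Ar ?J"
    have st: "Src ?J u \<in> Ob ?J" "Tgt ?J u \<in> Ob ?J"
      using category_shape[OF E] u unfolding category_def by blast+
    then show "Src ?J u \<in> Ob ?J \<and> Tgt ?J u \<in> Ob ?J \<and> on_ar (comp_functor F G) u
        \<in> hom SetCat (on_ob (comp_functor F G) (Src ?J u)) (on_ob (comp_functor F G) (Tgt ?J u))"
      using F_hom(1)[OF G_hom[OF u]] by (simp add: comp_functor_def G_ob)
    show "fn (on_ar (comp_functor F G) u) (x (Src ?J u)) = x (Tgt ?J u)"
      using u
    proof (rule shape_ArE)
      fix i assume i: "i < p" "u = prod_encode (i, i)"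
      then show ?thesis using Fa_ident[OF obs x(1)] by (simp add: comp_functor_def G_id)
    next
      fix i j assume ij: "(i, j) \<in> E" "u = prod_encode (i, j)"
      then show ?thesis using x(2)[OF ij(1)] by (simp add: comp_functor_def G_ar)
    qed
  next
    fix j assume "j \<in> Ob ?J"
    then show "x j \<in> on_ob (comp_functor F G) j" using x(1) by (simp add: comp_functor_def G_ob)
  qed
  then show ?thesis by (simp only: shape_simps Ball_def lessThan_iff)
qed

end

section \<open>Coordinates of the elements of a formula\<close>

context set_functor
begin

definition pr :: "'r fml \<Rightarrow> int \<Rightarrow> 'r syn_arrow" where
  "pr \<phi> x = reidx \<phi> (eqv 0 0) (\<lambda>_. x)"

definition coord :: "'r fml \<Rightarrow> 'u \<Rightarrow> int \<Rightarrow> 'u" where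
  "coord \<phi> z = (\<lambda>x\<in>fv \<phi>. Fa (pr \<phi> x) z)"

definition img :: "'r fml \<Rightarrow> (int \<Rightarrow> 'u) set" where
  "img \<phi> = coord \<phi> ` Fo \<phi>"

lemma pr_hom: "\<phi> \<in> Fml L \<Longrightarrow> x \<in> fv \<phi> \<Longrightarrow> pr \<phi> x \<in> hom C \<phi> (eqv 0 0)"
  unfolding pr_def by (rule reidx_hom[OF admissible_pr])

lemma Den_pr:
  "\<phi> \<in> Fml L \<Longrightarrow> x \<in> fv \<phi> \<Longrightarrow> ev (\<lambda>\<M>. Den (pr \<phi> x) \<M> = graph \<phi> (eqv 0 0) (\<lambda>_. x) \<M>)"
  unfolding pr_def by (rule Den_reidx[OF admissible_pr])

lemma coord_mem: "\<phi> \<in> Fml L \<Longrightarrow> z \<in> Fo \<phi> \<Longrightarrow> coord \<phi> z \<in> fv \<phi> \<rightarrow>\<^sub>E Fo (eqv 0 0)"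
  unfolding coord_def using Fa_mem[OF pr_hom] by simp

lemma pr_reidx:
  assumes "admissible \<alpha> \<beta> \<sigma>" "w \<in> fv \<beta>"
  shows "Comp C (pr \<beta> w) (reidx \<alpha> \<beta> \<sigma>) = pr \<alpha> (\<sigma> w)"
proof -
  have "\<alpha> \<in> Fml L" "\<beta> \<in> Fml L" "\<sigma> w \<in> fv \<alpha>" using assms unfolding admissible_def by blast+
  then show ?thesis
    unfolding pr_def by (intro reidx_comp[OF assms(1) admissible_pr[OF _ assms(2)] admissible_pr]) simp_all
qed

lemma coord_reidx:
  assumes "admissible \<alpha> \<beta> \<sigma>" "z \<in> Fo \<alpha>"
  shows "coord \<beta> (Fa (reidx \<alpha> \<beta> \<sigma>) z) = (\<lambda>w\<in>fv \<beta>. coord \<alpha> z (\<sigma> w))"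
  unfolding coord_def
proof (rule restrict_ext)
  fix w assume w: "w \<in> fv \<beta>"
  have F: "\<alpha> \<in> Fml L" "\<beta> \<in> Fml L" "\<sigma> w \<in> fv \<alpha>" using assms(1) w unfolding admissible_def by blast+
  have "Fa (pr \<beta> w) (Fa (reidx \<alpha> \<beta> \<sigma>) z) = Fa (Comp C (pr \<beta> w) (reidx \<alpha> \<beta> \<sigma>)) z"
    by (rule Fa_comp[OF reidx_hom[OF assms(1)] pr_hom[OF F(2) w] assms(2), symmetric])
  also have "\<dots> = Fa (pr \<alpha> (\<sigma> w)) z" by (simp only: pr_reidx[OF assms(1) w])
  finally show "Fa (pr \<beta> w) (Fa (reidx \<alpha> \<beta> \<sigma>) z) = (\<lambda>x\<in>fv \<alpha>. Fa (pr \<alpha> x) z) (\<sigma> w)"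
    using F(3) by simp
qed

lemma coord_restrict: "(\<lambda>w\<in>fv \<phi>. coord \<phi> z w) = coord \<phi> z"
  unfolding coord_def by (rule ext) simp

lemma coord_reidx_sub:
  assumes "admissible \<alpha> \<beta> (\<lambda>w. w)" "fv \<alpha> = fv \<beta>" "z \<in> Fo \<alpha>"
  shows "coord \<beta> (Fa (reidx \<alpha> \<beta> (\<lambda>w. w)) z) = coord \<alpha> z"
  using coord_reidx[OF assms(1,3)] coord_restrict[of \<alpha> z] assms(2) by simp

text \<open>
  An element of \<open>X\<close> and an element of \<open>Y\<close> with matching coordinates come from an element of the
  formula that says so: this formula is the limit of \<open>X\<close> and \<open>Y\<close> over their coordinates.
\<close>

lemma glue:
  assumes X: "X \<in> Fml L" and Y: "Y \<in> Fml L" and P: "P \<in> Fml L" "fv P = fv X" and \<sigma>: "\<sigma> ` fv Y \<subseteq> fv X"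
    and e: "ev (\<lambda>\<M>. extension \<M> P = {\<rho> \<in> extension \<M> X. (\<lambda>w\<in>fv Y. \<rho> (\<sigma> w)) \<in> extension \<M> Y})"
    and x: "x \<in> Fo X" and y: "y \<in> Fo Y" and xy: "coord Y y = (\<lambda>w\<in>fv Y. coord X x (\<sigma> w))"
  shows "admissible P X (\<lambda>w. w)" "admissible P Y \<sigma>"
    and "\<exists>z\<in>Fo P. Fa (reidx P X (\<lambda>w. w)) z = x \<and> Fa (reidx P Y \<sigma>) z = y"
proof -
  show rX: "admissible P X (\<lambda>w. w)"
    by (rule admissible_sub[OF P(1) X P(2)]) (use e in eventually_elim, blast)
  have "ev (\<lambda>\<M>. \<forall>\<rho>\<in>extension \<M> P. (\<lambda>w\<in>fv Y. \<rho> (\<sigma> w)) \<in> extension \<M> Y)"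
    using e by eventually_elim blast
  then show rY: "admissible P Y \<sigma>" using P Y \<sigma> unfolding admissible_def by simp
  define n where "n = card (fv Y)"
  obtain h where h: "bij_betw h {0..<n} (fv Y)"
    using ex_bij_betw_nat_finite[OF finite_fv[of Y]] unfolding n_def by blast
  have hY: "h k \<in> fv Y" and hX: "\<sigma> (h k) \<in> fv X" and hP: "\<sigma> (h k) \<in> fv P" if "k < n" for k
    using bij_betwE[OF h] that \<sigma> P(2) by auto
  let ?A = "eqv 0 0 :: 'r fml"
  \<comment> \<open>Vertices 0 and 1 are \<open>X\<close> and \<open>Y\<close>; vertex \<open>k + 2\<close> is the coordinate \<open>h k\<close>, with an edge from each of them.\<close>
  define obs where "obs i = (if i = 0 then X else if i = 1 then Y else ?A)" for i :: nat
  define ar where "ar i j = (if i = 0 then pr X (\<sigma> (h (j - 2))) else pr Y (h (j - 2)))" for i j :: nat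
  define leg where "leg i = (if i = 0 then reidx P X (\<lambda>w. w) else if i = 1 then reidx P Y \<sigma>
    else pr P (\<sigma> (h (i - 2))))" for i :: nat
  define xx where "xx i = (if i = 0 then x else if i = 1 then y else Fa (pr X (\<sigma> (h (i - 2)))) x)" for i :: nat
  define E where "E = {0, 1 :: nat} \<times> {2..<n + 2}"
  have EE: "(i = 0 \<or> i = 1) \<and> 2 \<le> j \<and> j - 2 < n" if "(i, j) \<in> E" for i j
    using that unfolding E_def by auto
  have cases: "i = 0 \<or> i = 1 \<or> (2 \<le> i \<and> i - 2 < n)" if "i < n + 2" for i using that by linarith
  have "\<exists>!z. z \<in> Fo P \<and> (\<forall>i<n + 2. Fa (leg i) z = xx i)"
  proof (rule F_limit[where E = E and obs = obs and ar = ar])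
    show "height_one (n + 2) E" unfolding height_one_def E_def by auto
    show "obs i \<in> Fml L" for i using X Y by (simp add: obs_def)
    show "ar i j \<in> hom C (obs i) (obs j)" if "(i, j) \<in> E" for i j
      using EE[OF that] pr_hom[OF X hX] pr_hom[OF Y hY] by (auto simp: ar_def obs_def)
    show "leg i \<in> hom C P (obs i)" if "i < n + 2" for i
      using cases[OF that] reidx_hom[OF rX] reidx_hom[OF rY] pr_hom[OF P(1) hP]
      by (auto simp: leg_def obs_def)
    show "Comp C (ar i j) (leg i) = leg j" if "(i, j) \<in> E" for i j
    proof -
      have j: "2 \<le> j" "j - 2 < n" using EE[OF that] by blast+
      then have lj: "leg j = pr P (\<sigma> (h (j - 2)))" by (simp add: leg_def)
      from EE[OF that] consider "i = 0" | "i = 1" by blast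
      then show ?thesis
      proof cases
        case 1
        then show ?thesis using pr_reidx[OF rX hX[OF j(2)]] unfolding lj by (simp add: ar_def leg_def)
      next
        case 2
        then show ?thesis using pr_reidx[OF rY hY[OF j(2)]] unfolding lj by (simp add: ar_def leg_def)
      qed
    qed
    show "xx i \<in> Fo (obs i)" if "i < n + 2" for i
      using cases[OF that] x y Fa_mem[OF pr_hom[OF X hX] x] by (auto simp: xx_def obs_def)
    show "Fa (ar i j) (xx i) = xx j" if "(i, j) \<in> E" for i j
    proof -
      have j: "2 \<le> j" "j - 2 < n" using EE[OF that] by blast+
      then have xj: "xx j = Fa (pr X (\<sigma> (h (j - 2)))) x" by (simp add: xx_def)
      from EE[OF that] consider "i = 0" | "i = 1" by blast
      then show ?thesis
      proof cases
        case 1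
        then show ?thesis unfolding xj by (simp add: ar_def xx_def)
      next
        case 2
        have "Fa (pr Y (h (j - 2))) y = coord Y y (h (j - 2))" using hY[OF j(2)] by (simp add: coord_def)
        also have "\<dots> = coord X x (\<sigma> (h (j - 2)))" unfolding xy using hY[OF j(2)] by simp
        also have "\<dots> = Fa (pr X (\<sigma> (h (j - 2)))) x" using hX[OF j(2)] by (simp add: coord_def)
        finally show ?thesis using 2 unfolding xj by (simp add: ar_def xx_def)
      qed
    qed
    have D: "ev (\<lambda>\<M>. \<forall>k\<in>{..<n}. Den (pr X (\<sigma> (h k))) \<M> = graph X ?A (\<lambda>_. \<sigma> (h k)) \<M> \<and>
        Den (pr Y (h k)) \<M> = graph Y ?A (\<lambda>_. h k) \<M> \<and>
        Den (pr P (\<sigma> (h k))) \<M> = graph P ?A (\<lambda>_. \<sigma> (h k)) \<M>)"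
      by (intro eventually_ball_finite finite_lessThan ballI eventually_conj Den_pr X Y P(1))
        (use hX hY hP in simp_all)
    show "ev (\<lambda>\<M>. \<forall>x. (\<forall>i<n + 2. x i \<in> extension \<M> (obs i)) \<longrightarrow>
      (\<forall>(i, j)\<in>E. (x i, x j) \<in> Den (ar i j) \<M>) \<longrightarrow>
      (\<exists>!z. z \<in> extension \<M> P \<and> (\<forall>i<n + 2. (z, x i) \<in> Den (leg i) \<M>)))"
      using D e Den_reidx[OF rX] Den_reidx[OF rY]
    proof eventually_elim
      case (elim \<M>)
      show ?case
      proof (intro allI impI)
        fix x assume x: "\<forall>i<n + 2. x i \<in> extension \<M> (obs i)"
          and xE: "\<forall>(i, j)\<in>E. (x i, x j) \<in> Den (ar i j) \<M>"
        have x0: "x 0 \<in> extension \<M> X" using x[rule_format, of 0] by (simp add: obs_def)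
        have x1: "x 1 \<in> extension \<M> Y" using x[rule_format, of 1] by (simp add: obs_def)
        have e0: "x (k + 2) = (\<lambda>w\<in>fv ?A. x 0 (\<sigma> (h k)))" and e1: "x (k + 2) = (\<lambda>w\<in>fv ?A. x 1 (h k))"
          if k: "k < n" for k
        proof -
          have "(0, k + 2) \<in> E" "(1, k + 2) \<in> E" using k by (simp_all add: E_def)
          then have "(x 0, x (k + 2)) \<in> Den (ar 0 (k + 2)) \<M>" "(x 1, x (k + 2)) \<in> Den (ar 1 (k + 2)) \<M>"
            using xE by blast+
          then have "(x 0, x (k + 2)) \<in> graph X ?A (\<lambda>_. \<sigma> (h k)) \<M>" "(x 1, x (k + 2)) \<in> graph Y ?A (\<lambda>_. h k) \<M>"
            using elim(1) k by (simp_all add: ar_def)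
          then show "x (k + 2) = (\<lambda>w\<in>fv ?A. x 0 (\<sigma> (h k)))" "x (k + 2) = (\<lambda>w\<in>fv ?A. x 1 (h k))"
            unfolding graph_iff by blast+
        qed
        have "x 1 w = x 0 (\<sigma> w)" if "w \<in> fv Y" for w
        proof -
          obtain k where k: "k < n" "w = h k"
            using bij_betw_imp_surj_on[OF h] \<open>w \<in> fv Y\<close> by (metis atLeastLessThan_iff imageE)
          have "(\<lambda>w\<in>fv ?A. x 1 (h k)) 0 = (\<lambda>w\<in>fv ?A. x 0 (\<sigma> (h k))) 0"
            unfolding e0[OF k(1), symmetric] e1[OF k(1), symmetric] by (rule HOL.refl)
          then show ?thesis using k(2) by simp
        qed
        then have "(\<lambda>w\<in>fv Y. x 0 (\<sigma> w)) = (\<lambda>w\<in>fv Y. x 1 w)" by (intro restrict_ext) simp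
        then have x01: "(\<lambda>w\<in>fv Y. x 0 (\<sigma> w)) = x 1" using restrict_extension[OF x1] by simp
        then have x0P: "x 0 \<in> extension \<M> P" using x0 x1 unfolding elim(2) by simp
        have legs: "(z, x i) \<in> Den (leg i) \<M>" if "i < n + 2" "z = x 0" for i z
        proof -
          from cases[OF that(1)] consider "i = 0" | "i = 1" | k where "i = k + 2" "k < n"
            by (metis le_add_diff_inverse2)
          then show ?thesis
          proof cases
            case 1
            then show ?thesis
              using x0P restrict_extension[OF x0] that(2) by (simp add: leg_def elim(3) graph_iff)
          next
            case 2
            then show ?thesis
              using x0P x01 that(2) by (simp add: leg_def elim(4) graph_iff)
          next
            case 3
            have "Den (leg i) \<M> = graph P ?A (\<lambda>_. \<sigma> (h k)) \<M>" using elim(1) 3 by (simp add: leg_def)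
            then show ?thesis using x0P e0[OF 3(2)] that(2) 3(1) by (simp add: graph_iff)
          qed
        qed
        show "\<exists>!z. z \<in> extension \<M> P \<and> (\<forall>i<n + 2. (z, x i) \<in> Den (leg i) \<M>)"
        proof (rule ex1I[of _ "x 0"])
          show "x 0 \<in> extension \<M> P \<and> (\<forall>i<n + 2. (x 0, x i) \<in> Den (leg i) \<M>)" using x0P legs by blast
          fix z assume z: "z \<in> extension \<M> P \<and> (\<forall>i<n + 2. (z, x i) \<in> Den (leg i) \<M>)"
          then have "(z, x 0) \<in> Den (leg 0) \<M>" by simp
          then have "x 0 = (\<lambda>w\<in>fv X. z w)" by (simp add: leg_def elim(3) graph_iff)
          then show "z = x 0" using z restrict_extension[of z \<M> P] unfolding P(2) by simp
        qed
      qed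
    qed
  qed (rule P(1))
  then obtain z where z: "z \<in> Fo P" "\<forall>i<n + 2. Fa (leg i) z = xx i" by blast
  have "Fa (leg 0) z = xx 0" "Fa (leg 1) z = xx 1" using z(2) by simp_all
  then show "\<exists>z\<in>Fo P. Fa (reidx P X (\<lambda>w. w)) z = x \<and> Fa (reidx P Y \<sigma>) z = y"
    using z(1) by (intro bexI[of _ z]) (simp_all add: leg_def xx_def)
qed

text \<open>
  Gluing \<open>\<phi>\<close> to itself along equal coordinates gives an element that one and the same arrow sends to
  both \<open>z\<close> and \<open>z'\<close>.
\<close>

lemma coord_inj:
  assumes "\<phi> \<in> Fml L" "z \<in> Fo \<phi>" "z' \<in> Fo \<phi>" "coord \<phi> z = coord \<phi> z'"
  shows "z = z'"
proof -
  have "{\<rho> \<in> extension \<M> \<phi>. (\<lambda>w\<in>fv \<phi>. \<rho> w) \<in> extension \<M> \<phi>} = extension \<M> \<phi>"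
    for \<M> :: "('r, int) struct" using restrict_extension[of _ \<M> \<phi>] by fastforce
  then have "ev (\<lambda>\<M>. extension \<M> \<phi> = {\<rho> \<in> extension \<M> \<phi>. (\<lambda>w\<in>fv \<phi>. \<rho> w) \<in> extension \<M> \<phi>})"
    by (simp add: always_eventually)
  moreover have "coord \<phi> z' = (\<lambda>w\<in>fv \<phi>. coord \<phi> z w)" using coord_restrict assms(4) by simp
  ultimately show ?thesis
    using glue(3)[OF assms(1,1,1) HOL.refl _ _ assms(2,3), of "\<lambda>w. w"] by auto
qed

lemma img_glue:
  assumes X: "X \<in> Fml L" and Y: "Y \<in> Fml L" and P: "P \<in> Fml L" "fv P = fv X" and \<sigma>: "\<sigma> ` fv Y \<subseteq> fv X"
    and e: "ev (\<lambda>\<M>. extension \<M> P = {\<rho> \<in> extension \<M> X. (\<lambda>w\<in>fv Y. \<rho> (\<sigma> w)) \<in> extension \<M> Y})"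
  shows "img P = {\<rho> \<in> img X. (\<lambda>w\<in>fv Y. \<rho> (\<sigma> w)) \<in> img Y}"
proof -
  have rX: "admissible P X (\<lambda>w. w)"
    by (rule admissible_sub[OF P(1) X P(2)]) (use e in eventually_elim, blast)
  have "ev (\<lambda>\<M>. \<forall>\<rho>\<in>extension \<M> P. (\<lambda>w\<in>fv Y. \<rho> (\<sigma> w)) \<in> extension \<M> Y)"
    using e by eventually_elim blast
  then have rY: "admissible P Y \<sigma>" using P Y \<sigma> unfolding admissible_def by simp
  show ?thesis
  proof (intro Set.set_eqI iffI)
    fix \<rho> assume "\<rho> \<in> img P"
    then obtain z where z: "z \<in> Fo P" "\<rho> = coord P z" unfolding img_def by blast
    have "\<rho> = coord X (Fa (reidx P X (\<lambda>w. w)) z)" using coord_reidx_sub[OF rX P(2) z(1)] z(2) by simp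
    moreover have "(\<lambda>w\<in>fv Y. \<rho> (\<sigma> w)) = coord Y (Fa (reidx P Y \<sigma>) z)"
      using coord_reidx[OF rY z(1)] z(2) by simp
    ultimately show "\<rho> \<in> {\<rho> \<in> img X. (\<lambda>w\<in>fv Y. \<rho> (\<sigma> w)) \<in> img Y}"
      unfolding img_def using Fa_mem[OF reidx_hom[OF rX] z(1)] Fa_mem[OF reidx_hom[OF rY] z(1)] by blast
  next
    fix \<rho> assume "\<rho> \<in> {\<rho> \<in> img X. (\<lambda>w\<in>fv Y. \<rho> (\<sigma> w)) \<in> img Y}"
    then obtain x y where xy: "x \<in> Fo X" "\<rho> = coord X x" "y \<in> Fo Y" "(\<lambda>w\<in>fv Y. \<rho> (\<sigma> w)) = coord Y y"
      unfolding img_def by blast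
    then have "coord Y y = (\<lambda>w\<in>fv Y. coord X x (\<sigma> w))" by simp
    from glue(3)[OF X Y P \<sigma> e xy(1,3) this]
    obtain z where z: "z \<in> Fo P" "Fa (reidx P X (\<lambda>w. w)) z = x" by blast
    then have "\<rho> = coord P z" using coord_reidx_sub[OF rX P(2) z(1)] xy(2) by simp
    then show "\<rho> \<in> img P" using z(1) unfolding img_def by blast
  qed
qed

lemma img_sub: "\<phi> \<in> Fml L \<Longrightarrow> img \<phi> \<subseteq> fv \<phi> \<rightarrow>\<^sub>E Fo (eqv 0 0)"
  unfolding img_def using coord_mem by blast

text \<open>\<open>EV V\<close> is a power of \<open>x\<^sub>0 = x\<^sub>0\<close>: the limit of a diagram without edges.\<close>

lemma img_EV:
  assumes V: "finite V"
  shows "img (EV V) = V \<rightarrow>\<^sub>E Fo (eqv 0 0)"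
proof
  have fvE: "fv (EV V :: 'r fml) = V" using V by simp
  have EV: "EV V \<in> Fml L" by simp
  show "img (EV V) \<subseteq> V \<rightarrow>\<^sub>E Fo (eqv 0 0)" using img_sub[OF EV] fvE by simp
  let ?A = "eqv 0 0 :: 'r fml"
  obtain h where h: "bij_betw h {0..<card V} V" using ex_bij_betw_nat_finite[OF V] by blast
  define g where "g = inv_into {0..<card V} h"
  have hV: "h k \<in> V" if "k < card V" for k using bij_betwE[OF h] that by simp
  have gh: "g (h k) = k" if "k < card V" for k
    unfolding g_def using bij_betw_inv_into_left[OF h] that by simp
  have gV: "g w < card V" "h (g w) = w" if "w \<in> V" for w
  proof -
    have "w \<in> h ` {0..<card V}" using bij_betw_imp_surj_on[OF h] that by simp
    from inv_into_into[OF this] f_inv_into_f[OF this]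
    show "g w < card V" "h (g w) = w" unfolding g_def by simp_all
  qed
  show "V \<rightarrow>\<^sub>E Fo (eqv 0 0) \<subseteq> img (EV V)"
  proof
    fix \<rho> assume \<rho>: "\<rho> \<in> V \<rightarrow>\<^sub>E Fo (eqv 0 0)"
    have "\<exists>!z. z \<in> Fo (EV V) \<and> (\<forall>i<card V. Fa (pr (EV V) (h i)) z = \<rho> (h i))"
    proof (rule F_limit[where E = "{}" and obs = "\<lambda>_. ?A" and ar = undefined])
      show "height_one (card V) {}" by (simp add: height_one_def)
      show "pr (EV V) (h i) \<in> hom C (EV V) ?A" if "i < card V" for i
        using pr_hom[OF EV, unfolded fvE, OF hV[OF that]] .
      show "\<rho> (h i) \<in> Fo ?A" if "i < card V" for i using PiE_mem[OF \<rho> hV[OF that]] .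
      have "ev (\<lambda>\<M>. \<forall>i\<in>{..<card V}. Den (pr (EV V) (h i)) \<M> = graph (EV V) ?A (\<lambda>_. h i) \<M>)"
        by (intro eventually_ball_finite finite_lessThan ballI Den_pr EV) (simp add: fvE hV)
      then show "ev (\<lambda>\<M>. \<forall>x. (\<forall>i<card V. x i \<in> extension \<M> ?A) \<longrightarrow>
        (\<forall>(i, j)\<in>{}. (x i, x j) \<in> Den (undefined i j) \<M>) \<longrightarrow>
        (\<exists>!z. z \<in> extension \<M> (EV V) \<and> (\<forall>i<card V. (z, x i) \<in> Den (pr (EV V) (h i)) \<M>)))"
      proof eventually_elim
        case (elim \<M>)
        show ?case
        proof (intro allI impI)
          fix x assume x: "\<forall>i<card V. x i \<in> extension \<M> ?A"
          have xU: "x i \<in> {0} \<rightarrow>\<^sub>E uni \<M>" if "i < card V" for i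
            using x that by (simp add: extension_iff)
          have xr: "x i = (\<lambda>w\<in>fv ?A. x i 0)" if "i < card V" for i
          proof
            fix w show "x i w = (\<lambda>w\<in>fv ?A. x i 0) w"
              using PiE_arb[OF xU[OF that], of w] by (cases "w = 0") simp_all
          qed
          have iff: "(z, x i) \<in> Den (pr (EV V) (h i)) \<M> \<longleftrightarrow> z \<in> extension \<M> (EV V) \<and> x i 0 = z (h i)"
            if i: "i < card V" for i z
          proof -
            have "x i = (\<lambda>w\<in>fv ?A. z (h i)) \<longleftrightarrow> x i 0 = z (h i)"
              using xr[OF i] by (metis fv_eqv insertI1 restrict_apply')
            then show ?thesis using elim i by (simp add: graph_iff)
          qed
          let ?z = "\<lambda>w\<in>V. x (g w) 0"
          have "?z \<in> V \<rightarrow>\<^sub>E uni \<M>"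
          proof (rule PiE_I)
            fix w assume "w \<in> V"
            then show "?z w \<in> uni \<M>" using PiE_mem[OF xU[OF gV(1)], of w 0] by simp
          qed simp
          then have zE: "?z \<in> extension \<M> (EV V)" by (simp add: ext_EV[OF V])
          have zi: "x i 0 = ?z (h i)" if "i < card V" for i using hV[OF that] gh[OF that] by simp
          show "\<exists>!z. z \<in> extension \<M> (EV V) \<and> (\<forall>i<card V. (z, x i) \<in> Den (pr (EV V) (h i)) \<M>)"
          proof (rule ex1I[of _ ?z])
            show "?z \<in> extension \<M> (EV V) \<and> (\<forall>i<card V. (?z, x i) \<in> Den (pr (EV V) (h i)) \<M>)"
              using zE zi iff by blast
            fix z assume z: "z \<in> extension \<M> (EV V) \<and> (\<forall>i<card V. (z, x i) \<in> Den (pr (EV V) (h i)) \<M>)"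
            show "z = ?z"
            proof
              fix w show "z w = ?z w"
              proof (cases "w \<in> V")
                case True
                have "x (g w) 0 = z (h (g w))" using z iff[OF gV(1)[OF True], of z] gV(1)[OF True] by blast
                then show ?thesis using True gV(2)[OF True] by simp
              next
                case False
                have "z \<in> V \<rightarrow>\<^sub>E uni \<M>" using z by (simp add: ext_EV[OF V])
                from PiE_arb[OF this False] False show ?thesis by simp
              qed
            qed
          qed
        qed
      qed
    qed simp_all
    then obtain z where z: "z \<in> Fo (EV V)" "\<forall>i<card V. Fa (pr (EV V) (h i)) z = \<rho> (h i)" by blast
    have "coord (EV V) z = \<rho>"
    proof
      fix w show "coord (EV V) z w = \<rho> w"
      proof (cases "w \<in> V")
        case True
        then show ?thesis using z(2)[rule_format, OF gV(1)[OF True]] gV(2)[OF True] by (simp add: coord_def V)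
      next
        case False
        then show ?thesis using PiE_arb[OF \<rho> False] by (simp add: coord_def V)
      qed
    qed
    then show "\<rho> \<in> img (EV V)" unfolding img_def using z(1) by blast
  qed
qed

text \<open>A change of variables that is onto in almost all structures is an effective epimorphism.\<close>

lemma img_image:
  assumes r: "admissible X Y \<sigma>"
    and e: "ev (\<lambda>\<M>. extension \<M> Y \<subseteq> (\<lambda>\<rho>. \<lambda>w\<in>fv Y. \<rho> (\<sigma> w)) ` extension \<M> X)"
  shows "img Y = (\<lambda>\<rho>. \<lambda>w\<in>fv Y. \<rho> (\<sigma> w)) ` img X"
proof -
  have "ev (\<lambda>\<M>. \<forall>b\<in>extension \<M> Y. \<exists>a. (a, b) \<in> Den (reidx X Y \<sigma>) \<M>)"
    using e Den_reidx[OF r]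
  proof eventually_elim
    case (elim \<M>)
    show ?case unfolding elim(2) graph_iff using elim(1) by blast
  qed
  then have "surjection (on_ar F (reidx X Y \<sigma>))"
    by (rule epis[OF effective_epi_if_surj[OF reidx_hom[OF r]]])
  moreover have "Src SetCat (on_ar F (reidx X Y \<sigma>)) = Fo X" "Tgt SetCat (on_ar F (reidx X Y \<sigma>)) = Fo Y"
    using F_hom(1)[OF reidx_hom[OF r]] unfolding hom_def by simp_all
  ultimately have "Fa (reidx X Y \<sigma>) ` Fo X = Fo Y" unfolding surjection_def by simp
  then have "img Y = (\<lambda>z. coord Y (Fa (reidx X Y \<sigma>) z)) ` Fo X"
    unfolding img_def by (metis image_image)
  also have "\<dots> = (\<lambda>\<rho>. \<lambda>w\<in>fv Y. \<rho> (\<sigma> w)) ` img X"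
    unfolding img_def image_image using coord_reidx[OF r] by (intro image_cong HOL.refl) simp
  finally show ?thesis .
qed

lemma mono_SetCat:
  assumes "a \<in> hom SetCat A B" "inj_on (fn a) A"
  shows "mono_arrow SetCat a"
proof -
  obtain f where f: "a = (A, f, B)" "f \<in> A \<rightarrow>\<^sub>E B" using assms(1) unfolding hom_SetCat by blast
  have ar: "a \<in> Ar SetCat" using f by (simp add: SetCat_def)
  have src: "Src SetCat a = A" by (simp add: f(1) SetCat_def)
  have "u = v" if uv: "u \<in> hom SetCat w A" "v \<in> hom SetCat w A" and eq: "Comp SetCat a u = Comp SetCat a v" for w u v
  proof -
    obtain u' v' where u: "u = (w, u', A)" "u' \<in> w \<rightarrow>\<^sub>E A" and v: "v = (w, v', A)" "v' \<in> w \<rightarrow>\<^sub>E A"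
      using uv unfolding hom_SetCat by blast
    have c: "compose w f u' = compose w f v'" using eq unfolding u v f(1) Comp_SetCat by simp
    have "u' z = v' z" if "z \<in> w" for z
    proof -
      have "f (u' z) = f (v' z)" using fun_cong[OF c, of z] that by (simp add: compose_eq)
      moreover have "u' z \<in> A" "v' z \<in> A" using PiE_mem[OF u(2) that] PiE_mem[OF v(2) that] .
      ultimately show ?thesis using assms(2) unfolding f(1) fn_def by (auto dest: inj_onD)
    qed
    then have "u' = v'" using PiE_ext[OF u(2) v(2)] by blast
    then show ?thesis unfolding u v by simp
  qed
  then show ?thesis unfolding mono_arrow_def src using ar by blast
qed

lemma iso_over_refl_SetCat:
  assumes "a \<in> hom SetCat A B" "inj_on (fn a) A"
  shows "(a, a) \<in> iso_over SetCat B"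
proof -
  obtain f where f: "a = (A, f, B)" "f \<in> A \<rightarrow>\<^sub>E B" using assms(1) unfolding hom_SetCat by blast
  let ?i = "(A, restrict id A, A)"
  have i: "?i \<in> hom SetCat A A" unfolding hom_SetCat by auto
  have ii: "Comp SetCat ?i ?i = ?i" "Ident SetCat A = ?i"
    by (auto simp: SetCat_def compose_def restrict_def)
  have s: "Src SetCat ?i = A" "Tgt SetCat ?i = A" "?i \<in> Ar SetCat" using i unfolding hom_def by auto
  have "iso_arrow SetCat ?i" unfolding iso_arrow_def s ii(2) using i ii(1) s(3) by blast
  moreover have "Comp SetCat a ?i = a"
  proof -
    have "compose A f (restrict id A) = f"
    proof
      fix z show "compose A f (restrict id A) z = f z"
        using PiE_arb[OF f(2), of z] by (cases "z \<in> A") (simp_all add: compose_def)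
    qed
    then show ?thesis unfolding f(1) Comp_SetCat by simp
  qed
  moreover have "a \<in> monos_into SetCat B" "Src SetCat a = A"
    using mono_SetCat[OF assms] by (simp_all add: monos_into_def f(1) SetCat_def)
  ultimately show ?thesis unfolding iso_over_def using i by auto
qed

text \<open>
  The images of the pieces form a subset of the set of all assignments that is an upper bound, so the
  image of their join cannot be larger.
\<close>

lemma img_union:
  assumes A: "finite A" "\<And>a. a \<in> A \<Longrightarrow> a \<in> Fml L" "\<And>a. a \<in> A \<Longrightarrow> fv a = V"
    and X: "X \<in> Fml L" "fv X = V" and un: "ev (\<lambda>\<M>. extension \<M> X = (\<Union>a\<in>A. extension \<M> a))"
  shows "img X = (\<Union>a\<in>A. img a)"
proof -
  have V: "finite V" using X(2) finite_fv by blast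
  have EV: "EV V \<in> Fml L" "fv (EV V :: 'r fml) = V" using V by simp_all
  define X0 where "X0 = Fo (EV V)"
  let ?P = "Sub C (EV V)" and ?Q = "Sub SetCat X0" and ?h = "Sub_map SetCat F (EV V)"
  let ?m = "\<lambda>a. on_ar F (sub V a)"
  have rs: "admissible a (EV V) (\<lambda>w. w)" if "a \<in> Fml L" "fv a = V" for a using admissible_EV[OF that(1)] that(2) by simp
  have cs: "coord (EV V) (fn (?m a) z) = coord a z" if "a \<in> Fml L" "fv a = V" "z \<in> Fo a" for a z
    unfolding sub_def using coord_reidx_sub[OF rs[OF that(1,2)] _ that(3)] that(2) EV(2) by simp
  have hm: "?m a \<in> hom SetCat (Fo a) X0" if "a \<in> Fml L" "fv a = V" for a
    unfolding X0_def by (rule F_hom(1)[OF sub(1)[OF that]])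
  have inj: "inj_on (fn (?m a)) (Fo a)" if "a \<in> Fml L" "fv a = V" for a
  proof (rule inj_onI)
    fix z z' assume z: "z \<in> Fo a" "z' \<in> Fo a" "fn (?m a) z = fn (?m a) z'"
    then have "coord a z = coord a z'" using cs[OF that z(1)] cs[OF that z(2)] by simp
    then show "z = z'" by (rule coord_inj[OF that(1) z(1,2)])
  qed
  have mem: "?m a \<in> ?h (cls V a)" if "a \<in> Fml L" "fv a = V" for a
    unfolding Sub_map_def using sub_in_cls[OF that] iso_over_refl_SetCat[OF hm[OF that] inj[OF that]]
    unfolding X0_def by blast
  \<comment> \<open>The candidate for the join in sets, included in \<open>X0\<close> by \<open>i\<close>.\<close>
  define U where "U = (\<Union>a\<in>A. fn (?m a) ` Fo a)"
  have fm: "fn (?m a) \<in> Fo a \<rightarrow>\<^sub>E X0" if "a \<in> Fml L" "fv a = V" for a using hom_SetCatD(2)[OF hm[OF that]] .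
  have UX: "U \<subseteq> X0" unfolding U_def using fm[OF A(2,3)] by blast
  define i where "i = (U, restrict id U, X0)"
  have ih: "i \<in> hom SetCat U X0" unfolding hom_SetCat i_def using UX by auto
  have iinj: "inj_on (fn i) U" by (simp add: i_def fn_def inj_on_def)
  have ifn: "fn i z = z" if "z \<in> U" for z using that by (simp add: i_def fn_def)
  define ci where "ci = iso_over SetCat X0 `` {i}"
  have im: "i \<in> monos_into SetCat X0"
    using mono_SetCat[OF ih iinj] ih by (simp add: monos_into_def hom_def)
  have ic: "i \<in> ci" unfolding ci_def using iso_over_refl_SetCat[OF ih iinj] by blast
  have cic: "ci \<in> carrier ?Q" unfolding ci_def Sub_def using im by (simp add: quotientI)
  have up: "le ?Q (?h (cls V a)) ci" if a: "a \<in> A" for a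
  proof -
    note aF = A(2,3)[OF a]
    have h: "(Fo a, fn (?m a), U) \<in> hom SetCat (Fo a) U"
      unfolding hom_SetCat
    proof (rule bexI[of _ "fn (?m a)"])
      show "fn (?m a) \<in> Fo a \<rightarrow>\<^sub>E U"
        using fm[OF aF] a unfolding U_def by (auto simp: PiE_iff)
    qed simp
    have "compose (Fo a) (restrict id U) (fn (?m a)) = fn (?m a)"
    proof
      fix z show "compose (Fo a) (restrict id U) (fn (?m a)) z = fn (?m a) z"
      proof (cases "z \<in> Fo a")
        case True
        then have "fn (?m a) z \<in> U" using a unfolding U_def by blast
        then show ?thesis using True by (simp add: compose_def)
      next
        case False
        then show ?thesis using PiE_arb[OF fm[OF aF] False] by (simp add: compose_def)
      qed
    qed
    then have "Comp SetCat i (Fo a, fn (?m a), U) = ?m a"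
      unfolding i_def Comp_SetCat using hom_SetCatD(1)[OF hm[OF aF]] by simp
    moreover have "Src SetCat (?m a) = Fo a" "Src SetCat i = U"
      using hm[OF aF] ih unfolding hom_def by simp_all
    ultimately show ?thesis unfolding Sub_le using mem[OF aF] ic h by metis
  qed
  have "join_hom ?P ?Q ?h" using joins[of "EV V"] EV(1) unfolding X0_def by simp
  moreover have "cls V ` A \<subseteq> carrier ?P" using cls_carrier[OF A(2,3)] by blast
  ultimately have "least ?Q (?h (cls V X)) (Upper ?Q (?h ` cls V ` A))"
    using Sub_join[OF A X un] A(1) unfolding join_hom_def by blast
  moreover have "ci \<in> Upper ?Q (?h ` cls V ` A)" unfolding Upper_def using up cic by blast
  ultimately have "le ?Q (?h (cls V X)) ci" unfolding least_def by blast
  then obtain y y' h where y: "y \<in> ?h (cls V X)" "y' \<in> ci" "h \<in> hom SetCat (Src SetCat y) (Src SetCat y')"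
    "Comp SetCat y' h = y" unfolding Sub_le by blast
  obtain m' where m': "m' \<in> cls V X" "(on_ar F m', y) \<in> iso_over SetCat X0"
    using y(1) unfolding Sub_map_def X0_def by blast
  obtain k where k: "k \<in> hom SetCat (Src SetCat (on_ar F m')) (Src SetCat y)" "Comp SetCat y k = on_ar F m'"
    and yA: "y \<in> hom SetCat (Src SetCat y) X0"
    using m'(2) unfolding iso_over_def monos_into_def mono_arrow_def hom_def by blast
  obtain k1 where k1: "k1 \<in> hom C (Src C (sub V X)) (Src C m')" "Comp C m' k1 = sub V X"
    and mA: "m' \<in> hom C (Src C m') (EV V)"
    using m'(1) unfolding cls_def iso_over_def monos_into_def mono_arrow_def hom_def by blast
  obtain k2 where k2: "k2 \<in> hom SetCat (Src SetCat i) (Src SetCat y')" "iso_arrow SetCat k2" "Comp SetCat y' k2 = i"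
    and y'A: "y' \<in> hom SetCat (Src SetCat y') X0"
    using y(2) unfolding ci_def iso_over_def monos_into_def mono_arrow_def hom_def by blast
  have srcX: "Src C (sub V X) = X" using sub(1)[OF X] by (simp add: hom_arr)
  have srci: "Src SetCat i = U" using ih unfolding hom_def by simp
  have k2s: "Src SetCat k2 = U" "Tgt SetCat k2 = Src SetCat y'" using k2(1) srci unfolding hom_def by simp_all
  obtain k3 where k3: "k3 \<in> hom SetCat (Src SetCat y') U" "Comp SetCat k2 k3 = Ident SetCat (Src SetCat y')"
    using k2(2) unfolding iso_arrow_def k2s by blast
  have srcm: "Src SetCat (on_ar F m') = Fo (Src C m')" using F_hom(1)[OF mA] unfolding hom_def by simp
  have XU: "fn (?m X) z \<in> U" if z: "z \<in> Fo X" for z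
  proof -
    have k1h: "k1 \<in> hom C X (Src C m')" using k1(1) srcX by simp
    define z1 where "z1 = Fa k1 z"
    have z1: "z1 \<in> Fo (Src C m')" unfolding z1_def by (rule Fa_mem[OF k1h z])
    have "fn (?m X) z = Fa m' z1" unfolding z1_def k1(2)[symmetric] by (rule Fa_comp[OF k1h mA z])
    also have "\<dots> = fn y (fn k z1)"
      unfolding k(2)[symmetric] by (rule fn_Comp[OF k(1) yA]) (use z1 srcm in simp)
    finally have e1: "fn (?m X) z = fn y (fn k z1)" .
    define z2 where "z2 = fn k z1"
    have z2: "z2 \<in> Src SetCat y" unfolding z2_def using PiE_mem[OF hom_SetCatD(2)[OF k(1)]] z1 srcm by simp
    have "fn y z2 = fn y' (fn h z2)"
      unfolding y(4)[symmetric] by (rule fn_Comp[OF _ y'A z2]) (use y(3) y(4) in simp)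
    moreover have z3: "fn h z2 \<in> Src SetCat y'" by (rule PiE_mem[OF hom_SetCatD(2)[OF y(3)] z2])
    moreover have "fn y' (fn h z2) = fn i (fn k3 (fn h z2))"
    proof -
      have z4: "fn k3 (fn h z2) \<in> U" by (rule PiE_mem[OF hom_SetCatD(2)[OF k3(1)] z3])
      have "fn k2 (fn k3 (fn h z2)) = fn (Comp SetCat k2 k3) (fn h z2)"
        by (rule fn_Comp[symmetric, OF k3(1) _ z3]) (use k2(1) srci in simp)
      also have "\<dots> = fn h z2" unfolding k3(2) using z3 by (simp add: SetCat_def fn_def)
      finally have "fn y' (fn k2 (fn k3 (fn h z2))) = fn y' (fn h z2)" by simp
      moreover have "fn i (fn k3 (fn h z2)) = fn y' (fn k2 (fn k3 (fn h z2)))"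
        unfolding k2(3)[symmetric] by (rule fn_Comp[OF _ y'A z4]) (use k2(1) srci k2(3) in simp)
      ultimately show ?thesis by simp
    qed
    moreover have "fn k3 (fn h z2) \<in> U" by (rule PiE_mem[OF hom_SetCatD(2)[OF k3(1)] z3])
    ultimately show ?thesis using e1 ifn unfolding z2_def by simp
  qed
  show ?thesis
  proof (intro Set.set_eqI iffI)
    fix \<rho> assume "\<rho> \<in> img X"
    then obtain z where z: "z \<in> Fo X" "\<rho> = coord X z" unfolding img_def by blast
    obtain a z' where a: "a \<in> A" "z' \<in> Fo a" "fn (?m X) z = fn (?m a) z'" using XU[OF z(1)] unfolding U_def by blast
    have "coord X z = coord a z'" using cs[OF X z(1)] cs[OF A(2,3)[OF a(1)] a(2)] a(3) by simp
    then show "\<rho> \<in> (\<Union>a\<in>A. img a)" unfolding img_def using z a by blast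
  next
    fix \<rho> assume "\<rho> \<in> (\<Union>a\<in>A. img a)"
    then obtain a z where a: "a \<in> A" "z \<in> Fo a" "\<rho> = coord a z" unfolding img_def by blast
    have "ev (\<lambda>\<M>. extension \<M> a \<subseteq> extension \<M> X)" using un by eventually_elim (use a in blast)
    then have r: "admissible a X (\<lambda>w. w)" using admissible_sub[of a X] A(2,3)[OF a(1)] X by simp
    have "coord X (Fa (reidx a X (\<lambda>w. w)) z) = \<rho>"
      using coord_reidx_sub[OF r _ a(2)] A(3)[OF a(1)] X(2) a(3) by simp
    then show "\<rho> \<in> img X" unfolding img_def using Fa_mem[OF reidx_hom[OF r] a(2)] by blast
  qed
qed

text \<open>The inclusion into \<open>E\<^sup>V\<close> followed by the projections gives the coordinate arrows.\<close>

lemma ext_map_coord: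
  assumes "\<phi> \<in> Fml L" "z \<in> Fo \<phi>"
  shows "ext_map L T F \<phi> z = coord \<phi> z"
  unfolding ext_map_def b_map_def coord_def o_def
proof (rule restrict_ext)
  fix x assume x: "x \<in> fv \<phi>"
  note i = incl[OF assms(1)] and p = proj[OF finite_fv x]
  have EV: "EV (fv \<phi>) \<in> Fml L" "fv (EV (fv \<phi>) :: 'r fml) = fv \<phi>" by simp_all
  have "ev (\<lambda>\<M>. Den (incl L T \<phi>) \<M> O Den (proj L T (fv \<phi>) (pos (fv \<phi>) x)) \<M> = Den (pr \<phi> x) \<M>)"
    using i[THEN conjunct2] p[THEN conjunct2] Den_pr[OF assms(1) x]
  proof eventually_elim
    case (elim \<M>)
    have "(a, b) \<in> Id_on (extension \<M> \<phi>) O graph (EV (fv \<phi>)) (eqv 0 0) (\<lambda>_. x) \<M> \<longleftrightarrow>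
      (a, b) \<in> graph \<phi> (eqv 0 0) (\<lambda>_. x) \<M>" for a b
      using extension_sub[of \<M> \<phi>] by (auto simp: graph_iff relcomp_unfold Id_on_iff ext_EV)
    then show ?case unfolding elim by (intro set_eq_subset[THEN iffD2] conjI subrelI) blast+
  qed
  then have "Comp C (proj L T (fv \<phi>) (pos (fv \<phi>) x)) (incl L T \<phi>) = pr \<phi> x"
    using comp_eq_iff[OF i[THEN conjunct1] p[THEN conjunct1] pr_hom[OF assms(1) x]] by blast
  then show "Fa (proj L T (fv \<phi>) (pos (fv \<phi>) x)) (Fa (incl L T \<phi>) z) = Fa (pr \<phi> x) z"
    using Fa_comp[OF i[THEN conjunct1] p[THEN conjunct1] assms(2)] by simp
qed

end

section \<open>Satisfaction clauses as operations on extensions\<close>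

lemma sat_restrict:
  assumes "fv \<phi> \<subseteq> W"
  shows "sat \<N> (\<lambda>w\<in>W. \<rho> w) bs \<phi> \<longleftrightarrow> sat \<N> \<rho> bs \<phi>"
  by (rule sat_cong) (use assms in auto)

lemma extension_context_sat:
  assumes "finite W" "fv \<phi> \<subseteq> W"
  shows "extension \<N> (conj \<phi> (EV W)) = {\<rho> \<in> W \<rightarrow>\<^sub>E uni \<N>. sat \<N> \<rho> [] \<phi>}"
proof -
  have fv: "fv (conj \<phi> (EV W)) = W" using assms by auto
  show ?thesis unfolding extension_def fv sat_conj by simp
qed

text \<open>
  Extra variables are added to \<open>\<phi>\<close> by conjunction with \<open>EV W\<close>; this is an inverse image along a
  projection.
\<close>

lemma extension_context:
  assumes "finite W" "fv \<phi> \<subseteq> W"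
  shows "extension \<N> (conj \<phi> (EV W)) = {\<rho> \<in> extension \<N> (EV W). (\<lambda>w\<in>fv \<phi>. \<rho> w) \<in> extension \<N> \<phi>}"
proof -
  have "(\<lambda>w\<in>fv \<phi>. \<rho> w) \<in> extension \<N> \<phi> \<longleftrightarrow> sat \<N> \<rho> [] \<phi>" if "\<rho> \<in> W \<rightarrow>\<^sub>E uni \<N>" for \<rho>
    unfolding extension_iff sat_restrict[OF order_refl]
    using reindex_PiE[OF that, of "\<lambda>w. w" "fv \<phi>"] assms(2) by simp
  then show ?thesis unfolding extension_context_sat[OF assms] ext_EV[OF assms(1)] by blast
qed

lemma extension_Or:
  assumes W_def: "W = fv \<phi> \<union> fv \<psi>"
  shows "extension \<N> (Or \<phi> \<psi>) = extension \<N> (conj \<phi> (EV W)) \<union> extension \<N> (conj \<psi> (EV W))"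
proof -
  have W: "finite W" "fv \<phi> \<subseteq> W" "fv \<psi> \<subseteq> W" "fv (Or \<phi> \<psi>) = W" by (simp_all add: W_def)
  show ?thesis
    unfolding extension_context_sat[OF W(1,2)] extension_context_sat[OF W(1,3)]
    unfolding extension_def W(4) sat.simps by blast
qed

lemma extension_Neg:
  "extension \<N> (EV (fv \<phi>)) = extension \<N> \<phi> \<union> extension \<N> (Neg \<phi>)"
  "extension \<N> (conj \<phi> (Neg \<phi>)) = {}"
  by (auto simp: extension_iff)

lemma extension_ex:
  assumes "\<phi> \<in> Fml L" and W_def: "W = insert X (fv \<phi>)"
  shows "extension \<N> (ex X \<phi>) = (\<lambda>\<rho>. \<lambda>w\<in>fv (ex X \<phi>). \<rho> w) ` extension \<N> (conj \<phi> (EV W))"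
proof -
  have W: "finite W" "fv \<phi> \<subseteq> W" "X \<in> W" by (auto simp: W_def)
  have sub: "fv (ex X \<phi>) \<subseteq> W" using W(2) by auto
  show ?thesis
    unfolding extension_context_sat[OF W(1,2)]
  proof (intro Set.set_eqI iffI)
    fix \<rho> assume "\<rho> \<in> extension \<N> (ex X \<phi>)"
    then have \<rho>: "\<rho> \<in> fv (ex X \<phi>) \<rightarrow>\<^sub>E uni \<N>" "sat \<N> \<rho> [] (ex X \<phi>)" unfolding extension_iff by blast+
    then obtain a where a: "a \<in> uni \<N>" "sat \<N> (\<rho>(X := a)) [] \<phi>"
      unfolding sat_ex[OF assms(1)] by blast
    have "\<rho>(X := a) \<in> W \<rightarrow>\<^sub>E uni \<N>"
      using PiE_fun_upd[where f = \<rho> and S = "fv (ex X \<phi>)" and T = "\<lambda>_. uni \<N>" and x = X, OF a(1) \<rho>(1)]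
      by (simp add: W_def)
    moreover have "(\<lambda>w\<in>fv (ex X \<phi>). (\<rho>(X := a)) w) = \<rho>"
    proof
      fix w show "(\<lambda>w\<in>fv (ex X \<phi>). (\<rho>(X := a)) w) w = \<rho> w"
        using PiE_arb[OF \<rho>(1), of w] by (cases "w \<in> fv (ex X \<phi>)") auto
    qed
    ultimately show "\<rho> \<in> (\<lambda>\<rho>. \<lambda>w\<in>fv (ex X \<phi>). \<rho> w) ` {\<rho> \<in> W \<rightarrow>\<^sub>E uni \<N>. sat \<N> \<rho> [] \<phi>}"
      using a(2) by (intro image_eqI[of _ _ "\<rho>(X := a)"]) simp_all
  next
    fix \<rho> assume "\<rho> \<in> (\<lambda>\<rho>. \<lambda>w\<in>fv (ex X \<phi>). \<rho> w) ` {\<rho> \<in> W \<rightarrow>\<^sub>E uni \<N>. sat \<N> \<rho> [] \<phi>}"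
    then obtain \<rho>' where r: "\<rho>' \<in> W \<rightarrow>\<^sub>E uni \<N>" "sat \<N> \<rho>' [] \<phi>" "\<rho> = (\<lambda>w\<in>fv (ex X \<phi>). \<rho>' w)" by blast
    have "sat \<N> (\<rho>'(X := \<rho>' X)) [] \<phi>" using r(2) by simp
    then have "sat \<N> \<rho>' [] (ex X \<phi>)" unfolding sat_ex[OF assms(1)] using PiE_mem[OF r(1) W(3)] by blast
    then have "sat \<N> \<rho> [] (ex X \<phi>)" unfolding r(3) sat_restrict[OF order_refl] .
    moreover have "\<rho> \<in> fv (ex X \<phi>) \<rightarrow>\<^sub>E uni \<N>"
      unfolding r(3) using reindex_PiE[OF r(1), of "\<lambda>w. w"] sub by simp
    ultimately show "\<rho> \<in> extension \<N> (ex X \<phi>)" unfolding extension_iff by blast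
  qed
qed

text \<open>The direct image of the universe along the diagonal, or along a renaming if \<open>X = Y\<close>.\<close>

lemma extension_eqv:
  fixes \<N> :: "('r, 'u) struct"
  shows "extension \<N> (eqv X Y) = (\<lambda>\<rho>. \<lambda>w\<in>fv (eqv X Y :: 'r fml). \<rho> 0) ` ({0 :: int} \<rightarrow>\<^sub>E uni \<N>)"
  unfolding fv_eqv
proof (intro Set.set_eqI iffI)
  fix \<rho> assume "\<rho> \<in> extension \<N> (eqv X Y)"
  then have \<rho>: "\<rho> \<in> {X, Y} \<rightarrow>\<^sub>E uni \<N>" "\<rho> X = \<rho> Y" unfolding extension_iff sat_eqv fv_eqv by blast+
  have "\<rho> X \<in> uni \<N>" by (rule PiE_mem[OF \<rho>(1)]) simp
  then have c: "(\<lambda>w\<in>{0 :: int}. \<rho> X) \<in> {0} \<rightarrow>\<^sub>E uni \<N>" by simp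
  have "\<rho> w = (\<lambda>w\<in>{X, Y}. \<rho> X) w" for w
  proof (cases "w \<in> {X, Y}")
    case True
    then have "\<rho> w = \<rho> X" using \<rho>(2) by (elim insertE emptyE) simp_all
    then show ?thesis using True by (simp only: restrict_apply')
  next
    case False
    then show ?thesis using PiE_arb[OF \<rho>(1) False] by (simp only: restrict_def if_False)
  qed
  then have "\<rho> = (\<lambda>w\<in>{X, Y}. \<rho> X)" by (rule ext)
  moreover have "(\<lambda>w\<in>{X, Y}. (\<lambda>w\<in>{0 :: int}. \<rho> X) 0) = (\<lambda>w\<in>{X, Y}. \<rho> X)" by simp
  ultimately have eq: "\<rho> = (\<lambda>w\<in>{X, Y}. (\<lambda>w\<in>{0 :: int}. \<rho> X) 0)" by (rule trans[OF _ sym])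
  show "\<rho> \<in> (\<lambda>\<rho>. \<lambda>w\<in>{X, Y}. \<rho> 0) ` ({0 :: int} \<rightarrow>\<^sub>E uni \<N>)" unfolding image_iff by (rule bexI[OF _ c]) (rule eq)
next
  fix \<rho> assume "\<rho> \<in> (\<lambda>\<rho>. \<lambda>w\<in>{X, Y}. \<rho> 0) ` ({0 :: int} \<rightarrow>\<^sub>E uni \<N>)"
  then obtain \<rho>' where r: "\<rho>' \<in> {0 :: int} \<rightarrow>\<^sub>E uni \<N>" "\<rho> = (\<lambda>w\<in>{X, Y}. \<rho>' 0)" by blast
  then show "\<rho> \<in> extension \<N> (eqv X Y)"
    unfolding extension_iff sat_eqv fv_eqv using reindex_PiE[OF r(1), of "\<lambda>_. 0" "{X, Y}"] by simp
qed

lemma fv_tilde: "L P = Some n \<Longrightarrow> fv (tilde L P) = xpos ` {1..n}"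
  by (simp add: tilde_def atLeastLessThanSuc_atLeastAtMost image_UN[symmetric] UNION_singleton_eq_range del: upt_Suc)

lemma s_map_eq:
  assumes "\<rho> \<in> xpos ` {1..n} \<rightarrow>\<^sub>E A" "\<rho>' \<in> xpos ` {1..n} \<rightarrow>\<^sub>E A" "s_map n \<rho> = s_map n \<rho>'"
  shows "\<rho> = \<rho>'"
proof (rule PiE_ext[OF assms(1,2)])
  fix k assume "k \<in> xpos ` {1..n}"
  then obtain i where i: "i \<in> {1..n}" "k = xpos i" by blast
  then have "i \<in> set [1..<Suc n]" by (simp del: upt_Suc)
  then show "\<rho> k = \<rho>' k" using assms(3) unfolding s_map_def map_eq_conv i(2) by blast
qed

lemma s_map_args:
  assumes "length Xs = n"
  shows "s_map n (\<lambda>w\<in>xpos ` {1..n}. \<rho> (Xs ! (nat w - 1))) = map \<rho> Xs"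
proof (rule nth_equalityI)
  fix i assume "i < length (s_map n (\<lambda>w\<in>xpos ` {1..n}. \<rho> (Xs ! (nat w - 1))))"
  then have i: "i < n" by (simp add: s_map_def del: upt_Suc)
  then have "[1..<Suc n] ! i = Suc i" by (simp del: upt_Suc)
  then have "s_map n (\<lambda>w\<in>xpos ` {1..n}. \<rho> (Xs ! (nat w - 1))) ! i =
      (\<lambda>w\<in>xpos ` {1..n}. \<rho> (Xs ! (nat w - 1))) (xpos (Suc i))"
    using i by (simp add: s_map_def del: upt_Suc)
  also have "\<dots> = \<rho> (Xs ! (nat (xpos (Suc i)) - 1))"
    by (rule restrict_apply') (use i in \<open>simp add: imageI\<close>)
  also have "nat (xpos (Suc i)) = Suc i" unfolding xpos_def by (rule nat_int)
  also have "\<rho> (Xs ! (Suc i - 1)) = map \<rho> Xs ! i" using i assms by simp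
  finally show "s_map n (\<lambda>w\<in>xpos ` {1..n}. \<rho> (Xs ! (nat w - 1))) ! i = map \<rho> Xs ! i" .
qed (simp add: s_map_def assms)

lemma sat_tilde:
  assumes "L P = Some n" "n > 0"
  shows "sat \<N> \<rho> [] (tilde L P) \<longleftrightarrow> s_map n \<rho> \<in> rel \<N> P"
proof -
  have "map (val \<rho> []) (map (\<lambda>i. Free (xpos i)) [1..<Suc n]) = s_map n \<rho>"
    by (simp add: s_map_def del: upt_Suc)
  moreover have "map (\<lambda>i. Free (xpos i)) [1..<Suc n] \<noteq> []" using assms(2) by simp
  ultimately show ?thesis unfolding tilde_def assms(1) option.sel sat.simps by presburger
qed

text \<open>The inverse image of \<open>P x\<^sub>1 \<dots> x\<^sub>n\<close> along the change of variables that sends \<open>x\<^sub>i\<close> to the \<open>i\<close>-th argument.\<close>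

lemma extension_Rel:
  assumes L: "L P = Some n" and n: "length Xs = n" "n > 0"
  shows "extension \<N> (Rel P (map Free Xs)) = {\<rho> \<in> extension \<N> (EV (set Xs)).
    (\<lambda>w\<in>fv (tilde L P). \<rho> (Xs ! (nat w - 1))) \<in> extension \<N> (tilde L P)}"
proof -
  have fv: "fv (Rel P (map Free Xs)) = set Xs" by auto
  have im: "(\<lambda>w. Xs ! (nat w - 1)) ` fv (tilde L P) \<subseteq> set Xs"
    using n by (auto simp: fv_tilde[where L = L, OF L] xpos_def)
  have key: "(\<lambda>w\<in>fv (tilde L P). \<rho> (Xs ! (nat w - 1))) \<in> extension \<N> (tilde L P) \<longleftrightarrow>
    sat \<N> \<rho> [] (Rel P (map Free Xs))" if \<rho>: "\<rho> \<in> set Xs \<rightarrow>\<^sub>E uni \<N>" for \<rho>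
  proof -
    have "map (val \<rho> []) (map Free Xs) = map \<rho> Xs" by simp
    moreover have "map Free Xs \<noteq> []" using n by auto
    ultimately have "sat \<N> \<rho> [] (Rel P (map Free Xs)) \<longleftrightarrow> map \<rho> Xs \<in> rel \<N> P"
      unfolding sat.simps by presburger
    moreover have "sat \<N> (\<lambda>w\<in>fv (tilde L P). \<rho> (Xs ! (nat w - 1))) [] (tilde L P) \<longleftrightarrow> map \<rho> Xs \<in> rel \<N> P"
      unfolding sat_tilde[where L = L, OF L n(2)] unfolding fv_tilde[where L = L, OF L] s_map_args[OF n(1)] ..
    ultimately show ?thesis
      unfolding extension_iff using reindex_PiE[OF \<rho> im] by simp
  qed
  have "extension \<N> (Rel P (map Free Xs)) = {\<rho> \<in> set Xs \<rightarrow>\<^sub>E uni \<N>. sat \<N> \<rho> [] (Rel P (map Free Xs))}"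
    unfolding extension_def fv ..
  also have "\<dots> = {\<rho> \<in> set Xs \<rightarrow>\<^sub>E uni \<N>.
      (\<lambda>w\<in>fv (tilde L P). \<rho> (Xs ! (nat w - 1))) \<in> extension \<N> (tilde L P)}"
    by (rule Collect_cong) (rule conj_cong[OF HOL.refl], rule key[symmetric])
  finally show ?thesis unfolding ext_EV[OF finite_set] .
qed

context set_functor
begin

abbreviation "\<F> \<equiv> functor_struct L T F"

lemma uni_F: "uni \<F> = Fo (eqv 0 0)"
  by (simp add: functor_struct_def)

lemma img_EV_F: "finite V \<Longrightarrow> img (EV V) = extension \<F> (EV V)"
  by (simp add: img_EV ext_EV uni_F)

lemma img_context:
  assumes "\<phi> \<in> Fml L" "finite W" "fv \<phi> \<subseteq> W" "img \<phi> = extension \<F> \<phi>"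
  shows "img (conj \<phi> (EV W)) = extension \<F> (conj \<phi> (EV W))"
proof -
  have F: "EV W \<in> Fml L" "conj \<phi> (EV W) \<in> Fml L" using assms(1) by simp_all
  have fv: "fv (EV W :: 'r fml) = W" "fv (conj \<phi> (EV W)) = W" using assms by auto
  have "img (conj \<phi> (EV W)) = {\<rho> \<in> img (EV W). (\<lambda>w\<in>fv \<phi>. \<rho> w) \<in> img \<phi>}"
  proof (rule img_glue[OF F(1) assms(1) F(2)])
    show "ev (\<lambda>\<M>. extension \<M> (conj \<phi> (EV W)) =
        {\<rho> \<in> extension \<M> (EV W). (\<lambda>w\<in>fv \<phi>. \<rho> w) \<in> extension \<M> \<phi>})"
      by (rule always_eventually) (rule allI, rule extension_context[OF assms(2,3)])
  qed (use fv assms(3) in simp_all)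
  then show ?thesis
    unfolding assms(4) img_EV_F[OF assms(2)] extension_context[OF assms(2,3)] .
qed

lemma tilde_Fml: "L P = Some n \<Longrightarrow> tilde L P \<in> Fml L"
  using Fml_Rel[of P "map xpos [1..<Suc n]" L] by (simp add: tilde_def comp_def del: upt_Suc)

text \<open>
  For \<open>P x\<^sub>1 \<dots> x\<^sub>n\<close> this is the definition of the structure; other arguments are inverse images of this case
  on both sides.
\<close>

lemma img_Rel:
  assumes L: "L P = Some n" and n: "length Xs = n" "n > 0"
  shows "img (Rel P (map Free Xs)) = extension \<F> (Rel P (map Free Xs))"
proof -
  have F: "Rel P (map Free Xs) \<in> Fml L" using L n by (simp add: Fml_Rel)
  note tF = tilde_Fml[OF L]
  have fv: "fv (Rel P (map Free Xs)) = set Xs" by auto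
  have fvE: "fv (EV (set Xs) :: 'r fml) = set Xs" by simp
  have im: "(\<lambda>w. Xs ! (nat w - 1)) ` fv (tilde L P) \<subseteq> set Xs"
    using n by (auto simp: fv_tilde[where L = L, OF L] xpos_def)
  have rel: "rel \<F> P = s_map n ` img (tilde L P)"
  proof -
    have "rel \<F> P = (\<lambda>z. s_map n (ext_map L T F (tilde L P) z)) ` Fo (tilde L P)"
      by (simp add: functor_struct_def L o_def)
    also have "\<dots> = (\<lambda>z. s_map n (coord (tilde L P) z)) ` Fo (tilde L P)"
      using ext_map_coord[OF tF] by (intro image_cong HOL.refl) simp
    finally show ?thesis unfolding img_def image_image .
  qed
  have sub: "img (tilde L P) \<subseteq> fv (tilde L P) \<rightarrow>\<^sub>E uni \<F>" unfolding uni_F by (rule img_sub[OF tF])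
  have t: "\<tau> \<in> img (tilde L P) \<longleftrightarrow> \<tau> \<in> extension \<F> (tilde L P)"
    if \<tau>: "\<tau> \<in> fv (tilde L P) \<rightarrow>\<^sub>E uni \<F>" for \<tau>
  proof -
    have "s_map n \<tau> \<in> rel \<F> P \<longleftrightarrow> \<tau> \<in> img (tilde L P)"
    proof
      assume "s_map n \<tau> \<in> rel \<F> P"
      then obtain \<tau>' where \<tau>': "\<tau>' \<in> img (tilde L P)" "s_map n \<tau> = s_map n \<tau>'" unfolding rel by blast
      have "\<tau>' \<in> fv (tilde L P) \<rightarrow>\<^sub>E uni \<F>" using \<tau>'(1) sub by blast
      then have "\<tau> = \<tau>'" using s_map_eq[of \<tau> n "uni \<F>" \<tau>'] \<tau> \<tau>'(2) unfolding fv_tilde[where L = L, OF L] by blast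
      then show "\<tau> \<in> img (tilde L P)" using \<tau>'(1) by simp
    qed (simp add: rel)
    then show ?thesis unfolding extension_iff sat_tilde[where L = L, OF L n(2)] using \<tau> by blast
  qed
  have "img (Rel P (map Free Xs)) = {\<rho> \<in> img (EV (set Xs)).
      (\<lambda>w\<in>fv (tilde L P). \<rho> (Xs ! (nat w - 1))) \<in> img (tilde L P)}"
  proof (rule img_glue[OF _ tF F])
    show "fv (Rel P (map Free Xs)) = fv (EV (set Xs) :: 'r fml)" unfolding fv fvE ..
    show "(\<lambda>w. Xs ! (nat w - 1)) ` fv (tilde L P) \<subseteq> fv (EV (set Xs) :: 'r fml)" unfolding fvE by (rule im)
    show "ev (\<lambda>\<M>. extension \<M> (Rel P (map Free Xs)) = {\<rho> \<in> extension \<M> (EV (set Xs)).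
        (\<lambda>w\<in>fv (tilde L P). \<rho> (Xs ! (nat w - 1))) \<in> extension \<M> (tilde L P)})"
      by (rule always_eventually) (rule allI, rule extension_Rel[where L = L, OF L n])
  qed simp
  also have "\<dots> = {\<rho> \<in> extension \<F> (EV (set Xs)).
      (\<lambda>w\<in>fv (tilde L P). \<rho> (Xs ! (nat w - 1))) \<in> extension \<F> (tilde L P)}"
  proof (intro Collect_cong conj_cong)
    show "\<rho> \<in> img (EV (set Xs)) \<longleftrightarrow> \<rho> \<in> extension \<F> (EV (set Xs))" for \<rho>
      by (simp only: img_EV_F[OF finite_set])
    fix \<rho> assume "\<rho> \<in> extension \<F> (EV (set Xs))"
    then have "\<rho> \<in> set Xs \<rightarrow>\<^sub>E uni \<F>" by (simp only: ext_EV[OF finite_set])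
    from t[OF reindex_PiE[OF this im]]
    show "(\<lambda>w\<in>fv (tilde L P). \<rho> (Xs ! (nat w - 1))) \<in> img (tilde L P) \<longleftrightarrow>
      (\<lambda>w\<in>fv (tilde L P). \<rho> (Xs ! (nat w - 1))) \<in> extension \<F> (tilde L P)" .
  qed
  finally show ?thesis by (simp only: extension_Rel[where L = L, OF L n])
qed

lemma EV_empty: "EV {} = (S_fml :: 'r fml)"
  by (simp add: EV_def)

lemma Fo_S: "\<exists>u. Fo S_fml = {u}"
proof -
  have i: "img S_fml = {\<lambda>_. undefined}" using img_EV[of "{}"] by (simp add: EV_empty)
  then obtain u where u: "u \<in> Fo S_fml" unfolding img_def by blast
  have "u' = u" if "u' \<in> Fo S_fml" for u'
  proof (rule coord_inj[OF Fml_S that u])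
    have "coord S_fml u' \<in> img S_fml" "coord S_fml u \<in> img S_fml" using that u unfolding img_def by blast+
    then show "coord S_fml u' = coord S_fml u" unfolding i by simp
  qed
  then show ?thesis using u by blast
qed

lemma img_sentence:
  assumes "sentence s"
  shows "img s = (if Fo s = {} then {} else {\<lambda>_. undefined})"
proof -
  have "coord s z = (\<lambda>_. undefined)" for z
    using assms by (simp add: coord_def sentence_def restrict_def)
  then show ?thesis unfolding img_def by auto
qed

lemma ext_map0_mem:
  assumes "s \<in> Fml L" "sentence s" "z \<in> Fo s"
  shows "ext_map0 L T F s z \<in> Fo S_fml"
proof -
  have "EV (fv s) = (S_fml :: 'r fml)" using assms(2) by (simp add: sentence_def EV_empty)
  then show ?thesis unfolding ext_map0_def using Fa_mem[OF incl[OF assms(1), THEN conjunct1] assms(3)] by simp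
qed

lemma ext_map0_image:
  assumes "s \<in> Fml L" "sentence s"
  shows "ext_map0 L T F s ` Fo s = (if Fo s = {} then {} else Fo S_fml)"
proof (cases "Fo s = {}")
  case False
  obtain u where u: "Fo S_fml = {u}" using Fo_S by blast
  have "ext_map0 L T F s ` Fo s \<subseteq> {u}" using ext_map0_mem[OF assms] unfolding u by blast
  moreover have "ext_map0 L T F s ` Fo s \<noteq> {}" using False by simp
  ultimately show ?thesis using False unfolding u by (simp add: subset_singleton_iff)
qed simp

lemma img_Rel0:
  assumes L: "L P = Some 0"
  shows "img (Rel P []) = extension \<F> (Rel P [])"
proof -
  have F: "Rel P [] \<in> Fml L" using Fml_Rel[of P "[]" L] L by simp
  have s: "sentence (Rel P [])" by (simp add: sentence_def)
  have "rel0 \<F> P = (if Fo (Rel P []) = {} then {} else Fo S_fml)"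
    unfolding ext_map0_image[OF F s, symmetric] by (simp add: functor_struct_def)
  moreover have "pt \<F> = Fo S_fml" by (simp add: functor_struct_def)
  ultimately have "holds \<F> (Rel P []) \<longleftrightarrow> Fo (Rel P []) \<noteq> {}" using Fo_S by (auto simp: holds_def)
  then show ?thesis unfolding img_sentence[OF s] extension_sentence[OF s] by auto
qed

text \<open>
  Each case writes the extension by an operation that \<open>img\<close> respects. The description is used twice:
  in almost all structures on the integers, to learn about \<open>img\<close>, and in the structure given by \<open>F\<close>.
\<close>

theorem img_extension: "\<phi> \<in> Fml L \<Longrightarrow> img \<phi> = extension \<F> \<phi>"
proof (induction rule: Fml.induct)
  case (1 P Xs)
  show ?case
  proof (cases "Xs = []")
    case True
    then show ?thesis using img_Rel0[of P] 1 by simp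
  next
    case False
    then show ?thesis using img_Rel[OF 1] by simp
  qed
next
  case (2 X Y)
  have "EV {0} = (eqv 0 0 :: 'r fml)" by (simp add: EV_def)
  then have A: "img (eqv 0 0) = {0} \<rightarrow>\<^sub>E uni \<F>" and eA: "extension \<M> (eqv 0 0) = {0} \<rightarrow>\<^sub>E uni \<M>"
    for \<M> :: "('r, int) struct"
    using img_EV[of "{0}"] ext_EV[of "{0}" \<M>] by (simp_all add: uni_F)
  have e: "extension \<M> (eqv X Y) = (\<lambda>\<rho>. \<lambda>w\<in>fv (eqv X Y :: 'r fml). \<rho> 0) ` extension \<M> (eqv 0 0)"
    for \<M> :: "('r, int) struct" unfolding eA by (rule extension_eqv)
  have "admissible (eqv 0 0) (eqv X Y) (\<lambda>_. 0)"
    unfolding admissible_def e by (simp add: always_eventually)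
  then have "img (eqv X Y) = (\<lambda>\<rho>. \<lambda>w\<in>fv (eqv X Y :: 'r fml). \<rho> 0) ` img (eqv 0 0)"
    by (rule img_image) (simp only: e order_refl eventually_True)
  also have "\<dots> = extension \<F> (eqv X Y)" unfolding A by (rule extension_eqv[symmetric])
  finally show ?case .
next
  case (3 \<phi>)
  have N: "Neg \<phi> \<in> Fml L" "conj \<phi> (Neg \<phi>) \<in> Fml L" using 3 by simp_all
  have E: "EV (fv \<phi>) \<in> Fml L" "fv (EV (fv \<phi>) :: 'r fml) = fv \<phi>" by simp_all
  have "img (EV (fv \<phi>)) = (\<Union>a\<in>{\<phi>, Neg \<phi>}. img a)"
    by (rule img_union[OF _ _ _ E])
      (use 3 N in \<open>auto simp: extension_Neg(1) intro!: always_eventually\<close>)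
  then have un: "extension \<F> \<phi> \<union> extension \<F> (Neg \<phi>) = img \<phi> \<union> img (Neg \<phi>)"
    using img_EV_F[OF finite_fv, of \<phi>] unfolding extension_Neg(1) by simp
  have "img (conj \<phi> (Neg \<phi>)) = (\<Union>a\<in>{}. img a)"
    by (rule img_union[of "{}" "fv \<phi>"]) (use N in \<open>simp_all add: extension_Neg(2)\<close>)
  moreover have "img (conj \<phi> (Neg \<phi>)) = {\<rho> \<in> img \<phi>. (\<lambda>w\<in>fv (Neg \<phi>). \<rho> w) \<in> img (Neg \<phi>)}"
  proof (rule img_glue[OF 3(1) N])
    have "extension \<M> (conj \<phi> (Neg \<phi>)) =
        {\<rho> \<in> extension \<M> \<phi>. (\<lambda>w\<in>fv (Neg \<phi>). \<rho> w) \<in> extension \<M> (Neg \<phi>)}"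
      for \<M> :: "('r, int) struct"
      using restrict_extension[of _ \<M> \<phi>] by (auto simp: extension_iff)
    then show "ev (\<lambda>\<M>. extension \<M> (conj \<phi> (Neg \<phi>)) =
        {\<rho> \<in> extension \<M> \<phi>. (\<lambda>w\<in>fv (Neg \<phi>). \<rho> w) \<in> extension \<M> (Neg \<phi>)})"
      by (rule always_eventually[OF allI])
  qed simp_all
  moreover have "(\<lambda>w\<in>fv (Neg \<phi>). \<rho> w) = \<rho>" if "\<rho> \<in> img \<phi>" for \<rho>
    using that coord_restrict[of \<phi>] unfolding img_def by auto
  ultimately have disj: "img \<phi> \<inter> img (Neg \<phi>) = {}" by auto
  have disj': "extension \<F> \<phi> \<inter> extension \<F> (Neg \<phi>) = {}" by (auto simp: extension_iff)
  show ?case using un disj disj' 3(2) by blast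
next
  case (4 \<phi> \<psi>)
  define W where "W = fv \<phi> \<union> fv \<psi>"
  have W: "finite W" "fv \<phi> \<subseteq> W" "fv \<psi> \<subseteq> W" "fv (Or \<phi> \<psi>) = W" by (simp_all add: W_def)
  have fv: "fv (conj \<phi> (EV W)) = W" "fv (conj \<psi> (EV W)) = W" using W by auto
  have "img (Or \<phi> \<psi>) = (\<Union>a\<in>{conj \<phi> (EV W), conj \<psi> (EV W)}. img a)"
  proof (rule img_union[of _ W])
    have "extension \<M> (Or \<phi> \<psi>) = (\<Union>a\<in>{conj \<phi> (EV W), conj \<psi> (EV W)}. extension \<M> a)"
      for \<M> :: "('r, int) struct"
      by (simp only: extension_Or[OF W_def] UN_insert UN_empty Un_empty_right)
    then show "ev (\<lambda>\<M>. extension \<M> (Or \<phi> \<psi>) = (\<Union>a\<in>{conj \<phi> (EV W), conj \<psi> (EV W)}. extension \<M> a))"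
      by (rule always_eventually[OF allI])
    show "a \<in> Fml L" if "a \<in> {conj \<phi> (EV W), conj \<psi> (EV W)}" for a
      using that 4(1,2) by (elim insertE emptyE) simp_all
    show "fv a = W" if "a \<in> {conj \<phi> (EV W), conj \<psi> (EV W)}" for a
      using that fv by blast
  qed (use 4(1,2) W(4) in simp_all)
  also have "\<dots> = extension \<F> (conj \<phi> (EV W)) \<union> extension \<F> (conj \<psi> (EV W))"
    using img_context[OF 4(1) W(1,2) 4(3)] img_context[OF 4(2) W(1,3) 4(4)] by simp
  also have "\<dots> = extension \<F> (Or \<phi> \<psi>)" by (rule extension_Or[OF W_def, symmetric])
  finally show ?case .
next
  case (5 \<phi> X)
  define W where "W = insert X (fv \<phi>)"
  have W: "finite W" "fv \<phi> \<subseteq> W" by (auto simp: W_def)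
  have F: "conj \<phi> (EV W) \<in> Fml L" "ex X \<phi> \<in> Fml L" using 5(1) by auto
  have fv: "fv (ex X \<phi>) \<subseteq> fv (conj \<phi> (EV W))" using W by auto
  note e = extension_ex[OF 5(1) W_def]
  have "admissible (conj \<phi> (EV W)) (ex X \<phi>) (\<lambda>w. w)"
    unfolding admissible_def using F fv unfolding e by (simp add: always_eventually)
  then have "img (ex X \<phi>) = (\<lambda>\<rho>. \<lambda>w\<in>fv (ex X \<phi>). \<rho> w) ` img (conj \<phi> (EV W))"
    by (rule img_image) (simp only: e order_refl eventually_True)
  then show ?case unfolding img_context[OF 5(1) W 5(2)] e .
qed

lemma F_structure: "is_structure L \<F>"
proof -
  have "uni \<F> \<noteq> {}" using nonempty by (simp add: uni_F)
  moreover have "\<exists>u. pt \<F> = {u}" using Fo_S by (simp add: functor_struct_def)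
  moreover have "rel \<F> P \<subseteq> {as. length as = n \<and> set as \<subseteq> uni \<F>}" if P: "L P = Some n" "n > 0" for P n
  proof
    fix as assume "as \<in> rel \<F> P"
    then obtain z where z: "z \<in> Fo (tilde L P)" "as = s_map n (ext_map L T F (tilde L P) z)"
      by (auto simp: functor_struct_def P)
    have "coord (tilde L P) z \<in> xpos ` {1..n} \<rightarrow>\<^sub>E uni \<F>"
      using coord_mem[OF tilde_Fml[OF P(1)] z(1)] unfolding fv_tilde[where L = L, OF P(1)] uni_F .
    then have "coord (tilde L P) z (xpos i) \<in> uni \<F>" if "i \<in> set [1..<Suc n]" for i
      using PiE_mem[of "coord (tilde L P) z" "xpos ` {1..n}" "\<lambda>_. uni \<F>" "xpos i"] that by auto
    then show "as \<in> {as. length as = n \<and> set as \<subseteq> uni \<F>}"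
      using z ext_map_coord[OF tilde_Fml[OF P(1)] z(1)] by (auto simp: s_map_def simp del: upt_Suc)
  qed
  moreover have "rel0 \<F> P \<subseteq> pt \<F>" if "L P = Some 0" for P
  proof -
    have "Rel P [] \<in> Fml L" "sentence (Rel P [])" using Fml_Rel[of P "[]" L] that by (simp_all add: sentence_def)
    from ext_map0_mem[OF this] show ?thesis by (auto simp: functor_struct_def)
  qed
  ultimately show ?thesis unfolding is_structure_def by blast
qed

text \<open>An axiom holds in almost all structures, so \<open>S\<close> maps to it; hence its value under \<open>F\<close> is not empty.\<close>

lemma F_model:
  assumes "s \<in> T"
  shows "holds \<F> s"
proof -
  have s: "s \<in> Fml L" "sentence s" using T assms unfolding is_theory_def by blast+
  have S: "sentence (S_fml :: 'r fml)" by (simp add: sentence_def)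
  have hS: "holds \<M> S_fml" for \<M> :: "('r, int) struct" by (simp add: holds_def)
  have "entails {s} (\<lambda>\<M>. holds \<M> s)" unfolding entails_def by simp
  then have "ev (\<lambda>\<M>. holds \<M> s)" unfolding eventually_Mods using assms by blast
  then have eq: "ev (\<lambda>\<M>. extension \<M> S_fml \<subseteq> extension \<M> s)"
    by eventually_elim (simp add: extension_sentence s(2) S)
  have "admissible S_fml s (\<lambda>w. w)"
    by (rule admissible_sub[OF Fml_S s(1) _ eq]) (use s(2) in \<open>simp add: sentence_def\<close>)
  from Fa_mem[OF reidx_hom[OF this]] Fo_S have "Fo s \<noteq> {}" by blast
  then have "img s \<noteq> {}" using img_sentence[OF s(2)] by simp
  then have "extension \<F> s \<noteq> {}" unfolding img_extension[OF s(1)] .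
  then show ?thesis by (simp add: extension_sentence[OF s(2)] split: if_splits)
qed

end

theorem mainTheorem2:
  fixes L :: "'r signature"
    and T :: "'r fml set"
    and F :: "('r fml, 'r syn_arrow, 'u set, 'u set_arrow) fnctr"
  assumes "is_theory L T"
    and "consistent L T"
    and "is_functor (Syn L T) SetCat F"
    and "preserves_finite_limits (Syn L T) SetCat F"
    and "\<And>g. effective_epi (Syn L T) g \<Longrightarrow> surjection (on_ar F g)"
    and "\<And>X. X \<in> Ob (Syn L T) \<Longrightarrow>
      join_hom (Sub (Syn L T) X) (Sub SetCat (on_ob F X)) (Sub_map SetCat F X)"
    and "on_ob F (eqv 0 0) \<noteq> {}"
  shows "(\<forall>\<phi>\<in>Fml L.
      if sentence \<phi>
      then bij_betw (ext_map0 L T F \<phi>) (on_ob F \<phi>) (extension0 (functor_struct L T F) \<phi>)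
      else bij_betw (ext_map L T F \<phi>) (on_ob F \<phi>) (extension (functor_struct L T F) \<phi>))
    \<and> is_model L (functor_struct L T F) T"
proof -
  interpret set_functor L T F
    by unfold_locales (fact assms)+
  have s: "bij_betw (ext_map0 L T F \<phi>) (on_ob F \<phi>) (extension0 (functor_struct L T F) \<phi>)"
    if \<phi>: "\<phi> \<in> Fml L" "sentence \<phi>" for \<phi>
    unfolding bij_betw_def
  proof
    have "coord \<phi> z = coord \<phi> z'" for z z'
      using \<phi>(2) by (simp add: coord_def sentence_def restrict_def)
    then show "inj_on (ext_map0 L T F \<phi>) (on_ob F \<phi>)"
      by (intro inj_onI) (rule coord_inj[OF \<phi>(1)])
    have "holds \<F> \<phi> \<longleftrightarrow> Fo \<phi> \<noteq> {}"
      using img_extension[OF \<phi>(1)] unfolding img_sentence[OF \<phi>(2)] extension_sentence[OF \<phi>(2)]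
      by (simp split: if_splits)
    then show "ext_map0 L T F \<phi> ` on_ob F \<phi> = extension0 (functor_struct L T F) \<phi>"
      unfolding ext_map0_image[OF \<phi>] extension0_def by (simp add: functor_struct_def)
  qed
  have n: "bij_betw (ext_map L T F \<phi>) (on_ob F \<phi>) (extension (functor_struct L T F) \<phi>)"
    if \<phi>: "\<phi> \<in> Fml L" for \<phi>
  proof -
    have "bij_betw (coord \<phi>) (on_ob F \<phi>) (extension \<F> \<phi>)"
      unfolding bij_betw_def img_extension[OF \<phi>, symmetric] img_def
      by (intro conjI inj_onI coord_inj[OF \<phi>] HOL.refl)
    then show ?thesis using ext_map_coord[OF \<phi>] by (subst bij_betw_cong[where g = "coord \<phi>"]) simp_all
  qed
  have "is_model L \<F> T" unfolding is_model_def using F_structure F_model by blast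
  moreover have "if sentence \<phi> then bij_betw (ext_map0 L T F \<phi>) (on_ob F \<phi>) (extension0 \<F> \<phi>)
      else bij_betw (ext_map L T F \<phi>) (on_ob F \<phi>) (extension \<F> \<phi>)" if "\<phi> \<in> Fml L" for \<phi>
    using s[OF that] n[OF that] by (cases "sentence \<phi>") simp_all
  ultimately show ?thesis by blast
qed

end
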